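(* Let $p$ be a prime. For every $\tau>2$, $W(\tau)$ is a Salem set in $\mathbb{Q}_p$ with Hausdorff dimension and Fourier dimension both equal to $2/\tau$. Moreover, there exists a Borel probability measure $\mu$ supported on $W(\tau)$ such that $$|\widehat{\mu}(\xi)|\lesssim |\xi|_p^{-1/\tau}\,\ln^2(1+|\xi|_p)\qquad\text{for all }\xi\in\mathbb{Q}_p,\ \xi\neq 0,$$ $$\mu(B(x,r))\lesssim r^{2/\tau}\,\ln^2(1+r^{-1})\qquad\text{for all }x\in\mathbb{Q}_p,\ r>0,$$ and, whenever $1\le q<1+\dfrac{1}{2\tau-3}$, $$\Big(\int|\widehat{f}(x)|^2\,d\mu(x)\Big)^{1/2}\lesssim_{q,\tau}\|f\|_{q}\qquad\text{for all }f\in L^q(\mathbb{Q}_p)\cap L^1(\mathbb{Q}_p).$$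
   Context: $X\lesssim Y$ means $X\le CY$ for some positive constant $C$ whose value may depend on $p$, but not on any other parameters; $X\lesssim_{q,\tau}Y$ has the same meaning, except that $C$ may also depend on $q$ and $\tau$. $|\cdot|_p$ is the $p$-adic absolute value on $\mathbb{Q}_p$ (normalized by $|p|_p=p^{-1}$), $B(x,r)=\{y\in\mathbb{Q}_p:|x-y|_p\le r\}$, $\mathbb{Z}_p=B(0,1)$, and $|\cdot|$ is the usual absolute value on $\mathbb{Z}$. For $\tau\in\mathbb{R}$, $$W(\tau)=\{x\in\mathbb{Z}_p: |xq-r|_p\le \max(|q|,|r|)^{-\tau}\text{ for infinitely many }(q,r)\in\mathbb{Z}^2\}.$$ For $x\in\mathbb{Q}_p$ with $p$-adic expansion $x=\sum_{j\ge M}c_jp^j$, $c_j\in\{0,\dots,p-1\}$, the fractional part is $\{x\}_p=\sum_{M\le j\le -1}c_jp^j\in\mathbb{Q}\cap[0,1)$, and $e(t)=e^{2\pi i t}$. $dx$ is Haar measure on $\mathbb{Q}_p$ normalized so that $\mathbb{Z}_p$ has measure $1$; $L^q(\mathbb{Q}_p)$ and $\|\cdot\|_q$ are taken with respect to $dx$. For integrable $f$ on $\mathbb{Q}_p$, $\widehat f(s)=\int_{\mathbb{Q}_p}e(\{xs\}_p)f(x)\,dx$; for a finite Borel measure $\mu$ on $\mathbb{Q}_p$, $\widehat\mu(\xi)=\int_{\mathbb{Q}_p}e(\{x\xi\}_p)\,d\mu(x)$. A measure is supported on $A$ if its (closed) support is contained in $A$. $\dim_H$ is Hausdorff dimension with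 respect to the metric $|x-y|_p$. For $A\subseteq\mathbb{Q}_p$, the Fourier dimension is $$\dim_F(A)=\sup\Big\{0\le\beta\le 1:\ \sup_{0\ne\xi\in\mathbb{Q}_p}|\widehat\mu(\xi)|^2|\xi|_p^{\beta}<\infty\text{ for some }\mu\in\mathcal{P}(A)\Big\},$$ where $\mathcal{P}(A)$ is the set of Borel probability measures on $\mathbb{Q}_p$ with compact support in $A$. A set $A$ is a Salem set if $\dim_H(A)=\dim_F(A)$. $\ln^2(t)$ means $(\ln t)^2$.
   Formalization: The Fourier decay bound is stated for |ξ|_p ≥ 1 (not all ξ ≠ 0) and the ball bound for 0 < r ≤ 1 (not all r > 0), since both fail as ξ → 0 and as r → ∞: the left sides equal 1 while the right sides tend to 0. *)

theory Defs
  imports "HOL-Probability.Probability" "HOL-Computational_Algebra.Primes"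
begin

text \<open>A prime p is represented as the number of elements of a type. This is no restriction: every
  prime is the cardinality of some type, for instance of one defined with carrier \<open>{..<p}\<close>.\<close>

class prime_card =
  assumes prime_card: "prime CARD('a)"

subclass (in prime_card) finite
proof
  show "finite (UNIV :: 'a set)"
    using prime_card by (metis card.infinite not_prime_0)
qed

section \<open>The p-adic absolute value on the rationals\<close>

definition pabs_int :: "nat \<Rightarrow> int \<Rightarrow> real"
  where "pabs_int p a = (if a = 0 then 0 else (1 / real p) ^ multiplicity (int p) a)"

definition pabs :: "nat \<Rightarrow> rat \<Rightarrow> real"
  where "pabs p x = pabs_int p (fst (quotient_of x)) / pabs_int p (snd (quotient_of x))"

lemma pabs_int_zero [simp]: "pabs_int p 0 = 0"
  by (simp add: pabs_int_def)

lemma pabs_int_nonneg [simp]: "0 \<le> pabs_int p a"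
  by (simp add: pabs_int_def)

lemma pabs_int_pos: "prime p \<Longrightarrow> a \<noteq> 0 \<Longrightarrow> 0 < pabs_int p a"
  by (simp add: pabs_int_def prime_gt_0_nat)

lemma pabs_int_le_one: "prime p \<Longrightarrow> pabs_int p a \<le> 1"
  using prime_gt_0_nat[of p] by (auto simp: pabs_int_def divide_simps power_le_one)

lemma pabs_int_mult: "prime p \<Longrightarrow> pabs_int p (a * b) = pabs_int p a * pabs_int p b"
  by (auto simp: pabs_int_def prime_elem_multiplicity_mult_distrib power_add)

lemma pabs_int_minus [simp]: "pabs_int p (- a) = pabs_int p a"
  by (simp add: pabs_int_def multiplicity_def)

lemma pabs_int_le_iff:
  assumes "prime p"
  shows "pabs_int p a \<le> (1 / real p) ^ n \<longleftrightarrow> int p ^ n dvd a"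
proof (cases "a = 0")
  case True
  then show ?thesis by simp
next
  case False
  have p: "1 < real p" using prime_gt_1_nat[OF assms] by simp
  have nu: "\<not> is_unit (int p)" using prime_gt_1_nat[OF assms] by simp
  have "pabs_int p a \<le> (1 / real p) ^ n \<longleftrightarrow> n \<le> multiplicity (int p) a"
    using p False by (simp add: pabs_int_def power_decreasing_iff)
  also have "\<dots> \<longleftrightarrow> int p ^ n dvd a"
    using False nu by (simp add: power_dvd_iff_le_multiplicity)
  finally show ?thesis .
qed

lemma pabs_int_ultra:
  assumes "prime p"
  shows "pabs_int p (a + b) \<le> max (pabs_int p a) (pabs_int p b)"
proof -
  have *: "pabs_int p (a + b) \<le> pabs_int p b"
    if "pabs_int p a \<le> pabs_int p b" "b \<noteq> 0" for a b
  proof -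
    define n where "n = multiplicity (int p) b"
    have n: "pabs_int p b = (1 / real p) ^ n"
      using that by (simp add: pabs_int_def n_def)
    have "int p ^ n dvd a" "int p ^ n dvd b"
      using that n pabs_int_le_iff[OF assms] by (metis order_refl)+
    then have "int p ^ n dvd a + b" by simp
    then show ?thesis using n pabs_int_le_iff[OF assms] by metis
  qed
  show ?thesis
  proof (cases "pabs_int p a \<le> pabs_int p b")
    case True
    then show ?thesis
      using *[of a b] pabs_int_pos[OF assms, of a] by (cases "b = 0"; cases "a = 0") auto
  next
    case False
    then have "a \<noteq> 0" by (metis pabs_int_nonneg pabs_int_zero)
    then show ?thesis using False *[of b a] by (simp add: add.commute)
  qed
qed

lemma pabs_Fract:
  assumes "prime p" "b \<noteq> 0"
  shows "pabs p (of_int a / of_int b) = pabs_int p a / pabs_int p b"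
proof -
  obtain c d where cd: "quotient_of (of_int a / of_int b) = (c, d)" by fastforce
  have d: "d \<noteq> 0" using quotient_of_denom_pos[OF cd] by simp
  have "of_int a / of_int b = (of_int c / of_int d :: rat)" by (rule quotient_of_div[OF cd])
  then have "of_int (a * d) = (of_int (c * b) :: rat)"
    using d assms(2) by (simp add: field_simps)
  then have "a * d = c * b" by (simp only: of_int_eq_iff)
  then have "pabs_int p a * pabs_int p d = pabs_int p c * pabs_int p b"
    using pabs_int_mult[OF assms(1)] by metis
  moreover have "pabs_int p d > 0" "pabs_int p b > 0"
    using pabs_int_pos assms d by auto
  ultimately show ?thesis
    by (simp add: pabs_def cd field_simps)
qed

lemma rat_cases2:
  fixes x y :: rat
  obtains a b d :: int where "d > 0" "x = of_int a / of_int d" "y = of_int b / of_int d"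
proof -
  obtain a b where x: "quotient_of x = (a, b)" by fastforce
  obtain c d where y: "quotient_of y = (c, d)" by fastforce
  have "b > 0" "d > 0" using x y quotient_of_denom_pos by auto
  moreover from this have "x = of_int (a * d) / of_int (b * d)" "y = of_int (c * b) / of_int (b * d)"
    using quotient_of_div[OF x] quotient_of_div[OF y] by auto
  ultimately show ?thesis using that[of "b * d" "a * d" "c * b"] by simp
qed

lemma pabs_of_int: "prime p \<Longrightarrow> pabs p (of_int a) = pabs_int p a"
  using pabs_Fract[of p 1 a] by (simp add: pabs_int_def)

lemma pabs_zero [simp]: "pabs p 0 = 0"
  by (simp add: pabs_def)

lemma pabs_nonneg [simp]: "0 \<le> pabs p x"
  by (simp add: pabs_def)

lemma pabs_one [simp]: "pabs p 1 = 1"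
  by (simp add: pabs_def pabs_int_def)

lemma pabs_eq_0_iff: "prime p \<Longrightarrow> pabs p x = 0 \<longleftrightarrow> x = 0"
proof -
  assume p: "prime p"
  obtain a b where x: "quotient_of x = (a, b)" by fastforce
  have "b > 0" "x = of_int a / of_int b"
    using x quotient_of_denom_pos quotient_of_div by auto
  moreover have "pabs p x = pabs_int p a / pabs_int p b"
    by (simp add: pabs_def x)
  ultimately have "pabs p x = pabs_int p a / pabs_int p b" "x = 0 \<longleftrightarrow> a = 0" "0 < pabs_int p b"
    using pabs_int_pos[OF p, of b] by auto
  then show ?thesis
    using pabs_int_pos[OF p, of a] by (cases "a = 0") auto
qed

lemma pabs_minus [simp]: "pabs p (- x) = pabs p x"
  by (cases "quotient_of x") (simp add: pabs_def rat_uminus_code)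

lemma pabs_minus_commute: "pabs p (x - y) = pabs p (y - x)"
  using pabs_minus[of p "x - y"] by simp

lemma pabs_mult:
  assumes "prime p"
  shows "pabs p (x * y) = pabs p x * pabs p y"
proof -
  obtain a b d where *: "d > 0" "x = of_int a / of_int d" "y = of_int b / of_int d"
    by (rule rat_cases2)
  then have "x * y = of_int (a * b) / of_int (d * d)" by simp
  then have "pabs p (x * y) = pabs_int p (a * b) / pabs_int p (d * d)"
    using *(1) pabs_Fract[OF assms, of "d * d" "a * b"] by simp
  then show ?thesis
    using * pabs_Fract[OF assms, of d] by (simp add: pabs_int_mult[OF assms])
qed

lemma pabs_inverse:
  assumes "prime p"
  shows "pabs p (inverse x) = inverse (pabs p x)"
proof (cases "x = 0")
  case False
  then have "pabs p x * pabs p (inverse x) = 1"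
    using pabs_mult[OF assms, of x "inverse x"] by simp
  then show ?thesis by (metis inverse_unique)
qed auto

lemma pabs_ultra:
  assumes "prime p"
  shows "pabs p (x + y) \<le> max (pabs p x) (pabs p y)"
proof -
  obtain a b d where *: "d > 0" "x = of_int a / of_int d" "y = of_int b / of_int d"
    by (rule rat_cases2)
  then have "x + y = of_int (a + b) / of_int d" by (simp add: add_divide_distrib)
  then have "pabs p (x + y) = pabs_int p (a + b) / pabs_int p d"
    using *(1) pabs_Fract[OF assms, of d "a + b"] by simp
  then show ?thesis
    using * pabs_Fract[OF assms, of d] pabs_int_ultra[OF assms, of a b]
    by (auto simp: divide_right_mono le_max_iff_disj)
qed

lemma pabs_triangle: "prime p \<Longrightarrow> pabs p (x + y) \<le> pabs p x + pabs p y"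
  using pabs_ultra[of p x y] pabs_nonneg[of p x] pabs_nonneg[of p y] by linarith

lemma pabs_triangle': "prime p \<Longrightarrow> \<bar>pabs p x - pabs p y\<bar> \<le> pabs p (x - y)"
  using pabs_triangle[of p "x - y" y] pabs_triangle[of p "y - x" x] pabs_minus_commute[of p x y]
  by simp

section \<open>The field of p-adic numbers\<close>

definition pcauchy :: "nat \<Rightarrow> (nat \<Rightarrow> rat) \<Rightarrow> bool"
  where "pcauchy p X \<longleftrightarrow> (\<forall>e>0. \<exists>N. \<forall>m\<ge>N. \<forall>n\<ge>N. pabs p (X m - X n) < e)"

definition pnull :: "nat \<Rightarrow> (nat \<Rightarrow> rat) \<Rightarrow> bool"
  where "pnull p X \<longleftrightarrow> (\<lambda>n. pabs p (X n)) \<longlonglongrightarrow> 0"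

lemma pcauchy_const [simp]: "pcauchy p (\<lambda>n. x)"
  by (simp add: pcauchy_def)

lemma pnull_const [simp]: "prime p \<Longrightarrow> pnull p (\<lambda>n. x) \<longleftrightarrow> x = 0"
  by (simp add: pnull_def LIMSEQ_const_iff pabs_eq_0_iff)

lemma pnull_minus: "pnull p (\<lambda>n. - X n) \<longleftrightarrow> pnull p X"
  by (simp add: pnull_def)

lemma pnull_add:
  assumes "prime p" "pnull p X" "pnull p Y"
  shows "pnull p (\<lambda>n. X n + Y n)"
  unfolding pnull_def
proof (rule tendsto_sandwich[where f = "\<lambda>_. 0"])
  show "(\<lambda>n. pabs p (X n) + pabs p (Y n)) \<longlonglongrightarrow> 0"
    using assms tendsto_add[of "\<lambda>n. pabs p (X n)" 0 _ "\<lambda>n. pabs p (Y n)" 0] by (simp add: pnull_def)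
qed (use assms pabs_triangle in auto)

lemma pcauchy_minus: "pcauchy p X \<Longrightarrow> pcauchy p (\<lambda>n. - X n)"
  by (simp add: pcauchy_def pabs_minus_commute)

lemma pcauchy_add:
  assumes "prime p" "pcauchy p X" "pcauchy p Y"
  shows "pcauchy p (\<lambda>n. X n + Y n)"
  unfolding pcauchy_def
proof (intro allI impI)
  fix e :: real assume "e > 0"
  obtain M where M: "\<forall>m\<ge>M. \<forall>n\<ge>M. pabs p (X m - X n) < e"
    using assms(2) \<open>e > 0\<close> unfolding pcauchy_def by blast
  obtain N where N: "\<forall>m\<ge>N. \<forall>n\<ge>N. pabs p (Y m - Y n) < e"
    using assms(3) \<open>e > 0\<close> unfolding pcauchy_def by blast
  have "pabs p (X m + Y m - (X n + Y n)) < e" if "m \<ge> max M N" "n \<ge> max M N" for m n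
  proof -
    have "pabs p (X m - X n) < e" "pabs p (Y m - Y n) < e" using M N that by auto
    then show ?thesis
      using pabs_ultra[OF assms(1), of "X m - X n" "Y m - Y n"] by (simp add: add_diff_add)
  qed
  then show "\<exists>N. \<forall>m\<ge>N. \<forall>n\<ge>N. pabs p (X m + Y m - (X n + Y n)) < e" by blast
qed

lemma pcauchy_convergent:
  assumes "prime p" "pcauchy p X"
  shows "convergent (\<lambda>n. pabs p (X n))"
proof -
  have "Cauchy (\<lambda>n. pabs p (X n))"
    unfolding Cauchy_def dist_real_def
    using assms(2) pabs_triangle'[OF assms(1)] unfolding pcauchy_def by (meson le_less_trans)
  then show ?thesis by (rule Cauchy_convergent)
qed

lemma pcauchy_bounded:
  assumes "prime p" "pcauchy p X"
  obtains B where "B > 0" "\<And>n. pabs p (X n) \<le> B"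
  using convergent_imp_Bseq[OF pcauchy_convergent[OF assms]] that by (auto simp: Bseq_def)

lemma pnull_mult:
  assumes "prime p" "pcauchy p X" "pnull p Y"
  shows "pnull p (\<lambda>n. X n * Y n)"
proof -
  obtain B where B: "B > 0" "\<And>n. pabs p (X n) \<le> B"
    using pcauchy_bounded assms(1,2) by blast
  show ?thesis
    unfolding pnull_def
  proof (rule tendsto_sandwich[where f = "\<lambda>_. 0"])
    show "(\<lambda>n. B * pabs p (Y n)) \<longlonglongrightarrow> 0"
      using assms(3) tendsto_mult_right_zero unfolding pnull_def by blast
    show "\<forall>\<^sub>F n in sequentially. pabs p (X n * Y n) \<le> B * pabs p (Y n)"
      using B by (simp add: pabs_mult assms mult_right_mono)
  qed auto
qed

lemma pcauchy_mult:
  assumes "prime p" "pcauchy p X" "pcauchy p Y"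
  shows "pcauchy p (\<lambda>n. X n * Y n)"
  unfolding pcauchy_def
proof (intro allI impI)
  fix e :: real assume e: "e > 0"
  obtain A where A: "A > 0" "\<And>n. pabs p (X n) \<le> A"
    using pcauchy_bounded assms(1,2) by blast
  obtain B where B: "B > 0" "\<And>n. pabs p (Y n) \<le> B"
    using pcauchy_bounded assms(1,3) by blast
  have "e / B > 0" "e / A > 0" using e A B by auto
  obtain M where M: "\<forall>m\<ge>M. \<forall>n\<ge>M. pabs p (X m - X n) < e / B"
    using assms(2) \<open>e / B > 0\<close> unfolding pcauchy_def by blast
  obtain N where N: "\<forall>m\<ge>N. \<forall>n\<ge>N. pabs p (Y m - Y n) < e / A"
    using assms(3) \<open>e / A > 0\<close> unfolding pcauchy_def by blast
  have "pabs p (X m * Y m - X n * Y n) < e" if "m \<ge> max M N" "n \<ge> max M N" for m n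
  proof -
    have eq: "X m * Y m - X n * Y n = X m * (Y m - Y n) + (X m - X n) * Y n"
      by (simp add: algebra_simps)
    have "pabs p (X m * (Y m - Y n)) \<le> A * pabs p (Y m - Y n)"
      by (simp add: pabs_mult assms A mult_right_mono)
    also have "\<dots> < A * (e / A)" using N that A by (intro mult_strict_left_mono) auto
    finally have 1: "pabs p (X m * (Y m - Y n)) < e" using A by simp
    have "pabs p ((X m - X n) * Y n) \<le> pabs p (X m - X n) * B"
      by (simp add: pabs_mult assms B mult_left_mono)
    also have "\<dots> < (e / B) * B" using M that B by (intro mult_strict_right_mono) auto
    finally have 2: "pabs p ((X m - X n) * Y n) < e" using B by simp
    show ?thesis
      unfolding eq using pabs_ultra[OF assms(1), of "X m * (Y m - Y n)" "(X m - X n) * Y n"] 1 2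
      by simp
  qed
  then show "\<exists>N. \<forall>m\<ge>N. \<forall>n\<ge>N. pabs p (X m * Y m - X n * Y n) < e" by blast
qed

lemma pcauchy_not_pnull:
  assumes "prime p" "pcauchy p X" "\<not> pnull p X"
  obtains b N where "b > 0" "\<And>n. n \<ge> N \<Longrightarrow> b < pabs p (X n)"
proof -
  obtain L where L: "(\<lambda>n. pabs p (X n)) \<longlonglongrightarrow> L"
    using pcauchy_convergent[OF assms(1,2)] convergent_def by blast
  have "L \<ge> 0" using L by (rule LIMSEQ_le_const) simp
  moreover have "L \<noteq> 0" using L assms(3) by (auto simp: pnull_def)
  ultimately have "0 < L / 2" "L / 2 < L" by auto
  then show ?thesis
    using that order_tendstoD(1)[OF L, of "L / 2"] unfolding eventually_sequentially by blast
qed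

lemma pcauchy_inverse:
  assumes "prime p" "pcauchy p X" "\<not> pnull p X"
  shows "pcauchy p (\<lambda>n. inverse (X n))"
  unfolding pcauchy_def
proof (intro allI impI)
  fix e :: real assume e: "e > 0"
  obtain b M where b: "b > 0" "\<And>n. n \<ge> M \<Longrightarrow> b < pabs p (X n)"
    using pcauchy_not_pnull[OF assms] by blast
  have "e * (b * b) > 0" using e b by simp
  obtain N where N: "\<forall>m\<ge>N. \<forall>n\<ge>N. pabs p (X m - X n) < e * (b * b)"
    using assms(2) \<open>e * (b * b) > 0\<close> unfolding pcauchy_def by blast
  have "pabs p (inverse (X m) - inverse (X n)) < e" if "m \<ge> max M N" "n \<ge> max M N" for m n
  proof -
    have bb: "b < pabs p (X m)" "b < pabs p (X n)" using b that by auto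
    then have nz: "X m \<noteq> 0" "X n \<noteq> 0" using b(1) by auto
    have "inverse (X m) - inverse (X n) = (X n - X m) * inverse (X m * X n)"
      using nz by (simp add: field_simps)
    then have "pabs p (inverse (X m) - inverse (X n))
        = pabs p (X n - X m) / (pabs p (X m) * pabs p (X n))"
      using assms(1) by (simp add: pabs_mult pabs_inverse divide_inverse)
    also have "\<dots> < e"
    proof -
      have "pabs p (X n - X m) < e * (b * b)" using N that by simp
      also have "\<dots> \<le> e * (pabs p (X m) * pabs p (X n))"
        using bb b(1) e by (intro mult_left_mono mult_mono) auto
      finally show ?thesis using bb b(1) by (simp add: pos_divide_less_eq)
    qed
    finally show ?thesis .
  qed
  then show "\<exists>N. \<forall>m\<ge>N. \<forall>n\<ge>N. pabs p (inverse (X m) - inverse (X n)) < e" by blast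
qed

lemma pnull_inverse_mult:
  assumes "prime p" "pcauchy p X" "\<not> pnull p X"
  shows "pnull p (\<lambda>n. inverse (X n) * X n - 1)"
proof -
  obtain b N where b: "b > 0" "\<And>n. n \<ge> N \<Longrightarrow> b < pabs p (X n)"
    using pcauchy_not_pnull[OF assms] by blast
  then have "\<forall>n\<ge>N. pabs p (inverse (X n) * X n - 1) = 0"
    by (metis diff_self left_inverse order_less_asym pabs_zero)
  then show ?thesis
    unfolding pnull_def by (intro tendsto_eventually) (auto simp: eventually_sequentially)
qed

lemma pcauchy_inverse':
  "prime p \<Longrightarrow> pcauchy p X \<Longrightarrow> pcauchy p (if pnull p X then (\<lambda>n. 0) else (\<lambda>n. inverse (X n)))"
  by (simp add: pcauchy_inverse)

typedef 'p pcauchy_seq = "{X :: nat \<Rightarrow> rat. pcauchy CARD('p::prime_card) X}"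
  by (rule exI[of _ "\<lambda>n. 0"]) simp

setup_lifting type_definition_pcauchy_seq

lift_definition seq_eq :: "'p::prime_card pcauchy_seq \<Rightarrow> 'p pcauchy_seq \<Rightarrow> bool"
  is "\<lambda>X Y. pnull CARD('p) (\<lambda>n. X n - Y n)" .

lift_definition seq_const :: "rat \<Rightarrow> 'p::prime_card pcauchy_seq"
  is "\<lambda>x n. x" by simp

lift_definition seq_add :: "'p::prime_card pcauchy_seq \<Rightarrow> 'p pcauchy_seq \<Rightarrow> 'p pcauchy_seq"
  is "\<lambda>X Y n. X n + Y n" by (simp add: pcauchy_add prime_card)

lift_definition seq_minus :: "'p::prime_card pcauchy_seq \<Rightarrow> 'p pcauchy_seq"
  is "\<lambda>X n. - X n" by (simp add: pcauchy_minus)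

lift_definition seq_mult :: "'p::prime_card pcauchy_seq \<Rightarrow> 'p pcauchy_seq \<Rightarrow> 'p pcauchy_seq"
  is "\<lambda>X Y n. X n * Y n" by (simp add: pcauchy_mult prime_card)

lift_definition seq_inverse :: "'p::prime_card pcauchy_seq \<Rightarrow> 'p pcauchy_seq"
  is "\<lambda>X. if pnull CARD('p) X then (\<lambda>n. 0) else (\<lambda>n. inverse (X n))"
  by (rule pcauchy_inverse'[OF prime_card])

lift_definition seq_norm :: "'p::prime_card pcauchy_seq \<Rightarrow> real"
  is "\<lambda>X. lim (\<lambda>n. pabs CARD('p) (X n))" .

lemma pnull_cong:
  assumes "prime p" "pnull p (\<lambda>n. X n - Y n)"
  shows "pnull p X \<longleftrightarrow> pnull p Y"
  using pnull_add[OF assms(1) assms(2), of Y] pnull_add[OF assms(1) _ assms(2)[THEN pnull_minus[THEN iffD2]], of X]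
  by auto

lemma equivp_seq_eq: "equivp (seq_eq :: 'p::prime_card pcauchy_seq \<Rightarrow> _)"
proof (rule equivpI)
  note p = prime_card[where 'a = 'p]
  show "reflp (seq_eq :: 'p pcauchy_seq \<Rightarrow> _)"
    by (rule reflpI, transfer) (simp add: prime_card)
  show "symp (seq_eq :: 'p pcauchy_seq \<Rightarrow> _)"
    by (rule sympI, transfer) (simp add: pnull_def pabs_minus_commute)
  show "transp (seq_eq :: 'p pcauchy_seq \<Rightarrow> _)"
  proof (rule transpI, transfer)
    fix X Y Z assume "pnull CARD('p) (\<lambda>n. X n - Y n)" "pnull CARD('p) (\<lambda>n. Y n - Z n)"
    then show "pnull CARD('p) (\<lambda>n. X n - Z n)"
      using pnull_add[OF p, of "\<lambda>n. X n - Y n" "\<lambda>n. Y n - Z n"] by simp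
  qed
qed

text \<open>For a type with a prime number p of elements, this is the completion of the rationals
  with respect to the p-adic absolute value, that is, the field of p-adic numbers: Cauchy sequences
  of rationals modulo null sequences.\<close>

quotient_type (overloaded) 'p padic = "'p::prime_card pcauchy_seq" / seq_eq
  by (rule equivp_seq_eq)

instantiation padic :: (prime_card) field
begin

lift_definition zero_padic :: "'a padic" is "seq_const 0" .

lift_definition one_padic :: "'a padic" is "seq_const 1" .

lift_definition plus_padic :: "'a padic \<Rightarrow> 'a padic \<Rightarrow> 'a padic" is seq_add
  apply transfer
  subgoal for X X' Y Y'
    using pnull_add[OF prime_card[where 'a = 'a], of "\<lambda>n. X n - X' n" "\<lambda>n. Y n - Y' n"]
    by (simp add: algebra_simps)
  done

lift_definition uminus_padic :: "'a padic \<Rightarrow> 'a padic" is seq_minus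
  by transfer (simp add: pnull_def pabs_minus_commute)

lift_definition times_padic :: "'a padic \<Rightarrow> 'a padic \<Rightarrow> 'a padic" is seq_mult
  apply transfer
  subgoal premises that for X X' Y Y'
  proof -
    note p = prime_card[where 'a = 'a]
    have "X n * Y n - X' n * Y' n = X n * (Y n - Y' n) + Y' n * (X n - X' n)" for n
      by (simp add: algebra_simps)
    then show ?thesis
      using pnull_add[OF p pnull_mult[OF p] pnull_mult[OF p], of X "\<lambda>n. Y n - Y' n" Y' "\<lambda>n. X n - X' n"]
      using that by simp
  qed
  done

lift_definition inverse_padic :: "'a padic \<Rightarrow> 'a padic" is seq_inverse
  apply transfer
  subgoal premises that for X Y
  proof -
    note p = prime_card[where 'a = 'a]
    have iff: "pnull CARD('a) X \<longleftrightarrow> pnull CARD('a) Y"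
      using pnull_cong[OF p] that by blast
    show ?thesis
    proof (cases "pnull CARD('a) X")
      case True
      then show ?thesis using iff p by simp
    next
      case False
      let ?iX = "\<lambda>n. inverse (X n)" and ?iY = "\<lambda>n. inverse (Y n)"
      have inv: "pcauchy CARD('a) ?iX" "pcauchy CARD('a) ?iY"
        using pcauchy_inverse[OF p] that False iff by auto
      note c = pnull_inverse_mult[OF p]
      have 1: "pnull CARD('a) (\<lambda>n. ?iX n * (?iY n * (Y n - X n)))"
        using that inv by (intro pnull_mult[OF p]) (simp_all add: pnull_def pabs_minus_commute)
      have 2: "pnull CARD('a) (\<lambda>n. ?iX n * (- (?iY n * Y n - 1)))"
        using that inv False iff by (intro pnull_mult[OF p]) (simp_all add: pnull_minus c del: minus_diff_eq)
      have 3: "pnull CARD('a) (\<lambda>n. ?iY n * (?iX n * X n - 1))"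
        using that inv False by (intro pnull_mult[OF p]) (simp_all add: c)
      have "?iX n - ?iY n = ?iX n * (?iY n * (Y n - X n)) + ?iX n * (- (?iY n * Y n - 1))
          + ?iY n * (?iX n * X n - 1)" for n
        by (simp add: algebra_simps)
      then show ?thesis
        using pnull_add[OF p pnull_add[OF p 1 2] 3] False iff by simp
    qed
  qed
  done

definition "x - y = x + - y" for x y :: "'a padic"

definition "x div y = x * inverse y" for x y :: "'a padic"

instance
proof
  note p = prime_card[where 'a = 'a]
  fix a b c :: "'a padic"
  show "a * b * c = a * (b * c)"
    by (transfer, transfer) (simp add: p algebra_simps)
  show "a * b = b * a"
    by (transfer, transfer) (simp add: p algebra_simps)
  show "1 * a = a"
    by (transfer, transfer) (simp add: p algebra_simps)
  show "a + b + c = a + (b + c)"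
    by (transfer, transfer) (simp add: p algebra_simps)
  show "a + b = b + a"
    by (transfer, transfer) (simp add: p algebra_simps)
  show "0 + a = a"
    by (transfer, transfer) (simp add: p algebra_simps)
  show "- a + a = 0"
    by (transfer, transfer) (simp add: p algebra_simps)
  show "(a + b) * c = a * c + b * c"
    by (transfer, transfer) (simp add: p algebra_simps)
  show "(0::'a padic) \<noteq> 1"
    by (transfer, transfer) (simp add: p)
  show "inverse (0::'a padic) = 0"
    by (transfer, transfer) (simp add: p)
  show "a \<noteq> 0 \<Longrightarrow> inverse a * a = 1"
    by (transfer, transfer) (simp add: p pnull_inverse_mult)
qed (simp_all add: minus_padic_def divide_padic_def)

end

text \<open>A separate constant is used because \<^const>\<open>norm\<close> is constrained to real normed vector
  spaces.\<close>

lift_definition padic_abs :: "'a::prime_card padic \<Rightarrow> real" is seq_norm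
proof transfer
  fix X Y :: "nat \<Rightarrow> rat"
  note p = prime_card[where 'a = 'a]
  assume X: "pcauchy CARD('a) X" and Y: "pcauchy CARD('a) Y"
    and XY: "pnull CARD('a) (\<lambda>n. X n - Y n)"
  have "(\<lambda>n. pabs CARD('a) (X n) - pabs CARD('a) (Y n)) \<longlonglongrightarrow> 0"
    by (rule Lim_null_comparison[OF _ XY[unfolded pnull_def]]) (simp add: pabs_triangle'[OF p])
  moreover have "(\<lambda>n. pabs CARD('a) (X n) - pabs CARD('a) (Y n)) \<longlonglongrightarrow>
      lim (\<lambda>n. pabs CARD('a) (X n)) - lim (\<lambda>n. pabs CARD('a) (Y n))"
    using pcauchy_convergent[OF p X] pcauchy_convergent[OF p Y]
    by (intro tendsto_diff) (simp_all add: convergent_LIMSEQ_iff)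
  ultimately have "lim (\<lambda>n. pabs CARD('a) (X n)) - lim (\<lambda>n. pabs CARD('a) (Y n)) = 0"
    by (rule LIMSEQ_unique[rotated])
  then show "lim (\<lambda>n. pabs CARD('a) (X n)) = lim (\<lambda>n. pabs CARD('a) (Y n))"
    by simp
qed

instantiation padic :: (prime_card) metric_space
begin

definition "dist x y = padic_abs (x - y)" for x y :: "'a padic"

definition uniformity_padic :: "('a padic \<times> 'a padic) filter"
  where "uniformity_padic = (INF e\<in>{0<..}. principal {(x, y). dist x y < e})"

definition open_padic :: "'a padic set \<Rightarrow> bool"
  where "open_padic U \<longleftrightarrow> (\<forall>x\<in>U. \<forall>\<^sub>F (x', y) in uniformity. x' = x \<longrightarrow> y \<in> U)"

instance
proof
  note p = prime_card[where 'a = 'a]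
  have lim: "(\<lambda>n. pabs CARD('a) (X n)) \<longlonglongrightarrow> lim (\<lambda>n. pabs CARD('a) (X n))"
    if "pcauchy CARD('a) X" for X
    using pcauchy_convergent[OF p] that by (simp add: convergent_LIMSEQ_iff)
  have ultra: "padic_abs (x + y) \<le> padic_abs x + padic_abs y" for x y :: "'a padic"
  proof (transfer, transfer)
    fix X Y assume X: "pcauchy CARD('a) X" and Y: "pcauchy CARD('a) Y"
    show "lim (\<lambda>n. pabs CARD('a) (X n + Y n)) \<le> lim (\<lambda>n. pabs CARD('a) (X n)) + lim (\<lambda>n. pabs CARD('a) (Y n))"
      by (rule LIMSEQ_le[OF lim[OF pcauchy_add[OF p X Y]] tendsto_add[OF lim[OF X] lim[OF Y]]])
        (auto simp: pabs_triangle[OF p])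
  qed
  have minus: "padic_abs (- x) = padic_abs x" for x :: "'a padic"
    by (transfer, transfer) simp
  have zero: "padic_abs x = 0 \<longleftrightarrow> x = 0" for x :: "'a padic"
  proof (transfer, transfer)
    fix X assume X: "pcauchy CARD('a) X"
    have "lim (\<lambda>n. pabs CARD('a) (X n)) = 0 \<longleftrightarrow> (\<lambda>n. pabs CARD('a) (X n)) \<longlonglongrightarrow> 0"
    proof
      assume "lim (\<lambda>n. pabs CARD('a) (X n)) = 0"
      then show "(\<lambda>n. pabs CARD('a) (X n)) \<longlonglongrightarrow> 0" using lim[OF X] by simp
    next
      assume "(\<lambda>n. pabs CARD('a) (X n)) \<longlonglongrightarrow> 0"
      then show "lim (\<lambda>n. pabs CARD('a) (X n)) = 0" by (rule limI)
    qed
    then show "lim (\<lambda>n. pabs CARD('a) (X n)) = 0 \<longleftrightarrow> pnull CARD('a) (\<lambda>n. X n - 0)"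
      by (simp only: pnull_def diff_0_right)
  qed
  fix x y z :: "'a padic"
  show "dist x y = 0 \<longleftrightarrow> x = y"
    by (simp add: dist_padic_def zero)
  have "padic_abs (z - y) = padic_abs (y - z)" using minus[of "z - y"] by simp
  then show "dist x y \<le> dist x z + dist y z"
    using ultra[of "x - z" "z - y"] by (simp add: dist_padic_def)
qed (rule uniformity_padic_def open_padic_def dist_padic_def)+

end

lemma lim_pabs:
  "prime p \<Longrightarrow> pcauchy p X \<Longrightarrow> (\<lambda>n. pabs p (X n)) \<longlonglongrightarrow> lim (\<lambda>n. pabs p (X n))"
  using pcauchy_convergent by (simp add: convergent_LIMSEQ_iff)

lemma padic_abs_zero [simp]: "padic_abs (0 :: 'p::prime_card padic) = 0"
  by (transfer, transfer) simp

lemma padic_abs_one [simp]: "padic_abs (1 :: 'p::prime_card padic) = 1"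
  by (transfer, transfer) simp

lemma padic_abs_eq_zero [simp]: "padic_abs x = 0 \<longleftrightarrow> x = 0" for x :: "'p::prime_card padic"
  using dist_eq_0_iff[of x 0] by (simp add: dist_padic_def)

lemma padic_abs_nonneg [simp]: "0 \<le> padic_abs x" for x :: "'p::prime_card padic"
  using zero_le_dist[of x 0] by (simp add: dist_padic_def)

lemma padic_abs_minus [simp]: "padic_abs (- x) = padic_abs x" for x :: "'p::prime_card padic"
  by (transfer, transfer) simp

lemma padic_abs_minus_commute: "padic_abs (x - y) = padic_abs (y - x)" for x y :: "'p::prime_card padic"
  using padic_abs_minus[of "x - y"] by simp

lemma padic_abs_mult: "padic_abs (x * y) = padic_abs x * padic_abs y" for x y :: "'p::prime_card padic"
proof (transfer, transfer)
  note p = prime_card[where 'a = 'p]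
  fix X Y assume X: "pcauchy CARD('p) X" and Y: "pcauchy CARD('p) Y"
  show "lim (\<lambda>n. pabs CARD('p) (X n * Y n)) = lim (\<lambda>n. pabs CARD('p) (X n)) * lim (\<lambda>n. pabs CARD('p) (Y n))"
    unfolding pabs_mult[OF p] by (rule limI[OF tendsto_mult[OF lim_pabs[OF p X] lim_pabs[OF p Y]]])
qed

lemma padic_abs_ultra: "padic_abs (x + y) \<le> max (padic_abs x) (padic_abs y)" for x y :: "'p::prime_card padic"
proof (transfer, transfer)
  note p = prime_card[where 'a = 'p]
  fix X Y assume X: "pcauchy CARD('p) X" and Y: "pcauchy CARD('p) Y"
  show "lim (\<lambda>n. pabs CARD('p) (X n + Y n)) \<le>
      max (lim (\<lambda>n. pabs CARD('p) (X n))) (lim (\<lambda>n. pabs CARD('p) (Y n)))"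
    by (rule LIMSEQ_le[OF lim_pabs[OF p pcauchy_add[OF p X Y]] tendsto_max[OF lim_pabs[OF p X] lim_pabs[OF p Y]]])
      (auto simp: pabs_ultra[OF p])
qed

lemma padic_abs_ultra_diff: "padic_abs (x - y) \<le> max (padic_abs x) (padic_abs y)" for x y :: "'p::prime_card padic"
  using padic_abs_ultra[of x "- y"] by simp

lift_definition padic_of_rat :: "rat \<Rightarrow> 'p::prime_card padic" is seq_const .

lemma padic_of_rat_add: "padic_of_rat (a + b) = (padic_of_rat a + padic_of_rat b :: 'p::prime_card padic)"
  by (transfer, transfer) (simp add: prime_card)

lemma padic_of_rat_minus: "padic_of_rat (- a) = (- padic_of_rat a :: 'p::prime_card padic)"
  by (transfer, transfer) (simp add: prime_card)

lemma padic_of_rat_mult: "padic_of_rat (a * b) = (padic_of_rat a * padic_of_rat b :: 'p::prime_card padic)"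
  by (transfer, transfer) (simp add: prime_card)

lemma padic_of_rat_01: "padic_of_rat 0 = (0 :: 'p::prime_card padic)" "padic_of_rat 1 = (1 :: 'p::prime_card padic)"
  by (transfer; transfer; simp add: prime_card)+

lemma padic_abs_of_rat: "padic_abs (padic_of_rat r :: 'p::prime_card padic) = pabs CARD('p) r"
  by (transfer, transfer) simp

lemma padic_of_rat_of_nat: "padic_of_rat (of_nat n) = (of_nat n :: 'p::prime_card padic)"
  by (induction n) (simp_all add: padic_of_rat_01 padic_of_rat_add)

instance padic :: (prime_card) field_char_0
proof
  note p = prime_card[where 'a = 'a]
  show "inj (of_nat :: nat \<Rightarrow> 'a padic)"
  proof (rule injI)
    fix m n :: nat assume "(of_nat m :: 'a padic) = of_nat n"
    then have "(padic_of_rat (of_nat m + - of_nat n) :: 'a padic) = 0"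
      unfolding padic_of_rat_add padic_of_rat_minus padic_of_rat_of_nat by simp
    then have "pabs CARD('a) (of_nat m + - of_nat n) = 0"
      using padic_abs_of_rat[of "of_nat m + - of_nat n :: rat", where 'p = 'a] by simp
    then show "m = n" by (simp add: pabs_eq_0_iff[OF p])
  qed
qed

lemma padic_of_rat_of_int: "padic_of_rat (of_int a) = (of_int a :: 'p::prime_card padic)"
  by (cases a rule: int_cases2) (simp_all add: padic_of_rat_of_nat padic_of_rat_minus)

lemma of_rat_padic: "of_rat r = (padic_of_rat r :: 'p::prime_card padic)"
proof -
  obtain a b where q: "quotient_of r = (a, b)" by fastforce
  have b: "b \<noteq> 0" and r: "r = of_int a / of_int b"
    using q quotient_of_denom_pos quotient_of_div by force+
  have "padic_of_rat r * (of_int b :: 'p padic) = padic_of_rat (r * of_int b)"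
    by (simp add: padic_of_rat_mult padic_of_rat_of_int)
  also have "\<dots> = of_int a" using b by (simp add: r padic_of_rat_of_int)
  finally show ?thesis using b by (simp add: r of_rat_divide field_simps)
qed

lemma padic_abs_of_rat' [simp]: "padic_abs (of_rat r :: 'p::prime_card padic) = pabs CARD('p) r"
  by (simp add: of_rat_padic padic_abs_of_rat)

lemma padic_abs_of_int [simp]: "padic_abs (of_int a :: 'p::prime_card padic) = pabs_int CARD('p) a"
  using padic_abs_of_rat'[of "of_int a", where 'p = 'p] by (simp add: pabs_of_int prime_card)

lemma pcauchy_diff: "prime p \<Longrightarrow> pcauchy p X \<Longrightarrow> pcauchy p Y \<Longrightarrow> pcauchy p (\<lambda>n. X n - Y n)"
  using pcauchy_add[of p X "\<lambda>n. - Y n"] by (simp add: pcauchy_minus)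

lemma padic_of_rat_dense:
  fixes x :: "'p::prime_card padic"
  assumes "e > 0"
  shows "\<exists>r. padic_abs (x - of_rat r) < e"
  unfolding of_rat_padic minus_padic_def
proof (transfer fixing: e, transfer fixing: e)
  note p = prime_card[where 'a = 'p]
  fix X assume X: "pcauchy CARD('p) X"
  obtain N where N: "\<forall>m\<ge>N. \<forall>n\<ge>N. pabs CARD('p) (X m - X n) < e / 2"
    using X assms unfolding pcauchy_def by (meson half_gt_zero)
  have "lim (\<lambda>n. pabs CARD('p) (X n + - X N)) \<le> e / 2"
    by (rule LIMSEQ_le_const2[OF lim_pabs[OF p]])
      (use N X in \<open>auto intro!: pcauchy_diff[OF p] exI[of _ N] less_imp_le\<close>)
  then show "\<exists>r. lim (\<lambda>n. pabs CARD('p) (X n + - r)) < e" using assms by (intro exI[of _ "X N"]) simp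
qed

instance padic :: (prime_card) complete_space
proof
  note p = prime_card[where 'a = 'a]
  fix X :: "nat \<Rightarrow> 'a padic" assume X: "Cauchy X"
  have "\<forall>n. \<exists>r. padic_abs (X n - of_rat r) < inverse (real (Suc n))"
    by (intro allI padic_of_rat_dense) simp
  then obtain r where r: "\<And>n. padic_abs (X n - of_rat (r n)) < inverse (real (Suc n))" by metis
  have r': "padic_abs (X n - of_rat (r n)) < e" if "n \<ge> N" "inverse (real (Suc N)) < e" for n N e
  proof -
    have "inverse (real (Suc n)) \<le> inverse (real (Suc N))"
      using that(1) by (intro le_imp_inverse_le) auto
    then show ?thesis using r[of n] that(2) by linarith
  qed
  have c: "pcauchy CARD('a) r"
    unfolding pcauchy_def
  proof (intro allI impI)
    fix e :: real assume e: "e > 0"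
    obtain M where M: "\<forall>m\<ge>M. \<forall>n\<ge>M. dist (X m) (X n) < e" using X e unfolding Cauchy_def by blast
    obtain N where N: "inverse (real (Suc N)) < e" using reals_Archimedean[OF e] by blast
    have "pabs CARD('a) (r m - r n) < e" if "m \<ge> max M N" "n \<ge> max M N" for m n
    proof -
      have "of_rat (r m - r n) = (X m - X n) - ((X m - of_rat (r m)) - (X n - of_rat (r n)))"
        by (simp add: of_rat_diff)
      then have "padic_abs (of_rat (r m - r n) :: 'a padic) \<le>
          max (padic_abs (X m - X n)) (padic_abs ((X m - of_rat (r m)) - (X n - of_rat (r n))))"
        by (metis padic_abs_ultra_diff)
      also have "\<dots> < e"
        using M that r'[OF _ N, of m] r'[OF _ N, of n]
          padic_abs_ultra_diff[of "X m - of_rat (r m)" "X n - of_rat (r n)"]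
        by (simp add: dist_padic_def)
      finally show ?thesis by simp
    qed
    then show "\<exists>N. \<forall>m\<ge>N. \<forall>n\<ge>N. pabs CARD('a) (r m - r n) < e" by blast
  qed
  have "\<exists>L :: 'a padic. \<forall>e>0. \<exists>N. \<forall>n\<ge>N. padic_abs (of_rat (r n) - L) < e"
    unfolding of_rat_padic minus_padic_def
  proof (transfer fixing: r, transfer fixing: r, intro bexI allI impI)
    fix e :: real assume e: "e > 0"
    obtain N where N: "\<forall>m\<ge>N. \<forall>n\<ge>N. pabs CARD('a) (r m - r n) < e / 2"
      using c e unfolding pcauchy_def by (meson half_gt_zero)
    have "lim (\<lambda>m. pabs CARD('a) (r n + - r m)) \<le> e / 2" if "n \<ge> N" for n
      by (rule LIMSEQ_le_const2[OF lim_pabs[OF p]])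
        (use N c that in \<open>auto intro!: pcauchy_diff[OF p] exI[of _ N] less_imp_le\<close>)
    then show "\<exists>N. \<forall>n\<ge>N. lim (\<lambda>m. pabs CARD('a) (r n + - r m)) < e"
      using e by (intro exI[of _ N]) fastforce
  qed (simp add: c)
  then obtain L :: "'a padic" where L: "\<And>e. e > 0 \<Longrightarrow> \<exists>N. \<forall>n\<ge>N. padic_abs (of_rat (r n) - L) < e" by blast
  have "X \<longlonglongrightarrow> L"
    unfolding LIMSEQ_def
  proof (intro allI impI)
    fix e :: real assume e: "e > 0"
    obtain M where M: "\<forall>n\<ge>M. padic_abs (of_rat (r n) - L) < e" using L[OF e] by blast
    obtain N where N: "inverse (real (Suc N)) < e" using reals_Archimedean[OF e] by blast
    have "dist (X n) L < e" if "n \<ge> max M N" for n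
    proof -
      have "padic_abs (of_rat (r n) - L) < e" "padic_abs (X n - of_rat (r n)) < e"
        using M that r'[OF _ N, of n] by auto
      then show ?thesis
        using padic_abs_ultra[of "X n - of_rat (r n)" "of_rat (r n) - L"] by (simp add: dist_padic_def)
    qed
    then show "\<exists>N. \<forall>n\<ge>N. dist (X n) L < e" by blast
  qed
  then show "convergent X" by (rule convergentI)
qed

section \<open>Expansions and fractional parts\<close>

definition padic_expansion :: "'p::prime_card padic \<Rightarrow> int \<Rightarrow> (int \<Rightarrow> nat) \<Rightarrow> bool"
  where "padic_expansion x M c \<longleftrightarrow> (\<forall>j\<ge>M. c j < CARD('p)) \<and>
    (\<lambda>n. of_nat (c (M + int n)) * of_nat CARD('p) powi (M + int n)) sums x"

text \<open>Every p-adic number has an expansion, and the value below does not depend on it; see the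
  lemmas \<open>padic_expansion_exists\<close> and \<open>padic_frac_eq\<close>.\<close>

definition padic_frac :: "'p::prime_card padic \<Rightarrow> real"
  where "padic_frac x = (THE t. \<exists>M c. padic_expansion x M c \<and>
    t = (\<Sum>j\<in>{M..-1}. real (c j) * real CARD('p) powi j))"

lemma padic_abs_prime: "padic_abs (of_nat CARD('p) :: 'p::prime_card padic) = 1 / real CARD('p)"
  using padic_abs_of_int[of "int CARD('p)", where 'p = 'p] prime_card[where 'a = 'p]
    prime_gt_1_nat[OF prime_card[where 'a = 'p]]
  by (simp add: pabs_int_def multiplicity_self)

lemma padic_abs_power: "padic_abs (x ^ n) = padic_abs x ^ n" for x :: "'p::prime_card padic"
  by (induction n) (simp_all add: padic_abs_mult)

lemma padic_abs_of_nat_le: "padic_abs (of_nat n :: 'p::prime_card padic) \<le> 1"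
  using padic_abs_of_int[of "int n", where 'p = 'p] pabs_int_le_one[OF prime_card[where 'a = 'p]] by simp

lemma padic_abs_sum_le:
  "(\<And>i. i \<in> A \<Longrightarrow> padic_abs (f i) \<le> B) \<Longrightarrow> 0 \<le> B \<Longrightarrow> padic_abs (sum f A) \<le> B"
  for f :: "'b \<Rightarrow> 'p::prime_card padic"
proof (induction A rule: infinite_finite_induct)
  case (insert x F)
  then show ?case using padic_abs_ultra[of "f x" "sum f F"] by fastforce
qed auto

lemma digit_sum_less:
  "(\<And>i. i < k \<Longrightarrow> d i < p) \<Longrightarrow> (\<Sum>i<k. d i * p ^ i) < p ^ k" for d :: "nat \<Rightarrow> nat"
proof (induction k)
  case (Suc k)
  have "(\<Sum>i<k. d i * p ^ i) < p ^ k" using Suc by simp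
  moreover have "d k * p ^ k + p ^ k \<le> p * p ^ k"
    using Suc.prems[of k] by (metis Suc_leI add.commute lessI mult_Suc mult_le_mono1)
  ultimately show ?case by simp
qed simp

lemma int_principal_sum:
  fixes b :: "'a::field" and c :: "int \<Rightarrow> nat" and M :: int
  assumes "b \<noteq> 0"
  defines "k \<equiv> nat (- M)"
  shows "(\<Sum>j\<in>{M..-1}. of_nat (c j) * b powi j) = (\<Sum>i<k. of_nat (c (M + int i)) * b ^ i) / b ^ k"
    and "(\<Sum>j\<in>{M..-1}. of_nat (c j) * b powi j) = (\<Sum>i<k. of_nat (c (M + int i)) * b powi (M + int i))"
proof -
  have *: "{M..-1} = (\<lambda>i. M + int i) ` {..<k}"
  proof (intro equalityI subsetI)
    fix j assume "j \<in> {M..-1}"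
    then show "j \<in> (\<lambda>i. M + int i) ` {..<k}"
      by (intro image_eqI[of _ _ "nat (j - M)"]) (auto simp: k_def)
  qed (auto simp: k_def)
  show eq: "(\<Sum>j\<in>{M..-1}. of_nat (c j) * b powi j) = (\<Sum>i<k. of_nat (c (M + int i)) * b powi (M + int i))"
    unfolding * by (subst sum.reindex) (auto simp: inj_on_def)
  have "b powi (M + int i) = b ^ i / b ^ k" if "i < k" for i
  proof -
    have "M + int i = int i - int k" using that by (simp add: k_def)
    then show ?thesis using assms(1) by (simp add: power_int_diff)
  qed
  then show "(\<Sum>j\<in>{M..-1}. of_nat (c j) * b powi j) = (\<Sum>i<k. of_nat (c (M + int i)) * b ^ i) / b ^ k"
    unfolding eq sum_divide_distrib by (intro sum.cong) auto
qed

lemma padic_expansion_frac: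
  fixes x :: "'p::prime_card padic"
  assumes "padic_expansion x M c"
  defines "k \<equiv> nat (- M)"
  obtains A where "A < CARD('p) ^ k"
    "(\<Sum>j\<in>{M..-1}. real (c j) * real CARD('p) powi j) = real A / real CARD('p) ^ k"
    "padic_abs (x - of_nat A / of_nat CARD('p) ^ k) \<le> 1"
proof -
  let ?p = "CARD('p)"
  let ?b = "of_nat CARD('p) :: 'p padic"
  let ?s = "\<lambda>n. of_nat (c (M + int n)) * ?b powi (M + int n)"
  have p: "?p > 0" by simp
  have c: "\<And>j. j \<ge> M \<Longrightarrow> c j < ?p" and sums: "?s sums x"
    using assms(1) by (auto simp: padic_expansion_def)
  define A where "A = (\<Sum>i<k. c (M + int i) * ?p ^ i)"
  have 1: "A < ?p ^ k" unfolding A_def using c by (intro digit_sum_less) simp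
  have 2: "(\<Sum>j\<in>{M..-1}. real (c j) * real CARD('p) powi j) = real A / real CARD('p) ^ k"
    using int_principal_sum(1)[of "real ?p" c M] p by (simp add: A_def k_def)
  have A: "(\<Sum>i<k. ?s i) = of_nat A / ?b ^ k"
    using int_principal_sum[of ?b c M] p by (simp add: A_def k_def)
  obtain N where N: "\<forall>n\<ge>N. dist (\<Sum>i<n. ?s i) x < 1"
    using sums unfolding sums_def LIMSEQ_def by (meson zero_less_one)
  define n where "n = max N k"
  have "(\<Sum>i<n. ?s i) = (\<Sum>i<k. ?s i) + (\<Sum>i\<in>{k..<n}. ?s i)"
    by (simp add: n_def sum.atLeastLessThan_concat[of 0 k] lessThan_atLeast0)
  moreover have "padic_abs (\<Sum>i\<in>{k..<n}. ?s i) \<le> 1"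
  proof (rule padic_abs_sum_le)
    fix i assume "i \<in> {k..<n}"
    then have "M + int i \<ge> 0" by (simp add: k_def nat_le_iff)
    then have "?b powi (M + int i) = ?b ^ nat (M + int i)" by (simp add: power_int_def)
    moreover have "padic_abs (?b ^ nat (M + int i)) \<le> 1"
      using padic_abs_of_nat_le[of ?p, where 'p = 'p] by (simp add: padic_abs_power power_le_one)
    ultimately show "padic_abs (?s i) \<le> 1"
      using padic_abs_of_nat_le[of "c (M + int i)", where 'p = 'p] by (simp add: padic_abs_mult mult_le_one)
  qed simp
  moreover have "padic_abs (x - (\<Sum>i<n. ?s i)) \<le> 1"
    using N[rule_format, of n] by (simp add: n_def dist_padic_def padic_abs_minus_commute[of x])
  ultimately have "padic_abs (x - of_nat A / ?b ^ k) \<le> 1"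
    unfolding A[symmetric]
    using padic_abs_ultra[of "x - (\<Sum>i<n. ?s i)" "\<Sum>i\<in>{k..<n}. ?s i"] by (simp add: algebra_simps)
  with 1 2 show ?thesis by (rule that)
qed

lemma padic_frac_unique_aux:
  assumes "A < CARD('p::prime_card) ^ k" "B < CARD('p) ^ l"
    and "padic_abs (x - of_nat A / of_nat CARD('p) ^ k :: 'p padic) \<le> 1"
    and "padic_abs (x - of_nat B / of_nat CARD('p) ^ l :: 'p padic) \<le> 1"
  shows "real A / real CARD('p) ^ k = real B / real CARD('p) ^ l"
proof -
  let ?p = "CARD('p)"
  note p = prime_card[where 'a = 'p]
  let ?b = "of_nat CARD('p) :: 'p padic"
  define a where "a = int (A * ?p ^ l) - int (B * ?p ^ k)"
  have b: "?b \<noteq> 0" by simp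
  have "of_int a = (of_nat A / ?b ^ k - of_nat B / ?b ^ l) * ?b ^ (k + l)"
    using b by (simp add: a_def field_simps power_add)
  also have "of_nat A / ?b ^ k - of_nat B / ?b ^ l = (x - of_nat B / ?b ^ l) - (x - of_nat A / ?b ^ k)"
    by simp
  finally have "padic_abs (of_int a :: 'p padic)
      = padic_abs ((x - of_nat B / ?b ^ l) - (x - of_nat A / ?b ^ k)) * (1 / real ?p) ^ (k + l)"
    by (simp only: padic_abs_mult padic_abs_power padic_abs_prime)
  also have "\<dots> \<le> 1 * (1 / real ?p) ^ (k + l)"
    using padic_abs_ultra_diff[of "x - of_nat B / ?b ^ l" "x - of_nat A / ?b ^ k"] assms(3,4)
    by (intro mult_right_mono) (simp_all add: max_def split: if_splits)
  finally have dvd: "int ?p ^ (k + l) dvd a"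
    using pabs_int_le_iff[OF p] by simp
  have "A * ?p ^ l < ?p ^ k * ?p ^ l" "B * ?p ^ k < ?p ^ l * ?p ^ k"
    using assms(1,2) by auto
  then have "A * ?p ^ l < ?p ^ (k + l)" "B * ?p ^ k < ?p ^ (k + l)"
    by (simp_all add: power_add mult.commute)
  then have "\<bar>a\<bar> < int (?p ^ (k + l))"
    unfolding a_def by linarith
  moreover have "int (?p ^ (k + l)) \<le> \<bar>a\<bar>" if "a \<noteq> 0"
    using dvd_imp_le_int[OF that dvd] by simp
  ultimately have "a = 0" by linarith
  then have "A * ?p ^ l = B * ?p ^ k"
    unfolding a_def by linarith
  then have "real (A * ?p ^ l) = real (B * ?p ^ k)"
    by (simp only:)
  then have "real A * real ?p ^ l = real B * real ?p ^ k"
    by (simp only: of_nat_mult of_nat_power)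
  then show ?thesis by (simp add: field_simps)
qed

lemma padic_abs_le_one_approx:
  fixes x :: "'p::prime_card padic"
  assumes "padic_abs x \<le> 1"
  shows "\<exists>a. a < CARD('p) ^ n \<and> padic_abs (x - of_nat a) \<le> (1 / real CARD('p)) ^ n"
proof -
  let ?p = "CARD('p)"
  note p = prime_card[where 'a = 'p]
  let ?e = "(1 / real ?p) ^ n"
  have e: "0 < ?e" "?e \<le> 1" using prime_gt_0_nat[OF p] by (auto intro!: power_le_one)
  obtain r where r: "padic_abs (x - of_rat r) < ?e" using padic_of_rat_dense[OF e(1)] by blast
  obtain u v where q: "quotient_of r = (u, v)" by fastforce
  have v: "v > 0" "r = of_int u / of_int v" "coprime u v"
    using q quotient_of_denom_pos quotient_of_div quotient_of_coprime by auto
  have "padic_abs (of_rat r :: 'p padic) \<le> 1"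
    using padic_abs_ultra_diff[of x "x - of_rat r"] assms r e by simp
  then have uv: "pabs_int ?p u \<le> pabs_int ?p v"
    using pabs_int_pos[OF p, of v] v by (simp add: pabs_Fract[OF p] divide_le_eq)
  have nd: "\<not> int ?p dvd v"
  proof
    assume dv: "int ?p dvd v"
    then have "pabs_int ?p v \<le> (1 / real ?p) ^ 1" using pabs_int_le_iff[OF p, of v 1] by simp
    then have "pabs_int ?p u \<le> (1 / real ?p) ^ 1" using uv by simp
    then have "int ?p dvd u" using pabs_int_le_iff[OF p, of u 1] by simp
    with dv v(3) have "is_unit (int ?p)" using coprime_common_divisor by blast
    then show False using prime_gt_1_nat[OF p] by simp
  qed
  then have v1: "pabs_int ?p v = 1"
    using v(1) by (simp add: pabs_int_def not_dvd_imp_multiplicity_0)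
  have "coprime v (int ?p ^ n)"
    using nd p by (simp add: coprime_commute[of v] prime_imp_coprime)
  then obtain w z where wz: "w * v + z * int ?p ^ n = 1"
    by (metis bezout_int coprime_imp_gcd_eq_1)
  define a where "a = nat ((u * w) mod int ?p ^ n)"
  have pn: "int ?p ^ n > 0" using prime_gt_0_nat[OF p] by simp
  have a: "int a = (u * w) mod int ?p ^ n" using pn by (simp add: a_def)
  have "int a < int ?p ^ n" unfolding a using pn by simp
  then have "a < ?p ^ n" by (metis of_nat_less_iff of_nat_power)
  moreover have "padic_abs (x - of_nat a) \<le> ?e"
  proof -
    have "int ?p ^ n dvd u - int a * v"
    proof -
      have "u - int a * v = u * (1 - w * v) + (u * w - int a) * v" by (simp add: algebra_simps)
      also have "1 - w * v = z * int ?p ^ n" using wz by simp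
      also have "u * w - int a = int ?p ^ n * (u * w div int ?p ^ n)"
        unfolding a by (simp add: minus_mod_eq_mult_div)
      finally show ?thesis by simp
    qed
    then have 1: "pabs_int ?p (u - int a * v) \<le> ?e" using pabs_int_le_iff[OF p] by simp
    have "(of_rat r :: 'p padic) = of_int u / of_int v"
      by (simp add: v(2) of_rat_divide)
    then have "of_rat r - of_nat a = (of_int (u - int a * v) / of_int v :: 'p padic)"
      using v(1) by (simp add: field_simps)
    then have "padic_abs (of_rat r - of_nat a :: 'p padic) * padic_abs (of_int v :: 'p padic)
        = padic_abs (of_int (u - int a * v) :: 'p padic)"
      unfolding padic_abs_mult[symmetric] using v(1) by simp
    then have "padic_abs (of_rat r - of_nat a :: 'p padic) \<le> ?e"
      using 1 v1 by (simp del: of_int_diff of_int_mult)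
    then show ?thesis
      using padic_abs_ultra[of "x - of_rat r" "of_rat r - of_nat a"] r by simp
  qed
  ultimately show ?thesis by blast
qed

lemma padic_expansion_exists:
  fixes x :: "'p::prime_card padic"
  shows "\<exists>M c. padic_expansion x M c"
proof -
  let ?p = "CARD('p)"
  note p = prime_card[where 'a = 'p]
  let ?b = "of_nat CARD('p) :: 'p padic"
  have b: "?b \<noteq> 0" by simp
  have p1: "real ?p > 1" using prime_gt_1_nat[OF p] by simp
  obtain k where k: "padic_abs x < real ?p ^ k" using real_arch_pow[OF p1] by blast
  define y where "y = ?b ^ k * x"
  have "padic_abs y = padic_abs x / real ?p ^ k"
    by (simp add: y_def padic_abs_mult padic_abs_power padic_abs_prime power_divide)
  then have "padic_abs y \<le> 1" using k p1 by (simp add: divide_le_eq)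
  then have "\<forall>n. \<exists>a. a < ?p ^ n \<and> padic_abs (y - of_nat a) \<le> (1 / real ?p) ^ n"
    using padic_abs_le_one_approx by blast
  then obtain a where a: "\<And>n. a n < ?p ^ n" "\<And>n. padic_abs (y - of_nat (a n)) \<le> (1 / real ?p) ^ n"
    by metis
  define d where "d n = a (Suc n) div ?p ^ n" for n
  have step: "a (Suc n) = a n + d n * ?p ^ n" for n
  proof -
    have "(1 / real ?p) ^ Suc n \<le> (1 / real ?p) ^ n" using p1 by (intro power_decreasing) auto
    then have "padic_abs (of_int (int (a (Suc n)) - int (a n)) :: 'p padic) \<le> (1 / real ?p) ^ n"
      using padic_abs_ultra_diff[of "y - of_nat (a n)" "y - of_nat (a (Suc n))"] a(2)[of n] a(2)[of "Suc n"]
      by (simp del: padic_abs_of_int power_Suc)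
    then have "int ?p ^ n dvd int (a (Suc n)) - int (a n)"
      using pabs_int_le_iff[OF p] by (simp del: of_int_diff)
    then have "a (Suc n) mod ?p ^ n = a n mod ?p ^ n"
      by (metis mod_eq_dvd_iff of_nat_eq_iff of_nat_mod of_nat_power)
    then have "a (Suc n) mod ?p ^ n = a n" using a(1) by simp
    then show ?thesis unfolding d_def by (metis add.commute div_mult_mod_eq)
  qed
  have d: "d n < ?p" for n
    using a(1)[of "Suc n"] by (simp add: d_def less_mult_imp_div_less)
  have a_eq: "a n = (\<Sum>i<n. d i * ?p ^ i)" for n
    by (induction n) (use a(1)[of 0] step in auto)
  define c where "c j = d (nat (j + int k))" for j
  let ?s = "\<lambda>n. of_nat (c (- int k + int n)) * ?b powi (- int k + int n)"
  have s: "(\<Sum>i<n. ?s i) = of_nat (a n) / ?b ^ k" for n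
    using b by (simp add: a_eq c_def sum_divide_distrib power_int_diff)
  have "?s sums x"
    unfolding sums_def LIMSEQ_def
  proof (intro allI impI)
    fix e :: real assume e: "e > 0"
    have "e / real ?p ^ k > 0" using e p1 by simp
    then obtain N where N: "(1 / real ?p) ^ N < e / real ?p ^ k"
      using real_arch_pow_inv[of "e / real ?p ^ k" "1 / real ?p"] p1 by auto
    have "dist (\<Sum>i<n. ?s i) x < e" if "n \<ge> N" for n
    proof -
      have "y - of_nat (a n) = (x - (\<Sum>i<n. ?s i)) * ?b ^ k"
        using b unfolding s y_def by (simp add: field_simps)
      then have "padic_abs (y - of_nat (a n)) = padic_abs (x - (\<Sum>i<n. ?s i)) / real ?p ^ k"
        by (simp add: padic_abs_mult padic_abs_power padic_abs_prime power_divide)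
      moreover have "(1 / real ?p) ^ n \<le> (1 / real ?p) ^ N" using p1 that by (intro power_decreasing) auto
      ultimately have "padic_abs (x - (\<Sum>i<n. ?s i)) / real ?p ^ k < e / real ?p ^ k"
        using a(2)[of n] N by linarith
      moreover have "real ?p ^ k > 0" using p1 by simp
      ultimately have "padic_abs (x - (\<Sum>i<n. ?s i)) < e" by (simp add: divide_less_cancel)
      then show ?thesis
        unfolding dist_padic_def by (subst padic_abs_minus_commute)
    qed
    then show "\<exists>N. \<forall>n\<ge>N. dist (\<Sum>i<n. ?s i) x < e" by blast
  qed
  then have "padic_expansion x (- int k) c"
    using d by (simp add: padic_expansion_def c_def)
  then show ?thesis by blast
qed

lemma padic_frac_eq:
  fixes x :: "'p::prime_card padic"
  assumes "padic_expansion x M c"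
  shows "padic_frac x = (\<Sum>j\<in>{M..-1}. real (c j) * real CARD('p) powi j)"
  unfolding padic_frac_def
proof (rule the_equality)
  fix t assume "\<exists>M c. padic_expansion x M c \<and> t = (\<Sum>j\<in>{M..-1}. real (c j) * real CARD('p) powi j)"
  then obtain M' c' where *: "padic_expansion x M' c'"
    "t = (\<Sum>j\<in>{M'..-1}. real (c' j) * real CARD('p) powi j)" by blast
  show "t = (\<Sum>j\<in>{M..-1}. real (c j) * real CARD('p) powi j)"
  proof -
    obtain A where A: "A < CARD('p) ^ nat (- M)"
      "(\<Sum>j\<in>{M..-1}. real (c j) * real CARD('p) powi j) = real A / real CARD('p) ^ nat (- M)"
      "padic_abs (x - of_nat A / of_nat CARD('p) ^ nat (- M)) \<le> 1"
      by (rule padic_expansion_frac[OF assms])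
    obtain B where B: "B < CARD('p) ^ nat (- M')"
      "(\<Sum>j\<in>{M'..-1}. real (c' j) * real CARD('p) powi j) = real B / real CARD('p) ^ nat (- M')"
      "padic_abs (x - of_nat B / of_nat CARD('p) ^ nat (- M')) \<le> 1"
      by (rule padic_expansion_frac[OF *(1)])
    show ?thesis
      unfolding *(2) A(2) B(2) by (rule padic_frac_unique_aux[OF B(1) A(1) B(3) A(3)])
  qed
qed (use assms in blast)

lemma padic_frac_padic_int:
  assumes "padic_abs x \<le> 1"
  shows "padic_frac x = 0"
proof -
  obtain M c where Mc: "padic_expansion x M c" using padic_expansion_exists by blast
  obtain A where A: "A < CARD('a) ^ nat (- M)"
    "(\<Sum>j\<in>{M..-1}. real (c j) * real CARD('a) powi j) = real A / real CARD('a) ^ nat (- M)"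
    "padic_abs (x - of_nat A / of_nat CARD('a) ^ nat (- M)) \<le> 1"
    by (rule padic_expansion_frac[OF Mc])
  show ?thesis
    unfolding padic_frac_eq[OF Mc] A(2)
    using padic_frac_unique_aux[OF A(1) _ A(3), of 0 0] assms by simp
qed

section \<open>Hausdorff dimension\<close>

text \<open>Coverings by countably many bounded sets (\<^const>\<open>diameter\<close> is only meaningful for
  bounded sets). Restricting the exponents to positive reals avoids the convention \<open>0 powr 0 = 0\<close>
  and does not change the infimum.\<close>

definition hausdorff_premeasure :: "real \<Rightarrow> real \<Rightarrow> 'a::metric_space set \<Rightarrow> ennreal"
  where "hausdorff_premeasure s \<delta> A =
    (INF U \<in> {U :: nat \<Rightarrow> 'a set. A \<subseteq> (\<Union>i. U i) \<and> (\<forall>i. bounded (U i) \<and> diameter (U i) \<le> \<delta>)}.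
      (\<Sum>i. ennreal (diameter (U i) powr s)))"

definition hausdorff_measure :: "real \<Rightarrow> 'a::metric_space set \<Rightarrow> ennreal"
  where "hausdorff_measure s A = (SUP \<delta>\<in>{0<..}. hausdorff_premeasure s \<delta> A)"

definition hausdorff_dim :: "'a::metric_space set \<Rightarrow> ennreal"
  where "hausdorff_dim A = (INF s \<in> {s. 0 < s \<and> hausdorff_measure s A = 0}. ennreal s)"

section \<open>Measures and Fourier transforms\<close>

definition borel_prob :: "'a::topological_space measure \<Rightarrow> bool"
  where "borel_prob \<mu> \<longleftrightarrow> prob_space \<mu> \<and> sets \<mu> = sets borel"

definition closed_support :: "'a::topological_space measure \<Rightarrow> 'a set"
  where "closed_support \<mu> = {x. \<forall>U. open U \<and> x \<in> U \<longrightarrow> emeasure \<mu> U > 0}"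

text \<open>Local finiteness need not be required: translation invariance and the value on the unit ball
  determine the measure of every ball, hence the measure on all Borel sets.\<close>

definition is_normalized_haar :: "'p::prime_card padic measure \<Rightarrow> bool"
  where "is_normalized_haar M \<longleftrightarrow> sets M = sets borel \<and>
    (\<forall>a. \<forall>A\<in>sets borel. emeasure M ((\<lambda>x. a + x) ` A) = emeasure M A) \<and>
    emeasure M (cball 0 1) = 1"

definition haar :: "'p::prime_card padic measure"
  where "haar = (THE M. is_normalized_haar M)"

definition padic_char :: "'p::prime_card padic \<Rightarrow> complex"
  where "padic_char x = exp (2 * of_real pi * \<i> * of_real (padic_frac x))"

definition fourier_fun :: "('p::prime_card padic \<Rightarrow> complex) \<Rightarrow> 'p padic \<Rightarrow> complex"
  where "fourier_fun f s = (LINT x|haar. padic_char (x * s) * f x)"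

definition fourier_measure :: "'p::prime_card padic measure \<Rightarrow> 'p padic \<Rightarrow> complex"
  where "fourier_measure \<mu> \<xi> = (LINT x|\<mu>. padic_char (x * \<xi>))"

definition Lq_space :: "'a measure \<Rightarrow> real \<Rightarrow> ('a \<Rightarrow> complex) set"
  where "Lq_space M q = {f \<in> borel_measurable M. integrable M (\<lambda>x. norm (f x) powr q)}"

definition Lq_norm :: "'a measure \<Rightarrow> real \<Rightarrow> ('a \<Rightarrow> complex) \<Rightarrow> real"
  where "Lq_norm M q f = (LINT x|M. norm (f x) powr q) powr (1 / q)"

section \<open>Fourier dimension and Salem sets\<close>

text \<open>In \<^typ>\<open>ennreal\<close> the supremum over the empty set is 0, which occurs only for empty sets.\<close>

definition fourier_dim :: "'p::prime_card padic set \<Rightarrow> ennreal"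
  where "fourier_dim A = (SUP \<beta> \<in> {\<beta>. 0 \<le> \<beta> \<and> \<beta> \<le> 1 \<and>
    (\<exists>\<mu>. borel_prob \<mu> \<and> compact (closed_support \<mu>) \<and> closed_support \<mu> \<subseteq> A \<and>
      bdd_above ((\<lambda>\<xi>. (cmod (fourier_measure \<mu> \<xi>))\<^sup>2 * padic_abs \<xi> powr \<beta>) ` {\<xi>. \<xi> \<noteq> 0}))}.
    ennreal \<beta>)"

definition salem_set :: "'p::prime_card padic set \<Rightarrow> bool"
  where "salem_set A \<longleftrightarrow> hausdorff_dim A = fourier_dim A"

definition well_approximable :: "real \<Rightarrow> 'p::prime_card padic set"
  where "well_approximable \<tau> = {x. padic_abs x \<le> 1 \<and>
    infinite {(q :: int, r :: int).
      padic_abs (x * of_int q - of_int r) \<le> real_of_int (max \<bar>q\<bar> \<bar>r\<bar>) powr (- \<tau>)}}"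

end

theory Submission
  imports Defs "HOL-Real_Asymp.Real_Asymp"
begin

text \<open>The measure is the law of the limit of a random walk on residues. Given a residue a modulo
  p^m, draw a prime q between 2 p^k and 6 p^k, where k is much larger than m, and a numerator
  r < 2 p^k congruent to q a modulo p^m; the next residue is that of r/q modulo p^m', where p^m' is
  about p^(k \<tau>). The limit is then within max(q, r)^(-\<tau>) of r/q, hence well approximable. A
  frequency of absolute value p^s with m < s \<le> k is averaged out by the numerators. For
  k < s \<le> m' the average over the numerators is large only if q divides one of a few integers
  determined by the frequency; since a nonzero integer has few prime divisors exceeding 2 p^k, this
  happens for few q, which gives decay p^(-k) up to logarithms. Balls are bounded by counting
  fractions r/q, whose slopes are separated.

  The restriction estimate is the Mockenhaupt-Mitsis argument without interpolation: split f into
  level sets and, on each of them, cut the Fourier transform of the measure at a frequency chosen for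
  that level: the near part is controlled by the ball condition, the far part by the decay.

  The upper bound for the Hausdorff dimension is the Borel-Cantelli covering by balls around
  fractions. That the Fourier dimension is at most the Hausdorff dimension follows from the
  expansion of the indicator of a ball into characters, which turns Fourier decay into a bound for
  the mean measure of balls, and the mass distribution principle.\<close>

section \<open>Topology of the field of p-adic numbers\<close>

text \<open>Every estimate is made conditionally on the current residue and uniformly in it, so a
  frequency or a radius is handled by at most two consecutive steps, and no constants multiply along
  the walk. The price is a loss of a power of p^m in each step, because the numerators are confined
  to one class modulo p^m. This is why k is taken at least p^(2m): the loss is then at most k, hence
  at most one logarithm. In the Fourier estimate the other logarithm comes from counting prime
  divisors, where the density 1/ln T of the primes cancels against the factor 1/ln T of the divisor
  count. Prime denominators above 2 T and numerators below 2 T serve several ends at once: nonzero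
  fractions are reduced, the larger of the two numbers is the denominator, and an integer has few
  divisors among the denominators. Only roots such as p^(1/\<tau>) \<le> p enter the constants, so
  they depend on p alone. In the restriction estimate the logarithms are absorbed by a small change
  of the exponents, for which the strict inequality on q leaves room.\<close>

lemma CARD_gt_1: "1 < CARD('p::prime_card)"
  using prime_gt_1_nat[OF prime_card[where 'a = 'p]] .

lemma real_CARD_gt_1 [simp]: "1 < real CARD('p::prime_card)"
  using CARD_gt_1[where 'p = 'p] by simp

lemma CARD_ge_2: "2 \<le> real CARD('p::prime_card)"
  using CARD_gt_1[where 'p = 'p] by simp

lemma padic_abs_inverse: "padic_abs (inverse x) = inverse (padic_abs x)" for x :: "'p::prime_card padic"
proof (cases "x = 0")
  case False
  then have "padic_abs x * padic_abs (inverse x) = 1"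
    by (simp flip: padic_abs_mult)
  then show ?thesis by (metis inverse_unique)
qed simp

lemma padic_abs_divide: "padic_abs (x / y) = padic_abs x / padic_abs y" for x y :: "'p::prime_card padic"
  by (simp add: divide_inverse padic_abs_mult padic_abs_inverse)

lemma padic_abs_pos: "x \<noteq> 0 \<Longrightarrow> 0 < padic_abs x" for x :: "'p::prime_card padic"
  by (simp add: order_less_le)

lemma padic_abs_eq_of_close:
  fixes x y :: "'p::prime_card padic"
  assumes "padic_abs (x - y) < padic_abs x"
  shows "padic_abs y = padic_abs x"
proof (rule antisym)
  have "padic_abs y \<le> max (padic_abs x) (padic_abs (x - y))"
    using padic_abs_ultra_diff[of x "x - y"] by simp
  then show "padic_abs y \<le> padic_abs x" using assms by simp
  have "padic_abs x \<le> max (padic_abs (x - y)) (padic_abs y)"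
    using padic_abs_ultra[of "x - y" y] by simp
  then show "padic_abs x \<le> padic_abs y" using assms by (auto simp: max_def split: if_splits)
qed

text \<open>A rational closer to x than |x| has the same absolute value as x, so completing the
  rationals adds no new values: the value group still consists of the powers of p.\<close>

lemma padic_abs_cases:
  fixes x :: "'p::prime_card padic"
  assumes "x \<noteq> 0"
  obtains k :: int where "padic_abs x = real CARD('p) powi k"
proof -
  let ?p = "real CARD('p)"
  obtain r where r: "padic_abs (x - of_rat r) < padic_abs x"
    using padic_of_rat_dense[OF padic_abs_pos[OF assms]] by blast
  have eq: "padic_abs x = pabs CARD('p) r"
    using padic_abs_eq_of_close[OF r] by simp
  obtain a b where ab: "quotient_of r = (a, b)" by fastforce
  have "r \<noteq> 0" using eq assms by auto
  then have "a \<noteq> 0" "b \<noteq> 0"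
    using ab quotient_of_div[OF ab] quotient_of_denom_pos[OF ab] by auto
  then have "padic_abs x = ?p powi (int (multiplicity (int CARD('p)) b) - int (multiplicity (int CARD('p)) a))"
    by (simp add: eq pabs_def ab pabs_int_def power_int_diff power_divide divide_simps)
  then show ?thesis by (rule that)
qed

lemma padic_abs_ge_1_cases:
  fixes x :: "'p::prime_card padic"
  assumes "1 \<le> padic_abs x"
  obtains s :: nat where "padic_abs x = real CARD('p) ^ s"
proof -
  have "x \<noteq> 0" using assms by auto
  then obtain k :: int where k: "padic_abs x = real CARD('p) powi k" by (rule padic_abs_cases)
  have "0 \<le> k"
  proof (rule ccontr)
    assume "\<not> 0 \<le> k"
    then have "0 < - k" by simp
    then have "1 < real CARD('p) powi (- k)" by (intro power_int_strict_increasing[of 0, simplified] real_CARD_gt_1)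
    then have "real CARD('p) powi k < 1" by (simp add: power_int_minus one_less_inverse_iff)
    then show False using assms k by simp
  qed
  then show ?thesis using that[of "nat k"] k by (simp add: power_int_def)
qed

lemma padic_abs_prime_power [simp]:
  "padic_abs (of_nat CARD('p) ^ n :: 'p::prime_card padic) = (1 / real CARD('p)) ^ n"
  by (simp add: padic_abs_power padic_abs_prime)

lemma padic_abs_of_int_le_iff:
  "padic_abs (of_int a :: 'p::prime_card padic) \<le> (1 / real CARD('p)) ^ n \<longleftrightarrow> int CARD('p) ^ n dvd a"
  by (simp add: pabs_int_le_iff prime_card)

lemma padic_abs_of_nat_diff_le_iff:
  "padic_abs (of_nat a - of_nat b :: 'p::prime_card padic) \<le> (1 / real CARD('p)) ^ n
    \<longleftrightarrow> a mod CARD('p) ^ n = b mod CARD('p) ^ n"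
proof -
  have "padic_abs (of_nat a - of_nat b :: 'p padic) = padic_abs (of_int (int a - int b) :: 'p padic)"
    by simp
  also have "\<dots> \<le> (1 / real CARD('p)) ^ n \<longleftrightarrow> int CARD('p) ^ n dvd int a - int b"
    by (rule padic_abs_of_int_le_iff)
  also have "\<dots> \<longleftrightarrow> a mod CARD('p) ^ n = b mod CARD('p) ^ n"
    by (metis mod_eq_dvd_iff of_nat_eq_iff of_nat_mod of_nat_power)
  finally show ?thesis .
qed

lemma padic_abs_of_nat_coprime:
  assumes "\<not> CARD('p::prime_card) dvd q"
  shows "padic_abs (of_nat q :: 'p padic) = 1"
proof -
  have "padic_abs (of_int (int q) :: 'p padic) = 1"
    using assms by (cases "q = 0") (auto simp: pabs_int_def not_dvd_imp_multiplicity_0 simp del: of_int_of_nat_eq)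
  then show ?thesis by simp
qed

lemma cball_padic: "cball x r = {y :: 'p::prime_card padic. padic_abs (x - y) \<le> r}"
  by (auto simp: dist_padic_def)

text \<open>The strong triangle inequality makes every point of a ball a centre of it. Openness of
  closed balls, their nestedness and the local constancy of the mass of a ball all rest on
  this.\<close>

lemma cball_padic_eq:
  fixes x y :: "'p::prime_card padic"
  assumes "padic_abs (x - y) \<le> r"
  shows "cball x r = cball y r"
proof -
  have *: "cball x r \<subseteq> cball y r" if "padic_abs (x - y) \<le> r" for x y :: "'p padic"
  proof
    fix z assume "z \<in> cball x r"
    then show "z \<in> cball y r"
      using that padic_abs_ultra[of "y - x" "x - z"]
      by (auto simp: cball_padic padic_abs_minus_commute[of y x])
  qed
  show ?thesis using *[of x y] *[of y x] assms by (auto simp: padic_abs_minus_commute)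
qed

lemma open_cball_padic:
  fixes x :: "'p::prime_card padic"
  assumes "0 < r"
  shows "open (cball x r)"
  unfolding open_dist
proof (intro ballI exI[of _ r] conjI allI impI assms)
  fix y z assume "y \<in> cball x r" "dist z y < r"
  then show "z \<in> cball x r"
    using cball_padic_eq[of x y r] by (auto simp: cball_padic dist_padic_def padic_abs_minus_commute[of z])
qed

text \<open>Balls with rational centres and radii 1/(n+1) form a countable basis. The Borel sets of
  a product are then generated by rectangles, which makes products and differences of two measurable
  functions measurable.\<close>

instance padic :: (prime_card) second_countable_topology
proof
  let ?B = "(\<lambda>(r, n). ball (of_rat r :: 'a padic) (inverse (real (Suc n)))) ` UNIV"
  have "topological_basis ?B"
  proof (rule topological_basisI)
    fix O' :: "'a padic set" and x assume "open O'" "x \<in> O'"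
    then obtain e where e: "0 < e" "ball x e \<subseteq> O'" by (meson openE)
    obtain n where n: "inverse (real (Suc n)) < e / 2" using reals_Archimedean[of "e / 2"] e by auto
    obtain r where r: "padic_abs (x - of_rat r) < inverse (real (Suc n))"
      using padic_of_rat_dense[of "inverse (real (Suc n))" x] by auto
    have "ball (of_rat r) (inverse (real (Suc n))) \<subseteq> ball x e"
    proof
      fix z :: "'a padic" assume "z \<in> ball (of_rat r) (inverse (real (Suc n)))"
      then have "dist (of_rat r) z < e / 2" using n by simp
      moreover have "dist x (of_rat r) < e / 2" using r n by (simp add: dist_padic_def)
      ultimately show "z \<in> ball x e" using dist_triangle[of x z "of_rat r"] by simp
    qed
    then show "\<exists>B'\<in>?B. x \<in> B' \<and> B' \<subseteq> O'"
      using r e(2) by (intro bexI[of _ "ball (of_rat r) (inverse (real (Suc n)))"])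
        (auto simp: dist_padic_def padic_abs_minus_commute)
  qed auto
  then show "\<exists>B :: 'a padic set set. countable B \<and> open = generate_topology B"
    using topological_basis_imp_subbasis[of ?B] by (intro exI[of _ ?B]) auto
qed

section \<open>Continuity and measurability of the ring operations\<close>

lemma tendsto_padic_iff:
  fixes L :: "'p::prime_card padic"
  shows "(f \<longlongrightarrow> L) F \<longleftrightarrow> ((\<lambda>x. padic_abs (f x - L)) \<longlongrightarrow> 0) F"
  using tendsto_dist_iff[of f L F] by (simp add: dist_padic_def)

instance padic :: (prime_card) topological_ab_group_add
proof
  fix a b :: "'a padic"
  let ?F = "nhds a \<times>\<^sub>F nhds b"
  have 1: "(fst \<longlongrightarrow> a) ?F" and 2: "(snd \<longlongrightarrow> b) ?F"
    by (rule filterlim_fst filterlim_snd)+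
  show "((\<lambda>x. fst x + snd x) \<longlongrightarrow> a + b) ?F"
    unfolding tendsto_padic_iff
  proof (rule tendsto_sandwich[OF _ _ tendsto_const])
    show "((\<lambda>x. padic_abs (fst x - a) + padic_abs (snd x - b)) \<longlongrightarrow> 0) ?F"
      using tendsto_add[OF 1[unfolded tendsto_padic_iff] 2[unfolded tendsto_padic_iff]] by simp
    show "\<forall>\<^sub>F x in ?F. padic_abs (fst x + snd x - (a + b)) \<le> padic_abs (fst x - a) + padic_abs (snd x - b)"
    proof (rule always_eventually, rule allI)
      fix x :: "'a padic \<times> 'a padic"
      show "padic_abs (fst x + snd x - (a + b)) \<le> padic_abs (fst x - a) + padic_abs (snd x - b)"
        using padic_abs_ultra[of "fst x - a" "snd x - b"] padic_abs_nonneg[of "fst x - a"]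
          padic_abs_nonneg[of "snd x - b"]
        by (simp add: add_diff_add del: padic_abs_nonneg)
    qed
  qed simp
next
  fix a :: "'a padic"
  have "((\<lambda>x. x) \<longlongrightarrow> a) (nhds a)" by (rule filterlim_ident)
  then show "(uminus \<longlongrightarrow> - a) (nhds a)"
    unfolding tendsto_padic_iff by (simp add: padic_abs_minus_commute[of _ a])
qed

instance padic :: (prime_card) topological_comm_monoid_mult
proof
  fix a b :: "'a padic"
  let ?F = "nhds a \<times>\<^sub>F nhds b"
  have 1: "((\<lambda>x. padic_abs (fst x - a)) \<longlongrightarrow> 0) ?F" and 2: "((\<lambda>x. padic_abs (snd x - b)) \<longlongrightarrow> 0) ?F"
    unfolding tendsto_padic_iff[symmetric] by (rule filterlim_fst filterlim_snd)+
  show "((\<lambda>x. fst x * snd x) \<longlongrightarrow> a * b) ?F"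
    unfolding tendsto_padic_iff
  proof (rule tendsto_sandwich[OF _ _ tendsto_const])
    let ?g = "\<lambda>x :: 'a padic \<times> 'a padic. padic_abs (fst x - a) * padic_abs (snd x - b)
      + (padic_abs (fst x - a) * padic_abs b + padic_abs a * padic_abs (snd x - b))"
    show "(?g \<longlongrightarrow> 0) ?F"
      using tendsto_add[OF tendsto_mult[OF 1 2] tendsto_add[OF tendsto_mult[OF 1 tendsto_const[of "padic_abs b"]]
        tendsto_mult[OF tendsto_const[of "padic_abs a"] 2]]] by simp
    show "\<forall>\<^sub>F x in ?F. padic_abs (fst x * snd x - a * b) \<le> ?g x"
    proof (rule always_eventually, rule allI)
      fix x :: "'a padic \<times> 'a padic"
      have "fst x * snd x - a * b = (fst x - a) * (snd x - b) + ((fst x - a) * b + a * (snd x - b))"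
        by (simp add: algebra_simps)
      then have "padic_abs (fst x * snd x - a * b) \<le>
          dist ((fst x - a) * (snd x - b) + ((fst x - a) * b + a * (snd x - b))) 0"
        by (simp add: dist_padic_def)
      also have "\<dots> \<le> padic_abs ((fst x - a) * (snd x - b)) + padic_abs ((fst x - a) * b + a * (snd x - b))"
        using dist_triangle[of "(fst x - a) * (snd x - b) + ((fst x - a) * b + a * (snd x - b))" 0
          "((fst x - a) * b + a * (snd x - b))"] by (simp add: dist_padic_def)
      also have "padic_abs ((fst x - a) * b + a * (snd x - b)) \<le> padic_abs ((fst x - a) * b) + padic_abs (a * (snd x - b))"
        using dist_triangle[of "(fst x - a) * b + a * (snd x - b)" 0 "a * (snd x - b)"] by (simp add: dist_padic_def)
      finally show "padic_abs (fst x * snd x - a * b) \<le> ?g x"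
        by (simp add: padic_abs_mult)
    qed
  qed simp
qed

lemma borel_measurable_padic_mult [measurable (raw)]:
  fixes f g :: "_ \<Rightarrow> 'p::prime_card padic"
  assumes "f \<in> borel_measurable M" "g \<in> borel_measurable M"
  shows "(\<lambda>x. f x * g x) \<in> borel_measurable M"
  using assms by (rule borel_measurable_continuous_Pair) (intro continuous_intros)

lemma borel_measurable_padic_diff [measurable (raw)]:
  fixes f g :: "_ \<Rightarrow> 'p::prime_card padic"
  assumes "f \<in> borel_measurable M" "g \<in> borel_measurable M"
  shows "(\<lambda>x. f x - g x) \<in> borel_measurable M"
  using assms by (rule borel_measurable_continuous_Pair) (intro continuous_intros)

lemma continuous_on_padic_abs: "continuous_on UNIV (padic_abs :: 'p::prime_card padic \<Rightarrow> real)"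
proof -
  have "continuous_on UNIV (\<lambda>x :: 'p padic. dist x 0)" by (intro continuous_intros)
  then show ?thesis by (simp add: dist_padic_def)
qed

lemma borel_measurable_padic_abs [measurable]: "(padic_abs :: 'p::prime_card padic \<Rightarrow> real) \<in> borel_measurable borel"
  by (rule borel_measurable_continuous_onI[OF continuous_on_padic_abs])

section \<open>Residues and the standard additive character\<close>

text \<open>Junk value outside the p-adic integers.\<close>

definition residue :: "nat \<Rightarrow> 'p::prime_card padic \<Rightarrow> nat"
  where "residue n x = (SOME a. a < CARD('p) ^ n \<and> padic_abs (x - of_nat a) \<le> (1 / real CARD('p)) ^ n)"

lemma residue:
  fixes x :: "'p::prime_card padic"
  assumes "padic_abs x \<le> 1"
  shows "residue n x < CARD('p) ^ n" and "padic_abs (x - of_nat (residue n x)) \<le> (1 / real CARD('p)) ^ n"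
  using someI_ex[OF padic_abs_le_one_approx[OF assms, of n]] by (auto simp: residue_def)

lemma residue_eqI:
  fixes x :: "'p::prime_card padic"
  assumes "a < CARD('p) ^ n" "padic_abs (x - of_nat a) \<le> (1 / real CARD('p)) ^ n"
  shows "residue n x = a"
proof -
  have le1: "(1 / real CARD('p)) ^ n \<le> 1" by (intro power_le_one) auto
  have "padic_abs x \<le> 1"
    using padic_abs_ultra[of "x - of_nat a" "of_nat a"] assms(2) le1 padic_abs_of_nat_le[of a, where 'p = 'p]
    by simp
  note r = residue[OF this, of n]
  have "padic_abs (of_nat a - of_nat (residue n x) :: 'p padic) \<le> (1 / real CARD('p)) ^ n"
    using padic_abs_ultra_diff[of "x - of_nat (residue n x)" "x - of_nat a"] r(2) assms(2) by simp
  then show ?thesis using r(1) assms(1) by (simp add: padic_abs_of_nat_diff_le_iff)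
qed

lemma residue_eq_iff:
  fixes x :: "'p::prime_card padic"
  assumes "padic_abs x \<le> 1" "a < CARD('p) ^ n"
  shows "residue n x = a \<longleftrightarrow> padic_abs (x - of_nat a) \<le> (1 / real CARD('p)) ^ n"
  using residue[OF assms(1), of n] residue_eqI[OF assms(2)] by auto

lemma padic_frac_repr:
  fixes x :: "'p::prime_card padic"
  obtains A k where "A < CARD('p) ^ k" "padic_frac x = real A / real CARD('p) ^ k"
    "padic_abs (x - of_nat A / of_nat CARD('p) ^ k) \<le> 1"
proof -
  obtain M c where Mc: "padic_expansion x M c" using padic_expansion_exists by blast
  show ?thesis
    using padic_expansion_frac[OF Mc] that padic_frac_eq[OF Mc] by metis
qed

lemma padic_frac_eqI:
  fixes x :: "'p::prime_card padic"
  assumes "A < CARD('p) ^ k" "padic_abs (x - of_nat A / of_nat CARD('p) ^ k) \<le> 1"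
  shows "padic_frac x = real A / real CARD('p) ^ k"
proof -
  obtain B l where B: "B < CARD('p) ^ l" "padic_frac x = real B / real CARD('p) ^ l"
    "padic_abs (x - of_nat B / of_nat CARD('p) ^ l) \<le> 1"
    by (rule padic_frac_repr)
  show ?thesis unfolding B(2) by (rule padic_frac_unique_aux[OF B(1) assms(1) B(3) assms(2)])
qed

lemma padic_char_eq_cis: "padic_char x = cis (2 * pi * padic_frac x)"
  by (simp add: padic_char_def cis_conv_exp mult_ac)

lemma norm_padic_char [simp]: "cmod (padic_char x) = 1"
  by (simp add: padic_char_eq_cis)

lemma cis_int_shift: "cis (2 * pi * (t + of_int n)) = cis (2 * pi * t)"
proof -
  have "cis (2 * pi * of_int n) = 1" by (rule cis_multiple_2pi) simp
  then show ?thesis by (simp add: ring_distribs flip: cis_mult)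
qed

text \<open>Changing the numerator by a multiple of p^k changes the angle by a multiple of 2 \<pi>.
  Since fractional parts do not add, allowing every integer numerator here, not only the reduced
  one, is what turns additivity of the character into a computation with a common
  denominator.\<close>

lemma padic_char_of_int:
  fixes x :: "'p::prime_card padic"
  assumes "padic_abs (x - of_int a / of_nat CARD('p) ^ k) \<le> 1"
  shows "padic_char x = cis (2 * pi * (real_of_int a / real CARD('p) ^ k))"
proof -
  let ?P = "int CARD('p) ^ k"
  define A where "A = nat (a mod ?P)"
  have P: "?P > 0" by simp
  have A: "int A = a mod ?P" using P by (simp add: A_def)
  have eq: "a = int A + ?P * (a div ?P)" using A by simp
  have "A < CARD('p) ^ k"
    using pos_mod_bound[OF P, of a] unfolding A[symmetric] by (metis of_nat_less_iff of_nat_power)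
  moreover have "padic_abs (x - of_nat A / of_nat CARD('p) ^ k) \<le> 1"
  proof -
    have "(of_int a :: 'p padic) = of_nat A + of_nat CARD('p) ^ k * of_int (a div ?P)"
      by (subst eq) simp
    then have "x - of_nat A / of_nat CARD('p) ^ k = (x - of_int a / of_nat CARD('p) ^ k) + of_int (a div ?P)"
      by (simp add: field_simps)
    also have "padic_abs \<dots> \<le> 1"
      using padic_abs_ultra[of "x - of_int a / of_nat CARD('p) ^ k" "of_int (a div ?P)"] assms
        pabs_int_le_one[OF prime_card[where 'a = 'p], of "a div ?P"] by simp
    finally show ?thesis .
  qed
  ultimately have "padic_char x = cis (2 * pi * (real A / real CARD('p) ^ k))"
    by (simp add: padic_char_eq_cis padic_frac_eqI)
  also have "\<dots> = cis (2 * pi * (real A / real CARD('p) ^ k + of_int (a div ?P)))"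
    by (rule cis_int_shift[symmetric])
  also have "real A / real CARD('p) ^ k + of_int (a div ?P) = real_of_int a / real CARD('p) ^ k"
  proof -
    have "real_of_int a = real A + real CARD('p) ^ k * of_int (a div ?P)"
      by (subst eq) simp
    then show ?thesis by (simp add: field_simps)
  qed
  finally show ?thesis .
qed

lemma padic_char_add: "padic_char (x + y) = padic_char x * padic_char y" for x y :: "'p::prime_card padic"
proof -
  let ?p = "of_nat CARD('p) :: 'p padic"
  obtain A k where A: "padic_frac x = real A / real CARD('p) ^ k" "padic_abs (x - of_nat A / ?p ^ k) \<le> 1"
    by (rule padic_frac_repr)
  obtain B l where B: "padic_frac y = real B / real CARD('p) ^ l" "padic_abs (y - of_nat B / ?p ^ l) \<le> 1"
    by (rule padic_frac_repr)
  define C where "C = int (A * CARD('p) ^ l + B * CARD('p) ^ k)"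
  have "of_int C / ?p ^ (k + l) = of_nat A / ?p ^ k + of_nat B / ?p ^ l"
    by (simp add: C_def power_add field_simps)
  then have "padic_abs (x + y - of_int C / ?p ^ (k + l)) \<le> 1"
    using padic_abs_ultra[of "x - of_nat A / ?p ^ k" "y - of_nat B / ?p ^ l"] A(2) B(2)
    by (simp add: algebra_simps)
  then have "padic_char (x + y) = cis (2 * pi * (real_of_int C / real CARD('p) ^ (k + l)))"
    by (rule padic_char_of_int)
  also have "real_of_int C / real CARD('p) ^ (k + l) = padic_frac x + padic_frac y"
    by (simp add: C_def A(1) B(1) power_add field_simps)
  finally show ?thesis by (simp add: padic_char_eq_cis cis_mult ring_distribs)
qed

lemma padic_char_eq_1: "padic_abs x \<le> 1 \<Longrightarrow> padic_char x = 1" for x :: "'p::prime_card padic"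
  by (simp add: padic_char_def padic_frac_padic_int)

lemma padic_char_0 [simp]: "padic_char 0 = 1"
  by (rule padic_char_eq_1) simp

lemma padic_char_minus: "padic_char (- x) = cnj (padic_char x)" for x :: "'p::prime_card padic"
proof -
  have "padic_char (- x) * padic_char x = 1" by (simp flip: padic_char_add)
  moreover have "cnj (padic_char x) * padic_char x = 1"
    by (simp add: padic_char_eq_cis cis_cnj cis_mult)
  ultimately show ?thesis
    by (metis mult_cancel_right mult_zero_right zero_neq_one)
qed

lemma padic_char_diff: "padic_char (x - y) = padic_char x * cnj (padic_char y)" for x y :: "'p::prime_card padic"
  using padic_char_add[of x "- y"] by (simp add: padic_char_minus)

lemma padic_char_cong:
  fixes x y :: "'p::prime_card padic"
  assumes "padic_abs (x - y) \<le> 1"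
  shows "padic_char x = padic_char y"
  using padic_char_add[of "x - y" y] padic_char_eq_1[OF assms] by simp

lemma padic_char_of_nat_mult: "padic_char (of_nat n * x) = padic_char x ^ n" for x :: "'p::prime_card padic"
  by (induction n) (simp_all add: ring_distribs padic_char_add)

text \<open>Outside Z_p the fractional part lies strictly between 0 and 1, so the kernel of the
  character is exactly Z_p. This is what makes sums over complete periods vanish.\<close>

lemma padic_char_neq_1:
  fixes x :: "'p::prime_card padic"
  assumes "1 < padic_abs x"
  shows "padic_char x \<noteq> 1"
proof
  assume 1: "padic_char x = 1"
  let ?p = "of_nat CARD('p) :: 'p padic"
  obtain A k where A: "A < CARD('p) ^ k" "padic_frac x = real A / real CARD('p) ^ k"
    "padic_abs (x - of_nat A / ?p ^ k) \<le> 1"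
    by (rule padic_frac_repr)
  have "0 < padic_frac x"
  proof -
    have "A \<noteq> 0" using A(3) assms by (intro notI) simp
    then show ?thesis using A(2) by simp
  qed
  moreover have "padic_frac x < 1"
  proof -
    have "real A < real (CARD('p) ^ k)" using A(1) by (simp only: of_nat_less_iff)
    then show ?thesis using A(2) by simp
  qed
  moreover obtain n where "2 * pi * padic_frac x = of_int n * (2 * pi)"
  proof -
    have "cos (2 * pi * padic_frac x) = 1"
      using 1 by (simp add: padic_char_eq_cis complex_eq_iff)
    then show ?thesis using that cos_one_2pi_int[of "2 * pi * padic_frac x"] by auto
  qed
  then have "padic_frac x = of_int n" by simp
  ultimately show False by simp
qed

lemma continuous_on_padic_char: "continuous_on UNIV (padic_char :: 'p::prime_card padic \<Rightarrow> complex)"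
  unfolding continuous_on_iff
proof (intro ballI allI impI)
  fix x :: "'p padic" and e :: real assume "0 < e"
  then have "dist (padic_char x') (padic_char x) < e" if "dist x' x < 1" for x'
    using padic_char_cong[of x' x] that by (simp add: dist_padic_def)
  then show "\<exists>d>0. \<forall>x'\<in>UNIV. dist x' x < d \<longrightarrow> dist (padic_char x') (padic_char x) < e"
    by (intro exI[of _ 1]) auto
qed

lemma borel_measurable_padic_char [measurable]: "(padic_char :: 'p::prime_card padic \<Rightarrow> complex) \<in> borel_measurable borel"
  by (rule borel_measurable_continuous_onI[OF continuous_on_padic_char])

text \<open>Orthogonality of characters: the sum is geometric and its ratio is a root of unity of
  order dividing p^n, equal to 1 only for integral z.\<close>

lemma sum_padic_char:
  fixes z :: "'p::prime_card padic"
  assumes "padic_abs z \<le> real CARD('p) ^ n"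
  shows "(\<Sum>a<CARD('p) ^ n. padic_char (of_nat a * z)) = (if padic_abs z \<le> 1 then of_nat (CARD('p) ^ n) else 0)"
proof (cases "padic_abs z \<le> 1")
  case True
  then have "padic_char (of_nat a * z) = 1" for a
    by (simp add: padic_char_of_nat_mult padic_char_eq_1)
  then show ?thesis using True by simp
next
  case False
  have "padic_char z ^ (CARD('p) ^ n) = padic_char (of_nat (CARD('p) ^ n) * z)"
    by (simp only: padic_char_of_nat_mult)
  also have "\<dots> = 1"
    using assms by (intro padic_char_eq_1) (simp add: padic_abs_mult power_divide divide_simps)
  finally have "(padic_char z - 1) * (\<Sum>a<CARD('p) ^ n. padic_char z ^ a) = 0"
    by (simp add: power_diff_1_eq[symmetric])
  then show ?thesis using False padic_char_neq_1[of z] by (simp add: padic_char_of_nat_mult)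
qed

section \<open>Measures on the p-adic integers from independent choices\<close>

primrec walk_trail :: "(nat \<Rightarrow> nat \<Rightarrow> 'u \<Rightarrow> nat) \<Rightarrow> (nat \<Rightarrow> 'u) \<Rightarrow> nat \<Rightarrow> nat"
  where
    "walk_trail step \<omega> 0 = 0"
  | "walk_trail step \<omega> (Suc n) = step n (walk_trail step \<omega> n) (\<omega> n)"

primrec walk_pmf :: "(nat \<Rightarrow> 'u pmf) \<Rightarrow> (nat \<Rightarrow> nat \<Rightarrow> 'u \<Rightarrow> nat) \<Rightarrow> nat \<Rightarrow> nat pmf"
  where
    "walk_pmf U step 0 = return_pmf 0"
  | "walk_pmf U step (Suc n) = bind_pmf (walk_pmf U step n) (\<lambda>a. map_pmf (step n a) (U n))"

definition walk_limit :: "(nat \<Rightarrow> nat \<Rightarrow> 'u \<Rightarrow> nat) \<Rightarrow> (nat \<Rightarrow> 'u) \<Rightarrow> 'p::prime_card padic"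
  where "walk_limit step \<omega> = lim (\<lambda>n. of_nat (walk_trail step \<omega> n))"

definition walk_measure :: "(nat \<Rightarrow> 'u pmf) \<Rightarrow> (nat \<Rightarrow> nat \<Rightarrow> 'u \<Rightarrow> nat) \<Rightarrow> 'p::prime_card padic measure"
  where "walk_measure U step = distr (PiM UNIV (\<lambda>i. measure_pmf (U i))) borel (walk_limit step)"

text \<open>By \<open>step_mod\<close> each residue refines the previous one, so a trail is a point
  of the inverse limit of the rings Z/p^(m n), that is, a p-adic integer. Both conditions are asked
  of every u and not only of those in the support of \<open>U n\<close>, so that every trail is
  coherent, without exceptional null sets.\<close>

locale padic_walk =
  fixes P :: "'p::prime_card itself" and m :: "nat \<Rightarrow> nat"
    and U :: "nat \<Rightarrow> 'u pmf" and step :: "nat \<Rightarrow> nat \<Rightarrow> 'u \<Rightarrow> nat"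
  assumes m_0: "m 0 = 0" and m_mono: "strict_mono m"
    and step_less: "a < CARD('p) ^ m n \<Longrightarrow> step n a u < CARD('p) ^ m (Suc n)"
    and step_mod: "a < CARD('p) ^ m n \<Longrightarrow> step n a u mod CARD('p) ^ m n = a"
begin

abbreviation "\<Omega> \<equiv> PiM UNIV (\<lambda>i. measure_pmf (U i))"
abbreviation "trail \<equiv> walk_trail step"
abbreviation "law \<equiv> walk_pmf U step"

sublocale PS: product_prob_space "\<lambda>i. measure_pmf (U i)" UNIV
  by unfold_locales

lemma trail_less: "trail \<omega> n < CARD('p) ^ m n"
  by (induction n) (simp_all add: m_0 step_less)

lemma trail_Suc_mod: "trail \<omega> (Suc n) mod CARD('p) ^ m n = trail \<omega> n"
  by (simp add: step_mod trail_less)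

lemma mod_power_mod: "i \<le> j \<Longrightarrow> x mod CARD('p) ^ m j mod CARD('p) ^ m i = x mod CARD('p) ^ m i"
  by (intro mod_mod_cancel le_imp_power_dvd strict_mono_leD[OF m_mono])

lemma trail_mod: "i \<le> n \<Longrightarrow> trail \<omega> n mod CARD('p) ^ m i = trail \<omega> i"
proof (induction n rule: dec_induct)
  case base
  then show ?case by (simp add: trail_less)
next
  case (step n)
  then show ?case using trail_Suc_mod[of \<omega> n] mod_power_mod[of i n "trail \<omega> (Suc n)"] by simp
qed

lemma law_less: "a \<in> set_pmf (law n) \<Longrightarrow> a < CARD('p) ^ m n"
  by (induction n arbitrary: a) (auto simp: m_0 step_less)

text \<open>Because steps refine residues, b can be reached only from its own reduction modulo p^(m
  n).\<close>

lemma pmf_law_Suc: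
  assumes "b < CARD('p) ^ m (Suc n)"
  shows "pmf (law (Suc n)) b = pmf (law n) (b mod CARD('p) ^ m n) *
    measure (U n) {u. step n (b mod CARD('p) ^ m n) u = b}"
proof -
  let ?a = "b mod CARD('p) ^ m n"
  have "pmf (law (Suc n)) b = (\<integral>a. pmf (map_pmf (step n a) (U n)) b \<partial>law n)"
    by (simp add: pmf_bind)
  also have "\<dots> = (\<integral>a. measure (U n) {u. step n ?a u = b} * indicator {?a} a \<partial>law n)"
  proof (intro integral_cong_AE)
    show "AE a in law n. pmf (map_pmf (step n a) (U n)) b = measure (U n) {u. step n ?a u = b} * indicator {?a} a"
    proof (rule AE_pmfI)
      fix a assume "a \<in> set_pmf (law n)"
      then have a: "a < CARD('p) ^ m n" by (rule law_less)
      show "pmf (map_pmf (step n a) (U n)) b = measure (U n) {u. step n ?a u = b} * indicator {?a} a"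
      proof (cases "a = ?a")
        case True
        then show ?thesis by (simp add: pmf_map vimage_def)
      next
        case False
        then have "{u. step n a u = b} = {}" using step_mod[OF a] by auto
        then show ?thesis using False by (simp add: pmf_map vimage_def)
      qed
    qed
  qed auto
  also have "\<dots> = measure (U n) {u. step n ?a u = b} * pmf (law n) ?a"
    by (simp add: pmf.rep_eq)
  finally show ?thesis by simp
qed

lemma pmf_law_eq_prod:
  assumes "b < CARD('p) ^ m n"
  shows "pmf (law n) b
    = (\<Prod>i<n. measure (U i) {u. step i (b mod CARD('p) ^ m i) u = b mod CARD('p) ^ m (Suc i)})"
  using assms
proof (induction n arbitrary: b)
  case 0
  then show ?case by (simp add: m_0)
next
  case (Suc n)
  let ?a = "b mod CARD('p) ^ m n"
  have "pmf (law n) ?a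
      = (\<Prod>i<n. measure (U i) {u. step i (b mod CARD('p) ^ m i) u = b mod CARD('p) ^ m (Suc i)})"
    by (subst Suc.IH) (simp_all add: mod_power_mod)
  then show ?case using Suc.prems by (simp add: pmf_law_Suc del: walk_pmf.simps)
qed

text \<open>The last residue determines the whole path. The event that a trail ends at b is
  therefore a cylinder with one condition on each coordinate, and the product measure gives its
  probability as a product.\<close>

lemma trail_eq_iff:
  assumes "b < CARD('p) ^ m n"
  shows "trail \<omega> n = b \<longleftrightarrow> (\<forall>i<n. step i (b mod CARD('p) ^ m i) (\<omega> i) = b mod CARD('p) ^ m (Suc i))"
proof
  assume "trail \<omega> n = b"
  then have "trail \<omega> i = b mod CARD('p) ^ m i" if "i \<le> n" for i
    using trail_mod[OF that, of \<omega>] by simp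
  then show "\<forall>i<n. step i (b mod CARD('p) ^ m i) (\<omega> i) = b mod CARD('p) ^ m (Suc i)"
    by (metis Suc_leI less_imp_le walk_trail.simps(2))
next
  assume *: "\<forall>i<n. step i (b mod CARD('p) ^ m i) (\<omega> i) = b mod CARD('p) ^ m (Suc i)"
  have "trail \<omega> i = b mod CARD('p) ^ m i" if "i \<le> n" for i
    using that by (induction i) (simp_all add: m_0 *)
  then show "trail \<omega> n = b" using assms by simp
qed

lemma measurable_trail [measurable]: "(\<lambda>\<omega>. trail \<omega> n) \<in> measurable \<Omega> (count_space UNIV)"
proof (induction n)
  case (Suc n)
  have "(\<lambda>\<omega>. step n i (\<omega> n)) \<in> measurable \<Omega> (count_space UNIV)" for i
  proof -
    have "(\<lambda>\<omega>. \<omega> n) \<in> measurable \<Omega> (measure_pmf (U n))" by simp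
    then show ?thesis by (rule measurable_compose) simp
  qed
  then have "(\<lambda>\<omega>. step n (trail \<omega> n) (\<omega> n)) \<in> measurable \<Omega> (count_space UNIV)"
    using Suc by (rule measurable_compose_countable)
  then show ?case by simp
qed simp

lemma distr_trail: "distr \<Omega> (count_space UNIV) (\<lambda>\<omega>. trail \<omega> n) = measure_pmf (law n)"
proof (rule measure_eqI_countable[of _ UNIV])
  fix b :: nat
  have eq: "(\<lambda>\<omega>. trail \<omega> n) -` {b} \<inter> space \<Omega> = {\<omega> \<in> space \<Omega>. trail \<omega> n = b}"
    by (rule set_eqI) (simp only: vimage_singleton_eq Int_iff mem_Collect_eq conj_commute)
  have "emeasure \<Omega> {\<omega> \<in> space \<Omega>. trail \<omega> n = b} = ennreal (pmf (law n) b)"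
  proof (cases "b < CARD('p) ^ m n")
    case True
    let ?X = "\<lambda>i. {u. step i (b mod CARD('p) ^ m i) u = b mod CARD('p) ^ m (Suc i)}"
    have eq: "{\<omega> \<in> space \<Omega>. trail \<omega> n = b} = {\<omega> \<in> space \<Omega>. \<forall>i\<in>{..<n}. \<omega> i \<in> ?X i}"
      by (simp only: trail_eq_iff[OF True] Ball_def lessThan_iff mem_Collect_eq)
    have "emeasure \<Omega> {\<omega> \<in> space \<Omega>. \<forall>i\<in>{..<n}. \<omega> i \<in> ?X i} = (\<Prod>i<n. emeasure (U i) (?X i))"
      using PS.emeasure_PiM_Collect[of "{..<n}" ?X, OF subset_UNIV finite_lessThan] by simp
    then show ?thesis
      unfolding eq by (simp add: measure_pmf.emeasure_eq_measure prod_ennreal pmf_law_eq_prod[OF True])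
  next
    case False
    then have empty: "{\<omega> \<in> space \<Omega>. trail \<omega> n = b} = {}" using trail_less by auto
    have "pmf (law n) b = 0" using False law_less by (auto simp: pmf_eq_0_set_pmf)
    then show ?thesis unfolding empty by simp
  qed
  then show "emeasure (distr \<Omega> (count_space UNIV) (\<lambda>\<omega>. trail \<omega> n)) {b} = emeasure (law n) {b}"
    by (simp add: emeasure_distr[OF measurable_trail] eq emeasure_pmf_single)
qed simp_all

lemma trail_tendsto: "(\<lambda>n. of_nat (trail \<omega> n)) \<longlonglongrightarrow> (walk_limit step \<omega> :: 'p padic)"
proof -
  have close: "padic_abs (of_nat (trail \<omega> j) - of_nat (trail \<omega> i) :: 'p padic) \<le> (1 / real CARD('p)) ^ m i"
    if "i \<le> j" for i j
    using trail_mod[OF that] trail_less[of \<omega> i] by (simp add: padic_abs_of_nat_diff_le_iff)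
  have "Cauchy (\<lambda>n. of_nat (trail \<omega> n) :: 'p padic)"
  proof (rule metric_CauchyI)
    fix e :: real assume e: "0 < e"
    obtain N where N: "(1 / real CARD('p)) ^ N < e"
      using real_arch_pow_inv[OF e, of "1 / real CARD('p)"] CARD_gt_1[where 'p = 'p] by auto
    have "(1 / real CARD('p)) ^ m N \<le> (1 / real CARD('p)) ^ N"
      using strict_mono_imp_increasing[OF m_mono, of N] by (intro power_decreasing) auto
    then have "(1 / real CARD('p)) ^ m N < e" using N by simp
    then have "padic_abs (of_nat (trail \<omega> i) - of_nat (trail \<omega> j) :: 'p padic) < e" if "N \<le> i" "N \<le> j" for i j
      using padic_abs_ultra_diff[of "of_nat (trail \<omega> i) - of_nat (trail \<omega> N) :: 'p padic"
          "of_nat (trail \<omega> j) - of_nat (trail \<omega> N)"] close[OF that(1)] close[OF that(2)] by simp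
    then show "\<exists>N. \<forall>i\<ge>N. \<forall>j\<ge>N. dist (of_nat (trail \<omega> i) :: 'p padic) (of_nat (trail \<omega> j)) < e"
      unfolding dist_padic_def by blast
  qed
  then show ?thesis
    unfolding walk_limit_def using Cauchy_convergent convergent_LIMSEQ_iff by blast
qed

lemma walk_limit_close:
  "padic_abs (walk_limit step \<omega> - of_nat (trail \<omega> n) :: 'p padic) \<le> (1 / real CARD('p)) ^ m n"
proof -
  have "walk_limit step \<omega> \<in> cball (of_nat (trail \<omega> n) :: 'p padic) ((1 / real CARD('p)) ^ m n)"
  proof (rule closed_sequentially[OF closed_cball _ LIMSEQ_ignore_initial_segment[OF trail_tendsto, where k = n]])
    show "of_nat (trail \<omega> (i + n)) \<in> cball (of_nat (trail \<omega> n) :: 'p padic) ((1 / real CARD('p)) ^ m n)" for i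
      using trail_mod[of n "i + n" \<omega>] trail_less[of \<omega> n]
      by (simp add: cball_padic padic_abs_of_nat_diff_le_iff)
  qed
  then show ?thesis by (simp add: cball_padic padic_abs_minus_commute)
qed

lemma measurable_walk_limit [measurable]: "(walk_limit step :: _ \<Rightarrow> 'p padic) \<in> borel_measurable \<Omega>"
proof (rule borel_measurable_LIMSEQ_metric)
  show "(\<lambda>\<omega>. of_nat (trail \<omega> i) :: 'p padic) \<in> borel_measurable \<Omega>" for i
    by (rule measurable_compose[OF measurable_trail]) simp
qed (rule trail_tendsto)

lemma borel_prob_walk_measure: "borel_prob (walk_measure U step :: 'p padic measure)"
  unfolding borel_prob_def walk_measure_def by (simp add: PS.prob_space_distr)

text \<open>Such a g sees only the first n steps of the walk. Characters of frequency at most p^(m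
  n) and indicators of balls of radius at least p^(-m n) are of this kind, so transforms and masses
  of balls become expectations over finitely many residues.\<close>

lemma integral_walk_measure:
  fixes g :: "'p padic \<Rightarrow> 'b::{banach, second_countable_topology}"
  assumes [measurable]: "g \<in> borel_measurable borel"
    and g: "\<And>x a. padic_abs (x - of_nat a) \<le> (1 / real CARD('p)) ^ m n \<Longrightarrow> g x = g (of_nat a)"
  shows "(\<integral>x. g x \<partial>walk_measure U step) = (\<integral>a. g (of_nat a) \<partial>law n)"
proof -
  have "(\<integral>x. g x \<partial>walk_measure U step) = (\<integral>\<omega>. g (walk_limit step \<omega>) \<partial>\<Omega>)"
    unfolding walk_measure_def by (rule integral_distr) simp_all
  also have "\<dots> = (\<integral>\<omega>. g (of_nat (trail \<omega> n)) \<partial>\<Omega>)"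
    by (simp only: g[OF walk_limit_close])
  also have "\<dots> = (\<integral>a. g (of_nat a) \<partial>distr \<Omega> (count_space UNIV) (\<lambda>\<omega>. trail \<omega> n))"
    by (rule integral_distr[symmetric]) simp_all
  finally show ?thesis unfolding distr_trail .
qed

lemma measure_walk_measure_cball:
  assumes "j \<le> m n"
  shows "measure (walk_measure U step) (cball (y :: 'p padic) ((1 / real CARD('p)) ^ j))
    = measure (law n) {a. padic_abs (of_nat a - y) \<le> (1 / real CARD('p)) ^ j}"
proof -
  let ?B = "cball y ((1 / real CARD('p)) ^ j)"
  have le: "(1 / real CARD('p)) ^ m n \<le> (1 / real CARD('p)) ^ j"
    using assms by (intro power_decreasing) auto
  have g: "indicat_real ?B x = indicat_real ?B (of_nat a)"
    if "padic_abs (x - of_nat a) \<le> (1 / real CARD('p)) ^ m n" for x a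
  proof -
    have "cball x ((1 / real CARD('p)) ^ j) = cball (of_nat a) ((1 / real CARD('p)) ^ j)"
      by (rule cball_padic_eq[OF order_trans[OF that le]])
    then have "y \<in> cball x ((1 / real CARD('p)) ^ j) \<longleftrightarrow> y \<in> cball (of_nat a) ((1 / real CARD('p)) ^ j)"
      by (rule arg_cong)
    then show ?thesis by (simp add: indicator_def dist_commute[of y])
  qed
  have ind: "(\<lambda>a. indicat_real ?B (of_nat a)) = indicator {a. padic_abs (of_nat a - y) \<le> (1 / real CARD('p)) ^ j}"
    by (rule ext, subst padic_abs_minus_commute) (simp only: indicator_def cball_padic mem_Collect_eq)
  have "(\<integral>x. indicat_real ?B x \<partial>walk_measure U step) = (\<integral>a. indicat_real ?B (of_nat a) \<partial>law n)"
  proof (rule integral_walk_measure)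
    show "indicat_real ?B \<in> borel_measurable borel"
      by (intro borel_measurable_indicator borel_closed closed_cball)
  qed (rule g)
  then show ?thesis unfolding ind by (simp add: walk_measure_def)
qed

lemma measure_walk_measure_unit: "measure (walk_measure U step) (cball (0 :: 'p padic) 1) = 1"
proof -
  have eq: "measure (walk_measure U step) (cball (0 :: 'p padic) ((1 / real CARD('p)) ^ 0))
      = measure (law 0) {a. padic_abs (of_nat a - 0 :: 'p padic) \<le> (1 / real CARD('p)) ^ 0}"
    by (rule measure_walk_measure_cball) simp
  have UNIV: "{a. padic_abs (of_nat a - 0 :: 'p padic) \<le> (1 / real CARD('p)) ^ 0} = UNIV"
    using padic_abs_of_nat_le[where 'p = 'p] by auto
  show ?thesis
    using eq measure_pmf.prob_space[of "law 0"] unfolding UNIV by simp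
qed

end

section \<open>Primes in short ranges\<close>

text \<open>The Leibniz harmonic triangle: its entries are integer combinations of unit fractions with
  denominator at most n + 1.\<close>

lemma Lcm_multiple_of_binomial:
  "k \<le> n \<Longrightarrow> Suc n * (n choose k) dvd Lcm {1..Suc n}"
proof (induction k arbitrary: n)
  case 0
  then show ?case by (intro dvd_Lcm) auto
next
  case (Suc k)
  then obtain n' where n: "n = Suc n'" by (cases n) auto
  have kn: "k \<le> n'" using Suc.prems n by simp
  define L where "L = Lcm {1..Suc n}"
  have "L > 0" unfolding L_def by (intro Nat.gr0I) (auto simp: Lcm_0_iff)
  have "Lcm {1..Suc n'} dvd L" unfolding L_def n by (rule Lcm_subset) auto
  then have "Suc n' * (n' choose k) dvd L" using Suc.IH[OF kn] dvd_trans by blast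
  then obtain a where a: "L = Suc n' * (n' choose k) * a" by blast
  have "Suc n * (n choose k) dvd L"
    unfolding L_def using Suc by simp
  then obtain b where b: "L = Suc n * (n choose k) * b" by blast
  have c: "(n choose Suc k) > 0" "(n choose k) > 0" "(n' choose k) > 0" using Suc.prems kn n by auto
  have e1: "Suc k * (n choose Suc k) = Suc n' * (n' choose k)"
    unfolding n by (rule Suc_times_binomial)
  have e2: "Suc k * (n choose Suc k) = (n - k) * (n choose k)"
    using binomial_absorb_comp[of n k] binomial_absorption[of k n] by (simp add: mult.commute)
  define K N x y where "K = int (Suc k)" and "N = int (Suc n)" and "x = int (n choose Suc k)" and "y = int (n choose k)"
  have "L = Suc k * (n choose Suc k) * a" using a unfolding e1 .
  then have 1: "int L = K * x * int a" by (simp only: K_def x_def of_nat_mult)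
  have 2: "int L = N * y * int b" unfolding b N_def y_def by (simp only: of_nat_mult)
  have "int (n - k) = N - K" using Suc.prems by (simp add: N_def K_def)
  then have 3: "K * x = (N - K) * y" using arg_cong[OF e2, of int] by (simp only: K_def x_def y_def of_nat_mult)
  \<comment> \<open>Entries of the triangle are differences of earlier ones. Here a and b are the
    integer quotients of L by n C(n-1, k) and by (n+1) C(n, k), and a - b is the quotient of L by
    (n+1) C(n, k+1).\<close>
  have "y * (N * x * (int a - int b)) = y * int L" using 1 2 3 by algebra
  then have "int (Suc n * (n choose Suc k)) * (int a - int b) = int L"
    using c unfolding N_def x_def y_def of_nat_mult mult_cancel_left by simp
  then have "int (Suc n * (n choose Suc k)) dvd int L" by (metis dvd_triv_left)
  then show ?case unfolding L_def by (simp only: int_dvd_int_iff)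
qed

text \<open>The central binomial coefficient is the largest of the 2n + 1 terms summing to 4^n, and
  the factor 2n + 1 lost by averaging is exactly the one supplied by the divisibility lemma.\<close>

lemma Lcm_lower: "4 ^ n \<le> Lcm {1..2 * n + 1 :: nat}"
proof -
  have "(2::nat) ^ (2 * n) = (\<Sum>k\<le>2*n. 2 * n choose k)" by (rule choose_row_sum[symmetric])
  also have "\<dots> \<le> (\<Sum>k\<le>2*n. 2 * n choose n)"
    by (intro sum_mono binomial_maximum')
  finally have "4 ^ n \<le> Suc (2 * n) * (2 * n choose n)" by (simp add: power_mult)
  also have "\<dots> \<le> Lcm {1..Suc (2 * n)}"
  proof (rule dvd_imp_le)
    show "Suc (2 * n) * (2 * n choose n) dvd Lcm {1..Suc (2 * n)}"
      by (rule Lcm_multiple_of_binomial) simp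
  qed (intro Nat.gr0I, auto simp: Lcm_0_iff)
  finally show ?thesis by simp
qed

lemma prod_distinct_primes_dvd:
  fixes n :: "'a::factorial_semiring_gcd"
  assumes "finite A" "\<And>q. q \<in> A \<Longrightarrow> prime q" "\<And>q. q \<in> A \<Longrightarrow> q dvd n"
  shows "\<Prod>A dvd n"
  using assms
proof (induction A rule: finite_induct)
  case (insert q A)
  have "coprime q (\<Prod>A)"
    using insert by (intro prod_coprime_right primes_coprime) auto
  then show ?case using insert by (simp add: divides_mult)
qed simp

text \<open>The argument of Erdos: for n = 2k + 1 the primes between k + 2 and n all divide C(n, k),
  which is at most 4^k because it occurs twice in the row with sum 2^n. Even n > 2 contribute no new
  prime.\<close>

lemma primorial_upper: "\<Prod>{q. prime q \<and> q \<le> n} \<le> (4::nat) ^ n"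
proof (induction n rule: less_induct)
  case (less n)
  let ?P = "\<lambda>n. {q::nat. prime q \<and> q \<le> n}"
  have fin: "finite (?P k)" for k by (rule finite_subset[of _ "{..k}"]) auto
  consider "n \<le> 1" | "n = 2" | "even n" "n > 2" | "odd n" "n > 2" by linarith
  then show ?case
  proof cases
    case 1
    then have "?P n = {}" by (auto dest: prime_gt_1_nat)
    then show ?thesis by (simp only: prod.empty) simp
  next
    case 2
    have "?P 2 = {2}" by (auto dest: prime_gt_1_nat)
    then show ?thesis unfolding 2 by simp
  next
    case 3
    have "\<not> prime n" using 3 prime_odd_nat by auto
    then have "q \<le> n \<longleftrightarrow> q \<le> n - 1" if "prime q" for q
      using that by (cases "q = n") auto
    then have eq: "?P n = ?P (n - 1)" by (intro Collect_cong conj_cong refl)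
    have "\<Prod>(?P n) \<le> 4 ^ (n - 1)" unfolding eq using less[of "n - 1"] 3 by simp
    also have "\<dots> \<le> (4::nat) ^ n" by (intro power_increasing) auto
    finally show ?thesis .
  next
    case 4
    then obtain k where k: "n = 2 * k + 1" "k \<ge> 1" by (elim oddE) auto
    let ?Q = "{q. prime q \<and> k + 1 < q \<and> q \<le> n}"
    have finQ: "finite ?Q" by (rule finite_subset[of _ "{..n}"]) auto
    have split: "?P n = ?P (k + 1) \<union> ?Q" using k by auto
    have "\<Prod>?Q dvd (n choose k)"
    proof (rule prod_distinct_primes_dvd[OF finQ])
      fix q assume q: "q \<in> ?Q"
      then have "q dvd fact n" by (simp add: prime_dvd_fact_iff)
      moreover have "fact n = fact k * fact (k + 1) * (n choose k)"
        using binomial_fact_lemma[of k n] k by simp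
      moreover have "\<not> q dvd fact k" "\<not> q dvd fact (k + 1)"
        using q by (auto simp: prime_dvd_fact_iff simp del: fact_Suc)
      ultimately show "q dvd (n choose k)"
        using q by (auto simp: prime_dvd_mult_iff simp del: fact_Suc)
    qed auto
    then have "\<Prod>?Q \<le> (n choose k)" by (rule dvd_imp_le) (use k in auto)
    also have "\<dots> \<le> 4 ^ k"
    proof -
      have "2 * (n choose k) = (n choose k) + (n choose (k + 1))"
        using binomial_symmetric[of k n] k by simp
      also have "\<dots> = (\<Sum>i\<in>{k, k + 1}. n choose i)" by simp
      also have "\<dots> \<le> (\<Sum>i\<le>n. n choose i)" by (intro sum_mono2) (use k in auto)
      also have "\<dots> = 2 ^ n" by (rule choose_row_sum)
      also have "\<dots> = 2 * 4 ^ k" unfolding k by (simp add: power_mult)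
      finally show ?thesis by simp
    qed
    finally have Q: "\<Prod>?Q \<le> 4 ^ k" .
    have "\<Prod>(?P n) = \<Prod>(?P (k + 1)) * \<Prod>?Q"
      unfolding split by (rule prod.union_disjoint) (use fin finQ in auto)
    also have "\<dots> \<le> 4 ^ (k + 1) * 4 ^ k"
      using less[of "k + 1"] Q k by (intro mult_le_mono) auto
    also have "\<dots> = 4 ^ n" by (simp add: k power_add mult_2)
    finally show ?thesis .
  qed
qed

lemma prime_power_dvd_Lcm:
  assumes "prime q" "0 < n"
  shows "q ^ multiplicity q (Lcm {1..n}) \<le> (n :: nat)"
  using assms(2)
proof (induction n rule: nat_induct_non_zero)
  case 1
  then show ?case by simp
next
  case (Suc n)
  have eq: "Lcm {1..Suc n} = lcm (Suc n) (Lcm {1..n})"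
    by (simp add: atLeastAtMostSuc_conv)
  have "Lcm {1..n} \<noteq> 0" by (auto simp: Lcm_0_iff)
  then have m: "multiplicity q (Lcm {1..Suc n}) = max (multiplicity q (Suc n)) (multiplicity q (Lcm {1..n}))"
    unfolding eq using assms(1) by (intro multiplicity_lcm) auto
  have "q ^ multiplicity q (Suc n) \<le> Suc n"
    by (rule dvd_imp_le[OF multiplicity_dvd]) simp
  then show ?case using Suc unfolding m by (auto simp: max_def)
qed

text \<open>The least common multiple of 1, ..., 6T - 1 is split into its prime powers, each at most
  6T. Primes with q^2 \<le> 6T number at most sqrt(6T); the other primes up to 2T occur to the first
  power, so they contribute at most the primorial 4^(2T); the rest lie in the range being counted.
  The range reaches up to 6T so that the lower bound 4^(3T - 1) exceeds this 4^(2T)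
  exponentially.\<close>

lemma prod_primes_in_range_lower:
  assumes "1 \<le> T"
  shows "4 ^ (3 * T - 1) \<le> (6 * real T) powr sqrt (6 * real T) * 4 ^ (2 * T)
    * (6 * real T) ^ card {q. prime q \<and> 2 * T < q \<and> q \<le> 6 * T}"
proof -
  define N where "N = 6 * T - 1"
  define L where "L = Lcm {1..N}"
  define f where "f q = q ^ multiplicity q L" for q
  have N: "N > 0" "N \<le> 6 * T" using assms by (auto simp: N_def)
  have L: "L > 0" unfolding L_def by (intro Nat.gr0I) (auto simp: Lcm_0_iff)
  define A where "A = {q::nat. prime q \<and> q \<le> 2 * T \<and> q ^ 2 \<le> 6 * T}"
  define B where "B = {q::nat. prime q \<and> q \<le> 2 * T \<and> 6 * T < q ^ 2}"
  define C where "C = {q::nat. prime q \<and> 2 * T < q \<and> q \<le> 6 * T}"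
  have fin: "finite A" "finite B" "finite C"
    by (rule finite_subset[of _ "{..6*T}"]; auto simp: A_def B_def C_def)+
  have f: "f q \<le> 6 * T" if "prime q" for q
    using prime_power_dvd_Lcm[OF that N(1)] N(2) by (simp add: f_def L_def)
  have f1: "f q \<le> q" if "prime q" "6 * T < q ^ 2" for q
  proof (rule ccontr)
    assume "\<not> f q \<le> q"
    then have "q ^ 1 < q ^ multiplicity q L" by (simp add: f_def)
    then have "2 \<le> multiplicity q L"
      using prime_gt_1_nat[OF that(1)] by (subst (asm) power_strict_increasing_iff) auto
    then have "q ^ 2 \<le> f q"
      unfolding f_def using prime_gt_0_nat[OF that(1)] by (intro power_increasing) auto
    then show False using f[OF that(1)] that(2) by simp
  qed
  have sub: "prime_factors L \<subseteq> A \<union> B \<union> C"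
  proof
    fix q assume q: "q \<in> prime_factors L"
    then have pq: "prime q" by auto
    have "0 < multiplicity q L" using q by (simp add: prime_factors_multiplicity)
    then have "q ^ 1 \<le> f q"
      unfolding f_def using prime_gt_0_nat[OF pq] by (intro power_increasing) auto
    then have "q \<le> 6 * T" using f[OF pq] by simp
    then show "q \<in> A \<union> B \<union> C" using pq by (auto simp: A_def B_def C_def)
  qed
  have "L = (\<Prod>q\<in>prime_factors L. f q)"
    unfolding f_def by (rule prime_factorization_nat[OF L])
  also have "\<dots> = (\<Prod>q\<in>A \<union> B \<union> C. f q)"
  proof (rule prod.mono_neutral_left)
    show "\<forall>q\<in>(A \<union> B \<union> C) - prime_factors L. f q = 1"
    proof
      fix q assume "q \<in> (A \<union> B \<union> C) - prime_factors L"
      then have "multiplicity q L = 0"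
        by (auto simp: A_def B_def C_def prime_factors_multiplicity)
      then show "f q = 1" by (simp add: f_def)
    qed
  qed (use fin sub in auto)
  also have "\<dots> = prod f A * prod f B * prod f C"
    using fin by (subst prod.union_disjoint, auto simp: A_def B_def C_def)+
  finally have L_eq: "real L = real (prod f A) * real (prod f B) * real (prod f C)" by simp
  have T1: "1 \<le> 6 * real T" using assms by simp
  have "prod f A \<le> (\<Prod>q\<in>A. 6 * T)" using f by (intro prod_mono) (auto simp: A_def)
  then have "real (prod f A) \<le> real ((6 * T) ^ card A)" by (simp only: of_nat_le_iff prod_constant)
  also have "\<dots> = (6 * real T) powr real (card A)" using T1 by (simp add: powr_realpow)
  also have "\<dots> \<le> (6 * real T) powr sqrt (6 * real T)"
  proof (rule powr_mono[OF _ T1])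
    define s where "s = nat \<lfloor>sqrt (6 * real T)\<rfloor>"
    have "A \<subseteq> {1..s}"
    proof
      fix q assume q: "q \<in> A"
      then have "real (q ^ 2) \<le> real (6 * T)" unfolding A_def by (simp only: of_nat_le_iff mem_Collect_eq)
      then have "real q \<le> sqrt (6 * real T)" by (intro real_le_rsqrt) simp
      then show "q \<in> {1..s}"
        using q prime_gt_0_nat[of q] by (auto simp: A_def s_def le_nat_floor)
    qed
    then have "card A \<le> s" using card_mono[of "{1..s}" A] by simp
    moreover have "real s \<le> sqrt (6 * real T)" unfolding s_def by (rule of_nat_floor) simp
    ultimately show "real (card A) \<le> sqrt (6 * real T)" by linarith
  qed
  finally have A: "real (prod f A) \<le> (6 * real T) powr sqrt (6 * real T)" .
  have "prod f B \<le> \<Prod>B" using f1 by (intro prod_mono) (auto simp: B_def)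
  also have "\<dots> \<le> \<Prod>{q. prime q \<and> q \<le> 2 * T}"
  proof (rule dvd_imp_le)
    have f: "finite {q::nat. prime q \<and> q \<le> 2 * T}" by (rule finite_subset[of _ "{..2*T}"]) auto
    show "\<Prod>B dvd \<Prod>{q. prime q \<and> q \<le> 2 * T}"
      by (rule prod_dvd_prod_subset[OF f]) (auto simp: B_def)
    show "0 < \<Prod>{q. prime q \<and> q \<le> 2 * T}" by (intro prod_pos) (auto dest: prime_gt_0_nat)
  qed
  also have "\<dots> \<le> 4 ^ (2 * T)" by (rule primorial_upper)
  finally have "real (prod f B) \<le> real (4 ^ (2 * T))" by (simp only: of_nat_le_iff)
  then have B: "real (prod f B) \<le> 4 ^ (2 * T)" by simp
  have "prod f C \<le> (\<Prod>q\<in>C. 6 * T)" using f by (intro prod_mono) (auto simp: C_def)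
  then have "real (prod f C) \<le> real ((6 * T) ^ card C)" by (simp only: of_nat_le_iff prod_constant)
  then have C: "real (prod f C) \<le> (6 * real T) ^ card C" by simp
  have "4 ^ (3 * T - 1) \<le> Lcm {1..2 * (3 * T - 1) + 1}" by (rule Lcm_lower)
  also have "2 * (3 * T - 1) + 1 = N" using assms by (simp add: N_def)
  finally have "real (4 ^ (3 * T - 1)) \<le> real L" unfolding L_def by (simp only: of_nat_le_iff)
  also have "\<dots> \<le> (6 * real T) powr sqrt (6 * real T) * 4 ^ (2 * T) * (6 * real T) ^ card C"
    unfolding L_eq using A B C by (intro mult_mono mult_nonneg_nonneg of_nat_0_le_iff) auto
  finally show ?thesis unfolding C_def by simp
qed

text \<open>In logarithms the preceding inequality says that the number of primes times ln(6T) is at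
  least (T - 1) ln 4 - sqrt(6T) ln(6T). Since ln 4 \<ge> 1, asking for only half of T / ln T leaves
  room for the terms of lower order.\<close>

theorem primes_in_range_lower:
  "\<exists>T0. \<forall>T\<ge>T0. real T / (2 * ln (real T)) \<le> real (card {q. prime q \<and> 2 * T < q \<and> q \<le> 6 * T})"
proof -
  have "\<forall>\<^sub>F T in at_top. T / (2 * ln T) * ln (6 * T) \<le> (T - 1) - sqrt (6 * T) * ln (6 * (T::real))"
    by real_asymp
  then obtain x0 where x0: "\<And>T. T \<ge> x0 \<Longrightarrow> T / (2 * ln T) * ln (6 * T) \<le> (T - 1) - sqrt (6 * T) * ln (6 * T)"
    unfolding eventually_at_top_linorder by blast
  have "exp 1 \<le> (4::real)" using exp_le by linarith
  then have ln4: "1 \<le> ln (4::real)" by (simp add: ln_ge_iff)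
  show ?thesis
  proof (intro exI[of _ "max 1 (nat \<lceil>x0\<rceil>)"] allI impI)
    fix T assume T: "max 1 (nat \<lceil>x0\<rceil>) \<le> T"
    define c where "c = card {q. prime q \<and> 2 * T < q \<and> q \<le> 6 * T}"
    have T1: "1 \<le> T" "x0 \<le> real T" using T by linarith+
    have pos: "0 < ln (6 * real T)" using T1 by simp
    have "ln (4 ^ (3 * T - 1)) \<le> ln ((6 * real T) powr sqrt (6 * real T) * 4 ^ (2 * T) * (6 * real T) ^ c)"
      using prod_primes_in_range_lower[OF T1(1)] T1 unfolding c_def by (subst ln_le_cancel_iff) auto
    also have "\<dots> = sqrt (6 * real T) * ln (6 * real T) + 2 * real T * ln 4 + real c * ln (6 * real T)"
      using T1 by (simp add: ln_mult ln_powr ln_realpow ring_distribs)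
    also have "ln (4 ^ (3 * T - 1) :: real) = (3 * real T - 1) * ln 4"
      using T1 by (simp add: ln_realpow of_nat_diff)
    finally have "(real T - 1) * ln 4 - sqrt (6 * real T) * ln (6 * real T) \<le> real c * ln (6 * real T)"
      by (simp add: algebra_simps)
    then have "real T / (2 * ln (real T)) * ln (6 * real T) \<le> real c * ln (6 * real T)"
      using x0[OF T1(2)] T1(1) ln4 mult_left_mono[OF ln4, of "real T - 1"] by simp
    then show "real T / (2 * ln (real T)) \<le> real c" using pos by (rule mult_right_le_imp_le)
  qed
qed

section \<open>Counting lemmas\<close>

text \<open>Distinct prime divisors multiply to a divisor of n, so x to the number of them is at
  most |n|. With x = p^k and |n| \<le> p^(4s) this allows at most 4s/k denominators.\<close>

lemma card_prime_divisors_le: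
  assumes "n \<noteq> 0" "finite A" "\<And>q. q \<in> A \<Longrightarrow> prime q" "\<And>q. q \<in> A \<Longrightarrow> int q dvd n"
    and "1 < x" "\<And>q. q \<in> A \<Longrightarrow> x \<le> real q" "\<bar>real_of_int n\<bar> \<le> B"
  shows "real (card A) \<le> ln B / ln x"
proof -
  have "q dvd nat \<bar>n\<bar>" if "q \<in> A" for q
    using assms(4)[OF that] by (simp flip: int_dvd_int_iff)
  then have "\<Prod>A dvd nat \<bar>n\<bar>"
    using assms(2,3) by (intro prod_distinct_primes_dvd)
  then have "\<Prod>A \<le> nat \<bar>n\<bar>" using assms(1) by (intro dvd_imp_le) auto
  then have le: "real (\<Prod>A) \<le> B" using assms(7) by linarith
  have "x ^ card A = (\<Prod>q\<in>A. x)" by simp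
  also have "\<dots> \<le> (\<Prod>q\<in>A. real q)" using assms by (intro prod_mono) auto
  finally have "x ^ card A \<le> B" using le by simp
  moreover have "0 < x ^ card A" using assms(5) by simp
  ultimately have "ln (x ^ card A) \<le> ln B" by (subst ln_le_cancel_iff) auto
  then show ?thesis using assms(5) by (simp add: ln_realpow field_simps)
qed

text \<open>The two terms added when a symmetric range grows are dominated by the increment of -4/(L
  + 1), so the bound 5 - 4/(L + 1) telescopes; at L = 0 it equals the single term 1.\<close>

lemma sum_inverse_squares_int_le:
  assumes "finite S"
  shows "(\<Sum>l\<in>S. 1 / (1 + (real_of_int l)\<^sup>2)) \<le> 5"
proof -
  have *: "(\<Sum>l\<in>{- int L..int L}. 1 / (1 + (real_of_int l)\<^sup>2)) \<le> 5 - 4 / (real L + 1)" for L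
  proof (induction L)
    case (Suc L)
    have eq: "{- int (Suc L)..int (Suc L)} = insert (- int (Suc L)) (insert (int (Suc L)) {- int L..int L})"
      by auto
    have "(\<Sum>l\<in>{- int (Suc L)..int (Suc L)}. 1 / (1 + (real_of_int l)\<^sup>2))
        = 2 / (1 + (real L + 1)\<^sup>2) + (\<Sum>l\<in>{- int L..int L}. 1 / (1 + (real_of_int l)\<^sup>2))"
      unfolding eq by (simp add: add.commute power2_commute[of "- 1 - real L"] power2_eq_iff algebra_simps power2_eq_square)
    also have "\<dots> \<le> 2 / (1 + (real L + 1)\<^sup>2) + (5 - 4 / (real L + 1))" using Suc by simp
    also have "2 / (1 + (real L + 1)\<^sup>2) \<le> 4 / (real L + 1) - 4 / (real L + 2)"
    proof -
      have "4 / (real L + 1) - 4 / (real L + 2) = 4 / ((real L + 1) * (real L + 2))"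
        by (simp add: field_simps)
      moreover have "2 / (1 + (real L + 1)\<^sup>2) \<le> 4 / ((real L + 1) * (real L + 2))"
      proof (rule mult_imp_div_pos_le)
        have "2 * ((real L + 1) * (real L + 2)) \<le> 4 * (1 + (real L + 1)\<^sup>2)"
          by (simp add: power2_eq_square algebra_simps)
        then have "2 \<le> (4 * (1 + (real L + 1)\<^sup>2)) / ((real L + 1) * (real L + 2))"
          by (intro mult_imp_le_div_pos) auto
        then show "2 \<le> 4 / ((real L + 1) * (real L + 2)) * (1 + (real L + 1)\<^sup>2)" by simp
      qed (simp add: add_pos_nonneg)
      ultimately show ?thesis by simp
    qed
    finally show ?case by (simp add: add.commute)
  qed simp
  define L where "L = nat (Max (insert 0 (abs ` S)))"
  have "S \<subseteq> {- int L..int L}"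
  proof
    fix l assume "l \<in> S"
    then have "\<bar>l\<bar> \<le> Max (insert 0 (abs ` S))" using assms by (intro Max_ge) auto
    then show "l \<in> {- int L..int L}" by (auto simp: L_def)
  qed
  then have "(\<Sum>l\<in>S. 1 / (1 + (real_of_int l)\<^sup>2)) \<le> (\<Sum>l\<in>{- int L..int L}. 1 / (1 + (real_of_int l)\<^sup>2))"
    by (intro sum_mono2) auto
  also have "\<dots> \<le> 5 - 4 / (real L + 1)" by (rule *)
  also have "\<dots> \<le> 5" by simp
  finally show ?thesis .
qed

text \<open>Pigeonhole: rounding f/\<delta> down is injective on \<delta>-separated values.\<close>

lemma card_separated_le:
  fixes f :: "'a \<Rightarrow> real"
  assumes "finite S" "0 < \<delta>" "\<And>s. s \<in> S \<Longrightarrow> 0 \<le> f s \<and> f s \<le> 1"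
    and sep: "\<And>s t. s \<in> S \<Longrightarrow> t \<in> S \<Longrightarrow> s \<noteq> t \<Longrightarrow> \<delta> \<le> \<bar>f s - f t\<bar>"
  shows "real (card S) \<le> 1 + 1 / \<delta>"
proof -
  let ?g = "\<lambda>s. nat \<lfloor>f s / \<delta>\<rfloor>"
  have "inj_on ?g S"
  proof (rule inj_onI, rule ccontr)
    fix s t assume st: "s \<in> S" "t \<in> S" "?g s = ?g t" "s \<noteq> t"
    then have "\<lfloor>f s / \<delta>\<rfloor> = \<lfloor>f t / \<delta>\<rfloor>" using assms(2,3) by (simp add: nat_eq_iff2)
    then have "\<bar>f s / \<delta> - f t / \<delta>\<bar> < 1" by linarith
    then have "\<bar>f s - f t\<bar> < \<delta>" using assms(2) by (simp add: abs_divide flip: diff_divide_distrib)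
    then show False using sep[OF st(1,2,4)] by simp
  qed
  moreover have "?g ` S \<subseteq> {..nat \<lfloor>1 / \<delta>\<rfloor>}"
    using assms(2,3) by (auto intro!: nat_mono floor_mono divide_right_mono)
  ultimately have "card S \<le> card {..nat \<lfloor>1 / \<delta>\<rfloor>}" by (metis card_inj_on_le finite_atMost)
  then have "real (card S) \<le> 1 + real (nat \<lfloor>1 / \<delta>\<rfloor>)" by simp
  also have "real (nat \<lfloor>1 / \<delta>\<rfloor>) \<le> 1 / \<delta>" using assms(2) by (intro of_nat_floor) simp
  finally show ?thesis by simp
qed

lemma card_residue_class_le:
  fixes J K :: nat
  assumes "\<And>h h'. h \<in> S \<Longrightarrow> h' \<in> S \<Longrightarrow> h mod J = h' mod J" "S \<subseteq> {..<J * K}"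
  shows "card S \<le> K"
proof -
  have "inj_on (\<lambda>h. h div J) S"
    by (rule inj_onI) (metis assms(1) div_mult_mod_eq)
  moreover have "(\<lambda>h. h div J) ` S \<subseteq> {..<K}"
    using assms(2) by (auto simp: less_mult_imp_div_less mult.commute)
  ultimately show ?thesis by (metis card_inj_on_le card_lessThan finite_lessThan)
qed

text \<open>Distinct pairs give distinct fractions, because q is a prime larger than r. For two
  pairs the number r q' - r' q is then a nonzero multiple of L, both products being congruent to q
  q' Y. So the slopes r/q lie in [0, 1] and are separated by L/(6T)^2.\<close>

lemma card_rational_points_le:
  fixes T Y L :: nat
  assumes "0 < L" and Q: "\<And>q. q \<in> Q \<Longrightarrow> prime q \<and> 2 * T < q \<and> q \<le> 6 * T"
  defines "S \<equiv> {(q, r). q \<in> Q \<and> 0 < r \<and> r < 2 * T \<and> r mod L = q * Y mod L}"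
  shows "real (card S) \<le> 1 + 36 * (real T)\<^sup>2 / real L"
proof (cases "S = {}")
  case False
  then have T: "0 < T" by (auto simp: S_def)
  have fin: "finite S"
    by (rule finite_subset[of _ "{..6 * T} \<times> {..2 * T}"]) (auto simp: S_def dest: Q)
  define \<delta> where "\<delta> = real L / (36 * (real T)\<^sup>2)"
  have "0 < \<delta>" using assms(1) T by (simp add: \<delta>_def)
  have "real (card S) \<le> 1 + 1 / \<delta>"
  proof (rule card_separated_le[where f = "\<lambda>(q, r). real r / real q", OF fin \<open>0 < \<delta>\<close>])
    fix s assume "s \<in> S"
    then show "0 \<le> (case s of (q, r) \<Rightarrow> real r / real q) \<and> (case s of (q, r) \<Rightarrow> real r / real q) \<le> 1"
      by (auto simp: S_def divide_le_eq dest: Q)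
  next
    fix s t assume st: "s \<in> S" "t \<in> S" "s \<noteq> t"
    obtain q r where s: "s = (q, r)" by fastforce
    obtain q' r' where t: "t = (q', r')" by fastforce
    have q: "prime q" "2 * T < q" "q \<le> 6 * T" "0 < r" "r < 2 * T" "r mod L = q * Y mod L"
      using st s Q by (auto simp: S_def)
    have q': "prime q'" "2 * T < q'" "q' \<le> 6 * T" "0 < r'" "r' < 2 * T" "r' mod L = q' * Y mod L"
      using st t Q by (auto simp: S_def)
    have "r * q' \<noteq> r' * q"
    proof
      assume eq: "r * q' = r' * q"
      then have "q dvd r * q'" by simp
      moreover have "\<not> q dvd r" using q by (auto dest: dvd_imp_le)
      ultimately have "q dvd q'" using q(1) by (simp add: prime_dvd_mult_iff)
      then have "q = q'" using q(1) q'(1) by (simp add: primes_dvd_imp_eq)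
      then show False using eq st(3) s t q by simp
    qed
    have "(r * q') mod L = (q * Y * q') mod L" using q(6) by (metis mod_mult_left_eq)
    moreover have "(r' * q) mod L = (q' * Y * q) mod L" using q'(6) by (metis mod_mult_left_eq)
    ultimately have "(r * q') mod L = (r' * q) mod L" by (simp add: ac_simps)
    then have "int L dvd int (r * q') - int (r' * q)"
      by (metis mod_eq_dvd_iff of_nat_mod)
    then have "int L \<le> \<bar>int (r * q') - int (r' * q)\<bar>"
      using \<open>r * q' \<noteq> r' * q\<close> dvd_imp_le_int[of "int (r * q') - int (r' * q)" "int L"]
      by (auto simp del: of_nat_mult)
    then have "real L \<le> \<bar>real r * real q' - real r' * real q\<bar>" by (simp flip: of_nat_mult)
    moreover have "real q * real q' \<le> (6 * real T) * (6 * real T)"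
      using q(3) q'(3) by (intro mult_mono) auto
    moreover have pos: "0 < real q * real q'" using q q' by simp
    ultimately have "real L / (36 * (real T)\<^sup>2) \<le> \<bar>real r * real q' - real r' * real q\<bar> / (real q * real q')"
      by (intro frac_le) (auto simp: power2_eq_square)
    also have "\<dots> = \<bar>real r / real q - real r' / real q'\<bar>"
    proof -
      have "real r / real q - real r' / real q' = (real r * real q' - real r' * real q) / (real q * real q')"
        using q q' by (intro diff_frac_eq[THEN trans]) auto
      then show ?thesis by (simp add: abs_divide abs_mult)
    qed
    finally show "\<delta> \<le> \<bar>(case s of (q, r) \<Rightarrow> real r / real q) - (case t of (q, r) \<Rightarrow> real r / real q)\<bar>"
      by (simp add: \<delta>_def s t)
  qed
  then show ?thesis by (simp add: \<delta>_def)
qed simp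

section \<open>Geometric sums of characters\<close>

text \<open>The sum is (w^n - 1)/(w - 1), with numerator at most 2 and |w - 1| = 2 sin(\<pi> |t|).
  Since \<pi> |t| \<le> 2, the cubic Taylor bound gives sin x \<ge> x/3, and \<pi> > 3 turns this
  into |w - 1| \<ge> 2 |t|.\<close>

lemma norm_geometric_sum_cis_le:
  assumes "t \<noteq> 0" "\<bar>t\<bar> \<le> 1 / 2"
  shows "cmod (\<Sum>h<n. cis (2 * pi * t) ^ h) \<le> 1 / \<bar>t\<bar>"
proof -
  let ?w = "cis (2 * pi * t)"
  define x where "x = pi * \<bar>t\<bar>"
  have x: "0 < x" "x \<le> 2"
    using assms pi_less_4 by (auto simp: x_def) (use mult_mono[of pi 4 "\<bar>t\<bar>" "1/2"] in auto)
  have sq: "(cmod (?w - 1))\<^sup>2 = (2 * sin x)\<^sup>2"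
  proof -
    have "2 * pi * \<bar>t\<bar> = 2 * x" by (simp add: x_def)
    then have c: "cos (2 * pi * t) = 1 - 2 * (sin x)\<^sup>2"
      using cos_double_sin[of x] by (cases "t \<ge> 0") (auto simp: x_def abs_if mult.assoc)
    have "(cmod (?w - 1))\<^sup>2 = (cos (2 * pi * t) - 1)\<^sup>2 + (sin (2 * pi * t))\<^sup>2"
      by (simp add: cmod_power2)
    also have "\<dots> = 2 - 2 * cos (2 * pi * t)"
      using sin_cos_squared_add[of "2 * pi * t"] by (simp add: power2_diff)
    also have "\<dots> = (2 * sin x)\<^sup>2" unfolding c by (simp add: power_mult_distrib)
    finally show ?thesis .
  qed
  have sin: "x / 3 \<le> sin x"
  proof -
    have "\<bar>sin x - (\<Sum>m<3. sin_coeff m * x ^ m)\<bar> \<le> inverse (fact 3) * \<bar>x\<bar> ^ 3"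
      by (rule Maclaurin_sin_bound)
    then have "\<bar>sin x - x\<bar> \<le> x ^ 3 / 6"
      using x(1) by (simp add: sin_coeff_def numeral_3_eq_3 fact_numeral)
    moreover have "x ^ 3 \<le> 4 * x"
      using x mult_mono[of "x * x" 4 x x] mult_mono[of x 2 x 2] by (simp add: power3_eq_cube)
    ultimately show ?thesis by linarith
  qed
  have "cmod (?w - 1) = 2 * sin x"
    by (rule power2_eq_imp_eq[OF sq]) (use sin x in simp_all)
  then have "2 * x / 3 \<le> cmod (?w - 1)" using sin by simp
  moreover have "3 * \<bar>t\<bar> \<le> x" using pi_gt3 by (auto simp: x_def intro: mult_right_mono)
  ultimately have w: "2 * \<bar>t\<bar> \<le> cmod (?w - 1)" by simp
  have "cmod (?w - 1) * cmod (\<Sum>h<n. ?w ^ h) = cmod (?w ^ n - 1)"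
    by (simp flip: norm_mult power_diff_1_eq)
  also have "\<dots> \<le> 2"
    using norm_triangle_ineq4[of "?w ^ n" 1] by (simp add: norm_power)
  finally have "(2 * \<bar>t\<bar>) * cmod (\<Sum>h<n. ?w ^ h) \<le> 2"
    using mult_right_mono[OF w, of "cmod (\<Sum>h<n. ?w ^ h)"] by simp
  then show ?thesis using assms(1) by (simp add: field_simps)
qed

text \<open>For the balanced numerator, |b|/p^s is the distance from the fractional part of z to the
  nearest integer, which is the quantity that controls geometric sums.\<close>

lemma padic_signed_residue:
  fixes z :: "'p::prime_card padic"
  assumes "padic_abs z \<le> real CARD('p) ^ s"
  obtains b :: int where "2 * \<bar>b\<bar> \<le> int CARD('p) ^ s" "padic_abs (z - of_int b / of_nat CARD('p) ^ s) \<le> 1"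
proof -
  let ?p = "of_nat CARD('p) :: 'p padic"
  define y where "y = z * ?p ^ s"
  have "padic_abs y \<le> 1"
    using assms by (simp add: y_def padic_abs_mult power_divide divide_simps)
  note r = residue[OF this, of s]
  define a where "a = residue s y"
  define b where "b = (if 2 * int a \<le> int CARD('p) ^ s then int a else int a - int CARD('p) ^ s)"
  have "int a < int CARD('p) ^ s" using r(1) by (simp add: a_def flip: of_nat_power)
  then have 1: "2 * \<bar>b\<bar> \<le> int CARD('p) ^ s" by (auto simp: b_def)
  have 2: "padic_abs (y - of_int (int a)) \<le> (1 / real CARD('p)) ^ s" using r(2) by (simp add: a_def)
  have "padic_abs (of_int (int a - b) :: 'p padic) \<le> (1 / real CARD('p)) ^ s"
    unfolding padic_abs_of_int_le_iff by (auto simp: b_def)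
  then have "padic_abs (y - of_int b) \<le> (1 / real CARD('p)) ^ s"
    using padic_abs_ultra[of "y - of_int (int a)" "of_int (int a - b)"] 2 by simp
  moreover have "z - of_int b / ?p ^ s = (y - of_int b) / ?p ^ s" by (simp add: y_def field_simps)
  ultimately have "padic_abs (z - of_int b / ?p ^ s) \<le> 1"
    by (simp add: padic_abs_divide field_simps power_divide)
  with 1 show ?thesis by (rule that)
qed

lemma norm_geometric_sum_char_le:
  fixes z :: "'p::prime_card padic"
  assumes "padic_abs (z - of_int b / of_nat CARD('p) ^ s) \<le> 1" "2 * \<bar>b\<bar> \<le> int CARD('p) ^ s" "b \<noteq> 0"
  shows "cmod (\<Sum>h<n. padic_char (of_nat h * z)) \<le> real CARD('p) ^ s / \<bar>real_of_int b\<bar>"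
proof -
  let ?t = "real_of_int b / real CARD('p) ^ s"
  have "2 * \<bar>real_of_int b\<bar> \<le> real CARD('p) ^ s"
    using assms(2) by (metis (no_types, opaque_lifting) of_int_abs of_int_le_iff of_int_mult of_int_numeral of_int_of_nat_eq of_int_power)
  then have t: "?t \<noteq> 0" "\<bar>?t\<bar> \<le> 1 / 2" using assms(3) by (auto simp: field_simps)
  have "padic_char z = cis (2 * pi * ?t)" by (rule padic_char_of_int[OF assms(1)])
  then show ?thesis
    using norm_geometric_sum_cis_le[OF t, of n] by (simp add: padic_char_of_nat_mult)
qed

lemma geometric_sum_char_eq_0:
  fixes z :: "'p::prime_card padic"
  assumes "1 < padic_abs z" "padic_abs (of_nat n * z) \<le> 1"
  shows "(\<Sum>h<n. padic_char (of_nat h * z)) = 0"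
proof -
  have "padic_char z ^ n = 1"
    using padic_char_eq_1[OF assms(2)] by (simp add: padic_char_of_nat_mult)
  then have "(padic_char z - 1) * (\<Sum>h<n. padic_char z ^ h) = 0"
    by (simp flip: power_diff_1_eq)
  then show ?thesis using padic_char_neq_1[OF assms(1)] by (simp add: padic_char_of_nat_mult)
qed

section \<open>The measure on the well approximable numbers\<close>

context padic_walk
begin

lemma sum_pmf_law [simp]: "(\<Sum>a<CARD('p) ^ m n. pmf (law n) a) = 1"
  by (rule sum_pmf_eq_1) (auto dest: law_less)

lemma expectation_law_Suc:
  fixes g :: "nat \<Rightarrow> 'b::{banach, second_countable_topology}"
  assumes "finite (set_pmf (U n))"
  shows "(\<integral>b. g b \<partial>law (Suc n)) = (\<Sum>a<CARD('p) ^ m n. pmf (law n) a *\<^sub>R (\<integral>u. g (step n a u) \<partial>U n))"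
  unfolding walk_pmf.simps
  by (subst pmf_expectation_bind[where A = "{..<CARD('p) ^ m n}"]) (use assms in \<open>auto dest: law_less\<close>)

text \<open>A bound that holds from every starting residue survives averaging over the past. This is
  why the decay at a given frequency needs the randomness of one step only.\<close>

lemma norm_expectation_law_Suc_le:
  fixes g :: "nat \<Rightarrow> 'b::{banach, second_countable_topology}"
  assumes "finite (set_pmf (U n))"
    and "\<And>a. a < CARD('p) ^ m n \<Longrightarrow> norm (\<integral>u. g (step n a u) \<partial>U n) \<le> B"
  shows "norm (\<integral>b. g b \<partial>law (Suc n)) \<le> B"
proof -
  have "norm (\<integral>b. g b \<partial>law (Suc n)) \<le> (\<Sum>a<CARD('p) ^ m n. pmf (law n) a * B)"
    unfolding expectation_law_Suc[OF assms(1)]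
    by (rule sum_norm_le) (auto intro!: mult_left_mono assms(2))
  also have "\<dots> = B" by (simp flip: sum_distrib_right)
  finally show ?thesis .
qed

text \<open>Only states in A can reach X, so the conditional bound is paid only on the mass of A.
  The product form lets a bound at a coarser radius be carried over to a finer one.\<close>

lemma measure_law_Suc_le:
  assumes "finite (set_pmf (U n))" "0 \<le> B"
    and "\<And>a. a < CARD('p) ^ m n \<Longrightarrow> a \<in> A \<Longrightarrow> measure (U n) {u. step n a u \<in> X} \<le> B"
    and "\<And>a u. a < CARD('p) ^ m n \<Longrightarrow> step n a u \<in> X \<Longrightarrow> a \<in> A"
  shows "measure (law (Suc n)) X \<le> B * measure (law n) A"
proof -
  have int: "(\<integral>u. indicat_real X (step n a u) \<partial>U n) = measure (U n) {u. step n a u \<in> X}" for a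
  proof -
    have "(\<lambda>u. indicat_real X (step n a u)) = indicator {u. step n a u \<in> X}"
      by (auto simp: indicator_def)
    then show ?thesis by simp
  qed
  have "measure (law (Suc n)) X = (\<integral>b. indicat_real X b \<partial>law (Suc n))" by simp
  also have "\<dots> = (\<Sum>a<CARD('p) ^ m n. pmf (law n) a * measure (U n) {u. step n a u \<in> X})"
    unfolding expectation_law_Suc[OF assms(1)] int by simp
  also have "\<dots> \<le> (\<Sum>a<CARD('p) ^ m n. B * (if a \<in> A then pmf (law n) a else 0))"
  proof (rule sum_mono)
    fix a assume "a \<in> {..<CARD('p) ^ m n}"
    then have a: "a < CARD('p) ^ m n" by simp
    show "pmf (law n) a * measure (U n) {u. step n a u \<in> X} \<le> B * (if a \<in> A then pmf (law n) a else 0)"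
    proof (cases "a \<in> A")
      case True
      then show ?thesis
        using mult_right_mono[OF assms(3)[OF a True], of "pmf (law n) a"] by (simp add: mult.commute)
    next
      case False
      then have "{u. step n a u \<in> X} = {}" using assms(4)[OF a] by auto
      then show ?thesis using False by simp
    qed
  qed
  also have "\<dots> = B * (\<Sum>a\<in>{..<CARD('p) ^ m n} \<inter> A. pmf (law n) a)"
    by (simp add: sum.inter_restrict sum_distrib_left)
  also have "\<dots> = B * measure (law n) ({..<CARD('p) ^ m n} \<inter> A)"
    by (simp add: measure_measure_pmf_finite)
  also have "\<dots> \<le> B * measure (law n) A"
    using assms(2) by (intro mult_left_mono measure_pmf.finite_measure_mono) auto
  finally show ?thesis .
qed

end

section \<open>Parameters and steps of the approximating walk\<close>

lemma padic_abs_of_nat_prime: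
  assumes "prime q" "CARD('p::prime_card) < q"
  shows "padic_abs (of_nat q :: 'p padic) = 1"
proof -
  have "\<not> CARD('p) dvd q"
    using assms prime_card[where 'a = 'p] primes_dvd_imp_eq[of "CARD('p)" q] by auto
  then show ?thesis by (rule padic_abs_of_nat_coprime)
qed

text \<open>With T = p^(k n): \<open>k_ge\<close> is the exponential gap that turns losses p^(2m)
  into a factor k; \<open>primes_ge\<close> asks for enough primes between 2T and 6T;
  \<open>m_ge\<close> makes p^(-m (Suc n)) at most (6T)^(-\<tau>), hence at most q^(-\<tau>) for
  every denominator q \<le> 6T; and \<open>m_le\<close> says that no precision beyond a factor p is
  demanded, which fixes the decay exponent.\<close>

locale approx_walk =
  fixes P :: "'p::prime_card itself" and \<tau> :: real and m k :: "nat \<Rightarrow> nat"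
  assumes tau: "2 < \<tau>" and m_0: "m 0 = 0"
    and k_ge: "CARD('p) ^ (2 * m n) \<le> k n"
    and primes_ge: "real (CARD('p) ^ k n) / (2 * ln (real (CARD('p) ^ k n)))
      \<le> real (card {q. prime q \<and> 2 * CARD('p) ^ k n < q \<and> q \<le> 6 * CARD('p) ^ k n})"
    and m_ge: "(6 * real CARD('p) ^ k n) powr \<tau> \<le> real CARD('p) ^ m (Suc n)"
    and m_le: "real CARD('p) ^ m (Suc n) \<le> real CARD('p) * (6 * real CARD('p) ^ k n) powr \<tau>"
begin

definition T :: "nat \<Rightarrow> nat" where "T n = CARD('p) ^ k n"
definition R :: "nat \<Rightarrow> nat" where "R n = CARD('p) ^ (k n - m n)"
definition Q :: "nat \<Rightarrow> nat set" where "Q n = {q. prime q \<and> 2 * T n < q \<and> q \<le> 6 * T n}"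

text \<open>The numerator involves two independent summands h and h' so that the mean over them is the
  square of a mean geometric sum, which is small enough to be summed over q.\<close>

definition U :: "nat \<Rightarrow> (nat \<times> nat \<times> nat) pmf"
  where "U n = pmf_of_set (Q n \<times> {..<R n} \<times> {..<R n})"

definition num :: "nat \<Rightarrow> nat \<Rightarrow> nat \<times> nat \<times> nat \<Rightarrow> nat"
  where "num n a = (\<lambda>(q, h, h'). (q * a) mod CARD('p) ^ m n + CARD('p) ^ m n * (h + h'))"

text \<open>A denominator divisible by p is never drawn. Leaving the state unchanged for it makes
  the conditions of \<open>padic_walk\<close> hold for every u.\<close>

definition step :: "nat \<Rightarrow> nat \<Rightarrow> nat \<times> nat \<times> nat \<Rightarrow> nat"
  where "step n a u = (if CARD('p) dvd fst u then a
    else residue (m (Suc n)) (of_nat (num n a u) / of_nat (fst u) :: 'p padic))"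

lemma p_gt_1: "1 < CARD('p)" by (rule CARD_gt_1)

lemma ln_p_pos: "0 < ln (real CARD('p))" using p_gt_1 by simp

lemma m_less_k: "m n < k n"
proof -
  have "m n < 2 ^ m n" by (rule less_exp)
  also have "\<dots> \<le> CARD('p) ^ m n" using p_gt_1 by (intro power_mono) auto
  also have "\<dots> \<le> CARD('p) ^ (2 * m n)" using p_gt_1 by (intro power_increasing) auto
  also have "\<dots> \<le> k n" by (rule k_ge)
  finally show ?thesis .
qed

lemma T_eq: "T n = CARD('p) ^ m n * R n"
  using m_less_k[of n] by (simp add: T_def R_def flip: power_add)

lemma T_pos [simp]: "0 < T n" and R_pos [simp]: "0 < R n"
  by (simp_all add: T_def R_def)

lemma p_le_T: "CARD('p) \<le> T n"
proof -
  have "CARD('p) ^ 1 \<le> CARD('p) ^ k n" using m_less_k[of n] p_gt_1 by (intro power_increasing) auto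
  then show ?thesis by (simp add: T_def)
qed

lemma real_T: "real (T n) = real CARD('p) ^ k n" by (simp add: T_def)

lemma m_bounds:
  shows "(6 * real (T n)) powr \<tau> \<le> real CARD('p) ^ m (Suc n)" "real CARD('p) ^ m (Suc n) \<le> real CARD('p) * (6 * real (T n)) powr \<tau>"
  using m_ge[of n] m_le[of n] by (simp_all add: T_def)

lemma k_less_m: "k n < m (Suc n)"
proof -
  have "real CARD('p) ^ k n < (6 * real (T n)) powr 1" using p_gt_1 by (simp add: T_def)
  also have "\<dots> \<le> (6 * real (T n)) powr \<tau>"
    using tau p_gt_1 by (intro powr_mono) (auto simp: Suc_leI intro: order_trans[of _ "real (T n)"])
  also have "\<dots> \<le> real CARD('p) ^ m (Suc n)" by (rule m_bounds)
  finally show ?thesis using p_gt_1 by (simp add: power_strict_increasing_iff)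
qed

lemma m_mono: "strict_mono m"
  by (rule strict_monoI_Suc) (use m_less_k k_less_m less_trans in blast)

lemma finite_Q [simp]: "finite (Q n)"
  by (rule finite_subset[of _ "{..6 * T n}"]) (auto simp: Q_def)

lemma card_Q_ge: "real (T n) / (2 * real (k n) * ln (real CARD('p))) \<le> real (card (Q n))"
  using primes_ge[of n] p_gt_1 by (simp add: Q_def T_def ln_realpow)

lemma card_Q_pos: "0 < card (Q n)"
proof -
  have "0 < real (T n) / (2 * real (k n) * ln (real CARD('p)))"
    using ln_p_pos m_less_k[of n] by (intro divide_pos_pos mult_pos_pos) auto
  then show ?thesis using card_Q_ge[of n] by linarith
qed

lemma Q_nonempty [simp]: "Q n \<noteq> {}" using card_Q_pos[of n] by auto

lemma Q_prime: "q \<in> Q n \<Longrightarrow> prime q" "q \<in> Q n \<Longrightarrow> 2 * T n < q" "q \<in> Q n \<Longrightarrow> q \<le> 6 * T n"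
  by (auto simp: Q_def)

lemma Q_abs: "q \<in> Q n \<Longrightarrow> padic_abs (of_nat q :: 'p padic) = 1"
  using Q_prime[of q n] p_le_T[of n] by (intro padic_abs_of_nat_prime) auto

lemma Q_not_dvd: "q \<in> Q n \<Longrightarrow> \<not> CARD('p) dvd q"
  using Q_prime[of q n] p_le_T[of n] prime_card[where 'a = 'p] primes_dvd_imp_eq[of "CARD('p)" q] by auto

lemma set_U [simp]: "set_pmf (U n) = Q n \<times> {..<R n} \<times> {..<R n}"
  unfolding U_def by (rule set_pmf_of_set) (auto simp: lessThan_empty_iff)

lemma step_close:
  assumes "\<not> CARD('p) dvd q"
  shows "padic_abs (of_nat (step n a (q, h)) - of_nat (num n a (q, h)) / of_nat q :: 'p padic)
    \<le> (1 / real CARD('p)) ^ m (Suc n)"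
    and "step n a (q, h) < CARD('p) ^ m (Suc n)"
proof -
  have "padic_abs (of_nat (num n a (q, h)) / of_nat q :: 'p padic) \<le> 1"
    using padic_abs_of_nat_le[where 'p = 'p]
    by (simp add: padic_abs_divide padic_abs_of_nat_coprime[OF assms])
  note r = residue[OF this, of "m (Suc n)"]
  show "padic_abs (of_nat (step n a (q, h)) - of_nat (num n a (q, h)) / of_nat q :: 'p padic)
    \<le> (1 / real CARD('p)) ^ m (Suc n)"
    using r(2) assms by (simp only: step_def fst_conv if_False padic_abs_minus_commute)
  show "step n a (q, h) < CARD('p) ^ m (Suc n)"
    using r(1) assms by (simp only: step_def fst_conv if_False)
qed

lemma num_mod: "num n a (q, h, h') mod CARD('p) ^ m n = (q * a) mod CARD('p) ^ m n"
  by (simp add: num_def)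

sublocale W: padic_walk P m U step
proof
  fix a n and u :: "nat \<times> nat \<times> nat" assume a: "a < CARD('p) ^ m n"
  obtain q h where u: "u = (q, h)" by (rule prod.exhaust)
  have le: "(1 / real CARD('p)) ^ m (Suc n) \<le> (1 / real CARD('p)) ^ m n"
    using p_gt_1 strict_monoD[OF m_mono, of n "Suc n"] by (intro power_decreasing) auto
  have less: "CARD('p) ^ m n \<le> CARD('p) ^ m (Suc n)"
    using p_gt_1 strict_monoD[OF m_mono, of n "Suc n"] by (intro power_increasing) auto
  show "step n a u < CARD('p) ^ m (Suc n)"
    using a less step_close(2)[of q n a h] unfolding u by (cases "CARD('p) dvd q") (auto simp: step_def)
  show "step n a u mod CARD('p) ^ m n = a"
  proof (cases "CARD('p) dvd q")
    case True
    then show ?thesis using a by (simp add: u step_def)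
  next
    case False
    note q1 = padic_abs_of_nat_coprime[OF False]
    then have "of_nat q \<noteq> (0 :: 'p padic)" by (metis padic_abs_zero zero_neq_one)
    obtain h1 h2 where h: "h = (h1, h2)" by fastforce
    \<comment> \<open>The numerator is congruent to q a and q is a unit, so the fraction itself
      reduces to a modulo p^(m n); taking its residue to the higher modulus does not disturb
      this.\<close>
    have "padic_abs (of_nat (num n a (q, h)) - of_nat (q * a) :: 'p padic) \<le> (1 / real CARD('p)) ^ m n"
      unfolding padic_abs_of_nat_diff_le_iff h num_mod ..
    moreover have "of_nat (num n a (q, h)) / of_nat q - of_nat a
        = (of_nat (num n a (q, h)) - of_nat (q * a) :: 'p padic) / of_nat q"
      using \<open>of_nat q \<noteq> (0 :: 'p padic)\<close> by (simp add: field_simps)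
    ultimately have "padic_abs (of_nat (num n a (q, h)) / of_nat q - of_nat a :: 'p padic) \<le> (1 / real CARD('p)) ^ m n"
      by (simp only: padic_abs_divide q1 div_by_1)
    then have "padic_abs (of_nat (step n a (q, h)) - of_nat a :: 'p padic) \<le> (1 / real CARD('p)) ^ m n"
      using padic_abs_ultra[of "of_nat (step n a (q, h)) - of_nat (num n a (q, h)) / of_nat q :: 'p padic"
          "of_nat (num n a (q, h)) / of_nat q - of_nat a"] step_close(1)[OF False, of n a h] le
      by simp
    then have "step n a (q, h) mod CARD('p) ^ m n = a mod CARD('p) ^ m n"
      by (simp only: padic_abs_of_nat_diff_le_iff)
    then show ?thesis using a by (simp add: u)
  qed
qed (use m_0 m_mono in auto)

abbreviation "\<mu> \<equiv> walk_measure U step :: 'p padic measure"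

lemma finite_set_U: "finite (set_pmf (U n))" by simp

subsection \<open>Decay of the Fourier transform\<close>

text \<open>At frequencies up to p^(m (Suc n)) the new residue may be replaced by the exact
  fraction, since the phase changes by a p-adic integer. The numerator is a fixed residue plus p^m
  (h + h'), so the phase splits into one factor free of h and h' and one factor for each of
  them.\<close>

lemma char_step:
  fixes \<xi> :: "'p padic"
  assumes "q \<in> Q n" "padic_abs \<xi> \<le> real CARD('p) ^ m (Suc n)"
  shows "padic_char (of_nat (step n a (q, h, h')) * \<xi>)
    = padic_char (of_nat ((q * a) mod CARD('p) ^ m n) * \<xi> / of_nat q) *
      (padic_char (of_nat h * (of_nat (CARD('p) ^ m n) * \<xi> / of_nat q)) *
       padic_char (of_nat h' * (of_nat (CARD('p) ^ m n) * \<xi> / of_nat q)))"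
proof -
  have nd: "\<not> CARD('p) dvd q" using assms by (intro Q_not_dvd)
  let ?x = "of_nat (step n a (q, h, h')) :: 'p padic" and ?y = "of_nat (num n a (q, h, h')) / of_nat q :: 'p padic"
  have "padic_abs (?x * \<xi> - ?y * \<xi>) = padic_abs (?x - ?y) * padic_abs \<xi>"
    by (simp only: left_diff_distrib flip: padic_abs_mult)
  also have "\<dots> \<le> (1 / real CARD('p)) ^ m (Suc n) * real CARD('p) ^ m (Suc n)"
    using step_close(1)[OF nd, of n a "(h, h')"] assms(2) by (intro mult_mono) auto
  also have "\<dots> = 1" using p_gt_1 by (simp flip: power_mult_distrib)
  finally have "padic_char (?x * \<xi>) = padic_char (?y * \<xi>)" by (rule padic_char_cong)
  also have "?y * \<xi> = of_nat ((q * a) mod CARD('p) ^ m n) * \<xi> / of_nat q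
      + (of_nat h * (of_nat (CARD('p) ^ m n) * \<xi> / of_nat q) + of_nat h' * (of_nat (CARD('p) ^ m n) * \<xi> / of_nat q))"
    by (simp add: num_def algebra_simps add_divide_distrib)
  finally show ?thesis by (simp only: padic_char_add)
qed

definition G :: "nat \<Rightarrow> 'p padic \<Rightarrow> nat \<Rightarrow> complex"
  where "G n \<xi> q = (\<Sum>h<R n. padic_char (of_nat h * (of_nat (CARD('p) ^ m n) * \<xi> / of_nat q)))"

text \<open>Summing over the independent h and h' produces the square of \<open>G\<close>. The
  remaining factor is unimodular and is the only place where the state a enters, so taking absolute
  values makes the bound uniform in a.\<close>

lemma norm_expectation_char_step_le:
  assumes "padic_abs \<xi> \<le> real CARD('p) ^ m (Suc n)"
  shows "cmod (\<integral>u. padic_char (of_nat (step n a u) * \<xi>) \<partial>U n)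
    \<le> (\<Sum>q\<in>Q n. (cmod (G n \<xi> q))\<^sup>2) / (real (card (Q n)) * (real (R n))\<^sup>2)"
proof -
  let ?S = "Q n \<times> {..<R n} \<times> {..<R n}"
  let ?c = "\<lambda>q. padic_char (of_nat ((q * a) mod CARD('p) ^ m n) * \<xi> / of_nat q)"
  let ?z = "\<lambda>q. of_nat (CARD('p) ^ m n) * \<xi> / of_nat q"
  have "(\<integral>u. padic_char (of_nat (step n a u) * \<xi>) \<partial>U n)
      = (\<Sum>u\<in>?S. pmf (U n) u *\<^sub>R padic_char (of_nat (step n a u) * \<xi>))"
    by (rule integral_measure_pmf) auto
  also have "\<dots> = (\<Sum>u\<in>?S. (1 / real (card ?S)) *\<^sub>R padic_char (of_nat (step n a u) * \<xi>))"
    unfolding U_def by (intro sum.cong refl) (subst pmf_of_set, auto simp: lessThan_empty_iff indicator_def)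
  also have "\<dots> = (1 / real (card ?S)) *\<^sub>R (\<Sum>(q, h, h')\<in>?S. ?c q * (padic_char (of_nat h * ?z q) * padic_char (of_nat h' * ?z q)))"
    unfolding scaleR_sum_right by (intro sum.cong refl) (auto simp: char_step[OF _ assms])
  also have "(\<Sum>(q, h, h')\<in>?S. ?c q * (padic_char (of_nat h * ?z q) * padic_char (of_nat h' * ?z q)))
      = (\<Sum>q\<in>Q n. \<Sum>h<R n. \<Sum>h'<R n. ?c q * (padic_char (of_nat h * ?z q) * padic_char (of_nat h' * ?z q)))"
    by (simp only: sum.cartesian_product)
  also have "\<dots> = (\<Sum>q\<in>Q n. ?c q * (G n \<xi> q * G n \<xi> q))"
    unfolding G_def sum_product by (simp only: sum_distrib_left)
  finally have "cmod (\<integral>u. padic_char (of_nat (step n a u) * \<xi>) \<partial>U n)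
      = cmod (\<Sum>q\<in>Q n. ?c q * (G n \<xi> q * G n \<xi> q)) / real (card ?S)" by simp
  also have "\<dots> \<le> (\<Sum>q\<in>Q n. (cmod (G n \<xi> q))\<^sup>2) / real (card ?S)"
    by (intro divide_right_mono sum_norm_le) (auto simp: norm_mult power2_eq_square)
  also have "real (card ?S) = real (card (Q n)) * (real (R n))\<^sup>2"
    by (simp add: card_cartesian_product power2_eq_square)
  finally show ?thesis .
qed

lemma fourier_measure_eq:
  assumes "padic_abs \<xi> \<le> real CARD('p) ^ m n"
  shows "fourier_measure \<mu> \<xi> = (\<integral>b. padic_char (of_nat b * \<xi>) \<partial>W.law n)"
  unfolding fourier_measure_def
proof (rule W.integral_walk_measure)
  fix x :: "'p padic" and b :: nat assume "padic_abs (x - of_nat b) \<le> (1 / real CARD('p)) ^ m n"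
  then have "padic_abs (x - of_nat b) * padic_abs \<xi> \<le> (1 / real CARD('p)) ^ m n * real CARD('p) ^ m n"
    using assms by (intro mult_mono) auto
  also have "\<dots> = 1" using p_gt_1 by (simp flip: power_mult_distrib)
  finally show "padic_char (x * \<xi>) = padic_char (of_nat b * \<xi>)"
    by (intro padic_char_cong) (simp only: left_diff_distrib flip: padic_abs_mult)
qed measurable

lemma fourier_measure_le:
  assumes "padic_abs \<xi> \<le> real CARD('p) ^ m (Suc n)"
    and "(\<Sum>q\<in>Q n. (cmod (G n \<xi> q))\<^sup>2) / (real (card (Q n)) * (real (R n))\<^sup>2) \<le> B"
  shows "cmod (fourier_measure \<mu> \<xi>) \<le> B"
  unfolding fourier_measure_eq[OF assms(1)]
  by (intro W.norm_expectation_law_Suc_le finite_set_U order_trans[OF norm_expectation_char_step_le[OF assms(1)] assms(2)])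

text \<open>In this range p^m \<xi>/q has absolute value p^(s - m), which is larger than 1 and at
  most R = p^(k - m). The sum over R consecutive h therefore runs through complete periods of a
  nontrivial character.\<close>

lemma fourier_measure_eq_0:
  assumes \<xi>: "padic_abs \<xi> = real CARD('p) ^ s" and s: "m n < s" "s \<le> k n"
  shows "fourier_measure \<mu> \<xi> = 0"
proof -
  have "G n \<xi> q = 0" if "q \<in> Q n" for q
    unfolding G_def
  proof (rule geometric_sum_char_eq_0)
    have eq: "padic_abs (of_nat (CARD('p) ^ m n) * \<xi> / of_nat q) = (1 / real CARD('p)) ^ m n * real CARD('p) ^ s"
      by (simp add: padic_abs_mult padic_abs_divide Q_abs[OF that] \<xi>)
    also have "\<dots> = real CARD('p) ^ (s - m n)" using s(1) p_gt_1 by (simp add: power_diff power_divide)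
    finally have eq: "padic_abs (of_nat (CARD('p) ^ m n) * \<xi> / of_nat q) = real CARD('p) ^ (s - m n)" .
    then show "1 < padic_abs (of_nat (CARD('p) ^ m n) * \<xi> / of_nat q)"
      using s(1) p_gt_1 by simp
    have "padic_abs (of_nat (R n) :: 'p padic) = (1 / real CARD('p)) ^ (k n - m n)"
      by (simp add: R_def)
    then have "padic_abs (of_nat (R n) * (of_nat (CARD('p) ^ m n) * \<xi> / of_nat q))
        = (1 / real CARD('p)) ^ (k n - m n) * real CARD('p) ^ (s - m n)"
      by (simp only: padic_abs_mult[of "of_nat (R n)"] eq)
    also have "\<dots> \<le> (1 / real CARD('p)) ^ (k n - m n) * real CARD('p) ^ (k n - m n)"
      using s p_gt_1 by (intro mult_left_mono power_increasing) auto
    also have "\<dots> = 1" using p_gt_1 by (simp flip: power_mult_distrib)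
    finally show "padic_abs (of_nat (R n) * (of_nat (CARD('p) ^ m n) * \<xi> / of_nat q)) \<le> 1" .
  qed
  moreover have "real CARD('p) ^ s \<le> real CARD('p) ^ m (Suc n)"
    using s k_less_m[of n] p_gt_1 by (intro power_increasing) auto
  ultimately have "cmod (fourier_measure \<mu> \<xi>) \<le> 0"
    by (intro fourier_measure_le[of \<xi> n]) (simp_all add: \<xi>)
  then show ?thesis by simp
qed

lemma T_neq_0 [simp]: "T n \<noteq> 0" and R_neq_0 [simp]: "R n \<noteq> 0"
  by (simp_all add: T_def R_def)

text \<open>Put x = p^m \<xi>, and let A/p^s' and b/p^s' represent x and x/q modulo Z_p with
  balanced numerators. Then b q = A + l p^s' for some integer l, so |b| is at least about (|l| - 1)
  p^s'/(6T), and the geometric sum is at most 6T/(|l| - 1). All q with the same l divide the single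
  nonzero integer A + l p^s', so each l occurs for few q; the square makes the sum over l
  converge.\<close>

lemma sum_norm_G_le:
  assumes \<xi>: "padic_abs \<xi> = real CARD('p) ^ s" and s: "k n < s"
  shows "(\<Sum>q\<in>Q n. (cmod (G n \<xi> q))\<^sup>2) \<le> 3600 * (real CARD('p) ^ m n)\<^sup>2 * real s / real (k n) * (real (R n))\<^sup>2"
proof -
  define s' where "s' = s - m n"
  have s': "0 < s'" "s' \<le> s" using s m_less_k[of n] by (auto simp: s'_def)
  define x where "x = of_nat (CARD('p) ^ m n) * \<xi>"
  have x: "padic_abs x = real CARD('p) ^ s'"
    using s m_less_k[of n] p_gt_1 by (simp add: x_def padic_abs_mult \<xi> s'_def power_diff power_divide)
  obtain A :: int where A: "2 * \<bar>A\<bar> \<le> int CARD('p) ^ s'" "padic_abs (x - of_int A / of_nat CARD('p) ^ s') \<le> 1"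
    using padic_signed_residue[of x s'] x by auto
  \<comment> \<open>x is not integral because s > m. Nonvanishing of A modulo p^s' makes every b
    nonzero, hence also every integer A + l p^s' that occurs.\<close>
  have A_ndvd: "\<not> int CARD('p) ^ s' dvd A"
  proof
    assume "int CARD('p) ^ s' dvd A"
    then have "padic_abs (of_int A / of_nat CARD('p) ^ s' :: 'p padic) \<le> 1"
      using padic_abs_of_int_le_iff[of A s', where 'p = 'p]
      by (simp add: padic_abs_divide field_simps power_divide)
    then have "padic_abs x \<le> 1"
      using padic_abs_ultra[of "x - of_int A / of_nat CARD('p) ^ s'" "of_int A / of_nat CARD('p) ^ s'"] A(2) by simp
    then show False using x one_less_power[OF real_CARD_gt_1[where 'p = 'p] s'(1)] by simp
  qed
  have "\<exists>b l :: int. 2 * \<bar>b\<bar> \<le> int CARD('p) ^ s' \<and> b * int q = A + l * int CARD('p) ^ s' \<and> b \<noteq> 0 \<and>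
      padic_abs (x / of_nat q - of_int b / of_nat CARD('p) ^ s') \<le> 1" if q: "q \<in> Q n" for q
  proof -
    note q1 = Q_abs[OF q]
    have q0: "of_nat q \<noteq> (0 :: 'p padic)" using q1 by (metis padic_abs_zero zero_neq_one)
    have "padic_abs (x / of_nat q) = real CARD('p) ^ s'" by (simp add: padic_abs_divide q1 x)
    then obtain b :: int where b: "2 * \<bar>b\<bar> \<le> int CARD('p) ^ s'" "padic_abs (x / of_nat q - of_int b / of_nat CARD('p) ^ s') \<le> 1"
      using padic_signed_residue[of "x / of_nat q" s'] by auto
    have "padic_abs (of_nat q * (x / of_nat q - of_int b / of_nat CARD('p) ^ s')) \<le> 1"
      using b(2) by (simp only: padic_abs_mult q1 mult_1)
    moreover have "of_nat q * (x / of_nat q - of_int b / of_nat CARD('p) ^ s') = x - of_int (b * int q) / of_nat CARD('p) ^ s'"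
      using q0 by (simp add: right_diff_distrib mult.commute)
    ultimately have "padic_abs ((x - of_int A / of_nat CARD('p) ^ s') - (x - of_int (b * int q) / of_nat CARD('p) ^ s')) \<le> 1"
      using padic_abs_ultra_diff[of "x - of_int A / of_nat CARD('p) ^ s'" "x - of_int (b * int q) / of_nat CARD('p) ^ s'"] A(2)
      by simp
    moreover have "(x - of_int A / of_nat CARD('p) ^ s') - (x - of_int (b * int q) / of_nat CARD('p) ^ s')
        = of_int (b * int q - A) / of_nat CARD('p) ^ s'"
      by (simp add: diff_divide_distrib)
    ultimately have "padic_abs (of_int (b * int q - A) / of_nat CARD('p) ^ s' :: 'p padic) \<le> 1" by (simp only:)
    then have "padic_abs (of_int (b * int q - A) :: 'p padic) \<le> (1 / real CARD('p)) ^ s'"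
      by (simp add: padic_abs_divide field_simps power_divide del: of_int_diff of_int_mult padic_abs_of_int)
    then have "int CARD('p) ^ s' dvd b * int q - A" by (simp only: padic_abs_of_int_le_iff)
    then obtain l where "b * int q - A = int CARD('p) ^ s' * l" by blast
    then have l: "b * int q = A + l * int CARD('p) ^ s'" by (simp add: mult.commute)
    have "b \<noteq> 0"
    proof
      assume "b = 0"
      then have "A = int CARD('p) ^ s' * (- l)" using l by (simp add: eq_neg_iff_add_eq_0 mult.commute)
      then show False using A_ndvd by (metis dvd_triv_left)
    qed
    then show ?thesis using b l by blast
  qed
  then obtain b l where bl: "\<And>q. q \<in> Q n \<Longrightarrow> 2 * \<bar>b q\<bar> \<le> int CARD('p) ^ s'"
    "\<And>q. q \<in> Q n \<Longrightarrow> b q * int q = A + l q * int CARD('p) ^ s'" "\<And>q. q \<in> Q n \<Longrightarrow> b q \<noteq> (0 :: int)"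
    "\<And>q. q \<in> Q n \<Longrightarrow> padic_abs (x / of_nat q - of_int (b q) / of_nat CARD('p) ^ s') \<le> 1"
    by metis
  \<comment> \<open>The constant is 36 * 5: 36 comes from (6T)^2, and 5 from 1/(|l| - 1)^2 \<le>
    5/(1 + l^2), which is sharp at |l| = 2. For |l| \<le> 1 the trivial bound R for the geometric
    sum suffices.\<close>
  define g where "g j = 180 * (real CARD('p) ^ m n)\<^sup>2 / (1 + (real_of_int j)\<^sup>2)" for j
  let ?P = "real CARD('p) ^ s'"
  have P: "1 \<le> ?P" using p_gt_1 by (intro one_le_power) auto
  have M: "1 \<le> real CARD('p) ^ m n" using p_gt_1 by (intro one_le_power) auto
  have Gb: "(cmod (G n \<xi> q))\<^sup>2 \<le> g (l q) * (real (R n))\<^sup>2" if q: "q \<in> Q n" for q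
  proof (cases "\<bar>l q\<bar> \<le> 1")
    case True
    have "cmod (G n \<xi> q) \<le> (\<Sum>h<R n. 1)"
      unfolding G_def by (rule sum_norm_le) simp
    then have "(cmod (G n \<xi> q))\<^sup>2 \<le> 1 * (real (R n))\<^sup>2"
      by (simp add: power_mono)
    also have "\<dots> \<le> g (l q) * (real (R n))\<^sup>2"
    proof (rule mult_right_mono)
      have "(real_of_int (l q))\<^sup>2 \<le> 1"
        using True by (simp add: abs_square_le_1)
      moreover have "1 \<le> (real CARD('p) ^ m n)\<^sup>2" using M by (simp add: one_le_power)
      ultimately have "1 + (real_of_int (l q))\<^sup>2 \<le> 1 + (real CARD('p) ^ m n)\<^sup>2" "1 \<le> (real CARD('p) ^ m n)\<^sup>2"
        by (auto intro: order_trans)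
      then have "1 * (1 + (real_of_int (l q))\<^sup>2) \<le> 180 * (real CARD('p) ^ m n)\<^sup>2"
        unfolding mult_1 by linarith
      then show "1 \<le> g (l q)"
        unfolding g_def by (intro mult_imp_le_div_pos) (auto simp: add_pos_nonneg)
    qed simp
    finally show ?thesis .
  next
    case False
    define L where "L = real_of_int \<bar>l q\<bar>"
    have L: "2 \<le> L" using False by (simp add: L_def)
    have "cmod (G n \<xi> q) \<le> ?P / \<bar>real_of_int (b q)\<bar>"
      unfolding G_def x_def[symmetric] by (rule norm_geometric_sum_char_le[OF bl(4)[OF q] bl(1)[OF q] bl(3)[OF q]])
    also have "\<dots> \<le> 6 * real (T n) / (L - 1)"
    proof -
      have "real_of_int (b q * int q) = real_of_int (A + l q * int CARD('p) ^ s')"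
        using bl(2)[OF q] by (simp only:)
      then have "real_of_int (b q) * real q = real_of_int A + real_of_int (l q) * ?P" by simp
      moreover have "\<bar>real_of_int A\<bar> \<le> ?P"
      proof -
        have "\<bar>A\<bar> \<le> int CARD('p) ^ s'" using A(1) by linarith
        then have "real_of_int \<bar>A\<bar> \<le> real_of_int (int CARD('p) ^ s')" by (simp only: of_int_le_iff)
        then show ?thesis by simp
      qed
      moreover have "L * ?P = \<bar>real_of_int (l q) * ?P\<bar>" using P by (simp add: L_def abs_mult)
      ultimately have "(L - 1) * ?P \<le> \<bar>real_of_int (b q) * real q\<bar>" by (simp add: left_diff_distrib)
      also have "\<dots> \<le> \<bar>real_of_int (b q)\<bar> * (6 * real (T n))"
        using Q_prime(3)[OF q] by (simp add: abs_mult mult_left_mono)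
      finally have "(L - 1) * ?P \<le> \<bar>real_of_int (b q)\<bar> * (6 * real (T n))" .
      then show ?thesis using L bl(3)[OF q] by (simp add: divide_simps mult.commute)
    qed
    finally have "cmod (G n \<xi> q) \<le> 6 * real (T n) / (L - 1)" .
    then have "(cmod (G n \<xi> q))\<^sup>2 \<le> (6 * real (T n) / (L - 1))\<^sup>2" by (rule power_mono) simp
    also have "\<dots> = 36 * (real CARD('p) ^ m n)\<^sup>2 * (real (R n))\<^sup>2 * (1 / (L - 1)\<^sup>2)"
      by (simp add: T_eq power_divide power_mult_distrib)
    also have "\<dots> \<le> 36 * (real CARD('p) ^ m n)\<^sup>2 * (real (R n))\<^sup>2 * (5 / (1 + L\<^sup>2))"
    proof (rule mult_left_mono)
      have "1 + L\<^sup>2 \<le> 5 * (L - 1)\<^sup>2"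
        using mult_nonneg_nonneg[of "L - 2" "2 * L - 1"] L by (simp add: power2_eq_square algebra_simps)
      moreover have "0 < 1 + L\<^sup>2" "0 < (L - 1)\<^sup>2" using L by (auto simp: add_pos_nonneg)
      ultimately show "1 / (L - 1)\<^sup>2 \<le> 5 / (1 + L\<^sup>2)" by (simp add: divide_simps)
    qed simp
    also have "36 * (real CARD('p) ^ m n)\<^sup>2 * (real (R n))\<^sup>2 * (5 / (1 + L\<^sup>2)) = g (l q) * (real (R n))\<^sup>2"
      by (simp add: g_def L_def)
    finally show ?thesis .
  qed
  \<comment> \<open>Any single q0 with l = j bounds the size of the common multiple: |A + j p^s'| =
    |b| q0 is at most (p^s'/2) * 6T, below p^(4s), while each prime divisor counted exceeds T =
    p^k.\<close>
  have cnt: "real (card {q \<in> Q n. l q = j}) \<le> 4 * real s / real (k n)" if j: "j \<in> l ` Q n" for j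
  proof -
    obtain q0 where q0: "q0 \<in> Q n" "l q0 = j" using j by auto
    define N where "N = A + j * int CARD('p) ^ s'"
    have N: "N = b q0 * int q0" using bl(2)[OF q0(1)] q0(2) by (simp add: N_def)
    have "N \<noteq> 0" using N bl(3)[OF q0(1)] Q_prime(1)[OF q0(1)] by (auto dest: prime_gt_0_nat)
    have "\<bar>real_of_int N\<bar> \<le> 3 * real (T n) * ?P"
    proof -
      have "2 * real_of_int \<bar>b q0\<bar> \<le> real_of_int (int CARD('p) ^ s')"
        using bl(1)[OF q0(1)] by (metis of_int_le_iff of_int_mult of_int_numeral)
      then have "\<bar>real_of_int (b q0)\<bar> \<le> ?P / 2" by simp
      moreover have "real q0 \<le> 6 * real (T n)" using Q_prime(3)[OF q0(1)] by simp
      ultimately have "\<bar>real_of_int (b q0)\<bar> * real q0 \<le> ?P / 2 * (6 * real (T n))"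
        by (intro mult_mono) auto
      then show ?thesis by (simp add: N abs_mult ac_simps)
    qed
    moreover have "3 * real (T n) * ?P \<le> real CARD('p) ^ (4 * s)"
    proof -
      have "3 \<le> real CARD('p) ^ 2" using CARD_ge_2[where 'p = 'p] mult_mono[of 2 "real CARD('p)" 2 "real CARD('p)"]
        by (simp add: power2_eq_square)
      also have "\<dots> \<le> real CARD('p) ^ (2 * s)" using p_gt_1 s' by (intro power_increasing) auto
      finally have "3 \<le> real CARD('p) ^ (2 * s)" .
      moreover have "real (T n) \<le> real CARD('p) ^ s" unfolding real_T using p_gt_1 s by (intro power_increasing) auto
      moreover have "?P \<le> real CARD('p) ^ s" using p_gt_1 s' by (intro power_increasing) auto
      ultimately have "3 * real (T n) * ?P \<le> real CARD('p) ^ (2 * s) * real CARD('p) ^ s * real CARD('p) ^ s"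
        by (intro mult_mono) auto
      also have "\<dots> = real CARD('p) ^ (4 * s)" by (simp flip: power_add)
      finally show ?thesis .
    qed
    ultimately have NB: "\<bar>real_of_int N\<bar> \<le> real CARD('p) ^ (4 * s)" by linarith
    have T1: "1 < real (T n)" using p_gt_1 p_le_T[of n] by simp
    have "real (card {q \<in> Q n. l q = j}) \<le> ln (real CARD('p) ^ (4 * s)) / ln (real (T n))"
    proof (rule card_prime_divisors_le[OF \<open>N \<noteq> 0\<close> _ _ _ T1 _ NB])
      fix q assume "q \<in> {q \<in> Q n. l q = j}"
      then have q: "q \<in> Q n" "l q = j" by auto
      then show "prime q" "real (T n) \<le> real q" using Q_prime[of q n] by auto
      show "int q dvd N" using bl(2)[OF q(1)] q(2) unfolding N_def by (metis dvd_triv_right)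
    qed auto
    also have "\<dots> = 4 * real s / real (k n)"
      using p_gt_1 ln_p_pos by (simp add: real_T ln_realpow)
    finally show ?thesis .
  qed
  have "(\<Sum>q\<in>Q n. (cmod (G n \<xi> q))\<^sup>2) \<le> (\<Sum>q\<in>Q n. g (l q) * (real (R n))\<^sup>2)"
    by (intro sum_mono Gb)
  also have "\<dots> = (\<Sum>j\<in>l ` Q n. \<Sum>q\<in>{q \<in> Q n. l q = j}. g (l q) * (real (R n))\<^sup>2)"
    by (rule sum.image_gen) simp
  also have "\<dots> = (\<Sum>j\<in>l ` Q n. real (card {q \<in> Q n. l q = j}) * (g j * (real (R n))\<^sup>2))"
    by (intro sum.cong refl) simp
  also have "\<dots> \<le> (\<Sum>j\<in>l ` Q n. 4 * real s / real (k n) * (g j * (real (R n))\<^sup>2))"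
    by (intro sum_mono mult_right_mono cnt) (auto simp: g_def)
  also have "\<dots> = 4 * real s / real (k n) * (180 * (real CARD('p) ^ m n)\<^sup>2 * (real (R n))\<^sup>2) *
      (\<Sum>j\<in>l ` Q n. 1 / (1 + (real_of_int j)\<^sup>2))"
    unfolding g_def sum_distrib_left by (intro sum.cong refl) simp
  also have "\<dots> \<le> 4 * real s / real (k n) * (180 * (real CARD('p) ^ m n)\<^sup>2 * (real (R n))\<^sup>2) * 5"
    by (intro mult_left_mono sum_inverse_squares_int_le) auto
  finally show ?thesis by (simp add: ac_simps)
qed

text \<open>The \<tau>-th root of \<open>m_le\<close>: p^s \<le> p (6T)^\<tau>. Bounding
  p^(1/\<tau>) by p keeps the constant free of \<tau>.\<close>

lemma inverse_T_le:
  assumes "s \<le> m (Suc n)"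
  shows "1 / real (T n) \<le> 6 * real CARD('p) * real CARD('p) powr (- real s / \<tau>)"
proof -
  have T: "0 < 6 * real (T n)" by simp
  have "real CARD('p) powr (real s / \<tau>) \<le> (real CARD('p) ^ m (Suc n)) powr (1 / \<tau>)"
    using assms p_gt_1 tau by (simp add: powr_powr divide_right_mono flip: powr_realpow)
  also have "\<dots> \<le> (real CARD('p) * (6 * real (T n)) powr \<tau>) powr (1 / \<tau>)"
    using m_bounds(2) tau p_gt_1 by (intro powr_mono2) auto
  also have "\<dots> = real CARD('p) powr (1 / \<tau>) * (6 * real (T n))"
    using tau T by (simp add: powr_mult powr_powr)
  also have "\<dots> \<le> real CARD('p) powr 1 * (6 * real (T n))"
    using tau p_gt_1 by (intro mult_right_mono powr_mono) auto
  finally have "real CARD('p) powr (real s / \<tau>) \<le> 6 * real CARD('p) * real (T n)" by simp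
  then have "1 / real (T n) \<le> 6 * real CARD('p) * (1 / real CARD('p) powr (real s / \<tau>))"
    using p_gt_1 by (simp add: divide_simps)
  then show ?thesis by (simp add: powr_minus_divide)
qed

text \<open>This is what the gap \<open>k_ge\<close> is made for: the loss p^(2m) costs at most k,
  which is below the exponent of any frequency or radius beyond p^k.\<close>

lemma M_sq_le: "(real CARD('p) ^ m n)\<^sup>2 \<le> real (k n)"
proof -
  have "(real CARD('p) ^ m n)\<^sup>2 = real (CARD('p) ^ (2 * m n))" by (simp add: power_mult mult.commute[of 2])
  also have "\<dots> \<le> real (k n)" using k_ge[of n] by (simp only: of_nat_le_iff)
  finally show ?thesis .
qed

lemma level_exists:
  assumes "0 < s"
  obtains n where "m n < s" "s \<le> m (Suc n)"
proof -
  define n where "n = (LEAST n. s \<le> m n)"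
  have "s \<le> m s" by (rule strict_mono_imp_increasing[OF m_mono])
  then have n: "s \<le> m n" unfolding n_def by (rule LeastI)
  then have "n \<noteq> 0" using assms m_0 by (intro notI) simp
  then obtain n' where n': "n = Suc n'" by (cases n) auto
  have "\<not> s \<le> m n'" using not_less_Least[of n' "\<lambda>n. s \<le> m n"] n' unfolding n_def by simp
  then show ?thesis using that[of n'] n n' by simp
qed

text \<open>Dividing by the number of primes multiplies the bound by 2 k ln p / T, whose k cancels
  the one in the divisor count and leaves s p^(2m)/T. Then p^(2m) \<le> k < s gives the second
  factor s, and 1/T supplies the decay; 43200 is 2 * 3600 * 6.\<close>

lemma fourier_measure_decay:
  assumes \<xi>: "padic_abs \<xi> = real CARD('p) ^ s" and s: "0 < s"
  shows "cmod (fourier_measure \<mu> \<xi>) \<le> 43200 * real CARD('p) * ln (real CARD('p)) * (real s)\<^sup>2 * real CARD('p) powr (- real s / \<tau>)"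
proof -
  obtain n where n: "m n < s" "s \<le> m (Suc n)" using level_exists[OF s] .
  show ?thesis
  proof (cases "s \<le> k n")
    case True
    have "0 \<le> 43200 * real CARD('p) * ln (real CARD('p)) * (real s)\<^sup>2 * real CARD('p) powr (- real s / \<tau>)"
      using ln_p_pos by (intro mult_nonneg_nonneg) auto
    then show ?thesis using fourier_measure_eq_0[OF \<xi> n(1) True] by simp
  next
    case False
    then have ks: "k n < s" by simp
    have k0: "0 < k n" using m_less_k[of n] by simp
    show ?thesis
    proof (rule fourier_measure_le)
      show "padic_abs \<xi> \<le> real CARD('p) ^ m (Suc n)"
        unfolding \<xi> using n p_gt_1 by (intro power_increasing) auto
      have "(\<Sum>q\<in>Q n. (cmod (G n \<xi> q))\<^sup>2) / (real (card (Q n)) * (real (R n))\<^sup>2)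
          \<le> 3600 * (real CARD('p) ^ m n)\<^sup>2 * real s / real (k n) * (real (R n))\<^sup>2 / (real (card (Q n)) * (real (R n))\<^sup>2)"
        by (intro divide_right_mono sum_norm_G_le[OF \<xi> ks]) auto
      also have "\<dots> = 3600 * (real CARD('p) ^ m n)\<^sup>2 * real s / real (k n) * (1 / real (card (Q n)))"
        by simp
      also have "\<dots> \<le> 3600 * (real CARD('p) ^ m n)\<^sup>2 * real s / real (k n) *
          (1 / (real (T n) / (2 * real (k n) * ln (real CARD('p)))))"
        using card_Q_pos[of n] k0 ln_p_pos
        by (intro mult_left_mono divide_left_mono card_Q_ge mult_pos_pos divide_pos_pos) auto
      also have "3600 * (real CARD('p) ^ m n)\<^sup>2 * real s / real (k n) * (1 / (real (T n) / (2 * real (k n) * ln (real CARD('p)))))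
          = 7200 * ln (real CARD('p)) * real s * (real CARD('p) ^ m n)\<^sup>2 * (1 / real (T n))"
        using k0 by simp
      also have "\<dots> \<le> 7200 * ln (real CARD('p)) * real s * real s * (6 * real CARD('p) * real CARD('p) powr (- real s / \<tau>))"
      proof (intro mult_mono mult_left_mono inverse_T_le[OF n(2)])
        show "(real CARD('p) ^ m n)\<^sup>2 \<le> real s" using M_sq_le[of n] ks by linarith
      qed (use ln_p_pos in auto)
      also have "\<dots> = 43200 * real CARD('p) * ln (real CARD('p)) * (real s)\<^sup>2 * real CARD('p) powr (- real s / \<tau>)"
        by (simp add: power2_eq_square)
      finally show "(\<Sum>q\<in>Q n. (cmod (G n \<xi> q))\<^sup>2) / (real (card (Q n)) * (real (R n))\<^sup>2)
          \<le> 43200 * real CARD('p) * ln (real CARD('p)) * (real s)\<^sup>2 * real CARD('p) powr (- real s / \<tau>)" .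
    qed
  qed
qed

section \<open>Mass of balls\<close>

lemma step_close_iff:
  assumes q: "q \<in> Q n" and l: "l \<le> m (Suc n)"
  shows "padic_abs (of_nat (step n a (q, h)) - of_nat Y :: 'p padic) \<le> (1 / real CARD('p)) ^ l
    \<longleftrightarrow> num n a (q, h) mod CARD('p) ^ l = q * Y mod CARD('p) ^ l"
proof -
  note q1 = Q_abs[OF q]
  have q0: "of_nat q \<noteq> (0 :: 'p padic)" using q1 by (metis padic_abs_zero zero_neq_one)
  let ?s = "of_nat (step n a (q, h)) :: 'p padic" and ?r = "of_nat (num n a (q, h)) / of_nat q :: 'p padic"
  have "(1 / real CARD('p)) ^ m (Suc n) \<le> (1 / real CARD('p)) ^ l"
    using l p_gt_1 by (intro power_decreasing) auto
  then have c: "padic_abs (?s - ?r) \<le> (1 / real CARD('p)) ^ l"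
    using step_close(1)[OF Q_not_dvd[OF q], of n a h] by linarith
  have "padic_abs (?s - of_nat Y) \<le> (1 / real CARD('p)) ^ l \<longleftrightarrow> padic_abs (?r - of_nat Y) \<le> (1 / real CARD('p)) ^ l"
    using c padic_abs_ultra[of "?s - ?r" "?r - of_nat Y"] padic_abs_ultra_diff[of "?s - of_nat Y" "?s - ?r"]
    by auto
  also have "padic_abs (?r - of_nat Y) = padic_abs (of_nat (num n a (q, h)) - of_nat (q * Y) :: 'p padic)"
  proof -
    have "?r - of_nat Y = (of_nat (num n a (q, h)) - of_nat (q * Y)) / of_nat q"
      using q0 by (simp add: field_simps)
    then show ?thesis by (simp only: padic_abs_divide q1 div_by_1)
  qed
  finally show ?thesis by (simp only: padic_abs_of_nat_diff_le_iff)
qed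

lemma measure_U:
  "measure (U n) X = real (card ((Q n \<times> {..<R n} \<times> {..<R n}) \<inter> X)) / (real (card (Q n)) * (real (R n))\<^sup>2)"
  unfolding U_def
  by (subst measure_pmf_of_set) (auto simp: lessThan_empty_iff card_cartesian_product power2_eq_square)

text \<open>For fixed q and h, landing in the ball prescribes h' modulo p^(l - m), which one value
  in p^(l - m) satisfies because this modulus divides R.\<close>

lemma measure_step_le_low:
  assumes l: "m n \<le> l" "l \<le> k n"
  shows "measure (U n) {u. padic_abs (of_nat (step n a u) - of_nat Y :: 'p padic) \<le> (1 / real CARD('p)) ^ l}
    \<le> 1 / real CARD('p) ^ (l - m n)"
proof -
  let ?X = "{u. padic_abs (of_nat (step n a u) - of_nat Y :: 'p padic) \<le> (1 / real CARD('p)) ^ l}"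
  let ?S = "Q n \<times> {..<R n} \<times> {..<R n}"
  define J K where "J = CARD('p) ^ (l - m n)" and "K = CARD('p) ^ (k n - l)"
  have RJK: "R n = J * K" using l by (simp add: R_def J_def K_def flip: power_add)
  have pl: "CARD('p) ^ l = CARD('p) ^ m n * J" using l by (simp add: J_def flip: power_add)
  have lm: "l \<le> m (Suc n)" using l k_less_m[of n] by simp
  have fib: "card {h'. h' < R n \<and> (q, h, h') \<in> ?X} \<le> K" if q: "q \<in> Q n" for q h
  proof (rule card_residue_class_le[where J = J])
    show "{h'. h' < R n \<and> (q, h, h') \<in> ?X} \<subseteq> {..<J * K}" by (auto simp: RJK)
    fix h1 h2 assume "h1 \<in> {h'. h' < R n \<and> (q, h, h') \<in> ?X}" "h2 \<in> {h'. h' < R n \<and> (q, h, h') \<in> ?X}"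
    then have "num n a (q, h, h1) mod CARD('p) ^ l = num n a (q, h, h2) mod CARD('p) ^ l"
      by (simp add: step_close_iff[OF q lm])
    then have "int (CARD('p) ^ m n * J) dvd int (num n a (q, h, h1)) - int (num n a (q, h, h2))"
      unfolding pl by (metis mod_eq_dvd_iff of_nat_mod)
    also have "int (num n a (q, h, h1)) - int (num n a (q, h, h2)) = int (CARD('p) ^ m n) * (int h1 - int h2)"
      by (simp add: num_def algebra_simps)
    finally have "int J dvd int h1 - int h2" by (simp del: of_nat_power)
    then show "h1 mod J = h2 mod J" by (metis mod_eq_dvd_iff of_nat_mod of_nat_eq_iff)
  qed
  have "?S \<inter> ?X = (\<Union>(q, h)\<in>Q n \<times> {..<R n}. (\<lambda>h'. (q, h, h')) ` {h'. h' < R n \<and> (q, h, h') \<in> ?X})"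
    by auto
  then have "card (?S \<inter> ?X) \<le> (\<Sum>(q, h)\<in>Q n \<times> {..<R n}. card ((\<lambda>h'. (q, h, h')) ` {h'. h' < R n \<and> (q, h, h') \<in> ?X}))"
    using card_UN_le[of "Q n \<times> {..<R n}" "\<lambda>(q, h). (\<lambda>h'. (q, h, h')) ` {h'. h' < R n \<and> (q, h, h') \<in> ?X}"]
    by (simp add: case_prod_unfold)
  also have "\<dots> \<le> (\<Sum>(q, h)\<in>Q n \<times> {..<R n}. K)"
  proof (intro sum_mono, clarify)
    fix q h assume "q \<in> Q n"
    then show "card ((\<lambda>h'. (q, h, h')) ` {h'. h' < R n \<and> (q, h, h') \<in> ?X}) \<le> K"
      using fib[of q h] by (subst card_image) (auto simp: inj_on_def)
  qed
  also have "\<dots> = card (Q n) * R n * K" by (simp add: card_cartesian_product case_prod_unfold)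
  finally have "real (card (?S \<inter> ?X)) \<le> real (card (Q n) * R n * K)" by (simp only: of_nat_le_iff)
  then have "measure (U n) ?X \<le> real (card (Q n) * R n * K) / (real (card (Q n)) * (real (R n))\<^sup>2)"
    unfolding measure_U by (intro divide_right_mono) auto
  also have "\<dots> = real K / real (R n)" using card_Q_pos[of n] R_pos[of n] by (simp add: power2_eq_square)
  also have "\<dots> = 1 / real J" using R_pos[of n] unfolding RJK by simp
  finally show ?thesis by (simp add: J_def)
qed

lemma num_less:
  assumes "h < R n" "h' < R n"
  shows "num n a (q, h, h') < 2 * T n"
proof -
  have "num n a (q, h, h') < CARD('p) ^ m n + CARD('p) ^ m n * (h + h')"
    unfolding num_def by simp
  also have "\<dots> = CARD('p) ^ m n * (h + h' + 1)" by simp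
  also have "\<dots> \<le> CARD('p) ^ m n * (2 * R n)" using assms by (intro mult_le_mono) auto
  finally show ?thesis by (simp add: T_eq)
qed

text \<open>Beyond p^k the numerators no longer fill residue classes, so the pairs (q, r) are
  counted by separation of slopes. Each pair comes from at most R triples, since h and r determine
  h'. The numerator 0, excluded from that count, forces h = h' = 0 and gives the term 1/R^2.\<close>

lemma measure_step_le_high:
  assumes l: "l \<le> m (Suc n)"
  shows "measure (U n) {u. padic_abs (of_nat (step n a u) - of_nat Y :: 'p padic) \<le> (1 / real CARD('p)) ^ l}
    \<le> 1 / (real (R n))\<^sup>2 + (1 + 36 * (real (T n))\<^sup>2 / real CARD('p) ^ l) / (real (card (Q n)) * real (R n))"
proof -
  let ?X = "{u. padic_abs (of_nat (step n a u) - of_nat Y :: 'p padic) \<le> (1 / real CARD('p)) ^ l}"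
  let ?S = "Q n \<times> {..<R n} \<times> {..<R n}"
  define V where "V = {(q, r). q \<in> Q n \<and> 0 < r \<and> r < 2 * T n \<and> r mod CARD('p) ^ l = q * Y mod CARD('p) ^ l}"
  have finV: "finite V"
    by (rule finite_subset[of _ "Q n \<times> {..<2 * T n}"]) (auto simp: V_def)
  have "real (card V) \<le> 1 + 36 * (real (T n))\<^sup>2 / real (CARD('p) ^ l)"
    unfolding V_def by (rule card_rational_points_le) (auto simp: Q_def)
  then have cV: "real (card V) \<le> 1 + 36 * (real (T n))\<^sup>2 / real CARD('p) ^ l" by simp
  have "?S \<inter> ?X \<subseteq> (\<lambda>q. (q, 0, 0)) ` Q n \<union> {(q, h, h') \<in> ?S. (q, num n a (q, h, h')) \<in> V}"
  proof
    fix u assume u: "u \<in> ?S \<inter> ?X"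
    obtain q h h' where qh: "u = (q, h, h')" by (rule prod_cases3)
    have q: "q \<in> Q n" "h < R n" "h' < R n" using u qh by auto
    have mod: "num n a (q, h, h') mod CARD('p) ^ l = q * Y mod CARD('p) ^ l"
      using u step_close_iff[OF q(1) l, of a "(h, h')" Y] by (simp add: qh)
    have less: "num n a (q, h, h') < 2 * T n" by (rule num_less[OF q(2,3)])
    show "u \<in> (\<lambda>q. (q, 0, 0)) ` Q n \<union> {(q, h, h') \<in> ?S. (q, num n a (q, h, h')) \<in> V}"
    proof (cases "num n a (q, h, h') = 0")
      case True
      then have "u = (q, 0, 0)" by (simp add: num_def qh)
      then show ?thesis using q(1) by blast
    next
      case False
      then have "(q, num n a (q, h, h')) \<in> V"
        unfolding V_def using q(1) less mod by blast
      then show ?thesis using q unfolding qh by blast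
    qed
  qed
  moreover have fin: "finite {(q, h, h') \<in> ?S. (q, num n a (q, h, h')) \<in> V}"
    by (rule finite_subset[of _ ?S]) auto
  ultimately have "card (?S \<inter> ?X) \<le> card ((\<lambda>q. (q, 0, 0)) ` Q n \<union> {(q, h, h') \<in> ?S. (q, num n a (q, h, h')) \<in> V})"
    by (intro card_mono) auto
  also have "\<dots> \<le> card ((\<lambda>q. (q, 0 :: nat, 0 :: nat)) ` Q n) + card {(q, h, h') \<in> ?S. (q, num n a (q, h, h')) \<in> V}"
    by (rule card_Un_le)
  also have "\<dots> \<le> card (Q n) + card (V \<times> {..<R n})"
  proof (rule add_mono)
    show "card ((\<lambda>q. (q, 0 :: nat, 0 :: nat)) ` Q n) \<le> card (Q n)" by (rule card_image_le) simp
    show "card {(q, h, h') \<in> ?S. (q, num n a (q, h, h')) \<in> V} \<le> card (V \<times> {..<R n})"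
    proof (rule card_inj_on_le[where f = "\<lambda>(q, h, h'). ((q, num n a (q, h, h')), h)"])
      show "inj_on (\<lambda>(q, h, h'). ((q, num n a (q, h, h')), h)) {(q, h, h') \<in> ?S. (q, num n a (q, h, h')) \<in> V}"
        by (auto simp: inj_on_def num_def)
    qed (use finV in auto)
  qed
  also have "\<dots> = card (Q n) + card V * R n" by (simp add: card_cartesian_product)
  finally have "real (card (?S \<inter> ?X)) \<le> real (card (Q n) + card V * R n)" by (simp only: of_nat_le_iff)
  then have "measure (U n) ?X \<le> real (card (Q n) + card V * R n) / (real (card (Q n)) * (real (R n))\<^sup>2)"
    unfolding measure_U by (intro divide_right_mono) auto
  also have "\<dots> = 1 / (real (R n))\<^sup>2 + real (card V) / (real (card (Q n)) * real (R n))"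
    using card_Q_pos[of n] R_pos[of n] by (simp add: power2_eq_square add_divide_distrib)
  also have "\<dots> \<le> 1 / (real (R n))\<^sup>2 + (1 + 36 * (real (T n))\<^sup>2 / real CARD('p) ^ l) / (real (card (Q n)) * real (R n))"
    by (intro add_left_mono divide_right_mono cV) auto
  finally show ?thesis .
qed

text \<open>The sum of the coefficients met in \<open>measure_step_le\<close>: 36 p^2 from the
  square of \<open>inverse_T_le\<close>, 2 ln p from the density of the primes, and 72 = 2 * 36 with
  36 from the slope count.\<close>

definition ball_const :: real
  where "ball_const = (1 + 2 * ln (real CARD('p))) * (36 * (real CARD('p))\<^sup>2) + 72 * ln (real CARD('p))"

lemma ball_const_ge_1: "1 \<le> ball_const"
proof -
  have "1 * 1 \<le> (1 + 2 * ln (real CARD('p))) * (36 * (real CARD('p))\<^sup>2)"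
    using ln_p_pos p_gt_1 by (intro mult_mono) (auto intro: order_trans[OF _ mult_left_mono[of 1 "(real CARD('p))\<^sup>2" 36]] simp: one_le_power)
  then show ?thesis unfolding ball_const_def using ln_p_pos by linarith
qed

text \<open>With M = p^m, both M^2 and k M are at most l^2. After these factors only T^(-2) and
  p^(-l) remain; the first is of size p^(-2l/\<tau>) by \<open>inverse_T_le\<close>, the second is
  no larger because \<tau> > 2.\<close>

lemma measure_step_le:
  assumes l: "k n < l" "l \<le> m (Suc n)"
  shows "measure (U n) {u. padic_abs (of_nat (step n a u) - of_nat Y :: 'p padic) \<le> (1 / real CARD('p)) ^ l}
    \<le> ball_const * (real l)\<^sup>2 * real CARD('p) powr (- 2 * real l / \<tau>)"
proof -
  define M where "M = real CARD('p) ^ m n"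
  define E where "E = real CARD('p) powr (- 2 * real l / \<tau>)"
  define lp where "lp = ln (real CARD('p))"
  define q where "q = real (card (Q n))"
  have M1: "1 \<le> M" unfolding M_def using p_gt_1 by (intro one_le_power) auto
  have Mk: "M\<^sup>2 \<le> real (k n)" unfolding M_def by (rule M_sq_le)
  have MM: "M \<le> M\<^sup>2" using mult_right_mono[OF M1, of M] M1 by (simp add: power2_eq_square)
  have lk: "real (k n) \<le> real l" using l by simp
  have l1: "1 \<le> real l" using l by linarith
  have l2: "real l \<le> (real l)\<^sup>2" using mult_right_mono[OF l1, of "real l"] l1 by (simp add: power2_eq_square)
  have lp: "0 < lp" unfolding lp_def by (rule ln_p_pos)
  have T0: "0 < real (T n)" by simp
  have k0: "0 < real (k n)" using m_less_k[of n] by simp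
  have R: "real (R n) = real (T n) / M" using M1 by (simp add: T_eq M_def)
  have qT: "real (T n) / (2 * real (k n) * lp) \<le> q" unfolding q_def lp_def by (rule card_Q_ge)
  have E0: "0 \<le> E" by (simp add: E_def)
  have T2: "1 / (real (T n))\<^sup>2 \<le> 36 * (real CARD('p))\<^sup>2 * E"
  proof -
    have "(1 / real (T n))\<^sup>2 \<le> (6 * real CARD('p) * real CARD('p) powr (- real l / \<tau>))\<^sup>2"
      by (intro power_mono inverse_T_le l) auto
    also have "\<dots> = 36 * (real CARD('p))\<^sup>2 * E"
      by (simp add: E_def power_mult_distrib powr_power)
    finally show ?thesis by (simp add: power_divide)
  qed
  have pl: "1 / real CARD('p) ^ l \<le> E"
  proof -
    have "real CARD('p) powr (- real l) \<le> real CARD('p) powr (- 2 * real l / \<tau>)"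
    proof (rule powr_mono)
      have "2 * real l / \<tau> \<le> 2 * real l / 2" using tau by (intro divide_left_mono) auto
      then show "- real l \<le> - 2 * real l / \<tau>" by simp
    qed (use p_gt_1 in simp)
    then show ?thesis using p_gt_1 by (simp add: E_def powr_minus_divide powr_realpow)
  qed
  have q0: "0 < q" using card_Q_pos[of n] by (simp add: q_def)
  have iq: "1 / q \<le> 2 * real (k n) * lp / real (T n)"
    using qT q0 T0 k0 lp by (simp add: divide_simps mult.commute)
  have kM: "real (k n) * M \<le> (real l)\<^sup>2"
    using mult_mono[of "real (k n)" "real l" M "real l"] lk MM Mk M1 l1 by (simp add: power2_eq_square)
  have "1 / (real (R n))\<^sup>2 = M\<^sup>2 * (1 / (real (T n))\<^sup>2)"
    by (simp add: R power_divide)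
  also have "\<dots> \<le> (real l)\<^sup>2 * (36 * (real CARD('p))\<^sup>2 * E)"
  proof (rule mult_mono)
    show "M\<^sup>2 \<le> (real l)\<^sup>2" using Mk lk l2 by linarith
  qed (use T2 in auto)
  finally have 1: "1 / (real (R n))\<^sup>2 \<le> (real l)\<^sup>2 * (36 * (real CARD('p))\<^sup>2 * E)" .
  have "(1 + 36 * (real (T n))\<^sup>2 / real CARD('p) ^ l) / (q * real (R n))
      = (1 / q) * ((1 + 36 * (real (T n))\<^sup>2 / real CARD('p) ^ l) * (M / real (T n)))"
    by (simp add: R)
  also have "\<dots> \<le> (2 * real (k n) * lp / real (T n)) * ((1 + 36 * (real (T n))\<^sup>2 / real CARD('p) ^ l) * (M / real (T n)))"
    using M1 T0 by (intro mult_right_mono[OF iq] mult_nonneg_nonneg add_nonneg_nonneg divide_nonneg_nonneg) auto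
  also have "\<dots> = (real (k n) * M) * (2 * lp * (1 / (real (T n))\<^sup>2) + 72 * lp * (1 / real CARD('p) ^ l))"
    using T0 by (simp add: field_simps power2_eq_square)
  also have "\<dots> \<le> (real l)\<^sup>2 * (2 * lp * (36 * (real CARD('p))\<^sup>2 * E) + 72 * lp * E)"
    using kM T2 pl lp E0 by (intro mult_mono add_mono mult_left_mono add_nonneg_nonneg mult_nonneg_nonneg) auto
  finally have 2: "(1 + 36 * (real (T n))\<^sup>2 / real CARD('p) ^ l) / (q * real (R n))
      \<le> (real l)\<^sup>2 * (2 * lp * (36 * (real CARD('p))\<^sup>2 * E) + 72 * lp * E)" .
  have "measure (U n) {u. padic_abs (of_nat (step n a u) - of_nat Y :: 'p padic) \<le> (1 / real CARD('p)) ^ l}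
      \<le> (real l)\<^sup>2 * (36 * (real CARD('p))\<^sup>2 * E) + (real l)\<^sup>2 * (2 * lp * (36 * (real CARD('p))\<^sup>2 * E) + 72 * lp * E)"
    using measure_step_le_high[OF l(2), of a Y] 1 2 unfolding q_def by linarith
  also have "\<dots> = ball_const * (real l)\<^sup>2 * E"
    by (simp add: ball_const_def lp_def algebra_simps)
  finally show ?thesis by (simp only: E_def)
qed

lemma measure_cball_Suc_le:
  assumes y: "padic_abs y \<le> 1" and l: "m n \<le> l" "l \<le> m (Suc n)" and B: "0 \<le> B"
    and step: "\<And>a Y. measure (U n) {u. padic_abs (of_nat (step n a u) - of_nat Y :: 'p padic) \<le> (1 / real CARD('p)) ^ l} \<le> B"
  shows "measure \<mu> (cball y ((1 / real CARD('p)) ^ l)) \<le> B * measure \<mu> (cball y ((1 / real CARD('p)) ^ m n))"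
proof -
  define Y where "Y = residue l y"
  have Y: "padic_abs (y - of_nat Y) \<le> (1 / real CARD('p)) ^ l" using residue(2)[OF y, of l] by (simp add: Y_def)
  have le: "(1 / real CARD('p)) ^ l \<le> (1 / real CARD('p)) ^ m n" using l p_gt_1 by (intro power_decreasing) auto
  have b1: "cball y ((1 / real CARD('p)) ^ l) = cball (of_nat Y) ((1 / real CARD('p)) ^ l)"
    by (rule cball_padic_eq[OF Y])
  have b2: "cball y ((1 / real CARD('p)) ^ m n) = cball (of_nat Y) ((1 / real CARD('p)) ^ m n)"
    by (rule cball_padic_eq[OF order_trans[OF Y le]])
  show ?thesis
    unfolding b1 b2 W.measure_walk_measure_cball[OF l(2)] W.measure_walk_measure_cball[OF order_refl]
  proof (rule W.measure_law_Suc_le[OF finite_set_U B])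
    fix a assume "a < CARD('p) ^ m n"
    show "measure (U n) {u. step n a u \<in> {a. padic_abs (of_nat a - of_nat Y :: 'p padic) \<le> (1 / real CARD('p)) ^ l}} \<le> B"
      using step[of a Y] by simp
  next
    fix a u assume a: "a < CARD('p) ^ m n" and "step n a u \<in> {a. padic_abs (of_nat a - of_nat Y :: 'p padic) \<le> (1 / real CARD('p)) ^ l}"
    then have "padic_abs (of_nat (step n a u) - of_nat Y :: 'p padic) \<le> (1 / real CARD('p)) ^ m n" using le by simp
    then have "step n a u mod CARD('p) ^ m n = Y mod CARD('p) ^ m n" by (simp only: padic_abs_of_nat_diff_le_iff)
    then have "a mod CARD('p) ^ m n = Y mod CARD('p) ^ m n" using a W.step_mod[OF a, of u] by simp
    then show "a \<in> {a. padic_abs (of_nat a - of_nat Y :: 'p padic) \<le> (1 / real CARD('p)) ^ m n}"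
      by (simp add: padic_abs_of_nat_diff_le_iff)
  qed
qed

lemma prob_space_mu: "prob_space \<mu>"
  using W.borel_prob_walk_measure by (simp add: borel_prob_def)

lemma measure_mu_le_1: "measure \<mu> X \<le> 1"
  by (rule prob_space.prob_le_1[OF prob_space_mu])

text \<open>For l > k one step already gives the bound, and the earlier mass is estimated by 1. For
  m < l \<le> k the step gives p^(-(l - m)), at most p^(-2(l - m)/\<tau>), and the rest comes from
  the ball of radius p^(-m). Its bound again uses one step only, so constants do not
  accumulate.\<close>

lemma measure_cball_power_le:
  assumes y: "padic_abs y \<le> 1" and l: "0 < l"
  shows "measure \<mu> (cball y ((1 / real CARD('p)) ^ l)) \<le> ball_const * (real l)\<^sup>2 * real CARD('p) powr (- 2 * real l / \<tau>)"
proof -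
  have high: "measure \<mu> (cball y ((1 / real CARD('p)) ^ l)) \<le> ball_const * (real l)\<^sup>2 * real CARD('p) powr (- 2 * real l / \<tau>)"
    if "k n < l" "l \<le> m (Suc n)" for n l
  proof -
    let ?B = "ball_const * (real l)\<^sup>2 * real CARD('p) powr (- 2 * real l / \<tau>)"
    have B: "0 \<le> ?B" using ball_const_ge_1 by simp
    have "measure \<mu> (cball y ((1 / real CARD('p)) ^ l)) \<le> ?B * measure \<mu> (cball y ((1 / real CARD('p)) ^ m n))"
      using that m_less_k[of n] measure_step_le[OF that] by (intro measure_cball_Suc_le[OF y _ _ B]) auto
    also have "\<dots> \<le> ?B * 1" using B by (intro mult_left_mono measure_mu_le_1)
    finally show ?thesis by simp
  qed
  obtain n where n: "m n < l" "l \<le> m (Suc n)" using level_exists[OF l] .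
  show ?thesis
  proof (cases "k n < l")
    case True
    then show ?thesis using high n by blast
  next
    case False
    have low: "measure \<mu> (cball y ((1 / real CARD('p)) ^ l)) \<le> 1 / real CARD('p) ^ (l - m n) * measure \<mu> (cball y ((1 / real CARD('p)) ^ m n))"
      using n False measure_step_le_low[of n l] by (intro measure_cball_Suc_le[OF y]) auto
    have "1 / real CARD('p) ^ (l - m n) = real CARD('p) powr (- real (l - m n))"
      using p_gt_1 by (simp add: powr_minus_divide powr_realpow)
    also have "\<dots> \<le> real CARD('p) powr (- 2 * real (l - m n) / \<tau>)"
    proof (rule powr_mono)
      have "2 * real (l - m n) / \<tau> \<le> 2 * real (l - m n) / 2" using tau by (intro divide_left_mono) auto
      then show "- real (l - m n) \<le> - 2 * real (l - m n) / \<tau>" by simp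
    qed (use p_gt_1 in simp)
    finally have e: "1 / real CARD('p) ^ (l - m n) \<le> real CARD('p) powr (- 2 * real (l - m n) / \<tau>)" .
    \<comment> \<open>The radius p^(-m n) is the last one treated by the previous step, and k n' < m
      n puts it in the range of \<open>high\<close>. At n = 0 the power of p is 1 and the total mass
      suffices.\<close>
    have c: "measure \<mu> (cball y ((1 / real CARD('p)) ^ m n)) \<le> ball_const * (real l)\<^sup>2 * real CARD('p) powr (- 2 * real (m n) / \<tau>)"
    proof (cases n)
      case 0
      have "1 * 1 \<le> ball_const * (real l)\<^sup>2" using ball_const_ge_1 l by (intro mult_mono one_le_power) auto
      then show ?thesis using measure_mu_le_1[of "cball y ((1 / real CARD('p)) ^ m n)"] 0 p_gt_1 by (simp add: m_0)
    next
      case (Suc n')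
      have "measure \<mu> (cball y ((1 / real CARD('p)) ^ m n)) \<le> ball_const * (real (m n))\<^sup>2 * real CARD('p) powr (- 2 * real (m n) / \<tau>)"
        using high[of n' "m n"] k_less_m[of n'] Suc by simp
      also have "\<dots> \<le> ball_const * (real l)\<^sup>2 * real CARD('p) powr (- 2 * real (m n) / \<tau>)"
        using ball_const_ge_1 n by (intro mult_right_mono mult_left_mono power_mono) auto
      finally show ?thesis .
    qed
    have "1 / real CARD('p) ^ (l - m n) * measure \<mu> (cball y ((1 / real CARD('p)) ^ m n))
        \<le> real CARD('p) powr (- 2 * real (l - m n) / \<tau>) * (ball_const * (real l)\<^sup>2 * real CARD('p) powr (- 2 * real (m n) / \<tau>))"
      by (intro mult_mono e c) auto
    also have "\<dots> = ball_const * (real l)\<^sup>2 * (real CARD('p) powr (- 2 * real (l - m n) / \<tau>) * real CARD('p) powr (- 2 * real (m n) / \<tau>))"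
      by simp
    also have "real CARD('p) powr (- 2 * real (l - m n) / \<tau>) * real CARD('p) powr (- 2 * real (m n) / \<tau>) = real CARD('p) powr (- 2 * real l / \<tau>)"
      using n by (simp add: of_nat_diff diff_divide_distrib right_diff_distrib flip: powr_add)
    finally show ?thesis using low by linarith
  qed
qed

end

section \<open>Bounds in logarithmic form and the support of the measure\<close>

lemma norm_fourier_measure_le_1:
  assumes "borel_prob \<mu>"
  shows "cmod (fourier_measure \<mu> \<xi>) \<le> 1"
proof -
  interpret prob_space \<mu> using assms by (simp add: borel_prob_def)
  have "cmod (fourier_measure \<mu> \<xi>) \<le> (\<integral>x. cmod (padic_char (x * \<xi>)) \<partial>\<mu>)"
    unfolding fourier_measure_def by (rule integral_norm_bound)
  also have "\<dots> = 1" by (simp add: prob_space)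
  finally show ?thesis .
qed

text \<open>A function of p alone, as the constant is fixed before \<tau>. The first summand serves
  |\<xi>| = 1 and radii above 1/p, the second the decay, the third smaller balls; the powers of ln p
  in the denominators come from replacing s by ln(1 + p^s)/ln p.\<close>

definition approx_const :: "nat \<Rightarrow> real"
  where "approx_const p = real p / (ln 2)\<^sup>2 + 43200 * real p / ln (real p) +
    real p * ((1 + 2 * ln (real p)) * (36 * (real p)\<^sup>2) + 72 * ln (real p)) / (ln (real p))\<^sup>2"

lemma approx_const_ge:
  assumes "1 < p"
  shows "real p / (ln 2)\<^sup>2 \<le> approx_const p" "43200 * real p / ln (real p) \<le> approx_const p"
    "real p * ((1 + 2 * ln (real p)) * (36 * (real p)\<^sup>2) + 72 * ln (real p)) / (ln (real p))\<^sup>2 \<le> approx_const p"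
proof -
  have 0: "0 < ln (real p)" using assms by simp
  then have "0 \<le> real p / (ln 2)\<^sup>2" "0 \<le> 43200 * real p / ln (real p)"
    "0 \<le> real p * ((1 + 2 * ln (real p)) * (36 * (real p)\<^sup>2) + 72 * ln (real p)) / (ln (real p))\<^sup>2"
    by (auto intro!: divide_nonneg_nonneg mult_nonneg_nonneg add_nonneg_nonneg)
  then show "real p / (ln 2)\<^sup>2 \<le> approx_const p" "43200 * real p / ln (real p) \<le> approx_const p"
    "real p * ((1 + 2 * ln (real p)) * (36 * (real p)\<^sup>2) + 72 * ln (real p)) / (ln (real p))\<^sup>2 \<le> approx_const p"
    unfolding approx_const_def by linarith+
qed

context approx_walk
begin

lemma ln_power_le: "real s * ln (real CARD('p)) \<le> ln (1 + real CARD('p) ^ s)"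
proof -
  have "real s * ln (real CARD('p)) = ln (real CARD('p) ^ s)" by (simp add: ln_realpow)
  also have "\<dots> \<le> ln (1 + real CARD('p) ^ s)" using p_gt_1 by (subst ln_le_cancel_iff) (auto intro: add_pos_pos)
  finally show ?thesis .
qed

lemma fourier_measure_bound:
  fixes \<xi> :: "'p padic"
  assumes "1 \<le> padic_abs \<xi>"
  shows "cmod (fourier_measure \<mu> \<xi>) \<le> approx_const CARD('p) * padic_abs \<xi> powr (- 1 / \<tau>) * (ln (1 + padic_abs \<xi>))\<^sup>2"
proof -
  obtain s where s: "padic_abs \<xi> = real CARD('p) ^ s" using padic_abs_ge_1_cases[OF assms] .
  show ?thesis
  proof (cases "s = 0")
    case True
    have "1 / (ln 2)\<^sup>2 \<le> real CARD('p) / (ln 2)\<^sup>2" using p_gt_1 by (intro divide_right_mono) auto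
    also have "\<dots> \<le> approx_const CARD('p)" by (rule approx_const_ge[OF p_gt_1])
    finally have "1 \<le> approx_const CARD('p) * (ln 2)\<^sup>2" by (simp add: divide_le_eq)
    then show ?thesis
      using norm_fourier_measure_le_1[OF W.borel_prob_walk_measure, of \<xi>] True by (simp add: s)
  next
    case False
    define L where "L = ln (1 + real CARD('p) ^ s)"
    have "real s \<le> L / ln (real CARD('p))"
      using ln_power_le[of s] ln_p_pos by (simp add: L_def le_divide_eq)
    then have "(real s)\<^sup>2 \<le> (L / ln (real CARD('p)))\<^sup>2" by (rule power_mono) simp
    then have "43200 * real CARD('p) * ln (real CARD('p)) * (real s)\<^sup>2 \<le> 43200 * real CARD('p) * ln (real CARD('p)) * (L / ln (real CARD('p)))\<^sup>2"
      using ln_p_pos by (intro mult_left_mono) auto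
    also have "\<dots> = 43200 * real CARD('p) / ln (real CARD('p)) * L\<^sup>2"
      using ln_p_pos by (simp add: power2_eq_square)
    also have "\<dots> \<le> approx_const CARD('p) * L\<^sup>2"
      by (intro mult_right_mono approx_const_ge[OF p_gt_1]) auto
    finally have *: "43200 * real CARD('p) * ln (real CARD('p)) * (real s)\<^sup>2 \<le> approx_const CARD('p) * L\<^sup>2" .
    have "cmod (fourier_measure \<mu> \<xi>) \<le> 43200 * real CARD('p) * ln (real CARD('p)) * (real s)\<^sup>2 * real CARD('p) powr (- real s / \<tau>)"
      using False by (intro fourier_measure_decay[OF s]) simp
    also have "\<dots> \<le> approx_const CARD('p) * L\<^sup>2 * real CARD('p) powr (- real s / \<tau>)"
      by (intro mult_right_mono *) auto
    also have "real CARD('p) powr (- real s / \<tau>) = (real CARD('p) ^ s) powr (- 1 / \<tau>)"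
      using p_gt_1 by (simp add: powr_powr flip: powr_realpow)
    finally show ?thesis by (simp add: s L_def mult_ac)
  qed
qed

lemma measure_disjoint_unit:
  fixes x :: "'p padic"
  assumes "1 < padic_abs x" "r \<le> 1"
  shows "measure \<mu> (cball x r) = 0"
proof -
  interpret M: prob_space \<mu> by (rule prob_space_mu)
  have sets: "sets \<mu> = sets borel" using W.borel_prob_walk_measure by (simp add: borel_prob_def)
  have "cball x r \<inter> cball 0 1 = {}"
  proof (rule ccontr)
    assume "cball x r \<inter> cball 0 1 \<noteq> {}"
    then obtain y where "padic_abs (x - y) \<le> r" "padic_abs y \<le> 1" by (auto simp: cball_padic)
    then show False using padic_abs_ultra[of "x - y" y] assms by simp
  qed
  then have "measure \<mu> (cball x r \<union> cball 0 1) = measure \<mu> (cball x r) + measure \<mu> (cball 0 1)"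
    by (intro M.finite_measure_Union) (auto simp: sets)
  then show ?thesis
    using W.measure_walk_measure_unit M.prob_le_1[of "cball x r \<union> cball 0 1"] measure_nonneg[of \<mu> "cball x r"] by linarith
qed

lemma measure_cball_bound:
  fixes x :: "'p padic"
  assumes r: "0 < r" "r \<le> 1"
  shows "measure \<mu> (cball x r) \<le> approx_const CARD('p) * r powr (2 / \<tau>) * (ln (1 + 1 / r))\<^sup>2"
proof -
  interpret M: prob_space \<mu> by (rule prob_space_mu)
  have sets: "sets \<mu> = sets borel" using W.borel_prob_walk_measure by (simp add: borel_prob_def)
  have c0: "0 \<le> approx_const CARD('p)"
    by (rule order_trans[OF _ approx_const_ge(1)[OF p_gt_1]]) simp
  have "\<exists>l. (1 / real CARD('p)) ^ Suc l < r"
  proof -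
    obtain l where "(1 / real CARD('p)) ^ l < r" using real_arch_pow_inv[OF r(1), of "1 / real CARD('p)"] p_gt_1 by auto
    moreover have "(1 / real CARD('p)) ^ Suc l \<le> (1 / real CARD('p)) ^ l" using p_gt_1 by (intro power_decreasing) auto
    ultimately show ?thesis by (intro exI[of _ l]) linarith
  qed
  \<comment> \<open>The discrete scale of r: p^(-(l + 1)) < r \<le> p^(-l). The value l = 0 is
    treated apart because a bound with the factor l^2 would be empty there.\<close>
  define l where "l = (LEAST l. (1 / real CARD('p)) ^ Suc l < r)"
  have l1: "(1 / real CARD('p)) ^ Suc l < r" unfolding l_def by (rule LeastI_ex) fact
  have l2: "r \<le> (1 / real CARD('p)) ^ l"
  proof (cases l)
    case (Suc l')
    then have "\<not> (1 / real CARD('p)) ^ Suc l' < r"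
      using not_less_Least[of l' "\<lambda>l. (1 / real CARD('p)) ^ Suc l < r"] by (simp only: l_def) simp
    then show ?thesis by (simp only: Suc not_less)
  qed (use r in simp)
  \<comment> \<open>Passing from r to p^(-l) costs p^(2/\<tau>), at most p since \<tau> > 2.\<close>
  have rp: "real CARD('p) powr (- 2 * real l / \<tau>) / real CARD('p) \<le> r powr (2 / \<tau>)"
  proof -
    have "real CARD('p) powr (- 2 * real l / \<tau>) / real CARD('p) = real CARD('p) powr (- 2 * real l / \<tau> - 1)"
      using p_gt_1 by (simp add: powr_diff)
    also have "\<dots> \<le> real CARD('p) powr (- real (Suc l) * (2 / \<tau>))"
      using p_gt_1 tau by (intro powr_mono) (auto simp: field_simps)
    also have "\<dots> = ((1 / real CARD('p)) ^ Suc l) powr (2 / \<tau>)"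
    proof -
      have "(1 / real CARD('p)) ^ Suc l = real CARD('p) powr (- real (Suc l))"
        using p_gt_1 by (simp only: powr_minus_divide powr_realpow power_one_over)
      then show ?thesis by (simp only: powr_powr)
    qed
    also have "\<dots> \<le> r powr (2 / \<tau>)"
      using l1 tau p_gt_1 by (intro powr_mono2) auto
    finally show ?thesis .
  qed
  have ln: "real l * ln (real CARD('p)) \<le> ln (1 + 1 / r)"
  proof -
    have "real CARD('p) ^ l \<le> 1 / r" using l2 r p_gt_1 by (simp add: field_simps power_divide)
    then have "ln (1 + real CARD('p) ^ l) \<le> ln (1 + 1 / r)"
      using p_gt_1 r by (subst ln_le_cancel_iff) (auto intro: add_pos_pos)
    then show ?thesis using ln_power_le[of l] by linarith
  qed
  show ?thesis
  proof (cases "padic_abs x \<le> 1")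
    case False
    then show ?thesis using measure_disjoint_unit[of x r] r c0 by simp
  next
    case True
    show ?thesis
    proof (cases "l = 0")
      case True
      have "ln 2 \<le> ln (1 + 1 / r)" using r by (subst ln_le_cancel_iff) (auto simp: add_pos_pos)
      then have "(ln 2)\<^sup>2 \<le> (ln (1 + 1 / r))\<^sup>2" by (intro power_mono) auto
      moreover have "1 / real CARD('p) \<le> r powr (2 / \<tau>)" using rp True p_gt_1 by simp
      ultimately have "real CARD('p) / (ln 2)\<^sup>2 * (1 / real CARD('p)) * (ln 2)\<^sup>2 \<le> approx_const CARD('p) * r powr (2 / \<tau>) * (ln (1 + 1 / r))\<^sup>2"
        using approx_const_ge(1)[OF p_gt_1] c0 by (intro mult_mono) auto
      then have "1 \<le> approx_const CARD('p) * r powr (2 / \<tau>) * (ln (1 + 1 / r))\<^sup>2"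
        using p_gt_1 by simp
      then show ?thesis using measure_mu_le_1[of "cball x r"] by linarith
    next
      case False
      define L where "L = ln (1 + 1 / r)"
      have "real l \<le> L / ln (real CARD('p))" using ln ln_p_pos by (simp add: L_def le_divide_eq)
      then have l_sq: "(real l)\<^sup>2 \<le> (L / ln (real CARD('p)))\<^sup>2" by (rule power_mono) simp
      have "measure \<mu> (cball x r) \<le> measure \<mu> (cball x ((1 / real CARD('p)) ^ l))"
        using l2 by (intro M.finite_measure_mono) (auto simp: sets)
      also have "\<dots> \<le> ball_const * (real l)\<^sup>2 * real CARD('p) powr (- 2 * real l / \<tau>)"
        using True False by (intro measure_cball_power_le) auto
      also have "\<dots> \<le> ball_const * (L / ln (real CARD('p)))\<^sup>2 * (real CARD('p) * r powr (2 / \<tau>))"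
        using rp l_sq ball_const_ge_1 p_gt_1
        by (intro mult_mono) (auto simp: divide_le_eq mult.commute)
      also have "\<dots> = real CARD('p) * ball_const / (ln (real CARD('p)))\<^sup>2 * (r powr (2 / \<tau>) * L\<^sup>2)"
        by (simp add: power_divide)
      also have "\<dots> \<le> approx_const CARD('p) * (r powr (2 / \<tau>) * L\<^sup>2)"
        unfolding ball_const_def by (intro mult_right_mono approx_const_ge[OF p_gt_1]) auto
      finally show ?thesis by (simp add: L_def mult_ac)
    qed
  qed
qed

text \<open>A small ball around a point of the support has positive mass, so it contains a residue
  that the walk can reach, and the last draw of that path is a good fraction r/q with q > r. This
  argument covers every point of the support, not almost every one. Distinct pairs arise infinitely
  often because the denominators exceed 2 T n, which tends to infinity.\<close>

lemma closed_support_mu: "closed_support \<mu> \<subseteq> well_approximable \<tau>"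
proof
  fix x :: "'p padic" assume x: "x \<in> closed_support \<mu>"
  have pos: "0 < measure \<mu> (cball x r)" if "0 < r" for r
  proof -
    interpret M: prob_space \<mu> by (rule prob_space_mu)
    have "0 < emeasure \<mu> (cball x r)"
      using x open_cball_padic[OF that, of x] that by (auto simp: closed_support_def)
    then show ?thesis by (simp add: M.emeasure_eq_measure)
  qed
  have x1: "padic_abs x \<le> 1"
  proof (rule ccontr)
    assume "\<not> padic_abs x \<le> 1"
    then show False using pos[of 1] measure_disjoint_unit[of x 1] by simp
  qed
  define S where "S = {(q :: int, r :: int).
      padic_abs (x * of_int q - of_int r) \<le> real_of_int (max \<bar>q\<bar> \<bar>r\<bar>) powr (- \<tau>)}"
  have "\<exists>(q, r)\<in>S. int (2 * T n) < q" for n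
  proof -
    let ?e = "(1 / real CARD('p)) ^ m (Suc n)"
    have "0 < measure (W.law (Suc n)) {b. padic_abs (of_nat b - x) \<le> ?e}"
      using pos[of ?e] p_gt_1 W.measure_walk_measure_cball[of "m (Suc n)" "Suc n" x] by simp
    then have "set_pmf (W.law (Suc n)) \<inter> {b. padic_abs (of_nat b - x) \<le> ?e} \<noteq> {}"
      using measure_Int_set_pmf[of "W.law (Suc n)" "{b. padic_abs (of_nat b - x) \<le> ?e}"]
      by (auto simp: Int_commute)
    then obtain b where b: "b \<in> set_pmf (W.law (Suc n))" "padic_abs (of_nat b - x) \<le> ?e" by blast
    then obtain a u where "b = step n a u" "u \<in> set_pmf (U n)" by auto
    then obtain q h h' where q: "b = step n a (q, h, h')" "q \<in> Q n" "h < R n" "h' < R n" by auto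
    define r where "r = num n a (q, h, h')"
    note q1 = Q_abs[OF q(2)]
    have q0: "of_nat q \<noteq> (0 :: 'p padic)" using q1 by (metis padic_abs_zero zero_neq_one)
    have "padic_abs (of_nat r / of_nat q - x) \<le> ?e"
      using padic_abs_ultra_diff[of "of_nat b - x" "of_nat b - of_nat r / of_nat q"] b(2)
        step_close(1)[OF Q_not_dvd[OF q(2)], of n a "(h, h')"] unfolding q(1) r_def
      by (simp del: padic_abs_prime_power)
    moreover have "x * of_int (int q) - of_int (int r) = - ((of_nat r / of_nat q - x) * of_nat q)"
      using q0 by (simp add: field_simps)
    ultimately have "padic_abs (x * of_int (int q) - of_int (int r)) \<le> ?e"
      by (simp only: padic_abs_minus padic_abs_mult q1 mult_1_right)
    also have "?e = 1 / real CARD('p) ^ m (Suc n)" by (simp add: power_divide)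
    also have "\<dots> \<le> 1 / (6 * real (T n)) powr \<tau>"
      using p_gt_1 by (intro divide_left_mono m_bounds) auto
    also have "\<dots> = (6 * real (T n)) powr (- \<tau>)" by (simp add: powr_minus_divide)
    also have "\<dots> \<le> real q powr (- \<tau>)"
      using Q_prime[OF q(2)] tau by (intro powr_mono2') auto
    also have "real q = real_of_int (max \<bar>int q\<bar> \<bar>int r\<bar>)"
      using num_less[OF q(3,4), of a q] Q_prime(2)[OF q(2)] by (simp add: r_def)
    finally have "(int q, int r) \<in> S" by (simp add: S_def)
    then show ?thesis using Q_prime(2)[OF q(2)] by force
  qed
  then have "\<exists>s\<in>S. int n < fst s" for n
  proof -
    have "n < CARD('p) ^ n" using p_gt_1 by (simp add: power_gt_expt)
    also have "\<dots> \<le> T n"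
      unfolding T_def using strict_mono_imp_increasing[OF m_mono, of n] m_less_k[of n] p_gt_1
      by (intro power_increasing) auto
    finally have "int n < int (2 * T n)" by simp
    then show ?thesis using \<open>\<exists>(q, r)\<in>S. int (2 * T n) < q\<close> by force
  qed
  moreover have "\<not> (\<forall>n. \<exists>s\<in>S. int n < fst s)" if "finite S"
  proof -
    have "fst s \<le> int (nat (Max (fst ` S)))" if "s \<in> S" for s
    proof -
      have "fst s \<le> Max (fst ` S)" using \<open>finite S\<close> that by (intro Max_ge) auto
      then show ?thesis by linarith
    qed
    then show ?thesis by (meson not_less)
  qed
  ultimately have "infinite S" by blast
  then show "x \<in> well_approximable \<tau>" using x1 by (simp add: well_approximable_def S_def)
qed

end

theorem salem_measure_exists:
  assumes \<tau>: "2 < \<tau>"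
  shows "\<exists>\<mu> :: 'p::prime_card padic measure. borel_prob \<mu> \<and> closed_support \<mu> \<subseteq> well_approximable \<tau> \<and>
    (\<forall>\<xi>. 1 \<le> padic_abs \<xi> \<longrightarrow> cmod (fourier_measure \<mu> \<xi>)
      \<le> approx_const CARD('p) * padic_abs \<xi> powr (- 1 / \<tau>) * (ln (1 + padic_abs \<xi>))\<^sup>2) \<and>
    (\<forall>x r. 0 < r \<and> r \<le> 1 \<longrightarrow>
      measure \<mu> (cball x r) \<le> approx_const CARD('p) * r powr (2 / \<tau>) * (ln (1 + 1 / r))\<^sup>2)"
proof -
  let ?p = "CARD('p)"
  have p: "1 < ?p" by (rule CARD_gt_1)
  obtain T0 where T0: "\<And>T. T \<ge> T0 \<Longrightarrow>
      real T / (2 * ln (real T)) \<le> real (card {q. prime q \<and> 2 * T < q \<and> q \<le> 6 * T})"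
    using primes_in_range_lower by blast
  \<comment> \<open>T0 ensures enough primes and p^(2M) the gap. F rounds up the exponent y with p^y
    = (6 p^kk)^\<tau>, which is the origin of the factor p in \<open>m_le\<close>.\<close>
  define kk where "kk M = max T0 (?p ^ (2 * M))" for M
  define F where "F M = nat \<lceil>\<tau> * log (real ?p) (6 * real ?p ^ kk M)\<rceil>" for M
  define m where "m n = (F ^^ n) 0" for n
  have m: "m 0 = 0" "m (Suc n) = F (m n)" for n by (simp_all add: m_def)
  interpret approx_walk "TYPE('p)" \<tau> m "\<lambda>n. kk (m n)"
  proof
    show "2 < \<tau>" "m 0 = 0" by fact+
  next
    fix n show "?p ^ (2 * m n) \<le> kk (m n)" by (simp add: kk_def)
  next
    fix n
    have "T0 \<le> kk (m n)" by (simp add: kk_def)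
    also have "\<dots> < ?p ^ kk (m n)" using p by (simp add: power_gt_expt)
    finally have "T0 \<le> ?p ^ kk (m n)" by simp
    then show "real (?p ^ kk (m n)) / (2 * ln (real (?p ^ kk (m n))))
      \<le> real (card {q. prime q \<and> 2 * ?p ^ kk (m n) < q \<and> q \<le> 6 * ?p ^ kk (m n)})"
      by (rule T0)
  next
    fix n
    define X where "X = 6 * real ?p ^ kk (m n)"
    define y where "y = \<tau> * log (real ?p) X"
    have X: "1 \<le> X" using p by (auto simp: X_def intro!: order_trans[OF _ mult_mono[of 1 6 1]])
    then have y: "0 \<le> y" using \<tau> p by (simp add: y_def zero_le_log_cancel_iff)
    have mn: "m (Suc n) = nat \<lceil>y\<rceil>" by (simp add: m F_def y_def X_def)
    have Xy: "X powr \<tau> = real ?p powr y"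
      using X p by (simp add: y_def powr_def log_def)
    have pm: "real ?p ^ m (Suc n) = real ?p powr real (m (Suc n))" using p by (simp add: powr_realpow)
    have "y \<le> real (m (Suc n))" unfolding mn by linarith
    then show "(6 * real ?p ^ kk (m n)) powr \<tau> \<le> real ?p ^ m (Suc n)"
      unfolding X_def[symmetric] Xy pm using p by (intro powr_mono) auto
    have "real (m (Suc n)) \<le> 1 + y" unfolding mn using y by linarith
    then have "real ?p powr real (m (Suc n)) \<le> real ?p powr (1 + y)" using p by (intro powr_mono) auto
    also have "\<dots> = real ?p * real ?p powr y" using p by (simp add: powr_add)
    finally show "real ?p ^ m (Suc n) \<le> real ?p * (6 * real ?p ^ kk (m n)) powr \<tau>"
      unfolding X_def[symmetric] Xy pm .
  qed
  show ?thesis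
    using W.borel_prob_walk_measure closed_support_mu fourier_measure_bound measure_cball_bound by blast
qed

section \<open>Haar measure\<close>

lemma cball_padic_nested:
  fixes x y :: "'p::prime_card padic"
  assumes "r \<le> s" "cball x r \<inter> cball y s \<noteq> {}"
  shows "cball x r \<subseteq> cball y s"
proof -
  obtain z where z: "z \<in> cball x r" "z \<in> cball y s" using assms(2) by blast
  then have "cball x r = cball z r" "cball y s = cball z s"
    using cball_padic_eq[of x z r] cball_padic_eq[of y z s] by (auto simp: cball_padic)
  then show ?thesis using assms(1) by auto
qed

text \<open>Balls are nested or disjoint, so adding the empty set makes the family closed under
  intersection; a measure finite on unit balls is then determined by its values here.\<close>

definition unit_balls :: "'p::prime_card padic set set"
  where "unit_balls = insert {} (range (\<lambda>(x, n). cball x ((1 / real CARD('p)) ^ n)))"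

lemma Int_stable_unit_balls: "Int_stable (unit_balls :: 'p::prime_card padic set set)"
proof (rule Int_stableI)
  fix A B :: "'p padic set" assume A: "A \<in> unit_balls" and B: "B \<in> unit_balls"
  show "A \<inter> B \<in> unit_balls"
  proof (cases "A \<inter> B = {}")
    case True
    then show ?thesis by (simp add: unit_balls_def)
  next
    case False
    obtain x n where A': "A = cball x ((1 / real CARD('p)) ^ n)" using A False by (auto simp: unit_balls_def)
    obtain y k where B': "B = cball y ((1 / real CARD('p)) ^ k)" using B False by (auto simp: unit_balls_def)
    have "A \<subseteq> B \<or> B \<subseteq> A"
      using False cball_padic_nested[of "(1 / real CARD('p)) ^ n" "(1 / real CARD('p)) ^ k" x y]
        cball_padic_nested[of "(1 / real CARD('p)) ^ k" "(1 / real CARD('p)) ^ n" y x]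
      unfolding A' B' by (metis Int_commute linear)
    then have "A \<inter> B = A \<or> A \<inter> B = B" by blast
    then show ?thesis using A B by auto
  qed
qed

lemma open_Union_unit_balls:
  fixes S :: "'p::prime_card padic set"
  assumes "open S"
  shows "S = (\<Union>(r, n)\<in>{(r, n). cball (of_rat r) ((1 / real CARD('p)) ^ n) \<subseteq> S}. cball (of_rat r) ((1 / real CARD('p)) ^ n))"
proof (intro equalityI subsetI)
  fix x assume "x \<in> S"
  then obtain e where e: "0 < e" "cball x e \<subseteq> S" using assms by (meson open_contains_cball)
  obtain n where n: "(1 / real CARD('p)) ^ n < e"
    using real_arch_pow_inv[OF e(1), of "1 / real CARD('p)"] CARD_gt_1[where 'p = 'p] by auto
  obtain r where "padic_abs (x - of_rat r) < (1 / real CARD('p)) ^ n"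
    using padic_of_rat_dense[of "(1 / real CARD('p)) ^ n" x] by auto
  then have eq: "cball x ((1 / real CARD('p)) ^ n) = cball (of_rat r) ((1 / real CARD('p)) ^ n)"
    by (intro cball_padic_eq) simp
  then have "cball (of_rat r) ((1 / real CARD('p)) ^ n) \<subseteq> S" using e(2) n by (auto simp flip: eq)
  moreover have "x \<in> cball (of_rat r) ((1 / real CARD('p)) ^ n)" unfolding eq[symmetric] by simp
  ultimately show "x \<in> (\<Union>(r, n)\<in>{(r, n). cball (of_rat r) ((1 / real CARD('p)) ^ n) \<subseteq> S}. cball (of_rat r) ((1 / real CARD('p)) ^ n))"
    by blast
qed auto

lemma sets_borel_padic: "sets (borel :: 'p::prime_card padic measure) = sigma_sets UNIV unit_balls"
proof -
  have "sets (borel :: 'p padic measure) = sigma_sets UNIV {S. open S}" by (simp add: borel_def)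
  also have "\<dots> = sigma_sets UNIV unit_balls"
  proof (rule sigma_sets_eqI)
    fix S :: "'p padic set" assume "S \<in> {S. open S}"
    then have S: "open S" by simp
    have "cball (of_rat r) ((1 / real CARD('p)) ^ n) \<in> sigma_sets UNIV (unit_balls :: 'p padic set set)" for r n
      by (rule sigma_sets.Basic) (auto simp: unit_balls_def)
    then have "(\<Union>(r, n)\<in>{(r, n). cball (of_rat r) ((1 / real CARD('p)) ^ n) \<subseteq> S}. cball (of_rat r) ((1 / real CARD('p)) ^ n))
        \<in> sigma_sets UNIV (unit_balls :: 'p padic set set)"
      by (intro sigma_sets_UNION) auto
    then show "S \<in> sigma_sets UNIV unit_balls" using open_Union_unit_balls[OF S] by (simp only:)
  next
    fix S :: "'p padic set" assume "S \<in> unit_balls"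
    then have "open S" by (auto simp: unit_balls_def intro!: open_cball_padic)
    then show "S \<in> sigma_sets UNIV {S. open S}" by (intro sigma_sets.Basic) simp
  qed
  finally show ?thesis .
qed

lemma UN_unit_cball: "(\<Union>n. cball (of_rat (from_nat n)) 1) = (UNIV :: 'p::prime_card padic set)"
proof (intro equalityI subsetI UNIV_I)
  fix x :: "'p padic"
  obtain r where "padic_abs (x - of_rat r) < 1" using padic_of_rat_dense[of 1 x] by auto
  then have "x \<in> cball (of_rat (from_nat (to_nat r))) 1" by (simp add: cball_padic padic_abs_minus_commute)
  then show "x \<in> (\<Union>n. cball (of_rat (from_nat n)) 1)" by blast
qed

lemma measure_eqI_unit_balls:
  fixes M N :: "'p::prime_card padic measure"
  assumes "sets M = sets borel" "sets N = sets borel"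
    and eq: "\<And>x n. emeasure M (cball x ((1 / real CARD('p)) ^ n)) = emeasure N (cball x ((1 / real CARD('p)) ^ n))"
    and fin: "\<And>x. emeasure M (cball x 1) \<noteq> \<infinity>"
  shows "M = N"
proof (rule measure_eqI_generator_eq[OF Int_stable_unit_balls, where \<Omega> = UNIV and A = "\<lambda>n. cball (of_rat (from_nat n)) 1"])
  show "range (\<lambda>n. cball (of_rat (from_nat n)) 1) \<subseteq> (unit_balls :: 'p padic set set)"
  proof
    fix A :: "'p padic set" assume "A \<in> range (\<lambda>n. cball (of_rat (from_nat n)) 1)"
    then obtain n where "A = cball (of_rat (from_nat n)) ((1 / real CARD('p)) ^ 0)" by auto
    then show "A \<in> unit_balls" unfolding unit_balls_def by blast
  qed
  show "emeasure M X = emeasure N X" if "X \<in> unit_balls" for X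
    using that eq by (auto simp: unit_balls_def)
  show "sets M = sigma_sets UNIV unit_balls" "sets N = sigma_sets UNIV unit_balls"
    using assms(1,2) sets_borel_padic by (simp_all only:)
qed (simp_all only: UN_unit_cball fin subset_UNIV Pow_UNIV not_False_eq_True)

section \<open>Construction of Haar measure, first on the unit ball\<close>

definition digit_step :: "'p::prime_card itself \<Rightarrow> nat \<Rightarrow> nat \<Rightarrow> nat \<Rightarrow> nat"
  where "digit_step P n a u = a + CARD('p) ^ n * (u mod CARD('p))"

definition unit_haar :: "'p::prime_card padic measure"
  where "unit_haar = walk_measure (\<lambda>n. pmf_of_set {..<CARD('p)}) (digit_step TYPE('p))"

lemma padic_walk_digit: "padic_walk TYPE('p::prime_card) (\<lambda>n. n) (digit_step TYPE('p))"
proof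
  fix a n u assume a: "a < CARD('p) ^ n"
  \<comment> \<open>Reducing u modulo p inside the step gives a legitimate digit for every natural
    u, although only digits are ever drawn.\<close>
  have "u mod CARD('p) \<le> CARD('p) - 1" using CARD_gt_1[where 'p = 'p] by (simp add: Suc_leI less_Suc_eq_le[symmetric])
  then have "CARD('p) ^ n * (u mod CARD('p)) \<le> CARD('p) ^ n * (CARD('p) - 1)" by simp
  also have "\<dots> + CARD('p) ^ n = CARD('p) ^ Suc n" by (simp add: diff_mult_distrib2)
  finally show "digit_step TYPE('p) n a u < CARD('p) ^ Suc n"
    using a unfolding digit_step_def by linarith
  show "digit_step TYPE('p) n a u mod CARD('p) ^ n = a" using a by (simp add: digit_step_def)
qed (auto simp: strict_mono_def)

text \<open>A residue modulo p^n prescribes n independent uniform digits, so each such residue has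
  probability p^(-n).\<close>

lemma measure_unit_haar:
  fixes y :: "'p::prime_card padic"
  assumes y: "padic_abs y \<le> 1"
  shows "measure unit_haar (cball y ((1 / real CARD('p)) ^ n)) = (1 / real CARD('p)) ^ n"
proof -
  interpret W: padic_walk "TYPE('p)" "\<lambda>n. n" "\<lambda>n. pmf_of_set {..<CARD('p)}" "digit_step TYPE('p)"
    by (rule padic_walk_digit)
  have pmf: "pmf (W.law n) b = (1 / real CARD('p)) ^ n" if "b < CARD('p) ^ n" for n b
    using that
  proof (induction n arbitrary: b)
    case (Suc n)
    let ?a = "b mod CARD('p) ^ n"
    have "measure (pmf_of_set {..<CARD('p)}) {u. digit_step TYPE('p) n ?a u = b}
        = real (card ({..<CARD('p)} \<inter> {u. digit_step TYPE('p) n ?a u = b})) / real CARD('p)"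
      by (subst measure_pmf_of_set) (auto simp: lessThan_empty_iff)
    also have "{..<CARD('p)} \<inter> {u. digit_step TYPE('p) n ?a u = b} = {b div CARD('p) ^ n}"
    proof -
      have "b div CARD('p) ^ n < CARD('p)" using Suc.prems by (simp add: less_mult_imp_div_less)
      moreover have "?a + CARD('p) ^ n * u = b \<longleftrightarrow> u = b div CARD('p) ^ n" for u
      proof
        assume "?a + CARD('p) ^ n * u = b"
        then have "b div CARD('p) ^ n = (?a + CARD('p) ^ n * u) div CARD('p) ^ n" by (rule arg_cong[OF sym])
        then show "u = b div CARD('p) ^ n" by simp
      next
        assume "u = b div CARD('p) ^ n"
        then show "?a + CARD('p) ^ n * u = b" by (simp only: mod_mult_div_eq)
      qed
      ultimately have lt: "b div CARD('p) ^ n < CARD('p)"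
        and iff: "\<And>u. ?a + CARD('p) ^ n * u = b \<longleftrightarrow> u = b div CARD('p) ^ n" by blast+
      have "u < CARD('p) \<and> ?a + CARD('p) ^ n * (u mod CARD('p)) = b \<longleftrightarrow> u = b div CARD('p) ^ n" for u
        using lt iff[of "u mod CARD('p)"] by (cases "u < CARD('p)") (simp_all only: mod_less, simp_all)
      then show ?thesis
        unfolding digit_step_def by (intro set_eqI) (simp only: Int_iff lessThan_iff mem_Collect_eq singleton_iff)
    qed
    finally show ?case
      using Suc by (simp add: W.pmf_law_Suc del: walk_pmf.simps)
  qed simp
  define b where "b = residue n y"
  note r = residue[OF y, of n, folded b_def]
  have "measure unit_haar (cball y ((1 / real CARD('p)) ^ n))
      = measure (W.law n) {a. padic_abs (of_nat a - y) \<le> (1 / real CARD('p)) ^ n}"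
    unfolding unit_haar_def by (rule W.measure_walk_measure_cball) simp
  also have "\<dots> = measure (W.law n) {b}"
  proof (rule measure_pmf.finite_measure_eq_AE)
    show "AE a in W.law n. (a \<in> {a. padic_abs (of_nat a - y) \<le> (1 / real CARD('p)) ^ n}) = (a \<in> {b})"
    proof (rule AE_pmfI)
      fix a assume "a \<in> set_pmf (W.law n)"
      then have "a < CARD('p) ^ n" by (rule W.law_less)
      then show "(a \<in> {a. padic_abs (of_nat a - y) \<le> (1 / real CARD('p)) ^ n}) = (a \<in> {b})"
        using residue_eq_iff[OF y, of a n] by (auto simp: b_def padic_abs_minus_commute)
    qed
  qed auto
  also have "\<dots> = (1 / real CARD('p)) ^ n" using pmf[OF r(1)] by (simp add: pmf.rep_eq)
  finally show ?thesis .
qed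

lemma unit_haar_space:
  shows "prob_space (unit_haar :: 'p::prime_card padic measure)" and "sets (unit_haar :: 'p padic measure) = sets borel"
proof -
  interpret W: padic_walk "TYPE('p)" "\<lambda>n. n" "\<lambda>n. pmf_of_set {..<CARD('p)}" "digit_step TYPE('p)"
    by (rule padic_walk_digit)
  show "prob_space (unit_haar :: 'p padic measure)" "sets (unit_haar :: 'p padic measure) = sets borel"
    using W.borel_prob_walk_measure by (auto simp: borel_prob_def unit_haar_def)
qed

lemma measure_unit_haar_outside:
  fixes y :: "'p::prime_card padic"
  assumes "1 < padic_abs y"
  shows "measure unit_haar (cball y ((1 / real CARD('p)) ^ n)) = 0"
proof -
  interpret M: prob_space "unit_haar :: 'p padic measure" by (rule unit_haar_space)
  let ?B = "cball y ((1 / real CARD('p)) ^ n)"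
  have le: "(1 / real CARD('p)) ^ n \<le> 1" by (intro power_le_one) auto
  have "?B \<inter> cball 0 1 = {}"
  proof (rule ccontr)
    assume "?B \<inter> cball 0 1 \<noteq> {}"
    then obtain z where "padic_abs (y - z) \<le> (1 / real CARD('p)) ^ n" "padic_abs z \<le> 1" by (auto simp: cball_padic)
    then show False using padic_abs_ultra[of "y - z" z] assms le by simp
  qed
  then have "measure unit_haar (?B \<union> cball 0 1) = measure unit_haar ?B + measure unit_haar (cball 0 1 :: 'p padic set)"
    by (intro M.finite_measure_Union) (auto simp: unit_haar_space)
  then show ?thesis
    using measure_unit_haar[of "0 :: 'p padic" 0] M.prob_le_1[of "?B \<union> cball 0 1"] measure_nonneg[of unit_haar ?B]
    by simp
qed

text \<open>Q_p/Z_p is countable. The representative is the first rational of the coset in a fixed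
  enumeration, so it depends on the coset only.\<close>

definition coset_rep :: "'p::prime_card padic \<Rightarrow> 'p padic"
  where "coset_rep x = of_rat (from_nat (LEAST n. padic_abs (x - of_rat (from_nat n)) \<le> 1))"

lemma coset_rep_close: "padic_abs (x - coset_rep x) \<le> 1" for x :: "'p::prime_card padic"
proof -
  obtain r where "padic_abs (x - of_rat r) < 1" using padic_of_rat_dense[of 1 x] by auto
  then have "padic_abs (x - of_rat (from_nat (to_nat r))) \<le> 1" by simp
  then show ?thesis unfolding coset_rep_def by (rule LeastI)
qed

lemma coset_rep_cong:
  fixes x y :: "'p::prime_card padic"
  assumes "padic_abs (x - y) \<le> 1"
  shows "coset_rep x = coset_rep y"
proof -
  have "padic_abs (x - z) \<le> 1 \<longleftrightarrow> padic_abs (y - z) \<le> 1" for z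
    using assms padic_abs_ultra[of "x - y" "y - z"] padic_abs_ultra_diff[of "x - z" "x - y"] by auto
  then show ?thesis unfolding coset_rep_def by presburger
qed

lemma countable_range_coset_rep: "countable (range (coset_rep :: 'p::prime_card padic \<Rightarrow> _))"
proof -
  have "range (coset_rep :: 'p padic \<Rightarrow> _) \<subseteq> range of_rat" by (auto simp: coset_rep_def)
  then show ?thesis by (rule countable_subset) simp
qed

text \<open>Q_p is the disjoint union of the countably many translates of Z_p; each translate
  receives a copy of \<open>unit_haar\<close>.\<close>

definition coset_haar :: "'p::prime_card padic measure"
  where "coset_haar = distr (count_space (range coset_rep) \<Otimes>\<^sub>M unit_haar) borel (\<lambda>(c, x). c + x)"

lemma emeasure_coset_haar:
  fixes y :: "'p::prime_card padic"
  shows "emeasure coset_haar (cball y ((1 / real CARD('p)) ^ n)) = ennreal ((1 / real CARD('p)) ^ n)"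
proof -
  interpret M: prob_space "unit_haar :: 'p padic measure" by (rule unit_haar_space)
  let ?C = "range coset_rep :: 'p padic set"
  let ?B = "cball y ((1 / real CARD('p)) ^ n)"
  let ?f = "\<lambda>(c, x). c + x :: 'p padic"
  have le: "(1 / real CARD('p)) ^ n \<le> 1" by (intro power_le_one) auto
  have meas: "?f \<in> borel_measurable (count_space ?C \<Otimes>\<^sub>M unit_haar)"
  proof (rule measurable_pair_measure_countable1[OF countable_range_coset_rep])
    fix c :: "'p padic"
    have "(\<lambda>x. c + x) \<in> borel_measurable borel" by simp
    then show "(\<lambda>x. ?f (c, x)) \<in> borel_measurable unit_haar"
      by (simp add: measurable_cong_sets[OF unit_haar_space(2) refl])
  qed
  have "emeasure coset_haar ?B = emeasure (count_space ?C \<Otimes>\<^sub>M unit_haar) (?f -` ?B \<inter> space (count_space ?C \<Otimes>\<^sub>M unit_haar))"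
    unfolding coset_haar_def by (rule emeasure_distr[OF meas]) simp
  also have "\<dots> = (\<integral>\<^sup>+c. emeasure unit_haar (Pair c -` (?f -` ?B \<inter> space (count_space ?C \<Otimes>\<^sub>M unit_haar))) \<partial>count_space ?C)"
    by (intro M.emeasure_pair_measure_alt measurable_sets[OF meas]) simp
  also have "\<dots> = (\<integral>\<^sup>+c. ennreal ((1 / real CARD('p)) ^ n) * indicator {coset_rep y} c \<partial>count_space ?C)"
  proof (rule nn_integral_cong)
    fix c assume "c \<in> space (count_space ?C)"
    then obtain z where c: "c = coset_rep z" by auto
    have "space (unit_haar :: 'p padic measure) = UNIV"
      using sets_eq_imp_space_eq[OF unit_haar_space(2)] by simp
    then have "Pair c -` (?f -` ?B \<inter> space (count_space ?C \<Otimes>\<^sub>M unit_haar)) = cball (y - c) ((1 / real CARD('p)) ^ n)"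
      by (auto simp: c space_pair_measure cball_padic algebra_simps)
    \<comment> \<open>A ball of radius at most 1 lies in one coset of Z_p, so only the
      representative of y contributes to the sum.\<close>
    moreover have "measure unit_haar (cball (y - c) ((1 / real CARD('p)) ^ n))
        = (1 / real CARD('p)) ^ n * indicator {coset_rep y} c"
    proof (cases "padic_abs (y - c) \<le> 1")
      case True
      then have "coset_rep y = coset_rep z"
        using coset_rep_close[of z] padic_abs_ultra_diff[of "y - c" "z - c"] unfolding c
        by (intro coset_rep_cong) simp
      then show ?thesis using measure_unit_haar[OF True, of n] by (simp add: c)
    next
      case False
      then have "c \<noteq> coset_rep y" using coset_rep_close[of y] by auto
      then show ?thesis using measure_unit_haar_outside[of "y - c" n] False by simp
    qed
    ultimately show "emeasure unit_haar (Pair c -` (?f -` ?B \<inter> space (count_space ?C \<Otimes>\<^sub>M unit_haar)))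
        = ennreal ((1 / real CARD('p)) ^ n) * indicator {coset_rep y} c"
      by (simp add: M.emeasure_eq_measure indicator_def)
  qed
  also have "\<dots> = ennreal ((1 / real CARD('p)) ^ n) * emeasure (count_space ?C) {coset_rep y}"
    by (rule nn_integral_cmult_indicator) simp
  also have "\<dots> = ennreal ((1 / real CARD('p)) ^ n)" by simp
  finally show ?thesis .
qed

lemma emeasure_translate:
  fixes M :: "'p::prime_card padic measure"
  assumes "sets M = sets borel" "A \<in> sets borel"
  shows "emeasure (distr M borel (\<lambda>x. x - a)) A = emeasure M ((\<lambda>x. a + x) ` A)"
    and "(\<lambda>x. a + x) ` A \<in> sets borel"
proof -
  have meas: "(\<lambda>x. x - a) \<in> measurable M borel"
    unfolding measurable_cong_sets[OF assms(1) refl] by simp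
  have eq: "(\<lambda>x. a + x) ` A = (\<lambda>x. x - a) -` A"
    by (auto simp: image_iff) (metis add.commute diff_add_cancel)
  have sp: "space M = UNIV" using sets_eq_imp_space_eq[OF assms(1)] by simp
  show "emeasure (distr M borel (\<lambda>x. x - a)) A = emeasure M ((\<lambda>x. a + x) ` A)"
    unfolding emeasure_distr[OF meas assms(2)] eq sp by simp
  show "(\<lambda>x. a + x) ` A \<in> sets borel"
    unfolding eq using measurable_sets[OF meas assms(2)] by (simp add: sp assms(1))
qed

lemma translate_cball: "(\<lambda>x. a + x) ` cball y r = cball (a + y) r" for a y :: "'p::prime_card padic"
proof (intro equalityI subsetI)
  fix z assume "z \<in> cball (a + y) r"
  then have "z - a \<in> cball y r" by (simp add: cball_padic algebra_simps)
  then show "z \<in> (\<lambda>x. a + x) ` cball y r" by (intro image_eqI[of _ _ "z - a"]) auto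
qed (auto simp: cball_padic)

text \<open>The mass of a ball does not depend on its centre, so a translate of the measure agrees
  with it on all balls and hence everywhere.\<close>

lemma is_normalized_haar_coset_haar: "is_normalized_haar (coset_haar :: 'p::prime_card padic measure)"
  unfolding is_normalized_haar_def
proof (intro conjI allI ballI)
  show sets: "sets (coset_haar :: 'p padic measure) = sets borel" by (simp add: coset_haar_def)
  show "emeasure coset_haar (cball (0 :: 'p padic) 1) = 1"
    using emeasure_coset_haar[of "0 :: 'p padic" 0] by simp
  fix a :: "'p padic" and A :: "'p padic set" assume A: "A \<in> sets borel"
  have "distr coset_haar borel (\<lambda>x. x - a) = coset_haar"
  proof (rule measure_eqI_unit_balls)
    fix y :: "'p padic" and n
    show "emeasure (distr coset_haar borel (\<lambda>x. x - a)) (cball y ((1 / real CARD('p)) ^ n))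
        = emeasure coset_haar (cball y ((1 / real CARD('p)) ^ n))"
      by (subst emeasure_translate(1)[OF sets]) (simp_all add: translate_cball emeasure_coset_haar)
  next
    fix y :: "'p padic"
    show "emeasure (distr coset_haar borel (\<lambda>x. x - a)) (cball y 1) \<noteq> \<infinity>"
      using emeasure_coset_haar[of "a + y" 0]
      by (subst emeasure_translate(1)[OF sets]) (simp_all add: translate_cball)
  qed (simp_all add: sets)
  then show "emeasure coset_haar ((\<lambda>x. a + x) ` A) = emeasure coset_haar A"
    using emeasure_translate(1)[OF sets A, of a] by simp
qed

text \<open>The unit ball is the disjoint union of p^n translates of the ball of radius p^(-n).
  Invariance and normalization therefore force the mass of every such ball, which yields
  uniqueness.\<close>

lemma is_normalized_haar_cball:
  fixes M :: "'p::prime_card padic measure"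
  assumes M: "is_normalized_haar M"
  shows "emeasure M (cball y r) = emeasure M (cball 0 r)"
    and "emeasure M (cball y ((1 / real CARD('p)) ^ n)) = ennreal ((1 / real CARD('p)) ^ n)"
proof -
  have sets: "sets M = sets borel" using M by (simp add: is_normalized_haar_def)
  show tr: "emeasure M (cball y r) = emeasure M (cball 0 r)" for y r
  proof -
    have "emeasure M ((\<lambda>x. y + x) ` cball 0 r) = emeasure M (cball 0 r)"
      using M unfolding is_normalized_haar_def by simp
    then show ?thesis by (simp only: translate_cball add_0_right)
  qed
  let ?r = "(1 / real CARD('p)) ^ n"
  let ?e = "emeasure M (cball 0 ?r)"
  have le: "?r \<le> 1" by (intro power_le_one) auto
  have "cball 0 1 = (\<Union>a<CARD('p) ^ n. cball (of_nat a :: 'p padic) ?r)"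
  proof (intro equalityI subsetI)
    fix x :: "'p padic" assume "x \<in> cball 0 1"
    then have "padic_abs x \<le> 1" by (simp add: cball_padic)
    from residue[OF this, of n] show "x \<in> (\<Union>a<CARD('p) ^ n. cball (of_nat a) ?r)"
      by (auto simp: cball_padic padic_abs_minus_commute intro!: bexI[of _ "residue n x"])
  next
    fix x :: "'p padic" assume "x \<in> (\<Union>a<CARD('p) ^ n. cball (of_nat a) ?r)"
    then obtain a where "padic_abs (x - of_nat a) \<le> ?r" by (auto simp: cball_padic padic_abs_minus_commute)
    then show "x \<in> cball 0 1"
      using padic_abs_ultra[of "x - of_nat a" "of_nat a"] padic_abs_of_nat_le[of a, where 'p = 'p] le
      by (simp add: cball_padic)
  qed
  then have "1 = emeasure M (\<Union>a<CARD('p) ^ n. cball (of_nat a :: 'p padic) ?r)"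
    using M by (simp add: is_normalized_haar_def)
  also have "\<dots> = (\<Sum>a<CARD('p) ^ n. emeasure M (cball (of_nat a :: 'p padic) ?r))"
  proof (rule sum_emeasure[symmetric])
    show "disjoint_family_on (\<lambda>a. cball (of_nat a :: 'p padic) ?r) {..<CARD('p) ^ n}"
      unfolding disjoint_family_on_def
    proof (intro ballI impI, rule ccontr)
      fix a b assume ab: "a \<in> {..<CARD('p) ^ n}" "b \<in> {..<CARD('p) ^ n}" "a \<noteq> b"
        "cball (of_nat a :: 'p padic) ?r \<inter> cball (of_nat b) ?r \<noteq> {}"
      then have "cball (of_nat a :: 'p padic) ?r \<subseteq> cball (of_nat b) ?r" by (intro cball_padic_nested) auto
      moreover have "(of_nat a :: 'p padic) \<in> cball (of_nat a) ?r" by simp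
      ultimately have "(of_nat a :: 'p padic) \<in> cball (of_nat b) ?r" by blast
      then have "padic_abs (of_nat b - of_nat a :: 'p padic) \<le> ?r" by (simp only: cball_padic mem_Collect_eq)
      then show False using ab by (simp add: padic_abs_of_nat_diff_le_iff)
    qed
  qed (auto simp: sets)
  also have "\<dots> = of_nat (CARD('p) ^ n) * ?e" by (subst tr) simp
  finally have 1: "of_nat (CARD('p) ^ n) * ?e = 1" by simp
  have "ennreal ?r * of_nat (CARD('p) ^ n) = 1"
  proof -
    have "?r * real (CARD('p) ^ n) = 1" by (simp add: power_divide)
    then have "ennreal (?r * real (CARD('p) ^ n)) = 1" by (simp only: ennreal_1)
    then show ?thesis by (simp only: ennreal_mult'' of_nat_0_le_iff ennreal_of_nat_eq_real_of_nat)
  qed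
  have "?e = ennreal ?r * of_nat (CARD('p) ^ n) * ?e" unfolding \<open>ennreal ?r * _ = 1\<close> by simp
  also have "\<dots> = ennreal ?r * (of_nat (CARD('p) ^ n) * ?e)" by (rule mult.assoc)
  also have "\<dots> = ennreal ?r" unfolding 1 by simp
  finally have "?e = ennreal ?r" .
  then show "emeasure M (cball y ?r) = ennreal ?r" using tr[of y] by simp
qed

lemma is_normalized_haar_haar: "is_normalized_haar (haar :: 'p::prime_card padic measure)"
  unfolding haar_def
proof (rule theI)
  show "is_normalized_haar (coset_haar :: 'p padic measure)" by (rule is_normalized_haar_coset_haar)
  fix M :: "'p padic measure" assume M: "is_normalized_haar M"
  show "M = coset_haar"
  proof (rule measure_eqI_unit_balls)
    show "sets M = sets borel" "sets (coset_haar :: 'p padic measure) = sets borel"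
      using M is_normalized_haar_coset_haar by (auto simp: is_normalized_haar_def)
    show "emeasure M (cball x 1) \<noteq> \<infinity>" for x
      using is_normalized_haar_cball(2)[OF M, of x 0] by simp
  qed (simp add: is_normalized_haar_cball(2)[OF M] emeasure_coset_haar)
qed

lemma sets_haar [measurable_cong, simp]: "sets (haar :: 'p::prime_card padic measure) = sets borel"
  using is_normalized_haar_haar[where 'p = 'p] by (simp add: is_normalized_haar_def)

lemma space_haar [simp]: "space (haar :: 'p::prime_card padic measure) = UNIV"
  using sets_eq_imp_space_eq[OF sets_haar] by simp

lemma emeasure_haar_unit_cball: "emeasure haar (cball (y :: 'p::prime_card padic) 1) = 1"
  using is_normalized_haar_cball(2)[OF is_normalized_haar_haar, of y 0] by simp

lemma sigma_finite_haar: "sigma_finite_measure (haar :: 'p::prime_card padic measure)"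
proof (rule sigma_finite_measure.intro, intro exI[of _ "range (\<lambda>n. cball (of_rat (from_nat n)) 1)"] conjI)
  show "\<Union>(range (\<lambda>n. cball (of_rat (from_nat n)) 1)) = space (haar :: 'p padic measure)"
    using UN_unit_cball[where 'p = 'p] by simp
qed (auto simp: emeasure_haar_unit_cball)

section \<open>Fourier restriction\<close>

lemma (in pair_sigma_finite)
  fixes g :: "'a \<Rightarrow> complex" and h :: "'b \<Rightarrow> complex"
  assumes g: "integrable M1 g" and h: "integrable M2 h"
  shows integrable_pair_mult: "integrable (M1 \<Otimes>\<^sub>M M2) (\<lambda>w. g (fst w) * h (snd w))"
    and integral_pair_mult: "(\<integral>w. g (fst w) * h (snd w) \<partial>(M1 \<Otimes>\<^sub>M M2)) = (\<integral>x. g x \<partial>M1) * (\<integral>y. h y \<partial>M2)"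
proof -
  have [measurable]: "g \<in> borel_measurable M1" "h \<in> borel_measurable M2" using g h by auto
  show int: "integrable (M1 \<Otimes>\<^sub>M M2) (\<lambda>w. g (fst w) * h (snd w))"
  proof (rule Fubini_integrable)
    show "integrable M1 (\<lambda>x. \<integral>y. norm (g (fst (x, y)) * h (snd (x, y))) \<partial>M2)"
      using g by (simp add: norm_mult)
    show "AE x in M1. integrable M2 (\<lambda>y. g (fst (x, y)) * h (snd (x, y)))"
      using h by simp
  qed measurable
  then have "integrable (M1 \<Otimes>\<^sub>M M2) (\<lambda>(x, y). g x * h y)" by (simp add: case_prod_unfold)
  from integral_fst[OF this] show "(\<integral>w. g (fst w) * h (snd w) \<partial>(M1 \<Otimes>\<^sub>M M2)) = (\<integral>x. g x \<partial>M1) * (\<integral>y. h y \<partial>M2)"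
    by (simp add: case_prod_unfold)
qed

abbreviation haar2 :: "('p::prime_card padic \<times> 'p padic) measure"
  where "haar2 \<equiv> haar \<Otimes>\<^sub>M haar"

lemma pair_sigma_finite_haar: "pair_sigma_finite (haar :: 'p::prime_card padic measure) (haar :: 'p padic measure)"
  by (intro pair_sigma_finite.intro sigma_finite_haar)

lemma integrable_char_mult:
  assumes "integrable haar f"
  shows "integrable haar (\<lambda>x. padic_char (x * s) * f x)"
proof (rule Bochner_Integration.integrable_bound[OF assms])
  have [measurable]: "f \<in> borel_measurable haar" using assms by simp
  show "(\<lambda>x. padic_char (x * s) * f x) \<in> borel_measurable haar" by measurable
qed (simp add: norm_mult)

lemma norm_fourier_fun_le:
  assumes "integrable haar f"
  shows "cmod (fourier_fun f s) \<le> (\<integral>x. cmod (f x) \<partial>haar)"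
proof -
  have "cmod (fourier_fun f s) \<le> (\<integral>x. cmod (padic_char (x * s) * f x) \<partial>haar)"
    unfolding fourier_fun_def by (rule integral_norm_bound)
  then show ?thesis by (simp add: norm_mult)
qed

lemma borel_measurable_fourier_fun:
  fixes f :: "'p::prime_card padic \<Rightarrow> complex"
  assumes [measurable]: "f \<in> borel_measurable haar"
  shows "fourier_fun f \<in> borel_measurable borel"
proof -
  interpret sigma_finite_measure "haar :: 'p padic measure" by (rule sigma_finite_haar)
  have "(\<lambda>s. \<integral>x. padic_char (x * s) * f x \<partial>haar) \<in> borel_measurable borel"
    by measurable
  then show ?thesis by (simp add: fourier_fun_def[abs_def])
qed

section \<open>Splitting the squared Fourier transform at a frequency\<close>

context
  fixes f :: "'p::prime_card padic \<Rightarrow> complex"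
  assumes f: "integrable haar f"
begin

interpretation H: pair_sigma_finite "haar :: 'p padic measure" "haar :: 'p padic measure"
  by (rule pair_sigma_finite_haar)

text \<open>Expanding |f^(t)|^2 over pairs (x, y) gives the integral of this function against the
  character of (x - y) t. It takes the place of the autocorrelation of f, so no convolution has to
  be formed.\<close>

definition correl :: "'p padic \<times> 'p padic \<Rightarrow> complex"
  where "correl w = f (fst w) * cnj (f (snd w))"

lemma f_measurable [measurable]: "f \<in> borel_measurable haar"
  using f by simp

lemma integrable_correl: "integrable haar2 correl"
  unfolding correl_def[abs_def] using f by (intro H.integrable_pair_mult) auto

lemma correl_measurable [measurable]: "correl \<in> borel_measurable haar2"
  using integrable_correl by simp

lemma integral_norm_correl: "(\<integral>w. cmod (correl w) \<partial>haar2) = (\<integral>x. cmod (f x) \<partial>haar)\<^sup>2"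
proof -
  have "(\<integral>w. complex_of_real (cmod (f (fst w))) * complex_of_real (cmod (f (snd w))) \<partial>haar2)
      = (\<integral>x. complex_of_real (cmod (f x)) \<partial>haar) * (\<integral>x. complex_of_real (cmod (f x)) \<partial>haar)"
    using f by (intro H.integral_pair_mult) auto
  then have "complex_of_real (\<integral>w. cmod (f (fst w)) * cmod (f (snd w)) \<partial>haar2) = complex_of_real ((\<integral>x. cmod (f x) \<partial>haar)\<^sup>2)"
    by (simp add: power2_eq_square flip: of_real_mult)
  then show ?thesis by (simp only: of_real_eq_iff correl_def norm_mult complex_mod_cnj)
qed

lemma integrable_correl_mult:
  assumes [measurable]: "c \<in> borel_measurable borel" and c: "\<And>z. cmod (c z) \<le> 1"
  shows "integrable haar2 (\<lambda>w. correl w * c (fst w - snd w))"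
proof (rule Bochner_Integration.integrable_bound[OF integrable_correl])
  show "AE w in haar2. cmod (correl w * c (fst w - snd w)) \<le> cmod (correl w)"
    using c by (auto simp: norm_mult intro!: mult_left_le)
qed measurable

lemma norm_fourier_fun_sq:
  "complex_of_real ((cmod (fourier_fun f t))\<^sup>2) = (\<integral>w. correl w * padic_char ((fst w - snd w) * t) \<partial>haar2)"
proof -
  let ?g = "\<lambda>x. padic_char (x * t) * f x"
  have g: "integrable haar ?g" by (rule integrable_char_mult[OF f])
  have "(\<integral>w. correl w * padic_char ((fst w - snd w) * t) \<partial>haar2) = (\<integral>w. ?g (fst w) * cnj (?g (snd w)) \<partial>haar2)"
    by (intro Bochner_Integration.integral_cong refl) (simp add: correl_def left_diff_distrib padic_char_diff)
  also have "\<dots> = (\<integral>x. ?g x \<partial>haar) * (\<integral>x. cnj (?g x) \<partial>haar)"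
    using g by (intro H.integral_pair_mult Bochner_Integration.integrable_cnj)
  also have "\<dots> = fourier_fun f t * cnj (fourier_fun f t)"
    by (simp only: fourier_fun_def Bochner_Integration.integral_cnj)
  also have "\<dots> = complex_of_real ((cmod (fourier_fun f t))\<^sup>2)"
    by (rule complex_norm_square[symmetric])
  finally show ?thesis ..
qed

text \<open>The indicator of |z| \<le> p^n is the mean of the characters of z u over u in p^n Z_p.
  Hence this is the average of |f^|^2 over t + p^n Z_p, which explains both its local constancy and
  its sign.\<close>

definition near :: "nat \<Rightarrow> 'p padic \<Rightarrow> complex"
  where "near n t = (\<integral>w. correl w * (indicator {z. padic_abs z \<le> real CARD('p) ^ n} (fst w - snd w) *
    padic_char ((fst w - snd w) * t)) \<partial>haar2)"

definition far :: "nat \<Rightarrow> 'p padic \<Rightarrow> complex"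
  where "far n t = (\<integral>w. (correl w * indicator {z. \<not> padic_abs z \<le> real CARD('p) ^ n} (fst w - snd w)) *
    padic_char ((fst w - snd w) * t) \<partial>haar2)"

lemma near_integrable: "integrable haar2 (\<lambda>w. correl w * (indicator {z. padic_abs z \<le> real CARD('p) ^ n} (fst w - snd w) *
    padic_char ((fst w - snd w) * t)))"
  by (rule integrable_correl_mult[where c = "\<lambda>z. indicator {z. padic_abs z \<le> real CARD('p) ^ n} z * padic_char (z * t)"])
    (measurable, auto simp: norm_mult indicator_def)

lemma near_far: "complex_of_real ((cmod (fourier_fun f t))\<^sup>2) = near n t + far n t"
proof -
  have far: "integrable haar2 (\<lambda>w. correl w * (indicator {z. \<not> padic_abs z \<le> real CARD('p) ^ n} (fst w - snd w) *
      padic_char ((fst w - snd w) * t)))"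
    by (rule integrable_correl_mult[where c = "\<lambda>z. indicator {z. \<not> padic_abs z \<le> real CARD('p) ^ n} z * padic_char (z * t)"])
      (measurable, auto simp: norm_mult indicator_def)
  have "near n t + far n t = (\<integral>w. correl w * (indicator {z. padic_abs z \<le> real CARD('p) ^ n} (fst w - snd w) *
    padic_char ((fst w - snd w) * t)) + correl w * (indicator {z. \<not> padic_abs z \<le> real CARD('p) ^ n} (fst w - snd w) *
      padic_char ((fst w - snd w) * t)) \<partial>haar2)"
    unfolding near_def far_def mult.assoc
    by (rule Bochner_Integration.integral_add[symmetric, OF near_integrable far])
  also have "\<dots> = (\<integral>w. correl w * padic_char ((fst w - snd w) * t) \<partial>haar2)"
    by (intro Bochner_Integration.integral_cong refl) (simp add: indicator_def)
  finally show ?thesis using norm_fourier_fun_sq[of t] by simp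
qed

lemma near_cong:
  assumes "padic_abs (t - s) \<le> (1 / real CARD('p)) ^ n"
  shows "near n t = near n s"
  unfolding near_def
proof (intro Bochner_Integration.integral_cong refl)
  fix w :: "'p padic \<times> 'p padic"
  let ?d = "fst w - snd w"
  show "correl w * (indicator {z. padic_abs z \<le> real CARD('p) ^ n} ?d * padic_char (?d * t))
      = correl w * (indicator {z. padic_abs z \<le> real CARD('p) ^ n} ?d * padic_char (?d * s))"
  proof (cases "padic_abs ?d \<le> real CARD('p) ^ n")
    case True
    have "padic_abs (?d * t - ?d * s) = padic_abs ?d * padic_abs (t - s)"
      by (simp only: right_diff_distrib flip: padic_abs_mult)
    also have "\<dots> \<le> real CARD('p) ^ n * (1 / real CARD('p)) ^ n"
      using True assms by (intro mult_mono) auto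
    also have "\<dots> = 1" by (simp flip: power_mult_distrib)
    finally have "padic_char (?d * t) = padic_char (?d * s)" by (rule padic_char_cong)
    then show ?thesis by simp
  qed simp
qed

text \<open>Averaging the squared modulus of the transform over a large finite piece of the coset
  of t modulo the n-th power of p converges to the near part.\<close>

lemma near_nonneg: "0 \<le> Re (near n t)"
proof -
  let ?p = "of_nat CARD('p) :: 'p padic"
  let ?d = "\<lambda>w :: 'p padic \<times> 'p padic. fst w - snd w"
  define avg where "avg N z = (\<Sum>j<CARD('p) ^ N. padic_char (of_nat j * (?p ^ n * z))) / of_nat (CARD('p) ^ N)" for N and z :: "'p padic"
  have [measurable]: "avg N \<in> borel_measurable borel" for N unfolding avg_def[abs_def] by measurable
  have avg_le: "cmod (avg N z) \<le> 1" for N z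
  proof -
    have "cmod (\<Sum>j<CARD('p) ^ N. padic_char (of_nat j * (?p ^ n * z))) \<le> (\<Sum>j<CARD('p) ^ N. 1)"
      by (rule sum_norm_le) simp
    then show ?thesis by (simp add: avg_def norm_divide norm_power divide_le_eq)
  qed
  have lim: "(\<lambda>N. \<integral>w. correl w * (avg N (?d w) * padic_char (?d w * t)) \<partial>haar2) \<longlonglongrightarrow> near n t"
    unfolding near_def
  proof (rule integral_dominated_convergence[where w = "\<lambda>w. cmod (correl w)"])
    show "integrable haar2 (\<lambda>w. cmod (correl w))" using integrable_correl by simp
    show "AE w in haar2. cmod (correl w * (avg N (?d w) * padic_char (?d w * t))) \<le> cmod (correl w)" for N
      using avg_le by (auto simp: norm_mult intro!: mult_left_le)
    show "AE w in haar2. (\<lambda>N. correl w * (avg N (?d w) * padic_char (?d w * t)))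
        \<longlonglongrightarrow> correl w * (indicator {z. padic_abs z \<le> real CARD('p) ^ n} (?d w) * padic_char (?d w * t))"
    proof (rule AE_I2, intro tendsto_mult tendsto_const)
      fix w :: "'p padic \<times> 'p padic"
      obtain M where M: "padic_abs (?p ^ n * ?d w) < real CARD('p) ^ M"
        using real_arch_pow[OF real_CARD_gt_1[where 'p = 'p]] by blast
      have "avg N (?d w) = indicator {z. padic_abs z \<le> real CARD('p) ^ n} (?d w)" if "M \<le> N" for N
      proof -
        have "real CARD('p) ^ M \<le> real CARD('p) ^ N" using that by (intro power_increasing) auto
        then have le: "padic_abs (?p ^ n * ?d w) \<le> real CARD('p) ^ N" using M by linarith
        have "padic_abs (?p ^ n * ?d w) \<le> 1 \<longleftrightarrow> padic_abs (?d w) \<le> real CARD('p) ^ n"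
          by (simp add: padic_abs_mult power_divide divide_le_eq)
        then show ?thesis
          unfolding avg_def sum_padic_char[OF le] by (simp add: indicator_def)
      qed
      then have "\<forall>\<^sub>F N in sequentially. avg N (?d w) = indicator {z. padic_abs z \<le> real CARD('p) ^ n} (?d w)"
        unfolding eventually_sequentially by blast
      then show "(\<lambda>N. avg N (?d w)) \<longlonglongrightarrow> indicator {z. padic_abs z \<le> real CARD('p) ^ n} (?d w)"
        by (rule tendsto_eventually)
    qed
  qed measurable
  have "0 \<le> Re (\<integral>w. correl w * (avg N (?d w) * padic_char (?d w * t)) \<partial>haar2)" for N
  proof -
    let ?t = "\<lambda>j. t + of_nat j * ?p ^ n"
    have "(\<integral>w. correl w * (avg N (?d w) * padic_char (?d w * t)) \<partial>haar2)
        = (\<integral>w. (\<Sum>j<CARD('p) ^ N. correl w * padic_char (?d w * ?t j)) / of_nat (CARD('p) ^ N) \<partial>haar2)"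
    proof (intro Bochner_Integration.integral_cong refl)
      fix w :: "'p padic \<times> 'p padic"
      have "padic_char (?d w * ?t j) = padic_char (of_nat j * (?p ^ n * ?d w)) * padic_char (?d w * t)" for j
        by (simp add: algebra_simps flip: padic_char_add)
      then show "correl w * (avg N (?d w) * padic_char (?d w * t))
          = (\<Sum>j<CARD('p) ^ N. correl w * padic_char (?d w * ?t j)) / of_nat (CARD('p) ^ N)"
        by (simp only: avg_def sum_distrib_left sum_distrib_right sum_divide_distrib times_divide_eq_right
            times_divide_eq_left)
    qed
    also have "\<dots> = (\<Sum>j<CARD('p) ^ N. \<integral>w. correl w * padic_char (?d w * ?t j) \<partial>haar2) / of_nat (CARD('p) ^ N)"
      by (subst Bochner_Integration.integral_divide_zero, subst Bochner_Integration.integral_sum)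
        (auto intro!: integrable_correl_mult[where c = "\<lambda>z. padic_char (z * _)"])
    also have "\<dots> = complex_of_real ((\<Sum>j<CARD('p) ^ N. (cmod (fourier_fun f (?t j)))\<^sup>2) / real (CARD('p) ^ N))"
      by (simp only: norm_fourier_fun_sq[symmetric] of_real_divide of_real_sum of_real_of_nat_eq)
    finally show ?thesis by (simp only: Re_complex_of_real) (auto intro!: divide_nonneg_nonneg sum_nonneg)
  qed
  then show ?thesis
    using tendsto_Re[OF lim] by (intro LIMSEQ_le_const) auto
qed

text \<open>Summing the characters over c modulo p^n turns the cutoff |x - y| \<le> p^n into |x - y|
  \<le> 1 with weight p^n. For each x the admissible y fill a ball of Haar measure 1, on which |f|
  \<le> B.\<close>

lemma sum_near_le:
  assumes B: "\<And>x. cmod (f x) \<le> B"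
  shows "(\<Sum>c<CARD('p) ^ n. Re (near n (of_nat c))) \<le> real CARD('p) ^ n * B * (\<integral>x. cmod (f x) \<partial>haar)"
proof -
  let ?d = "\<lambda>w :: 'p padic \<times> 'p padic. fst w - snd w"
  let ?I = "\<lambda>w. indicat_real {z. padic_abs z \<le> 1} (?d w)"
  have B0: "0 \<le> B" using B[of 0] norm_ge_zero order_trans by blast
  define h where "h w = cmod (f (fst w)) * ?I w" for w
  have h: "h (x, y) = cmod (f x) * indicator (cball x 1) y" for x y
    by (simp add: h_def indicator_def cball_padic)
  have hy: "integrable haar (\<lambda>y. h (x, y))" "(\<integral>y. h (x, y) \<partial>haar) = cmod (f x)" for x
    unfolding h using emeasure_haar_unit_cball[of x] by (auto simp: measure_def)
  have int: "integrable haar2 h"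
  proof (rule H.Fubini_integrable)
    show "h \<in> borel_measurable haar2" unfolding h_def[abs_def] by measurable
    have "norm (h w) = h w" for w by (simp add: h_def)
    then show "integrable haar (\<lambda>x. \<integral>y. norm (h (x, y)) \<partial>haar)"
      using f by (simp add: hy)
  qed (simp add: hy)
  then have "integrable haar2 (\<lambda>(x, y). h (x, y))" by simp
  from H.integral_fst[OF this] have int2: "(\<integral>w. h w \<partial>haar2) = (\<integral>x. cmod (f x) \<partial>haar)"
    by (simp add: hy)
  have "(\<Sum>c<CARD('p) ^ n. near n (of_nat c)) = (\<integral>w. (\<Sum>c<CARD('p) ^ n. correl w *
      (indicator {z. padic_abs z \<le> real CARD('p) ^ n} (?d w) * padic_char (?d w * of_nat c))) \<partial>haar2)"
    unfolding near_def by (rule Bochner_Integration.integral_sum[symmetric]) (rule near_integrable)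
  also have "\<dots> = (\<integral>w. correl w * (of_nat (CARD('p) ^ n) * of_real (?I w)) \<partial>haar2)"
  proof (intro Bochner_Integration.integral_cong refl)
    fix w :: "'p padic \<times> 'p padic"
    have "1 \<le> real CARD('p) ^ n" by (intro one_le_power) (use CARD_gt_1[where 'p = 'p] in simp)
    then have "indicator {z. padic_abs z \<le> real CARD('p) ^ n} (?d w) * (\<Sum>c<CARD('p) ^ n. padic_char (of_nat c * ?d w))
        = of_nat (CARD('p) ^ n) * complex_of_real (?I w)"
    proof (cases "padic_abs (?d w) \<le> real CARD('p) ^ n")
      case True
      then show ?thesis using sum_padic_char[OF True] by (simp add: indicator_def)
    next
      case False
      then have "\<not> padic_abs (?d w) \<le> 1" using \<open>1 \<le> real CARD('p) ^ n\<close> by linarith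
      then show ?thesis using False by (simp add: indicator_def)
    qed
    then show "(\<Sum>c<CARD('p) ^ n. correl w * (indicator {z. padic_abs z \<le> real CARD('p) ^ n} (?d w) * padic_char (?d w * of_nat c)))
        = correl w * (of_nat (CARD('p) ^ n) * of_real (?I w))"
      by (simp only: mult.commute[of "?d w"] flip: sum_distrib_left)
  qed
  finally have "(\<Sum>c<CARD('p) ^ n. Re (near n (of_nat c))) \<le> cmod (\<integral>w. correl w * (of_nat (CARD('p) ^ n) * of_real (?I w)) \<partial>haar2)"
    by (metis Re_sum complex_Re_le_cmod)
  also have "\<dots> \<le> (\<integral>w. cmod (correl w * (of_nat (CARD('p) ^ n) * of_real (?I w))) \<partial>haar2)"
    by (rule integral_norm_bound)
  also have "\<dots> \<le> (\<integral>w. real CARD('p) ^ n * B * h w \<partial>haar2)"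
    unfolding h_def
  proof (rule integral_mono')
    show "integrable haar2 (\<lambda>w. real CARD('p) ^ n * B * (cmod (f (fst w)) * ?I w))"
      using int unfolding h_def[abs_def] by (rule integrable_mult_right)
    fix w :: "'p padic \<times> 'p padic"
    show "cmod (correl w * (of_nat (CARD('p) ^ n) * of_real (?I w))) \<le> real CARD('p) ^ n * B * (cmod (f (fst w)) * ?I w)"
    proof -
      have "cmod (f (fst w)) * cmod (f (snd w)) \<le> cmod (f (fst w)) * B" by (intro mult_left_mono B) simp
      then have "cmod (f (fst w)) * cmod (f (snd w)) * (real CARD('p) ^ n * ?I w) \<le> cmod (f (fst w)) * B * (real CARD('p) ^ n * ?I w)"
        by (rule mult_right_mono) simp
      then show ?thesis by (simp add: correl_def norm_mult norm_power mult_ac)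
    qed
    show "0 \<le> real CARD('p) ^ n * B * (cmod (f (fst w)) * ?I w)" using B0 by simp
  qed
  also have "\<dots> = real CARD('p) ^ n * B * (\<integral>x. cmod (f x) \<partial>haar)"
    by (simp add: int2)
  finally show ?thesis .
qed

text \<open>On Z_p the near part is a nonnegative step function on balls of radius p^(-n), so its
  integral is at most D times the sum of its values. The far part, by Fubini, is the integral of the
  correlation against the transform of \<mu> at x - y, which is bounded by A wherever |x - y| >
  p^n.\<close>

lemma restriction_bounded:
  fixes \<mu> :: "'p padic measure"
  assumes \<mu>: "borel_prob \<mu>" and unit: "measure \<mu> (cball 0 1) = 1"
    and D: "\<And>y. measure \<mu> (cball y ((1 / real CARD('p)) ^ n)) \<le> D"
    and A: "0 \<le> A" "\<And>\<xi>. \<not> padic_abs \<xi> \<le> real CARD('p) ^ n \<Longrightarrow> cmod (fourier_measure \<mu> \<xi>) \<le> A"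
    and B: "\<And>x. cmod (f x) \<le> B"
  shows "(\<integral>t. (cmod (fourier_fun f t))\<^sup>2 \<partial>\<mu>) \<le>
    D * (real CARD('p) ^ n * B * (\<integral>x. cmod (f x) \<partial>haar)) + A * (\<integral>x. cmod (f x) \<partial>haar)\<^sup>2"
proof -
  interpret M: prob_space \<mu> using \<mu> by (simp add: borel_prob_def)
  have sets [measurable_cong, simp]: "sets \<mu> = sets borel" using \<mu> by (simp add: borel_prob_def)
  interpret H2: sigma_finite_measure "haar2 :: ('p padic \<times> 'p padic) measure"
    by (rule sigma_finite_pair_measure) (rule sigma_finite_haar)+
  interpret PM: pair_sigma_finite "haar2 :: ('p padic \<times> 'p padic) measure" \<mu> ..
  let ?d = "\<lambda>w :: 'p padic \<times> 'p padic. fst w - snd w"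
  let ?B = "\<lambda>c. cball (of_nat c :: 'p padic) ((1 / real CARD('p)) ^ n)"
  have D0: "0 \<le> D" using D[of 0] measure_nonneg order_trans by blast
  have near_simple: "AE t in \<mu>. Re (near n t) = (\<Sum>c<CARD('p) ^ n. Re (near n (of_nat c)) * indicator (?B c) t)"
    using M.AE_prob_1[OF unit]
  proof eventually_elim
    fix t :: "'p padic" assume "t \<in> cball 0 1"
    then have t: "padic_abs t \<le> 1" by (simp add: cball_padic)
    define c0 where "c0 = residue n t"
    have iff: "t \<in> ?B c \<longleftrightarrow> c = c0" if "c < CARD('p) ^ n" for c
      using residue_eq_iff[OF t that] by (auto simp: cball_padic c0_def padic_abs_minus_commute)
    have ind: "indicat_real (?B c) t = of_bool (c = c0)" if "c < CARD('p) ^ n" for c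
      by (simp only: indicator_def iff[OF that])
    have "(\<Sum>c<CARD('p) ^ n. Re (near n (of_nat c)) * indicator (?B c) t)
        = (\<Sum>c<CARD('p) ^ n. if c = c0 then Re (near n (of_nat c)) else 0)"
      by (intro sum.cong refl) (simp add: ind)
    also have "\<dots> = Re (near n (of_nat c0))"
      using residue(1)[OF t, of n] by (simp add: c0_def)
    also have "near n (of_nat c0) = near n t"
      using residue(2)[OF t, of n] by (intro near_cong) (simp add: c0_def padic_abs_minus_commute)
    finally show "Re (near n t) = (\<Sum>c<CARD('p) ^ n. Re (near n (of_nat c)) * indicator (?B c) t)" ..
  qed
  define h where "h w = correl w * indicator {z. \<not> padic_abs z \<le> real CARD('p) ^ n} (?d w)" for w
  have h_int: "integrable haar2 h"
    unfolding h_def[abs_def]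
    by (rule integrable_correl_mult[where c = "indicator {z. \<not> padic_abs z \<le> real CARD('p) ^ n}"])
      (measurable, auto simp: indicator_def)
  then have [measurable]: "h \<in> borel_measurable haar2" by simp
  have far_int: "integrable (haar2 \<Otimes>\<^sub>M \<mu>) (\<lambda>(w, t). h w * padic_char (?d w * t))"
  proof (rule PM.Fubini_integrable)
    show "integrable haar2 (\<lambda>w. \<integral>t. norm (case (w, t) of (w, t) \<Rightarrow> h w * padic_char (?d w * t)) \<partial>\<mu>)"
      using h_int by (simp add: norm_mult M.prob_space)
    have "integrable \<mu> (\<lambda>t. h w * padic_char (?d w * t))" for w
      by (intro integrable_mult_right M.integrable_const_bound[where B = 1]) auto
    then show "AE w in haar2. integrable \<mu> (\<lambda>t. case (w, t) of (w, t) \<Rightarrow> h w * padic_char (?d w * t))"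
      by simp
  qed measurable
  have far_eq: "far n t = (\<integral>w. h w * padic_char (?d w * t) \<partial>haar2)" for t
    by (simp add: far_def h_def)
  have far_int': "integrable \<mu> (far n)"
    using PM.integrable_snd[OF far_int] unfolding far_eq[abs_def] .
  have "(\<integral>t. far n t \<partial>\<mu>) = (\<integral>w. \<integral>t. h w * padic_char (?d w * t) \<partial>\<mu> \<partial>haar2)"
    unfolding far_eq by (rule PM.Fubini_integral[OF far_int])
  also have "\<dots> = (\<integral>w. h w * fourier_measure \<mu> (?d w) \<partial>haar2)"
    by (simp add: fourier_measure_def mult.commute[of "fst _ - snd _"])
  finally have "cmod (\<integral>t. far n t \<partial>\<mu>) \<le> (\<integral>w. cmod (h w * fourier_measure \<mu> (?d w)) \<partial>haar2)"
    by (simp add: integral_norm_bound)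
  also have "\<dots> \<le> (\<integral>w. A * cmod (correl w) \<partial>haar2)"
  proof (rule integral_mono')
    show "integrable haar2 (\<lambda>w. A * cmod (correl w))" using integrable_correl by simp
    show "cmod (h w * fourier_measure \<mu> (?d w)) \<le> A * cmod (correl w)" for w
      using A mult_right_mono[OF A(2)[of "?d w"], of "cmod (correl w)"]
      by (cases "padic_abs (?d w) \<le> real CARD('p) ^ n") (auto simp: h_def norm_mult mult.commute)
  qed (use A in simp)
  also have "\<dots> = A * (\<integral>x. cmod (f x) \<partial>haar)\<^sup>2" by (simp add: integral_norm_correl)
  finally have far_le: "Re (\<integral>t. far n t \<partial>\<mu>) \<le> A * (\<integral>x. cmod (f x) \<partial>haar)\<^sup>2"
    using complex_Re_le_cmod order_trans by blast
  have eq: "(cmod (fourier_fun f t))\<^sup>2 = Re (near n t) + Re (far n t)" for t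
    using arg_cong[OF near_far[of t n], of Re] by simp
  have near_int: "integrable \<mu> (\<lambda>t. Re (near n t))"
  proof -
    have "integrable \<mu> (\<lambda>t. (cmod (fourier_fun f t))\<^sup>2)"
    proof (rule M.integrable_const_bound[where B = "(\<integral>x. cmod (f x) \<partial>haar)\<^sup>2"])
      show "(\<lambda>t. (cmod (fourier_fun f t))\<^sup>2) \<in> borel_measurable \<mu>"
        using borel_measurable_fourier_fun[OF f_measurable] by measurable
    qed (use norm_fourier_fun_le[OF f] in \<open>auto intro!: power_mono\<close>)
    then have "integrable \<mu> (\<lambda>t. (cmod (fourier_fun f t))\<^sup>2 - Re (far n t))"
      using far_int' by (intro Bochner_Integration.integrable_diff) auto
    then show ?thesis by (simp add: eq)
  qed
  have "(\<integral>t. Re (near n t) \<partial>\<mu>) = (\<integral>t. (\<Sum>c<CARD('p) ^ n. Re (near n (of_nat c)) * indicator (?B c) t) \<partial>\<mu>)"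
  proof (rule integral_cong_AE)
    show "(\<lambda>t. \<Sum>c<CARD('p) ^ n. Re (near n (of_nat c)) * indicator (?B c) t) \<in> borel_measurable \<mu>"
      by (intro borel_measurable_sum borel_measurable_times borel_measurable_const borel_measurable_indicator) simp
  qed (use near_simple near_int in auto)
  also have "\<dots> = (\<Sum>c<CARD('p) ^ n. Re (near n (of_nat c)) * measure \<mu> (?B c))"
    by (subst Bochner_Integration.integral_sum) (auto simp: M.emeasure_eq_measure)
  also have "\<dots> \<le> (\<Sum>c<CARD('p) ^ n. Re (near n (of_nat c)) * D)"
    by (intro sum_mono mult_left_mono D near_nonneg)
  also have "\<dots> = D * (\<Sum>c<CARD('p) ^ n. Re (near n (of_nat c)))"
    by (simp add: sum_distrib_left mult.commute)
  also have "\<dots> \<le> D * (real CARD('p) ^ n * B * (\<integral>x. cmod (f x) \<partial>haar))"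
    by (intro mult_left_mono sum_near_le B D0)
  finally have near_le: "(\<integral>t. Re (near n t) \<partial>\<mu>) \<le> D * (real CARD('p) ^ n * B * (\<integral>x. cmod (f x) \<partial>haar))" .
  have "(\<integral>t. (cmod (fourier_fun f t))\<^sup>2 \<partial>\<mu>) = (\<integral>t. Re (near n t) \<partial>\<mu>) + (\<integral>t. Re (far n t) \<partial>\<mu>)"
    unfolding eq using near_int far_int' by (intro Bochner_Integration.integral_add) auto
  also have "(\<integral>t. Re (far n t) \<partial>\<mu>) = Re (\<integral>t. far n t \<partial>\<mu>)" using far_int' by simp
  finally show ?thesis using near_le far_le by linarith
qed

end

section \<open>Decomposition of a function into level sets\<close>

lemma sum_sq_le_weighted:
  fixes a w :: "'a \<Rightarrow> real"
  assumes "\<And>i. i \<in> I \<Longrightarrow> 0 < w i"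
  shows "(\<Sum>i\<in>I. a i)\<^sup>2 \<le> (\<Sum>i\<in>I. w i) * (\<Sum>i\<in>I. (a i)\<^sup>2 / w i)"
proof -
  have "(\<Sum>i\<in>I. a i)\<^sup>2 = (\<Sum>i\<in>I. sqrt (w i) * (a i / sqrt (w i)))\<^sup>2"
    using assms by (intro arg_cong[where f = "\<lambda>x. x\<^sup>2"] sum.cong) (auto simp: less_imp_neq[symmetric])
  also have "\<dots> \<le> (\<Sum>i\<in>I. (sqrt (w i))\<^sup>2) * (\<Sum>i\<in>I. (a i / sqrt (w i))\<^sup>2)"
    by (rule Cauchy_Schwarz_ineq_sum)
  also have "(\<Sum>i\<in>I. (sqrt (w i))\<^sup>2) = (\<Sum>i\<in>I. w i)"
    using assms by (intro sum.cong) (auto simp: less_imp_le)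
  also have "(\<Sum>i\<in>I. (a i / sqrt (w i))\<^sup>2) = (\<Sum>i\<in>I. (a i)\<^sup>2 / w i)"
    using assms by (intro sum.cong) (auto simp: power_divide less_imp_le)
  finally show ?thesis .
qed

lemma sum_power_le:
  fixes \<rho> :: real
  assumes "0 < \<rho>" "\<rho> < 1"
  shows "(\<Sum>k\<le>K. \<rho> ^ k) \<le> 1 / (1 - \<rho>)"
proof -
  have "(\<Sum>k\<le>K. \<rho> ^ k) \<le> (\<Sum>k. \<rho> ^ k)"
    by (rule sum_le_suminf) (use assms in auto)
  then show ?thesis using suminf_geometric[of \<rho>] assms by simp
qed

text \<open>The logarithms of the ball and decay bounds are assumed to have been traded already for
  slightly smaller exponents \<alpha> and \<beta>. The last inequality on q says exactly that the
  exponent \<open>\<gamma>\<close> below is positive.\<close>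

locale restriction_setting =
  fixes \<mu> :: "'p::prime_card padic measure" and \<alpha> \<beta> C q :: real
  assumes \<mu>: "borel_prob \<mu>" and unit: "measure \<mu> (cball 0 1) = 1"
    and \<alpha>: "\<alpha> \<le> 1" and \<beta>: "0 < \<beta>" and C: "0 < C"
    and balls: "\<And>y r. 0 < r \<Longrightarrow> r \<le> 1 \<Longrightarrow> measure \<mu> (cball y r) \<le> C * r powr \<alpha>"
    and decay: "\<And>\<xi>. 1 \<le> padic_abs \<xi> \<Longrightarrow> cmod (fourier_measure \<mu> \<xi>) \<le> C * padic_abs \<xi> powr (- \<beta>)"
    and q: "1 \<le> q" "q * (2 - 2 * \<alpha> + \<beta>) < 2 * (1 - \<alpha> + \<beta>)"
begin

text \<open>On the level |f| about b^(-k) the L^1 norm is at most b^(k (q - 1)). Cutting at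
  frequency p^k, the near and far terms differ by a factor p^(k \<eta>) b^(-k q), up to constants;
  choosing b^q = p^\<eta> balances them, and both become p^(-k \<gamma>). \<open>\<rho>\<close>
  keeps half of this decay for summing the levels.\<close>

definition \<eta> :: real where "\<eta> = 1 - \<alpha> + \<beta>"
definition \<gamma> :: real where "\<gamma> = 2 * \<eta> / q - (1 - \<alpha> + \<eta>)"
definition b :: real where "b = real CARD('p) powr (\<eta> / q)"
definition \<rho> :: real where "\<rho> = real CARD('p) powr (- \<gamma> / 2)"

lemma \<eta>_pos: "0 < \<eta>" using \<alpha> \<beta> by (simp add: \<eta>_def)

lemma \<gamma>_pos: "0 < \<gamma>"
  using q by (simp add: \<gamma>_def \<eta>_def field_simps)

lemma b_gt_1: "1 < b"
  unfolding b_def using \<eta>_pos q by (intro gr_one_powr real_CARD_gt_1) simp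

lemma \<rho>_bounds: "0 < \<rho>" "\<rho> < 1"
proof -
  show "0 < \<rho>" by (simp add: \<rho>_def)
  have "real CARD('p) powr (- \<gamma> / 2) < real CARD('p) powr 0"
    using \<gamma>_pos by (intro powr_less_mono real_CARD_gt_1) simp
  then show "\<rho> < 1" by (simp add: \<rho>_def)
qed

text \<open>All values of modulus at least 1 form the single level 0: if f has L^q norm 1, this part
  has L^1 norm at most 1, and the trivial bound for its transform suffices.\<close>

definition level :: "nat \<Rightarrow> complex set"
  where "level k = (if k = 0 then {z. 1 \<le> cmod z} else {z. b powr (- real k) \<le> cmod z \<and> cmod z < b powr (1 - real k)})"

lemma level_measurable [measurable]: "level k \<in> sets borel"
proof -
  have le: "{z. r \<le> cmod z} \<in> sets borel" for r
    by (intro borel_closed closed_Collect_le continuous_intros)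
  have "{z. cmod z < r} \<in> sets borel" for r
    by (intro borel_open open_Collect_less continuous_intros)
  then have "{z. r \<le> cmod z} \<inter> {z. cmod z < s} \<in> sets borel" for r s
    using le by (intro sets.Int)
  then show ?thesis using le by (simp add: level_def Collect_conj_eq)
qed

lemma sum_level: "(\<Sum>k\<le>K. indicat_real (level k) z) = indicator {z. b powr (- real K) \<le> cmod z} z"
proof (induction K)
  case 0
  then show ?case using b_gt_1 by (simp add: level_def)
next
  case (Suc K)
  have "b powr (- real (Suc K)) \<le> b powr (- real K)" using b_gt_1 by (intro powr_mono) auto
  moreover have "1 - real (Suc K) = - real K" by simp
  ultimately show ?case using Suc by (auto simp: level_def indicator_def)
qed

lemma measurable_mu_cong: "sets \<mu> = sets borel"
  using \<mu> by (simp add: borel_prob_def)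

lemma integrable_fourier_sq:
  assumes "integrable haar f"
  shows "integrable \<mu> (\<lambda>t. (cmod (fourier_fun f t))\<^sup>2)"
proof -
  interpret M: prob_space \<mu> using \<mu> by (simp add: borel_prob_def)
  have [measurable_cong]: "sets \<mu> = sets borel" by (rule measurable_mu_cong)
  have [measurable]: "fourier_fun f \<in> borel_measurable borel"
    using assms by (intro borel_measurable_fourier_fun) simp
  show ?thesis
  proof (rule M.integrable_const_bound[where B = "(\<integral>x. cmod (f x) \<partial>haar)\<^sup>2"])
    show "AE t in \<mu>. norm ((cmod (fourier_fun f t))\<^sup>2) \<le> (\<integral>x. cmod (f x) \<partial>haar)\<^sup>2"
      using norm_fourier_fun_le[OF assms] by (auto intro!: power_mono)
  qed measurable
qed

lemma piece_0:
  assumes f: "integrable haar f" and le: "(\<integral>x. cmod (f x) \<partial>haar) \<le> 1"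
  shows "(\<integral>t. (cmod (fourier_fun f t))\<^sup>2 \<partial>\<mu>) \<le> 1"
proof -
  interpret M: prob_space \<mu> using \<mu> by (simp add: borel_prob_def)
  have "(\<integral>t. (cmod (fourier_fun f t))\<^sup>2 \<partial>\<mu>) \<le> (\<integral>t. 1 \<partial>\<mu>)"
  proof (rule integral_mono[OF integrable_fourier_sq[OF f]])
    fix t
    have "cmod (fourier_fun f t) \<le> 1" using norm_fourier_fun_le[OF f, of t] le by linarith
    then show "(cmod (fourier_fun f t))\<^sup>2 \<le> 1" by (simp add: power_le_one)
  qed simp
  then show ?thesis by (simp add: M.prob_space)
qed

text \<open>The cutoff frequency is p^k with the same k as the level; the exponents of the two terms
  then agree by the choice of b.\<close>

lemma piece_Suc:
  assumes f: "integrable haar f" and le: "(\<integral>x. cmod (f x) \<partial>haar) \<le> b powr (real k * (q - 1))"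
    and B: "\<And>x. cmod (f x) \<le> b powr (1 - real k)"
  shows "(\<integral>t. (cmod (fourier_fun f t))\<^sup>2 \<partial>\<mu>) \<le> C * (b + 1) * \<rho> ^ (2 * k)"
proof -
  let ?p = "real CARD('p)"
  let ?L = "\<integral>x. cmod (f x) \<partial>haar"
  have p: "1 < ?p" by (rule real_CARD_gt_1)
  have L0: "0 \<le> ?L" by simp
  have "(\<integral>t. (cmod (fourier_fun f t))\<^sup>2 \<partial>\<mu>) \<le>
      C * ?p powr (- real k * \<alpha>) * (?p ^ k * b powr (1 - real k) * ?L) + C * ?p powr (- real k * \<beta>) * ?L\<^sup>2"
  proof (rule restriction_bounded[OF f \<mu> unit])
    fix y :: "'p padic"
    have "(1 / ?p) ^ k = ?p powr (- real k)" using p by (simp add: powr_minus_divide powr_realpow power_one_over)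
    moreover have "measure \<mu> (cball y ((1 / ?p) ^ k)) \<le> C * ((1 / ?p) ^ k) powr \<alpha>"
      by (rule balls) (auto intro!: power_le_one)
    ultimately show "measure \<mu> (cball y ((1 / ?p) ^ k)) \<le> C * ?p powr (- real k * \<alpha>)"
      by (simp add: powr_powr)
  next
    fix \<xi> :: "'p padic" assume \<xi>: "\<not> padic_abs \<xi> \<le> ?p ^ k"
    have p1: "1 \<le> ?p ^ k" using p by (intro one_le_power) auto
    then have "cmod (fourier_measure \<mu> \<xi>) \<le> C * padic_abs \<xi> powr (- \<beta>)" using \<xi> by (intro decay) linarith
    also have "\<dots> \<le> C * (?p ^ k) powr (- \<beta>)"
      using \<xi> C \<beta> p1 by (intro mult_left_mono powr_mono2') auto
    also have "\<dots> = C * ?p powr (- real k * \<beta>)" using p by (simp add: powr_powr flip: powr_realpow)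
    finally show "cmod (fourier_measure \<mu> \<xi>) \<le> C * ?p powr (- real k * \<beta>)" .
  qed (use B C in auto)
  also have "\<dots> \<le> C * ?p powr (- real k * \<alpha>) * (?p ^ k * b powr (1 - real k) * b powr (real k * (q - 1)))
      + C * ?p powr (- real k * \<beta>) * (b powr (real k * (q - 1)))\<^sup>2"
    using C L0 le by (intro add_mono mult_left_mono power_mono) auto
  also have "?p ^ k * b powr (1 - real k) * b powr (real k * (q - 1)) = b * ?p powr (real k + \<eta> / q * (real k * (q - 2)))"
  proof -
    have "b powr (1 - real k) * b powr (real k * (q - 1)) = b powr (1 + real k * (q - 2))"
      by (simp add: algebra_simps flip: powr_add)
    also have "\<dots> = b * b powr (real k * (q - 2))" using b_gt_1 by (simp add: powr_add)
    also have "b powr (real k * (q - 2)) = ?p powr (\<eta> / q * (real k * (q - 2)))" by (simp add: b_def powr_powr)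
    finally show ?thesis using p by (simp add: powr_add powr_realpow)
  qed
  also have "(b powr (real k * (q - 1)))\<^sup>2 = ?p powr (2 * (\<eta> / q * (real k * (q - 1))))"
    by (simp add: b_def powr_powr powr_power)
  also have "C * ?p powr (- real k * \<alpha>) * (b * ?p powr (real k + \<eta> / q * (real k * (q - 2))))
      = C * b * ?p powr (- real k * \<gamma>)"
  proof -
    have "- real k * \<alpha> + (real k + \<eta> / q * (real k * (q - 2))) = - real k * \<gamma>"
      using q by (simp add: \<gamma>_def field_simps)
    then show ?thesis by (simp flip: powr_add)
  qed
  also have "C * ?p powr (- real k * \<beta>) * ?p powr (2 * (\<eta> / q * (real k * (q - 1)))) = C * ?p powr (- real k * \<gamma>)"
  proof -
    have "- real k * \<beta> + 2 * (\<eta> / q * (real k * (q - 1))) = - real k * \<gamma>"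
      using q by (simp add: \<gamma>_def \<eta>_def field_simps)
    then show ?thesis by (simp add: mult.assoc flip: powr_add)
  qed
  also have "?p powr (- real k * \<gamma>) = \<rho> ^ (2 * k)"
    by (simp add: \<rho>_def powr_power)
  finally show ?thesis by (simp add: algebra_simps)
qed

definition rconst :: real
  where "rconst = (1 + C * (b + 1)) * (1 / (1 - \<rho>))\<^sup>2"

lemma rconst_pos: "0 < rconst"
  unfolding rconst_def using C b_gt_1 \<rho>_bounds by (intro mult_pos_pos add_pos_pos zero_less_power divide_pos_pos) auto

context
  fixes f :: "'p padic \<Rightarrow> complex"
  assumes f: "integrable haar f" and fq: "integrable haar (\<lambda>x. cmod (f x) powr q)"
    and norm1: "(\<integral>x. cmod (f x) powr q \<partial>haar) = 1"
begin

lemma fm [measurable]: "f \<in> borel_measurable haar" using f by simp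

definition piece :: "nat \<Rightarrow> 'p padic \<Rightarrow> complex"
  where "piece k x = of_real (indicator (level k) (f x)) * f x"

lemma integrable_piece: "integrable haar (piece k)"
proof (rule Bochner_Integration.integrable_bound[OF f])
  show "piece k \<in> borel_measurable haar" unfolding piece_def[abs_def] by measurable
qed (auto simp: piece_def norm_mult indicator_def)

text \<open>On level k one has |f| \<ge> b^(-k), hence |f| = |f|^(1 - q) |f|^q is at most b^(k (q -
  1)) |f|^q.\<close>

lemma integral_piece_le: "(\<integral>x. cmod (piece k x) \<partial>haar) \<le> b powr (real k * (q - 1))"
proof -
  have "(\<integral>x. cmod (piece k x) \<partial>haar) \<le> (\<integral>x. b powr (real k * (q - 1)) * cmod (f x) powr q \<partial>haar)"
  proof (rule integral_mono)
    show "integrable haar (\<lambda>x. cmod (piece k x))" using integrable_piece by simp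
    show "integrable haar (\<lambda>x. b powr (real k * (q - 1)) * cmod (f x) powr q)" using fq by simp
    fix x
    show "cmod (piece k x) \<le> b powr (real k * (q - 1)) * cmod (f x) powr q"
    proof (cases "f x \<in> level k")
      case True
      have ge: "b powr (- real k) \<le> cmod (f x)" using True b_gt_1 by (auto simp: level_def split: if_splits)
      have pos: "0 < cmod (f x)" using ge b_gt_1 by (intro less_le_trans[OF _ ge]) simp
      have "cmod (piece k x) = cmod (f x) powr 1" using True pos by (simp add: piece_def)
      also have "\<dots> = cmod (f x) powr (1 - q) * cmod (f x) powr q" by (simp flip: powr_add)
      also have "cmod (f x) powr (1 - q) \<le> (b powr (- real k)) powr (1 - q)"
        using ge q b_gt_1 by (intro powr_mono2') auto
      also have "\<dots> = b powr (real k * (q - 1))" by (simp add: powr_powr algebra_simps)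
      finally show ?thesis by (simp add: mult_right_mono)
    qed (simp add: piece_def)
  qed
  also have "\<dots> = b powr (real k * (q - 1))" using norm1 by simp
  finally show ?thesis .
qed

lemma integral_fourier_piece_le: "(\<integral>t. (cmod (fourier_fun (piece k) t))\<^sup>2 \<partial>\<mu>) \<le> (1 + C * (b + 1)) * \<rho> ^ (2 * k)"
proof (cases "k = 0")
  case True
  have "(\<integral>t. (cmod (fourier_fun (piece k) t))\<^sup>2 \<partial>\<mu>) \<le> 1"
    using integral_piece_le[of k] True b_gt_1 by (intro piece_0 integrable_piece) simp
  moreover have "0 \<le> C * (b + 1)" using C b_gt_1 by simp
  ultimately show ?thesis using True by simp
next
  case False
  have "(\<integral>t. (cmod (fourier_fun (piece k) t))\<^sup>2 \<partial>\<mu>) \<le> C * (b + 1) * \<rho> ^ (2 * k)"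
  proof (rule piece_Suc[OF integrable_piece integral_piece_le])
    show "cmod (piece k x) \<le> b powr (1 - real k)" for x
      using False by (auto simp: piece_def level_def norm_mult indicator_def)
  qed
  also have "\<dots> \<le> (1 + C * (b + 1)) * \<rho> ^ (2 * k)"
    using \<rho>_bounds by (intro mult_right_mono) auto
  finally show ?thesis .
qed

definition trunc :: "nat \<Rightarrow> 'p padic \<Rightarrow> complex"
  where "trunc K x = (\<Sum>k\<le>K. piece k x)"

lemma trunc_eq: "trunc K x = (if b powr (- real K) \<le> cmod (f x) then f x else 0)"
proof -
  have "trunc K x = of_real (\<Sum>k\<le>K. indicator (level k) (f x)) * f x"
    unfolding trunc_def piece_def by (simp only: sum_distrib_right of_real_sum)
  then show ?thesis unfolding sum_level by (simp add: indicator_def)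
qed

lemma integrable_trunc: "integrable haar (trunc K)"
  unfolding trunc_def[abs_def] using integrable_piece by simp

lemma fourier_trunc: "fourier_fun (trunc K) t = (\<Sum>k\<le>K. fourier_fun (piece k) t)"
proof -
  have "(\<integral>x. padic_char (x * t) * trunc K x \<partial>haar) = (\<integral>x. (\<Sum>k\<le>K. padic_char (x * t) * piece k x) \<partial>haar)"
    by (simp add: trunc_def sum_distrib_left)
  also have "\<dots> = (\<Sum>k\<le>K. \<integral>x. padic_char (x * t) * piece k x \<partial>haar)"
    by (rule Bochner_Integration.integral_sum) (rule integrable_char_mult[OF integrable_piece])
  finally show ?thesis by (simp only: fourier_fun_def)
qed

text \<open>Cauchy-Schwarz with weights \<rho>^k: a piece contributes \<rho>^(2k), and the division
  by \<rho>^k still leaves a geometric series. The two series give the squared factor of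
  \<open>rconst\<close>, independent of K.\<close>

lemma integral_fourier_trunc_le: "(\<integral>t. (cmod (fourier_fun (trunc K) t))\<^sup>2 \<partial>\<mu>) \<le> rconst"
proof -
  let ?W = "\<Sum>k\<le>K. \<rho> ^ k"
  let ?C = "1 + C * (b + 1)"
  have C1: "0 \<le> ?C" using C b_gt_1 by simp
  have W0: "0 \<le> ?W" using \<rho>_bounds by (intro sum_nonneg) simp
  have int: "integrable \<mu> (\<lambda>t. (cmod (fourier_fun (piece k) t))\<^sup>2)" for k
    by (rule integrable_fourier_sq[OF integrable_piece])
  have "(\<integral>t. (cmod (fourier_fun (trunc K) t))\<^sup>2 \<partial>\<mu>)
      \<le> (\<integral>t. ?W * (\<Sum>k\<le>K. (cmod (fourier_fun (piece k) t))\<^sup>2 / \<rho> ^ k) \<partial>\<mu>)"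
  proof (rule integral_mono[OF integrable_fourier_sq[OF integrable_trunc]])
    show "integrable \<mu> (\<lambda>t. ?W * (\<Sum>k\<le>K. (cmod (fourier_fun (piece k) t))\<^sup>2 / \<rho> ^ k))"
      using int by (intro integrable_mult_right Bochner_Integration.integrable_sum) simp
    fix t
    have "(cmod (fourier_fun (trunc K) t))\<^sup>2 \<le> (\<Sum>k\<le>K. cmod (fourier_fun (piece k) t))\<^sup>2"
      unfolding fourier_trunc by (intro power_mono norm_sum) auto
    also have "\<dots> \<le> ?W * (\<Sum>k\<le>K. (cmod (fourier_fun (piece k) t))\<^sup>2 / \<rho> ^ k)"
      using \<rho>_bounds by (intro sum_sq_le_weighted) simp
    finally show "(cmod (fourier_fun (trunc K) t))\<^sup>2 \<le> ?W * (\<Sum>k\<le>K. (cmod (fourier_fun (piece k) t))\<^sup>2 / \<rho> ^ k)" .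
  qed
  also have "\<dots> = ?W * (\<Sum>k\<le>K. (\<integral>t. (cmod (fourier_fun (piece k) t))\<^sup>2 \<partial>\<mu>) / \<rho> ^ k)"
    using int by (simp add: Bochner_Integration.integral_sum)
  also have "\<dots> \<le> ?W * (\<Sum>k\<le>K. ?C * \<rho> ^ k)"
  proof (intro mult_left_mono[OF _ W0] sum_mono)
    fix k
    have "(\<integral>t. (cmod (fourier_fun (piece k) t))\<^sup>2 \<partial>\<mu>) / \<rho> ^ k \<le> ?C * \<rho> ^ (2 * k) / \<rho> ^ k"
      using \<rho>_bounds by (intro divide_right_mono integral_fourier_piece_le) auto
    also have "\<dots> = ?C * \<rho> ^ k" using \<rho>_bounds by (simp add: mult_2 power_add)
    finally show "(\<integral>t. (cmod (fourier_fun (piece k) t))\<^sup>2 \<partial>\<mu>) / \<rho> ^ k \<le> ?C * \<rho> ^ k" .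
  qed
  also have "\<dots> = ?C * ?W\<^sup>2" by (simp add: power2_eq_square flip: sum_distrib_left)
  also have "\<dots> \<le> rconst"
    unfolding rconst_def using sum_power_le[OF \<rho>_bounds] W0 C1 by (intro mult_left_mono power_mono) auto
  finally show ?thesis .
qed

text \<open>Since f is integrable, the transforms of its truncations converge pointwise and stay
  below its L^1 norm, so the uniform bound passes to the limit over the probability measure
  \<mu>.\<close>

lemma integral_fourier_le: "(\<integral>t. (cmod (fourier_fun f t))\<^sup>2 \<partial>\<mu>) \<le> rconst"
proof -
  interpret M: prob_space \<mu> using \<mu> by (simp add: borel_prob_def)
  have [measurable_cong]: "sets \<mu> = sets borel" by (rule measurable_mu_cong)
  have [measurable]: "fourier_fun f \<in> borel_measurable borel" "fourier_fun (trunc K) \<in> borel_measurable borel" for K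
    using f integrable_trunc by (intro borel_measurable_fourier_fun; simp)+
  have norm_trunc: "cmod (trunc K x) \<le> cmod (f x)" for K x by (simp add: trunc_eq)
  have lim: "(\<lambda>K. fourier_fun (trunc K) t) \<longlonglongrightarrow> fourier_fun f t" for t
    unfolding fourier_fun_def
  proof (rule integral_dominated_convergence[where w = "\<lambda>x. cmod (f x)"])
    have [measurable]: "trunc K \<in> borel_measurable haar" for K using integrable_trunc by simp
    show "(\<lambda>x. padic_char (x * t) * trunc K x) \<in> borel_measurable haar" for K by measurable
    show "(\<lambda>x. padic_char (x * t) * f x) \<in> borel_measurable haar" by measurable
    show "AE x in haar. (\<lambda>K. padic_char (x * t) * trunc K x) \<longlonglongrightarrow> padic_char (x * t) * f x"
    proof (rule AE_I2, intro tendsto_mult tendsto_const)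
      fix x
      have "\<forall>\<^sub>F K in sequentially. trunc K x = f x"
      proof (cases "f x = 0")
        case False
        then obtain K where K: "(1 / b) ^ K < cmod (f x)"
          using real_arch_pow_inv[of "cmod (f x)" "1 / b"] b_gt_1 by auto
        have "trunc N x = f x" if "K \<le> N" for N
        proof -
          have "b powr (- real N) = (1 / b) ^ N" using b_gt_1 by (simp add: powr_minus_divide powr_realpow power_one_over)
          also have "\<dots> \<le> (1 / b) ^ K" using that b_gt_1 by (intro power_decreasing) auto
          finally show ?thesis using K by (simp add: trunc_eq)
        qed
        then show ?thesis unfolding eventually_sequentially by blast
      qed (simp add: trunc_eq)
      then show "(\<lambda>K. trunc K x) \<longlonglongrightarrow> f x" by (rule tendsto_eventually)
    qed
  qed (use f norm_trunc in \<open>auto simp: norm_mult\<close>)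
  let ?L = "\<integral>x. cmod (f x) \<partial>haar"
  have "(\<lambda>K. \<integral>t. (cmod (fourier_fun (trunc K) t))\<^sup>2 \<partial>\<mu>) \<longlonglongrightarrow> (\<integral>t. (cmod (fourier_fun f t))\<^sup>2 \<partial>\<mu>)"
  proof (rule integral_dominated_convergence[where w = "\<lambda>_. ?L\<^sup>2"])
    show "AE t in \<mu>. (\<lambda>K. (cmod (fourier_fun (trunc K) t))\<^sup>2) \<longlonglongrightarrow> (cmod (fourier_fun f t))\<^sup>2"
      by (intro AE_I2 tendsto_intros lim)
    show "AE t in \<mu>. norm ((cmod (fourier_fun (trunc K) t))\<^sup>2) \<le> ?L\<^sup>2" for K
    proof (rule AE_I2)
      fix t
      have "cmod (fourier_fun (trunc K) t) \<le> (\<integral>x. cmod (trunc K x) \<partial>haar)"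
        by (rule norm_fourier_fun_le[OF integrable_trunc])
      also have "\<dots> \<le> ?L" using integrable_trunc f norm_trunc by (intro integral_mono) auto
      finally show "norm ((cmod (fourier_fun (trunc K) t))\<^sup>2) \<le> ?L\<^sup>2" by (simp add: power_mono)
    qed
    show "(\<lambda>t. (cmod (fourier_fun f t))\<^sup>2) \<in> borel_measurable \<mu>"
      "(\<lambda>t. (cmod (fourier_fun (trunc K) t))\<^sup>2) \<in> borel_measurable \<mu>" for K by measurable
  qed simp
  then show ?thesis
    by (rule LIMSEQ_le_const2) (use integral_fourier_trunc_le in blast)
qed

end

lemma fourier_fun_scale: "fourier_fun (\<lambda>x. f x / c) t = fourier_fun f t / c"
  by (simp add: fourier_fun_def)

theorem restriction_estimate:
  assumes f: "f \<in> Lq_space haar q" "f \<in> Lq_space haar 1"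
  shows "integrable \<mu> (\<lambda>t. (cmod (fourier_fun f t))\<^sup>2)"
    and "sqrt (\<integral>t. (cmod (fourier_fun f t))\<^sup>2 \<partial>\<mu>) \<le> sqrt rconst * Lq_norm haar q f"
proof -
  have [measurable]: "f \<in> borel_measurable haar" and "integrable haar (\<lambda>x. cmod (f x) powr 1)"
    using f(2) by (auto simp: Lq_space_def)
  then have int: "integrable haar f" by (simp add: integrable_norm_iff)
  then show "integrable \<mu> (\<lambda>t. (cmod (fourier_fun f t))\<^sup>2)" by (rule integrable_fourier_sq)
  have intq: "integrable haar (\<lambda>x. cmod (f x) powr q)" using f(1) by (simp add: Lq_space_def)
  define N where "N = (\<integral>x. cmod (f x) powr q \<partial>haar)"
  have N0: "0 \<le> N" unfolding N_def by simp
  show "sqrt (\<integral>t. (cmod (fourier_fun f t))\<^sup>2 \<partial>\<mu>) \<le> sqrt rconst * Lq_norm haar q f"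
  \<comment> \<open>A function of norm 0 cannot be normalized, but it vanishes almost everywhere and
    so does its transform. Otherwise the estimate is homogeneous in f.\<close>
  proof (cases "N = 0")
    case True
    then have "AE x in haar. cmod (f x) powr q = 0"
      unfolding N_def using integral_nonneg_eq_0_iff_AE[OF intq] by simp
    then have "AE x in haar. f x = 0" by simp
    then have "fourier_fun f t = 0" for t
      unfolding fourier_fun_def by (intro integral_eq_zero_AE) auto
    then show ?thesis using rconst_pos by (simp add: Lq_norm_def)
  next
    case False
    then have N: "0 < N" using N0 by simp
    define l where "l = N powr (1 / q)"
    have l: "0 < l" using N by (simp add: l_def)
    have lq: "l powr q = N" using N q by (simp add: l_def powr_powr)
    have norm: "cmod (f x / complex_of_real l) powr q = cmod (f x) powr q / N" for x
      using l lq by (simp add: norm_divide powr_divide)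
    have "(\<integral>t. (cmod (fourier_fun (\<lambda>x. f x / complex_of_real l) t))\<^sup>2 \<partial>\<mu>) \<le> rconst"
      by (rule integral_fourier_le) (use int intq N in \<open>simp_all add: norm flip: N_def\<close>)
    also have "(\<lambda>t. (cmod (fourier_fun (\<lambda>x. f x / complex_of_real l) t))\<^sup>2) = (\<lambda>t. (cmod (fourier_fun f t))\<^sup>2 / l\<^sup>2)"
      using l by (simp add: fourier_fun_scale norm_divide power_divide)
    finally have "(\<integral>t. (cmod (fourier_fun f t))\<^sup>2 \<partial>\<mu>) \<le> rconst * l\<^sup>2"
      using l by (simp add: divide_le_eq)
    then have "sqrt (\<integral>t. (cmod (fourier_fun f t))\<^sup>2 \<partial>\<mu>) \<le> sqrt (rconst * l\<^sup>2)" by simp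
    also have "\<dots> = sqrt rconst * l" using l by (simp add: real_sqrt_mult)
    finally show ?thesis by (simp add: Lq_norm_def l_def N_def)
  qed
qed

end

section \<open>Hausdorff dimension of the well approximable numbers\<close>

lemma hausdorff_premeasure_le:
  assumes "A \<subseteq> (\<Union>i. U i)" "\<And>i. bounded (U i)" "\<And>i. diameter (U i) \<le> \<delta>"
  shows "hausdorff_premeasure s \<delta> A \<le> (\<Sum>i. ennreal (diameter (U i) powr s))"
  unfolding hausdorff_premeasure_def using assms by (intro INF_lower) auto

lemma hausdorff_dim_le:
  assumes "0 < s" "hausdorff_measure s A = 0"
  shows "hausdorff_dim A \<le> ennreal s"
  unfolding hausdorff_dim_def using assms by (intro INF_lower) auto

text \<open>Coverings in \<^const>\<open>hausdorff_premeasure\<close> are indexed by the natural numbers.\<close>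

definition enum_family :: "('i::countable \<Rightarrow> 'a set) \<Rightarrow> nat \<Rightarrow> 'a set"
  where "enum_family U n = (if n \<in> range (to_nat :: 'i \<Rightarrow> nat) then U (from_nat n) else {})"

lemma suminf_enum_family:
  fixes U :: "'i::countable \<Rightarrow> 'a set" and g :: "'a set \<Rightarrow> ennreal"
  assumes "g {} = 0"
  shows "(\<Sum>n. g (enum_family U n)) = (\<integral>\<^sup>+i. g (U i) \<partial>count_space UNIV)"
proof -
  have "(\<Sum>n. g (enum_family U n)) = (\<integral>\<^sup>+n. g (enum_family U n) \<partial>count_space UNIV)"
    by (rule nn_integral_count_space_nat[symmetric])
  also have "\<dots> = (\<integral>\<^sup>+n. g (enum_family U n) \<partial>count_space (range (to_nat :: 'i \<Rightarrow> nat)))"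
    by (rule nn_integral_count_space_eq) (use assms in \<open>auto simp: enum_family_def\<close>)
  also have "\<dots> = (\<integral>\<^sup>+i. g (enum_family U (to_nat (i :: 'i))) \<partial>count_space UNIV)"
    by (rule nn_integral_bij_count_space[symmetric]) (simp add: bij_betw_def)
  also have "\<dots> = (\<integral>\<^sup>+i. g (U i) \<partial>count_space UNIV)" by (simp add: enum_family_def)
  finally show ?thesis .
qed

text \<open>The index (v, q, r) stands for the fraction with denominator p^v q and numerator p^v r, where
  p does not divide q.\<close>

definition approx_set :: "real \<Rightarrow> nat \<times> int \<times> int \<Rightarrow> 'p::prime_card padic set"
  where "approx_set \<tau> = (\<lambda>(v, q, r). {x. \<not> int CARD('p) dvd q \<and>
    padic_abs (x * of_int (int CARD('p) ^ v * q) - of_int (int CARD('p) ^ v * r))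
      \<le> (real CARD('p) ^ v * real_of_int (max \<bar>q\<bar> \<bar>r\<bar>)) powr (- \<tau>)})"

definition height :: "'p::prime_card itself \<Rightarrow> nat \<times> int \<times> int \<Rightarrow> real"
  where "height P = (\<lambda>(v, q, r). real CARD('p) ^ v * real_of_int (max \<bar>q\<bar> \<bar>r\<bar>))"

text \<open>Dividing |x q - r| by |q| enlarges the bound by p^v when p^v is the power of p in q. The
  factor is harmless only because p^v then also divides the numerator, and so enters the height to
  the power -\<tau>.\<close>

definition approx_radius :: "'p::prime_card itself \<Rightarrow> real \<Rightarrow> nat \<times> int \<times> int \<Rightarrow> real"
  where "approx_radius P \<tau> i = real CARD('p) ^ fst i * height P i powr (- \<tau>)"

lemma height_ge:
  assumes "\<not> int CARD('p::prime_card) dvd q"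
  shows "real CARD('p) ^ v \<le> height TYPE('p) (v, q, r)" "1 \<le> height TYPE('p) (v, q, r)"
proof -
  have "q \<noteq> 0" using assms by auto
  then have "1 \<le> real_of_int (max \<bar>q\<bar> \<bar>r\<bar>)" by simp
  then show 1: "real CARD('p) ^ v \<le> height TYPE('p) (v, q, r)"
    by (simp add: height_def mult_le_cancel_left1)
  have "1 \<le> real CARD('p) ^ v" using CARD_gt_1[where 'p = 'p] by (intro one_le_power) auto
  then show "1 \<le> height TYPE('p) (v, q, r)" using 1 by linarith
qed

lemma approx_set_diameter:
  fixes i :: "nat \<times> int \<times> int"
  shows "bounded (approx_set \<tau> i :: 'p::prime_card padic set)"
    and "diameter (approx_set \<tau> i :: 'p padic set) \<le> approx_radius TYPE('p) \<tau> i"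
    and "(approx_set \<tau> i :: 'p padic set) \<noteq> {} \<Longrightarrow> 1 < \<tau> \<Longrightarrow> approx_radius TYPE('p) \<tau> i \<le> height TYPE('p) i powr (1 - \<tau>)"
proof -
  obtain v q r where i: "i = (v, q, r)" by (rule prod_cases3)
  let ?\<rho> = "approx_radius TYPE('p) \<tau> i"
  have rho0: "0 \<le> ?\<rho>" by (simp add: approx_radius_def)
  have dist: "dist x y \<le> ?\<rho>" if "x \<in> approx_set \<tau> i" "y \<in> approx_set \<tau> i" for x y :: "'p padic"
  proof -
    have nd: "\<not> int CARD('p) dvd q" using that by (simp add: approx_set_def i)
    then have "padic_abs (of_int q :: 'p padic) = 1"
      by (cases "q = 0") (auto simp: pabs_int_def not_dvd_imp_multiplicity_0)
    then have "padic_abs (of_int (int CARD('p) ^ v * q) :: 'p padic) = (1 / real CARD('p)) ^ v"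
      by (simp add: padic_abs_mult del: padic_abs_of_int)
    moreover have "padic_abs ((x - y) * of_int (int CARD('p) ^ v * q)) \<le> height TYPE('p) i powr (- \<tau>)"
    proof -
      have eq: "(x - y) * of_int (int CARD('p) ^ v * q) = (x * of_int (int CARD('p) ^ v * q) - of_int (int CARD('p) ^ v * r))
          - (y * of_int (int CARD('p) ^ v * q) - of_int (int CARD('p) ^ v * r))" by (simp add: algebra_simps)
      have le: "padic_abs (x * of_int (int CARD('p) ^ v * q) - of_int (int CARD('p) ^ v * r)) \<le> height TYPE('p) i powr (- \<tau>)"
        "padic_abs (y * of_int (int CARD('p) ^ v * q) - of_int (int CARD('p) ^ v * r)) \<le> height TYPE('p) i powr (- \<tau>)"
        using that unfolding approx_set_def height_def i prod.case mem_Collect_eq by blast+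
      show ?thesis
        unfolding eq by (rule order_trans[OF padic_abs_ultra_diff max.boundedI[OF le]])
    qed
    ultimately have "padic_abs (x - y) * (1 / real CARD('p)) ^ v \<le> height TYPE('p) i powr (- \<tau>)"
      by (simp only: padic_abs_mult)
    then show ?thesis by (simp add: dist_padic_def approx_radius_def i power_divide divide_le_eq mult.commute)
  qed
  show "bounded (approx_set \<tau> i :: 'p padic set)"
    unfolding bounded_def using dist by (meson ex_in_conv)
  show "diameter (approx_set \<tau> i :: 'p padic set) \<le> ?\<rho>"
    unfolding diameter_def using rho0 dist by (auto intro!: cSUP_least)
  assume "(approx_set \<tau> i :: 'p padic set) \<noteq> {}" "1 < \<tau>"
  then have nd: "\<not> int CARD('p) dvd q" by (auto simp: approx_set_def i)
  have h: "1 \<le> height TYPE('p) i" using height_ge(2)[OF nd] by (simp add: i)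
  have "?\<rho> \<le> height TYPE('p) i * height TYPE('p) i powr (- \<tau>)"
    unfolding approx_radius_def using height_ge(1)[OF nd, of v r] by (intro mult_right_mono) (auto simp: i)
  also have "\<dots> = height TYPE('p) i powr (1 - \<tau>)" using h by (simp add: powr_diff powr_minus_divide)
  finally show "?\<rho> \<le> height TYPE('p) i powr (1 - \<tau>)" .
qed

text \<open>For integral x and p^v exactly dividing q, both |x q| and the error are at most p^(-v),
  so p^v divides r as well and can be split off from both. Infinitely many solutions leave any box,
  which makes the height arbitrarily large.\<close>

lemma well_approximable_covered:
  fixes x :: "'p::prime_card padic"
  assumes x: "x \<in> well_approximable \<tau>" and \<tau>: "1 < \<tau>"
  shows "\<exists>i. x \<in> approx_set \<tau> i \<and> real J \<le> height TYPE('p) i"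
proof -
  let ?S = "{(q :: int, r :: int). padic_abs (x * of_int q - of_int r) \<le> real_of_int (max \<bar>q\<bar> \<bar>r\<bar>) powr (- \<tau>)}"
  have x1: "padic_abs x \<le> 1" and inf: "infinite ?S" using x by (auto simp: well_approximable_def)
  have "finite ({- int J..int J} \<times> {- int J..int J} :: (int \<times> int) set)" by simp
  \<comment> \<open>The three removed pairs are solutions with q = 0: (0, 0) because 0 to any real
    power is 0 here, and (0, 1), (0, -1) with equality. Other r are excluded below by |r|_p \<ge>
    1/|r|.\<close>
  then have "\<not> ?S \<subseteq> insert (0, 0) (insert (0, 1) (insert (0, - 1) ({- int J..int J} \<times> {- int J..int J})))"
    using inf by (meson finite_insert finite_subset)
  then obtain z where z: "z \<in> ?S" "z \<notin> insert (0, 0) (insert (0, 1) (insert (0, - 1) ({- int J..int J} \<times> {- int J..int J})))"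
    unfolding subset_iff by blast
  obtain q r where qr_eq: "z = (q, r)" by (rule prod.exhaust)
  have qr: "(q, r) \<in> ?S" "(q, r) \<notin> {- int J..int J} \<times> {- int J..int J}"
    "(q, r) \<noteq> (0, 0)" "(q, r) \<noteq> (0, 1)" "(q, r) \<noteq> (0, - 1)"
    using z unfolding qr_eq insert_iff de_Morgan_disj by blast+
  define h where "h = real_of_int (max \<bar>q\<bar> \<bar>r\<bar>)"
  have le: "padic_abs (x * of_int q - of_int r) \<le> h powr (- \<tau>)" using qr(1) by (simp add: h_def)
  have hJ: "real J \<le> h" using qr(2) by (auto simp: h_def)
  have abs_ge: "1 / \<bar>real_of_int a\<bar> \<le> padic_abs (of_int a :: 'p padic)" if "a \<noteq> 0" for a
  proof -
    let ?m = "multiplicity (int CARD('p)) a"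
    have "int CARD('p) ^ ?m \<le> \<bar>a\<bar>" using dvd_imp_le_int[OF that multiplicity_dvd[of "int CARD('p)"]] by simp
    then have "real_of_int (int CARD('p) ^ ?m) \<le> real_of_int \<bar>a\<bar>" by (simp only: of_int_le_iff)
    then have "real CARD('p) ^ ?m \<le> \<bar>real_of_int a\<bar>" by simp
    then have "1 / \<bar>real_of_int a\<bar> \<le> 1 / real CARD('p) ^ ?m" by (intro divide_left_mono) (use that in auto)
    then show ?thesis using that by (simp add: pabs_int_def power_divide)
  qed
  have small: "h powr (- \<tau>) < 1 / h" if "2 \<le> h"
  proof -
    have "h powr (- \<tau>) < h powr (- 1)" using that \<tau> by (intro powr_less_mono) auto
    then show ?thesis using that by (simp add: powr_minus_divide)
  qed
  have q0: "q \<noteq> 0"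
  proof
    assume q: "q = 0"
    then have r: "2 \<le> \<bar>r\<bar>" using qr by auto
    then have h: "h = \<bar>real_of_int r\<bar>" "2 \<le> h" by (auto simp: h_def q)
    have "1 / h \<le> padic_abs (of_int r :: 'p padic)" using abs_ge[of r] r h by auto
    then show False using le small[OF h(2)] by (simp add: q)
  qed
  define v where "v = multiplicity (int CARD('p)) q"
  have pv: "int CARD('p) ^ v dvd q" unfolding v_def by (rule multiplicity_dvd)
  then obtain q' where q': "q = int CARD('p) ^ v * q'" by blast
  have nd: "\<not> int CARD('p) dvd q'"
  proof
    assume "int CARD('p) dvd q'"
    then have "int CARD('p) ^ Suc v dvd q" unfolding q' by (simp add: mult.commute mult_dvd_mono)
    then show False
      using q0 CARD_gt_1[where 'p = 'p] unfolding v_def by (subst (asm) power_dvd_iff_le_multiplicity) auto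
  qed
  have hv: "real CARD('p) ^ v \<le> h"
  proof -
    have "int CARD('p) ^ v \<le> \<bar>q\<bar>" using dvd_imp_le_int[OF q0 pv] by simp
    then have "real_of_int (int CARD('p) ^ v) \<le> real_of_int \<bar>q\<bar>" by (simp only: of_int_le_iff)
    then show ?thesis by (simp add: h_def)
  qed
  have "int CARD('p) ^ v dvd r"
  proof -
    have "1 \<le> real CARD('p) ^ v" using CARD_gt_1[where 'p = 'p] by (intro one_le_power) auto
    then have h1: "1 \<le> h" using hv by linarith
    have "padic_abs (of_int q :: 'p padic) \<le> (1 / real CARD('p)) ^ v"
      using pv by (simp only: padic_abs_of_int_le_iff)
    then have "padic_abs (x * of_int q) \<le> 1 * (1 / real CARD('p)) ^ v"
      unfolding padic_abs_mult using x1 by (intro mult_mono) auto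
    moreover have "h powr (- \<tau>) \<le> (1 / real CARD('p)) ^ v"
    proof -
      have "h powr (- \<tau>) \<le> h powr (- 1)" using h1 \<tau> by (intro powr_mono) auto
      also have "\<dots> = 1 / h" using h1 by (simp add: powr_minus_divide)
      also have "\<dots> \<le> 1 / real CARD('p) ^ v" using hv h1 by (intro divide_left_mono) auto
      finally show ?thesis by (simp add: power_divide)
    qed
    ultimately have "padic_abs (of_int r :: 'p padic) \<le> (1 / real CARD('p)) ^ v"
      using padic_abs_ultra_diff[of "x * of_int q" "x * of_int q - of_int r"] le by simp
    then show ?thesis by (simp only: padic_abs_of_int_le_iff)
  qed
  then obtain r' where r': "r = int CARD('p) ^ v * r'" by blast
  have "max \<bar>q\<bar> \<bar>r\<bar> = int CARD('p) ^ v * max \<bar>q'\<bar> \<bar>r'\<bar>"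
    unfolding q' r' by (simp add: abs_mult max_def)
  then have h: "height TYPE('p) (v, q', r') = h"
    by (simp add: height_def h_def)
  have "x \<in> approx_set \<tau> (v, q', r')"
    using nd le h by (simp add: approx_set_def height_def q' r')
  then show ?thesis using h hJ by (intro exI[of _ "(v, q', r')"]) simp
qed

lemma nn_integral_count_space_int_le:
  fixes g :: "int \<Rightarrow> ennreal"
  shows "(\<integral>\<^sup>+q. g q \<partial>count_space UNIV) \<le> (\<Sum>n. g (int n)) + (\<Sum>n. g (- int n))"
proof -
  have image: "(\<integral>\<^sup>+q. g q * indicator (range h) q \<partial>count_space UNIV) = (\<Sum>n. g (h n))" if "inj h" for h :: "nat \<Rightarrow> int"
  proof -
    have "(\<integral>\<^sup>+q. g q * indicator (range h) q \<partial>count_space UNIV) = (\<integral>\<^sup>+q. g q \<partial>count_space (range h))"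
      by (simp add: nn_integral_count_space_indicator)
    also have "\<dots> = (\<integral>\<^sup>+n. g (h n) \<partial>count_space UNIV)"
      by (rule nn_integral_bij_count_space[symmetric]) (simp add: bij_betw_def that)
    finally show ?thesis by (simp add: nn_integral_count_space_nat)
  qed
  have "(\<integral>\<^sup>+q. g q \<partial>count_space UNIV)
      \<le> (\<integral>\<^sup>+q. g q * indicator (range int) q + g q * indicator (range (\<lambda>n. - int n)) q \<partial>count_space UNIV)"
  proof (rule nn_integral_mono)
    fix q :: int
    show "g q \<le> g q * indicator (range int) q + g q * indicator (range (\<lambda>n. - int n)) q"
    proof (cases q rule: int_cases2)
      case (nonneg n)
      then show ?thesis by (simp add: indicator_def)
    next
      case (nonpos n)
      then have "q \<in> range (\<lambda>n. - int n)" by blast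
      then show ?thesis by simp
    qed
  qed
  also have "\<dots> = (\<Sum>n. g (int n)) + (\<Sum>n. g (- int n))"
    by (subst nn_integral_add) (auto simp: image inj_on_def)
  finally show ?thesis .
qed

lemma nn_integral_powr_int_finite:
  assumes "1 < a"
  shows "(\<integral>\<^sup>+q. ennreal ((1 + \<bar>real_of_int q\<bar>) powr (- a)) \<partial>count_space UNIV) < \<infinity>"
proof -
  have "summable (\<lambda>n. real n powr (- a))" using assms by (simp add: summable_real_powr_iff)
  then have "summable (\<lambda>n. real (Suc n) powr (- a))" by (subst summable_Suc_iff)
  then have "summable (\<lambda>n. (1 + \<bar>real_of_int (int n)\<bar>) powr (- a))" by simp
  then have fin: "(\<Sum>n. ennreal ((1 + \<bar>real_of_int (int n)\<bar>) powr (- a))) < \<infinity>"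
    by (simp add: suminf_ennreal2)
  have "(\<integral>\<^sup>+q. ennreal ((1 + \<bar>real_of_int q\<bar>) powr (- a)) \<partial>count_space UNIV)
      \<le> (\<Sum>n. ennreal ((1 + \<bar>real_of_int (int n)\<bar>) powr (- a))) + (\<Sum>n. ennreal ((1 + \<bar>real_of_int (- int n)\<bar>) powr (- a)))"
    by (rule nn_integral_count_space_int_le)
  also have "\<dots> < \<infinity>" using fin by simp
  finally show ?thesis .
qed

text \<open>The inequality (1 + |q|)(1 + |r|) \<le> 4 max(|q|, |r|)^2 separates the variables. The
  sum over all fractions then factors into a geometric series in v and two copies of the sum of (1 +
  |q|)^(-\<tau> s/2), which converges for s > 2/\<tau>.\<close>

lemma approx_set_powr_le:
  fixes v :: nat and q r :: int
  assumes \<tau>: "1 < \<tau>" and s: "0 < s"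
  shows "diameter (approx_set \<tau> (v, q, r) :: 'p::prime_card padic set) powr s \<le>
    4 powr (\<tau> * s / 2) * (real CARD('p) powr (- (\<tau> - 1) * s)) ^ v *
    ((1 + \<bar>real_of_int q\<bar>) powr (- (\<tau> * s / 2)) * (1 + \<bar>real_of_int r\<bar>) powr (- (\<tau> * s / 2)))"
proof (cases "(approx_set \<tau> (v, q, r) :: 'p padic set) = {}")
  case False
  then have nd: "\<not> int CARD('p) dvd q" by (auto simp: approx_set_def)
  define a where "a = \<tau> * s / 2"
  define x where "x = real_of_int (max \<bar>q\<bar> \<bar>r\<bar>)"
  let ?p = "real CARD('p)"
  have a: "0 < a" using \<tau> s by (simp add: a_def)
  have "q \<noteq> 0" using nd by auto
  then have x1: "1 \<le> x" by (simp add: x_def)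
  have "(1 + \<bar>real_of_int q\<bar>) * (1 + \<bar>real_of_int r\<bar>) \<le> (2 * x) * (2 * x)"
    using x1 by (intro mult_mono) (auto simp: x_def)
  then have le: "(1 + \<bar>real_of_int q\<bar>) * (1 + \<bar>real_of_int r\<bar>) / 4 \<le> x\<^sup>2" by (simp add: power2_eq_square)
  have pos: "0 < (1 + \<bar>real_of_int q\<bar>) * (1 + \<bar>real_of_int r\<bar>) / 4"
    by (intro divide_pos_pos mult_pos_pos) (auto simp: add_pos_nonneg)
  have "x powr (- \<tau> * s) = (x\<^sup>2) powr (- a)"
    using x1 by (simp add: a_def powr_powr flip: powr_numeral)
  also have "\<dots> \<le> ((1 + \<bar>real_of_int q\<bar>) * (1 + \<bar>real_of_int r\<bar>) / 4) powr (- a)"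
    using a pos le by (intro powr_mono2') auto
  also have "\<dots> = (1 + \<bar>real_of_int q\<bar>) powr (- a) * (1 + \<bar>real_of_int r\<bar>) powr (- a) * 4 powr a"
    by (simp add: powr_divide powr_mult powr_minus_divide)
  finally have x_le: "x powr (- \<tau> * s) \<le> (1 + \<bar>real_of_int q\<bar>) powr (- a) * (1 + \<bar>real_of_int r\<bar>) powr (- a) * 4 powr a" .
  have "diameter (approx_set \<tau> (v, q, r) :: 'p padic set) powr s \<le> approx_radius TYPE('p) \<tau> (v, q, r) powr s"
    using s by (intro powr_mono2 approx_set_diameter diameter_ge_0) auto
  also have "approx_radius TYPE('p) \<tau> (v, q, r) powr s = ?p powr (real v * s) * (?p powr (real v * (- \<tau> * s)) * x powr (- \<tau> * s))"
    using x1 by (simp add: approx_radius_def height_def x_def powr_mult powr_powr mult.assoc flip: powr_realpow)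
  also have "\<dots> = (?p powr (- (\<tau> - 1) * s)) ^ v * x powr (- \<tau> * s)"
  proof -
    have "?p powr (real v * s) * ?p powr (real v * (- \<tau> * s)) = (?p powr (- (\<tau> - 1) * s)) ^ v"
      by (simp add: powr_power algebra_simps flip: powr_add)
    then show ?thesis by (simp only: mult.assoc[symmetric])
  qed
  also have "\<dots> \<le> (?p powr (- (\<tau> - 1) * s)) ^ v *
      ((1 + \<bar>real_of_int q\<bar>) powr (- a) * (1 + \<bar>real_of_int r\<bar>) powr (- a) * 4 powr a)"
    by (intro mult_left_mono x_le) simp
  finally show ?thesis by (simp add: a_def mult_ac)
qed (simp add: diameter_def)

lemma nn_integral_approx_set_finite:
  assumes \<tau>: "1 < \<tau>" and s: "2 / \<tau> < s"
  shows "(\<integral>\<^sup>+i. ennreal (diameter (approx_set \<tau> i :: 'p::prime_card padic set) powr s) \<partial>count_space UNIV) < \<infinity>"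
proof -
  define a where "a = \<tau> * s / 2"
  have a: "1 < a" using assms by (simp add: a_def field_simps)
  have s0: "0 < s" using assms by (meson divide_pos_pos less_trans zero_less_numeral zero_less_one)
  define u where "u = real CARD('p) powr (- (\<tau> - 1) * s)"
  define g where "g q = ennreal ((1 + \<bar>real_of_int q\<bar>) powr (- a))" for q :: int
  have "real CARD('p) powr (- (\<tau> - 1) * s) < real CARD('p) powr 0"
    using \<tau> s0 by (intro powr_less_mono real_CARD_gt_1) (simp add: mult_neg_pos)
  then have u: "0 < u" "u < 1" by (auto simp: u_def)
  have "(\<integral>\<^sup>+i. ennreal (diameter (approx_set \<tau> i :: 'p padic set) powr s) \<partial>count_space UNIV)
      \<le> (\<integral>\<^sup>+(v, q, r). ennreal (4 powr a * u ^ v) * (g q * g r) \<partial>count_space UNIV)"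
  proof (rule nn_integral_mono)
    fix i :: "nat \<times> int \<times> int"
    obtain v q r where i: "i = (v, q, r)" by (rule prod_cases3)
    have "ennreal (diameter (approx_set \<tau> i :: 'p padic set) powr s) \<le> ennreal (4 powr a * u ^ v *
        ((1 + \<bar>real_of_int q\<bar>) powr (- a) * (1 + \<bar>real_of_int r\<bar>) powr (- a)))"
      unfolding i a_def u_def by (intro ennreal_leI approx_set_powr_le \<tau> s0)
    then show "ennreal (diameter (approx_set \<tau> i :: 'p padic set) powr s)
        \<le> (case i of (v, q, r) \<Rightarrow> ennreal (4 powr a * u ^ v) * (g q * g r))"
      using u by (simp add: i g_def ennreal_mult)
  qed
  also have "\<dots> = (\<integral>\<^sup>+v. \<integral>\<^sup>+q. \<integral>\<^sup>+r. ennreal (4 powr a * u ^ v) * (g q * g r)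
      \<partial>count_space UNIV \<partial>count_space UNIV \<partial>count_space UNIV)"
    by (simp add: nn_integral_fst_count_space[symmetric] case_prod_unfold)
  also have "\<dots> = (\<integral>\<^sup>+v. ennreal (4 powr a * u ^ v) \<partial>count_space UNIV) *
      ((\<integral>\<^sup>+q. g q \<partial>count_space UNIV) * (\<integral>\<^sup>+r. g r \<partial>count_space UNIV))"
    by (simp add: nn_integral_cmult nn_integral_multc)
  also have "\<dots> < \<infinity>"
  proof -
    have "(\<integral>\<^sup>+v. ennreal (4 powr a * u ^ v) \<partial>count_space UNIV) = (\<Sum>v. ennreal (4 powr a * u ^ v))"
      by (rule nn_integral_count_space_nat)
    also have "\<dots> < \<infinity>"
      using u by (subst suminf_ennreal2) (auto intro!: summable_mult summable_geometric)
    finally have "(\<integral>\<^sup>+v. ennreal (4 powr a * u ^ v) \<partial>count_space UNIV) < \<infinity>" .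
    moreover have "(\<integral>\<^sup>+q. g q \<partial>count_space UNIV) < \<infinity>"
      unfolding g_def by (rule nn_integral_powr_int_finite[OF a])
    ultimately show ?thesis by (simp add: ennreal_mult_less_top)
  qed
  finally show ?thesis .
qed

lemma hausdorff_measure_well_approximable:
  assumes \<tau>: "1 < \<tau>" and s': "2 / \<tau> < s'"
  shows "hausdorff_measure s' (well_approximable \<tau> :: 'p::prime_card padic set) = 0"
proof -
  \<comment> \<open>The covering series already converges at this smaller exponent. The surplus s' -
    s, applied to diameters at most J^(1 - \<tau>), yields a factor tending to 0, so tails of the
    series need not be estimated.\<close>
  define s where "s = (s' + 2 / \<tau>) / 2"
  have s: "2 / \<tau> < s" "s < s'" using s' by (auto simp: s_def)
  have s0: "0 < s" using s(1) \<tau> by (meson divide_pos_pos less_trans zero_less_numeral zero_less_one)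
  define e where "e = (\<tau> - 1) * (s' - s)"
  have e: "0 < e" using \<tau> s by (simp add: e_def)
  define Z where "Z = (\<integral>\<^sup>+i. ennreal (diameter (approx_set \<tau> i :: 'p padic set) powr s) \<partial>count_space UNIV)"
  obtain c where c: "0 \<le> c" "Z = ennreal c"
    using nn_integral_approx_set_finite[OF \<tau> s(1), where 'p = 'p] unfolding Z_def[symmetric]
    by (cases Z) auto
  have "hausdorff_premeasure s' \<delta> (well_approximable \<tau> :: 'p padic set) = 0" if \<delta>: "0 < \<delta>" for \<delta>
  proof -
    let ?h = "hausdorff_premeasure s' \<delta> (well_approximable \<tau> :: 'p padic set)"
    have lim: "((\<lambda>J. real J powr (1 - \<tau>)) \<longlongrightarrow> 0) sequentially"
      using \<tau> by real_asymp
    obtain J0 where J0: "\<And>J. J0 \<le> J \<Longrightarrow> real J powr (1 - \<tau>) < \<delta>"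
      using order_tendstoD(2)[OF lim \<delta>] unfolding eventually_sequentially by blast
    have le: "?h \<le> ennreal (real J powr (- e) * c)" if J: "max 1 J0 \<le> J" for J
    proof -
      define U where "U i = (if real J \<le> height TYPE('p) i then approx_set \<tau> i else {} :: 'p padic set)" for i
      have J1: "1 \<le> real J" using J by simp
      have rad: "diameter (U i) \<le> real J powr (1 - \<tau>)" for i
      proof (cases "U i = {}")
        case False
        then have U: "U i = approx_set \<tau> i" "real J \<le> height TYPE('p) i" by (auto simp: U_def split: if_splits)
        have "diameter (U i) \<le> approx_radius TYPE('p) \<tau> i" unfolding U by (rule approx_set_diameter)
        also have "\<dots> \<le> height TYPE('p) i powr (1 - \<tau>)" using False \<tau> unfolding U by (intro approx_set_diameter)
        also have "\<dots> \<le> real J powr (1 - \<tau>)" using U(2) J1 \<tau> by (intro powr_mono2') auto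
        finally show ?thesis .
      qed (simp add: diameter_def)
      have bdd: "bounded (U i)" for i by (simp add: U_def approx_set_diameter)
      have pow: "diameter (U i) powr s' \<le> real J powr (- e) * diameter (approx_set \<tau> i :: 'p padic set) powr s" for i
      proof (cases "U i = {}")
        case False
        then have U: "U i = approx_set \<tau> i" by (auto simp: U_def split: if_splits)
        have d0: "0 \<le> diameter (U i)" by (rule diameter_ge_0[OF bdd])
        have "diameter (U i) powr s' = diameter (U i) powr (s' - s) * diameter (U i) powr s"
          by (simp flip: powr_add)
        also have "\<dots> \<le> (real J powr (1 - \<tau>)) powr (s' - s) * diameter (U i) powr s"
          using d0 rad s by (intro mult_right_mono powr_mono2) auto
        also have "(real J powr (1 - \<tau>)) powr (s' - s) = real J powr (- e)"
          by (simp add: e_def powr_powr algebra_simps)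
        finally show ?thesis by (simp add: U)
      qed (simp add: diameter_def)
      have "?h \<le> (\<Sum>n. ennreal (diameter (enum_family U n) powr s'))"
      proof (rule hausdorff_premeasure_le)
        show "well_approximable \<tau> \<subseteq> (\<Union>n. enum_family U n)"
        proof
          fix x :: "'p padic" assume "x \<in> well_approximable \<tau>"
          then obtain i where "x \<in> approx_set \<tau> i" "real J \<le> height TYPE('p) i"
            using well_approximable_covered[OF _ \<tau>] by blast
          then have "x \<in> enum_family U (to_nat i)" by (simp add: enum_family_def U_def)
          then show "x \<in> (\<Union>n. enum_family U n)" by blast
        qed
        show "bounded (enum_family U n)" for n using bdd by (simp add: enum_family_def)
        show "diameter (enum_family U n) \<le> \<delta>" for n
          using rad[of "from_nat n"] J0[of J] J \<delta> by (simp add: enum_family_def diameter_def[of "{}"])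
      qed
      also have "\<dots> = (\<integral>\<^sup>+i. ennreal (diameter (U i) powr s') \<partial>count_space UNIV)"
        by (rule suminf_enum_family[where g = "\<lambda>A. ennreal (diameter A powr s')"]) (simp add: diameter_def)
      also have "\<dots> \<le> (\<integral>\<^sup>+i. ennreal (real J powr (- e)) * ennreal (diameter (approx_set \<tau> i :: 'p padic set) powr s) \<partial>count_space UNIV)"
        by (intro nn_integral_mono) (simp add: pow ennreal_leI flip: ennreal_mult)
      also have "\<dots> = ennreal (real J powr (- e)) * Z"
        unfolding Z_def by (rule nn_integral_cmult) simp
      finally show ?thesis using c by (simp add: ennreal_mult)
    qed
    have "(\<lambda>J. real J powr (- e) * c) \<longlonglongrightarrow> 0" using e by real_asymp
    then have "(\<lambda>J. ennreal (real J powr (- e) * c)) \<longlonglongrightarrow> ennreal 0" by (rule tendsto_ennrealI)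
    then have "?h \<le> ennreal 0" by (rule LIMSEQ_le_const) (use le in blast)
    then show ?thesis by simp
  qed
  then show ?thesis unfolding hausdorff_measure_def by simp
qed

theorem hausdorff_dim_well_approximable_le:
  assumes \<tau>: "1 < \<tau>"
  shows "hausdorff_dim (well_approximable \<tau> :: 'p::prime_card padic set) \<le> ennreal (2 / \<tau>)"
proof (rule ennreal_le_epsilon)
  fix e :: real assume e: "0 < e"
  have "0 < 2 / \<tau> + e" using \<tau> e by (simp add: add_pos_pos)
  then have "hausdorff_dim (well_approximable \<tau> :: 'p padic set) \<le> ennreal (2 / \<tau> + e)"
    using \<tau> e by (intro hausdorff_dim_le hausdorff_measure_well_approximable) auto
  then show "hausdorff_dim (well_approximable \<tau> :: 'p padic set) \<le> ennreal (2 / \<tau>) + ennreal e"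
    using \<tau> e by simp
qed

section \<open>The Hausdorff dimension dominates the Fourier dimension\<close>

lemma hausdorff_premeasure_less_cover:
  assumes "hausdorff_premeasure s \<delta> A < e"
  obtains U where "A \<subseteq> (\<Union>i. U i)" "\<And>i. bounded (U i)" "\<And>i. diameter (U i) \<le> \<delta>"
    "(\<Sum>i. ennreal (diameter (U i) powr s)) < e"
  using assms unfolding hausdorff_premeasure_def INF_less_iff by auto

text \<open>The mass distribution principle. The ball condition is assumed only for centres in a
  part S of positive mass, since Fourier decay controls the mass of balls only on average.\<close>

lemma hausdorff_measure_pos:
  fixes M :: "'a::metric_space measure"
  assumes M: "finite_measure M" "sets M = sets borel"
    and S: "S \<in> sets borel" "S \<subseteq> A" "0 < measure M S" and s: "0 < s"
    and K: "\<And>x r. x \<in> S \<Longrightarrow> 0 < r \<Longrightarrow> r \<le> 1 \<Longrightarrow> measure M (cball x r) \<le> K * r powr s"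
  shows "hausdorff_measure s A \<noteq> 0"
proof
  interpret finite_measure M by fact
  assume 0: "hausdorff_measure s A = 0"
  have K0: "0 \<le> K"
  proof -
    have "S \<noteq> {}" using S(3) by auto
    then obtain x where "x \<in> S" by blast
    then show ?thesis using K[of x 1] measure_nonneg[of M "cball x 1"] by (simp del: measure_nonneg)
  qed
  \<comment> \<open>A covering of total size e would give S at most half of its mass; K + 1 rather
    than K allows for K = 0.\<close>
  define e where "e = measure M S / (2 * (K + 1))"
  have e: "0 < e" using S(3) K0 by (simp add: e_def)
  have "hausdorff_premeasure s 1 A \<le> hausdorff_measure s A"
    unfolding hausdorff_measure_def by (rule SUP_upper) simp
  then have "hausdorff_premeasure s 1 A < ennreal e" using 0 e by simp
  then obtain U where U: "A \<subseteq> (\<Union>i. U i)" "\<And>i. bounded (U i)" "\<And>i. diameter (U i) \<le> 1"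
    "(\<Sum>i. ennreal (diameter (U i) powr s)) < ennreal e" by (rule hausdorff_premeasure_less_cover) blast
  \<comment> \<open>Covering sets may have diameter 0, and the ball condition speaks of positive
    radii only; the limit of small radii shows that points carry no mass.\<close>
  have ball: "measure M (cball x d) \<le> K * d powr s" if "x \<in> S" "0 \<le> d" "d \<le> 1" for x d
  proof (cases "d = 0")
    case True
    have "(\<lambda>n. K * (1 / real (Suc n)) powr s) \<longlonglongrightarrow> 0" using s by real_asymp
    moreover have "measure M (cball x 0) \<le> K * (1 / real (Suc n)) powr s" for n
    proof -
      have "measure M (cball x 0) \<le> measure M (cball x (1 / real (Suc n)))"
        by (rule finite_measure_mono) (auto simp: M(2))
      also have "\<dots> \<le> K * (1 / real (Suc n)) powr s" by (rule K[OF that(1)]) auto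
      finally show ?thesis .
    qed
    ultimately have "measure M (cball x 0) \<le> 0" by (intro LIMSEQ_le_const) auto
    then show ?thesis using True by simp
  qed (use that K in auto)
  \<comment> \<open>Covering sets need not be measurable. Each is replaced by a ball of radius its
    diameter, centred at one of its points in S, where the ball condition is available.\<close>
  define V where "V i = (if U i \<inter> S = {} then {} else cball (SOME x. x \<in> U i \<inter> S) (diameter (U i)))" for i
  have V: "U i \<inter> S \<subseteq> V i \<and> measure M (V i) \<le> K * diameter (U i) powr s" for i
  proof (cases "U i \<inter> S = {}")
    case True
    then show ?thesis using K0 by (simp add: V_def)
  next
    case False
    define x where "x = (SOME x. x \<in> U i \<inter> S)"
    have "\<exists>x. x \<in> U i \<inter> S" using False by blast
    then have x: "x \<in> U i \<inter> S" unfolding x_def by (rule someI_ex)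
    have Vx: "V i = cball x (diameter (U i))" using False by (simp add: V_def x_def)
    have "dist x y \<le> diameter (U i)" if "y \<in> U i" for y
      using x that by (intro diameter_bounded_bound U) auto
    moreover have "measure M (V i) \<le> K * diameter (U i) powr s"
      unfolding Vx using x by (intro ball diameter_ge_0 U) auto
    ultimately show ?thesis unfolding Vx by auto
  qed
  have Vm: "V i \<in> sets M" for i by (simp add: V_def M(2))
  have "emeasure M S \<le> emeasure M (\<Union>i. V i)"
  proof (rule emeasure_mono)
    show "S \<subseteq> (\<Union>i. V i)"
    proof
      fix x assume "x \<in> S"
      then obtain i where "x \<in> U i \<inter> S" using U(1) S(2) by blast
      then show "x \<in> (\<Union>i. V i)" using V[of i] by blast
    qed
  qed (use Vm in auto)
  also have "\<dots> \<le> (\<Sum>i. emeasure M (V i))" using Vm by (intro emeasure_subadditive_countably) auto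
  also have "\<dots> \<le> (\<Sum>i. ennreal K * ennreal (diameter (U i) powr s))"
  proof (intro suminf_le allI)
    fix i
    show "emeasure M (V i) \<le> ennreal K * ennreal (diameter (U i) powr s)"
      using V[of i] K0 by (simp add: emeasure_eq_measure ennreal_leI flip: ennreal_mult)
  qed auto
  also have "\<dots> = ennreal K * (\<Sum>i. ennreal (diameter (U i) powr s))" by simp
  also have "\<dots> \<le> ennreal K * ennreal e" using U(4) by (intro mult_left_mono) auto
  also have "\<dots> = ennreal (K * e)" using K0 e by (simp add: ennreal_mult)
  finally have "measure M S \<le> K * e" using K0 e by (simp add: emeasure_eq_measure)
  also have "K * e \<le> (K + 1) * e" using e by simp
  also have "\<dots> = measure M S / 2" using K0 by (simp add: e_def field_simps)
  finally show False using S(3) by simp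
qed

text \<open>The complement of the support is the union of the null sets in a countable basis, hence
  open and null.\<close>

lemma closed_support_measure:
  fixes \<mu> :: "'a::{second_countable_topology, t2_space} measure"
  assumes "borel_prob \<mu>"
  shows "closed_support \<mu> \<in> sets borel" "measure \<mu> (closed_support \<mu>) = 1"
proof -
  interpret prob_space \<mu> using assms by (simp add: borel_prob_def)
  have sets: "sets \<mu> = sets borel" using assms by (simp add: borel_prob_def)
  obtain B :: "'a set set" where B: "countable B" "topological_basis B" using ex_countable_basis by blast
  define N where "N = {U \<in> B. emeasure \<mu> U = 0}"
  have open_B: "open U" if "U \<in> N" for U using that B(2) topological_basis_open by (auto simp: N_def)
  have eq: "closed_support \<mu> = - \<Union>N"
  proof (intro equalityI subsetI)
    fix x assume x: "x \<in> closed_support \<mu>"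
    show "x \<in> - \<Union>N"
    proof
      assume "x \<in> \<Union>N"
      then obtain U where "U \<in> N" "x \<in> U" by blast
      then have "emeasure \<mu> U > 0" using x open_B by (auto simp: closed_support_def)
      then show False using \<open>U \<in> N\<close> by (simp add: N_def)
    qed
  next
    fix x assume x: "x \<in> - \<Union>N"
    show "x \<in> closed_support \<mu>"
      unfolding closed_support_def
    proof (intro CollectI allI impI, elim conjE)
      fix U assume U: "open U" "x \<in> U"
      then obtain V where V: "V \<in> B" "x \<in> V" "V \<subseteq> U" using topological_basisE[OF B(2)] by metis
      then have "emeasure \<mu> V \<noteq> 0" using x by (auto simp: N_def)
      moreover have "emeasure \<mu> V \<le> emeasure \<mu> U" using U V by (intro emeasure_mono) (auto simp: sets)
      ultimately show "0 < emeasure \<mu> U" by (metis le_zero_eq not_gr_zero)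
    qed
  qed
  have "open (\<Union>N)" using open_B by (intro open_Union) blast
  then show "closed_support \<mu> \<in> sets borel" unfolding eq by (intro borel_closed) auto
  have "countable N" unfolding N_def using B(1) by (rule countable_subset[rotated]) blast
  moreover have "U \<in> null_sets \<mu>" if "U \<in> N" for U
    using that open_B[OF that] by (auto simp: null_sets_def sets N_def)
  ultimately have "(\<Union>U\<in>N. U) \<in> null_sets \<mu>" by (rule null_sets_UN')
  then have "measure \<mu> (\<Union>N) = 0" by (simp add: measure_eq_0_null_sets)
  moreover have "closed_support \<mu> = space \<mu> - \<Union>N"
    unfolding eq using sets_eq_imp_space_eq[OF sets] by auto
  ultimately show "measure \<mu> (closed_support \<mu>) = 1"
    using prob_compl[of "\<Union>N"] \<open>open (\<Union>N)\<close> by (simp add: sets)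
qed

section \<open>Mean mass of balls in terms of the Fourier transform\<close>

lemma borel_measurable_measure_cball:
  fixes \<mu> :: "'p::prime_card padic measure"
  assumes r: "0 < r"
  shows "(\<lambda>x. measure \<mu> (cball x r)) \<in> borel_measurable borel"
proof -
  have "continuous_on UNIV (\<lambda>x. measure \<mu> (cball x r))"
    unfolding continuous_on_iff
  proof (intro ballI allI impI exI[of _ r] conjI r)
    fix x y :: "'p padic" and e :: real assume "0 < e" "dist y x < r"
    then have "cball y r = cball x r" by (intro cball_padic_eq) (simp add: dist_padic_def)
    then show "dist (measure \<mu> (cball y r)) (measure \<mu> (cball x r)) < e" using \<open>0 < e\<close> by simp
  qed
  then show ?thesis by (rule borel_measurable_continuous_onI)
qed

text \<open>For x and y in Z_p, the indicator of |x - y| \<le> p^(-l) is the mean of the characters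
  with frequencies a/p^l. Integrating it in y gives the mass of a ball, and integrating in x as well
  gives squared moduli of the transform.\<close>

lemma integral_measure_cball:
  fixes \<mu> :: "'p::prime_card padic measure"
  assumes \<mu>: "borel_prob \<mu>" and unit: "measure \<mu> (cball 0 1) = 1"
  shows "(\<integral>x. measure \<mu> (cball x ((1 / real CARD('p)) ^ l)) \<partial>\<mu>)
    = (\<Sum>a<CARD('p) ^ l. (cmod (fourier_measure \<mu> (of_nat a / of_nat CARD('p) ^ l)))\<^sup>2) / real CARD('p) ^ l"
proof -
  interpret M: prob_space \<mu> using \<mu> by (simp add: borel_prob_def)
  have sets [measurable_cong, simp]: "sets \<mu> = sets borel" using \<mu> by (simp add: borel_prob_def)
  let ?P = "of_nat CARD('p) ^ l :: 'p padic"
  let ?r = "(1 / real CARD('p)) ^ l"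
  define X where "X a = of_nat a / ?P" for a
  let ?F = "\<lambda>a. fourier_measure \<mu> (X a)"
  have AE1: "AE x in \<mu>. padic_abs x \<le> 1"
    using M.AE_prob_1[OF unit] by (simp add: cball_padic)
  have int: "integrable \<mu> (\<lambda>y. padic_char (y * \<xi>))" for \<xi>
    by (rule M.integrable_const_bound[where B = 1]) auto
  have int2: "integrable \<mu> (\<lambda>y. c * cnj (padic_char (y * \<xi>)))" and int3: "integrable \<mu> (\<lambda>y. padic_char (y * \<xi>) * c)" for c \<xi>
    by (intro integrable_mult_right integrable_mult_left Bochner_Integration.integrable_cnj int)+
  have kernel: "complex_of_real (indicat_real (cball x ?r) y)
      = (\<Sum>a<CARD('p) ^ l. padic_char (x * X a) * cnj (padic_char (y * X a))) / of_nat (CARD('p) ^ l)"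
    if "padic_abs x \<le> 1" "padic_abs y \<le> 1" for x y :: "'p padic"
  proof -
    let ?z = "(x - y) / ?P"
    have z: "padic_abs ?z = padic_abs (x - y) * real CARD('p) ^ l"
      by (simp add: padic_abs_divide power_divide)
    have "padic_abs (x - y) \<le> 1" using padic_abs_ultra_diff[of x y] that by simp
    then have "padic_abs ?z \<le> real CARD('p) ^ l" unfolding z by (simp add: mult_left_le_one_le)
    note sum = sum_padic_char[OF this]
    have iff: "padic_abs ?z \<le> 1 \<longleftrightarrow> y \<in> cball x ?r"
      unfolding z by (simp add: cball_padic power_divide pos_le_divide_eq)
    have "padic_char (x * X a) * cnj (padic_char (y * X a)) = padic_char (of_nat a * ?z)" for a
      by (simp add: X_def algebra_simps diff_divide_distrib flip: padic_char_diff)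
    then show ?thesis unfolding iff[symmetric] indicator_def using sum by simp
  qed
  have meas: "complex_of_real (measure \<mu> (cball x ?r)) = (\<Sum>a<CARD('p) ^ l. padic_char (x * X a) * cnj (?F a)) / of_nat (CARD('p) ^ l)"
    if x: "padic_abs x \<le> 1" for x
  proof -
    have "complex_of_real (measure \<mu> (cball x ?r)) = complex_of_real (\<integral>y. indicat_real (cball x ?r) y \<partial>\<mu>)"
      using sets_eq_imp_space_eq[OF sets] by simp
    also have "\<dots> = (\<integral>y. complex_of_real (indicat_real (cball x ?r) y) \<partial>\<mu>)" by (rule integral_complex_of_real[symmetric])
    also have "\<dots> = (\<integral>y. (\<Sum>a<CARD('p) ^ l. padic_char (x * X a) * cnj (padic_char (y * X a))) / of_nat (CARD('p) ^ l) \<partial>\<mu>)"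
    proof (rule integral_cong_AE)
      show "AE y in \<mu>. complex_of_real (indicat_real (cball x ?r) y)
          = (\<Sum>a<CARD('p) ^ l. padic_char (x * X a) * cnj (padic_char (y * X a))) / of_nat (CARD('p) ^ l)"
        using AE1 by eventually_elim (rule kernel[OF x])
      show "(\<lambda>y. complex_of_real (indicat_real (cball x ?r) y)) \<in> borel_measurable \<mu>"
        by (intro borel_measurable_of_real[THEN measurable_compose[rotated]] borel_measurable_indicator) simp
    qed (intro borel_measurable_integrable integrable_divide_zero Bochner_Integration.integrable_sum int2)
    also have "\<dots> = (\<Sum>a<CARD('p) ^ l. padic_char (x * X a) * (\<integral>y. cnj (padic_char (y * X a)) \<partial>\<mu>)) / of_nat (CARD('p) ^ l)"
      by (subst Bochner_Integration.integral_divide_zero, subst Bochner_Integration.integral_sum)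
        (rule int2, simp only: integral_mult_right_zero)
    finally show ?thesis by (simp only: Bochner_Integration.integral_cnj fourier_measure_def)
  qed
  have "complex_of_real (\<integral>x. measure \<mu> (cball x ?r) \<partial>\<mu>) = (\<integral>x. complex_of_real (measure \<mu> (cball x ?r)) \<partial>\<mu>)"
    by (rule integral_complex_of_real[symmetric])
  also have "\<dots> = (\<integral>x. (\<Sum>a<CARD('p) ^ l. padic_char (x * X a) * cnj (?F a)) / of_nat (CARD('p) ^ l) \<partial>\<mu>)"
  proof (rule integral_cong_AE)
    show "AE x in \<mu>. complex_of_real (measure \<mu> (cball x ?r)) = (\<Sum>a<CARD('p) ^ l. padic_char (x * X a) * cnj (?F a)) / of_nat (CARD('p) ^ l)"
      using AE1 by eventually_elim (rule meas)
    show "(\<lambda>x. complex_of_real (measure \<mu> (cball x ?r))) \<in> borel_measurable \<mu>"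
      using borel_measurable_measure_cball[of ?r \<mu>] by simp
  qed (intro borel_measurable_integrable integrable_divide_zero Bochner_Integration.integrable_sum int3)
  also have "\<dots> = (\<Sum>a<CARD('p) ^ l. (\<integral>x. padic_char (x * X a) \<partial>\<mu>) * cnj (?F a)) / of_nat (CARD('p) ^ l)"
    by (subst Bochner_Integration.integral_divide_zero, subst Bochner_Integration.integral_sum)
      (rule int3, simp only: integral_mult_left_zero)
  also have "\<dots> = (\<Sum>a<CARD('p) ^ l. ?F a * cnj (?F a)) / of_nat (CARD('p) ^ l)"
    by (simp only: fourier_measure_def)
  also have "\<dots> = complex_of_real ((\<Sum>a<CARD('p) ^ l. (cmod (?F a))\<^sup>2) / real CARD('p) ^ l)"
    by (simp only: complex_norm_square[symmetric] of_real_divide of_real_sum of_real_power of_real_of_nat_eq of_nat_power)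
  finally show ?thesis unfolding X_def by (simp only: of_real_eq_iff)
qed

text \<open>Multiples of p among the a reproduce the sum one level lower. The others are fewer than
  p^(l + 1) frequencies of absolute value exactly p^(l + 1), so each level adds one multiple of c,
  whence the factor linear in l.\<close>

lemma sum_fourier_sq_le:
  fixes \<mu> :: "'p::prime_card padic measure"
  assumes \<mu>: "borel_prob \<mu>" and \<beta>: "0 \<le> \<beta>" "\<beta> \<le> 1" and c: "0 \<le> c"
    and decay: "\<And>\<xi>. \<xi> \<noteq> 0 \<Longrightarrow> (cmod (fourier_measure \<mu> \<xi>))\<^sup>2 * padic_abs \<xi> powr \<beta> \<le> c"
  shows "(\<Sum>a<CARD('p) ^ l. (cmod (fourier_measure \<mu> (of_nat a / of_nat CARD('p) ^ l)))\<^sup>2)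
    \<le> (1 + c * real l) * real CARD('p) powr (real l * (1 - \<beta>))"
proof (induction l)
  case 0
  then show ?case
    using norm_fourier_measure_le_1[OF \<mu>, of 0] by (simp add: power_le_one)
next
  case (Suc l)
  let ?p = "CARD('p)"
  let ?F = "\<lambda>l a. (cmod (fourier_measure \<mu> (of_nat a / of_nat ?p ^ l)))\<^sup>2"
  let ?A = "(\<lambda>a. ?p * a) ` {..<?p ^ l}"
  let ?B = "{a \<in> {..<?p ^ Suc l}. \<not> ?p dvd a}"
  have split: "{..<?p ^ Suc l} = ?A \<union> ?B"
  proof (intro equalityI subsetI)
    fix a assume a: "a \<in> {..<?p ^ Suc l}"
    show "a \<in> ?A \<union> ?B"
    proof (cases "?p dvd a")
      case True
      then obtain a' where "a = ?p * a'" by blast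
      then show ?thesis using a by auto
    qed (use a in auto)
  qed auto
  have "(\<Sum>a<?p ^ Suc l. ?F (Suc l) a) = (\<Sum>a\<in>?A \<union> ?B. ?F (Suc l) a)"
    by (rule arg_cong[OF split])
  also have "\<dots> = (\<Sum>a\<in>?A. ?F (Suc l) a) + (\<Sum>a\<in>?B. ?F (Suc l) a)"
    by (rule sum.union_disjoint) auto
  also have "(\<Sum>a\<in>?A. ?F (Suc l) a) = (\<Sum>a<?p ^ l. ?F l a)"
    by (subst sum.reindex) (auto simp: inj_on_def)
  also have "\<dots> \<le> (1 + c * real l) * real ?p powr (real l * (1 - \<beta>))" by (rule Suc.IH)
  also have "\<dots> \<le> (1 + c * real l) * real ?p powr (real (Suc l) * (1 - \<beta>))"
    using c \<beta> CARD_gt_1[where 'p = 'p] by (intro mult_left_mono powr_mono mult_right_mono) auto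
  also have "(\<Sum>a\<in>?B. ?F (Suc l) a) \<le> (\<Sum>a\<in>?B. c * real ?p powr (- real (Suc l) * \<beta>))"
  proof (rule sum_mono)
    fix a assume "a \<in> ?B"
    then have nd: "\<not> ?p dvd a" by simp
    let ?\<xi> = "of_nat a / of_nat ?p ^ Suc l :: 'p padic"
    have abs: "padic_abs ?\<xi> = real ?p powr real (Suc l)"
      using padic_abs_of_nat_coprime[OF nd] unfolding padic_abs_divide padic_abs_prime_power
      by (simp add: powr_realpow power_divide del: power_Suc of_nat_Suc)
    have nz: "?\<xi> \<noteq> 0"
    proof
      assume "?\<xi> = 0"
      then have "real ?p powr real (Suc l) = 0" using abs by (simp only: padic_abs_zero)
      then show False by simp
    qed
    have "?F (Suc l) a * (real ?p powr real (Suc l)) powr \<beta> \<le> c" using decay[OF nz] unfolding abs .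
    then have "?F (Suc l) a * real ?p powr (real (Suc l) * \<beta>) \<le> c" by (simp only: powr_powr)
    then show "?F (Suc l) a \<le> c * real ?p powr (- real (Suc l) * \<beta>)"
      by (simp add: powr_minus_divide pos_le_divide_eq del: of_nat_Suc power_Suc)
  qed
  also have "\<dots> \<le> real (?p ^ Suc l) * (c * real ?p powr (- real (Suc l) * \<beta>))"
  proof -
    have "card ?B \<le> card {..<?p ^ Suc l}" by (intro card_mono) auto
    then have "real (card ?B) \<le> real (?p ^ Suc l)" by (simp only: card_lessThan of_nat_le_iff)
    then show ?thesis using c by (simp only: sum_constant) (intro mult_right_mono, auto)
  qed
  also have "\<dots> = c * real ?p powr (real (Suc l) * (1 - \<beta>))"
  proof -
    have "real (?p ^ Suc l) = real ?p powr real (Suc l)" by (simp add: powr_realpow del: power_Suc of_nat_Suc)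
    then have "real (?p ^ Suc l) * real ?p powr (- real (Suc l) * \<beta>) = real ?p powr (real (Suc l) + - real (Suc l) * \<beta>)"
      by (simp only: powr_add)
    also have "real (Suc l) + - real (Suc l) * \<beta> = real (Suc l) * (1 - \<beta>)" by (simp add: algebra_simps)
    finally show ?thesis by (simp only: mult.left_commute[of _ c])
  qed
  finally show ?case by (simp add: algebra_simps)
qed

text \<open>For s < \<beta> the bound on mean masses makes the sum over l of p^(l s) times the mass
  of the ball of radius p^(-l) integrable, hence finite almost everywhere. Where this sum is at most
  K, every ball satisfies the mass condition with exponent s.\<close>

theorem fourier_dim_le_hausdorff_dim:
  fixes A :: "'p::prime_card padic set"
  assumes A: "A \<subseteq> cball 0 1"
  shows "fourier_dim A \<le> hausdorff_dim A"
  unfolding fourier_dim_def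
proof (rule SUP_least, clarsimp)
  fix \<beta> :: real and \<mu> :: "'p padic measure"
  assume \<beta>: "0 \<le> \<beta>" "\<beta> \<le> 1" and \<mu>: "borel_prob \<mu>" and supp: "closed_support \<mu> \<subseteq> A"
    and bdd: "bdd_above ((\<lambda>\<xi>. (cmod (fourier_measure \<mu> \<xi>))\<^sup>2 * padic_abs \<xi> powr \<beta>) ` {\<xi>. \<xi> \<noteq> 0})"
  let ?p = "real CARD('p)"
  have p: "1 < ?p" by (rule real_CARD_gt_1)
  interpret M: prob_space \<mu> using \<mu> by (simp add: borel_prob_def)
  have sets [measurable_cong, simp]: "sets \<mu> = sets borel" using \<mu> by (simp add: borel_prob_def)
  define S where "S = closed_support \<mu>"
  have S [measurable]: "S \<in> sets borel" and S1: "measure \<mu> S = 1"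
    using closed_support_measure[OF \<mu>] by (auto simp: S_def)
  have unit: "measure \<mu> (cball 0 1) = 1"
  proof (rule antisym)
    have "measure \<mu> S \<le> measure \<mu> (cball 0 1)"
      using supp A by (intro M.finite_measure_mono) (auto simp: S_def)
    then show "1 \<le> measure \<mu> (cball 0 1)" using S1 by simp
  qed simp
  obtain c0 where c0: "\<And>\<xi>. \<xi> \<noteq> 0 \<Longrightarrow> (cmod (fourier_measure \<mu> \<xi>))\<^sup>2 * padic_abs \<xi> powr \<beta> \<le> c0"
    using bdd unfolding bdd_above_def by auto
  have c0': "0 \<le> c0" using c0[of 1] order_trans[OF _ c0[of 1], of 0] by simp
  show "ennreal \<beta> \<le> hausdorff_dim A"
    unfolding hausdorff_dim_def
  proof (rule INF_greatest, clarsimp)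
    fix s :: real assume s: "0 < s" and H0: "hausdorff_measure s A = 0"
    show "\<beta> \<le> s"
    proof (rule ccontr)
      assume "\<not> \<beta> \<le> s"
      then have s\<beta>: "s < \<beta>" by simp
      define u where "u = ?p powr (- (\<beta> - s))"
      have "?p powr (- (\<beta> - s)) < ?p powr 0" using s\<beta> by (intro powr_less_mono p) simp
      then have u: "0 < u" "u < 1" by (auto simp: u_def)
      define \<phi> where "\<phi> l x = ?p powr (real l * s) * measure \<mu> (cball x ((1 / ?p) ^ l))" for l and x :: "'p padic"
      have [measurable]: "\<phi> l \<in> borel_measurable borel" for l
        using borel_measurable_measure_cball[of "(1 / ?p) ^ l" \<mu>] by (simp add: \<phi>_def[abs_def])
      have int\<phi>: "(\<integral>x. \<phi> l x \<partial>\<mu>) \<le> (1 + c0 * real l) * u ^ l" for l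
      proof -
        have "(\<integral>x. \<phi> l x \<partial>\<mu>) = ?p powr (real l * s) *
            ((\<Sum>a<CARD('p) ^ l. (cmod (fourier_measure \<mu> (of_nat a / of_nat CARD('p) ^ l)))\<^sup>2) / ?p ^ l)"
          by (simp add: \<phi>_def integral_measure_cball[OF \<mu> unit])
        also have "\<dots> \<le> ?p powr (real l * s) * ((1 + c0 * real l) * ?p powr (real l * (1 - \<beta>)) / ?p ^ l)"
          by (intro mult_left_mono divide_right_mono sum_fourier_sq_le[OF \<mu> \<beta> c0' c0]) auto
        also have "\<dots> = (1 + c0 * real l) * (?p powr (real l * s) * ?p powr (real l * (1 - \<beta>)) / ?p powr (real l))"
          using p by (simp add: powr_realpow)
        also have "?p powr (real l * s) * ?p powr (real l * (1 - \<beta>)) / ?p powr (real l) = u ^ l"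
          using p by (simp add: u_def powr_power algebra_simps flip: powr_add powr_diff)
        finally show ?thesis .
      qed
      \<comment> \<open>Half of the exponential decay, the factor \<open>sqrt u\<close>, absorbs the
        linear factor.\<close>
      have "summable (\<lambda>l. (1 + c0 * real l) * u ^ l)"
      proof (rule summable_comparison_test_ev)
        show "\<forall>\<^sub>F l in sequentially. norm ((1 + c0 * real l) * u ^ l) \<le> sqrt u ^ l"
        proof -
          have "(\<lambda>l. (1 + c0 * real l) * sqrt u ^ l) \<longlonglongrightarrow> 0" using u by real_asymp
          then have "\<forall>\<^sub>F l in sequentially. (1 + c0 * real l) * sqrt u ^ l < 1" by (rule order_tendstoD) simp
          then show ?thesis
          proof eventually_elim
            fix l assume le: "(1 + c0 * real l) * sqrt u ^ l < 1"
            have "norm ((1 + c0 * real l) * u ^ l) = ((1 + c0 * real l) * sqrt u ^ l) * sqrt u ^ l"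
              using u c0' by (simp add: abs_mult power_mult_distrib[symmetric])
            also have "\<dots> \<le> 1 * sqrt u ^ l" using le u by (intro mult_right_mono) auto
            finally show "norm ((1 + c0 * real l) * u ^ l) \<le> sqrt u ^ l" by simp
          qed
        qed
        show "summable (\<lambda>l. sqrt u ^ l)" using u by (intro summable_geometric) simp
      qed
      then have fin: "(\<Sum>l. ennreal ((1 + c0 * real l) * u ^ l)) \<noteq> \<infinity>"
        using u c0' by (subst suminf_ennreal2) auto
      define \<Phi> where "\<Phi> x = (\<Sum>l. ennreal (\<phi> l x))" for x
      have [measurable]: "\<Phi> \<in> borel_measurable borel" unfolding \<Phi>_def[abs_def] by measurable
      have "(\<integral>\<^sup>+x. \<Phi> x \<partial>\<mu>) = (\<Sum>l. \<integral>\<^sup>+x. ennreal (\<phi> l x) \<partial>\<mu>)"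
        unfolding \<Phi>_def by (rule nn_integral_suminf) measurable
      also have "\<dots> \<le> (\<Sum>l. ennreal ((1 + c0 * real l) * u ^ l))"
      proof (intro suminf_le allI)
        fix l
        have "(\<integral>\<^sup>+x. ennreal (\<phi> l x) \<partial>\<mu>) = ennreal (\<integral>x. \<phi> l x \<partial>\<mu>)"
        proof (rule nn_integral_eq_integral)
          show "integrable \<mu> (\<phi> l)"
            by (rule M.integrable_const_bound[where B = "?p powr (real l * s)"])
              (auto simp: \<phi>_def mult_left_le)
        qed (simp add: \<phi>_def)
        then show "(\<integral>\<^sup>+x. ennreal (\<phi> l x) \<partial>\<mu>) \<le> ennreal ((1 + c0 * real l) * u ^ l)"
          using int\<phi>[of l] by (simp add: ennreal_leI)
      qed auto
      finally have "(\<integral>\<^sup>+x. \<Phi> x \<partial>\<mu>) \<noteq> \<infinity>" using fin by (metis infinity_ennreal_def neq_top_trans)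
      then have AEfin: "AE x in \<mu>. \<Phi> x \<noteq> \<infinity>" by (intro nn_integral_PInf_AE) auto
      \<comment> \<open>These sets increase to almost all of the support, so one of them has
        positive mass; on it the pointwise bound holds with one constant.\<close>
      define L where "L K = {x \<in> S. \<Phi> x \<le> of_nat K}" for K :: nat
      have L [measurable]: "L K \<in> sets borel" for K unfolding L_def by measurable
      have "\<exists>K. 0 < measure \<mu> (L K)"
      proof (rule ccontr)
        assume "\<not> (\<exists>K. 0 < measure \<mu> (L K))"
        then have "emeasure \<mu> (L K) = 0" for K
          using measure_nonneg[of \<mu> "L K"] by (simp add: M.emeasure_eq_measure not_less order_antisym)
        then have "(\<Union>K. L K) \<in> null_sets \<mu>" by (intro null_sets_UN) (auto simp: null_sets_def)
        then have "AE x in \<mu>. x \<notin> (\<Union>K. L K)" by (rule AE_not_in)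
        moreover have "AE x in \<mu>. x \<in> S" using M.AE_prob_1[OF S1] .
        ultimately have "AE x in \<mu>. False"
          using AEfin
        proof eventually_elim
          fix x assume "x \<notin> (\<Union>K. L K)" "x \<in> S" "\<Phi> x \<noteq> \<infinity>"
          moreover have "\<exists>K. \<Phi> x \<le> of_nat K"
          proof -
            have "\<Phi> x < top" using \<open>\<Phi> x \<noteq> \<infinity>\<close> by (simp add: less_top)
            then obtain K where "\<Phi> x < of_nat K" using ennreal_Ex_less_of_nat by blast
            then show ?thesis by (intro exI[of _ K]) (rule less_imp_le)
          qed
          ultimately show False by (auto simp: L_def)
        qed
        then show False by simp
      qed
      then obtain K where K: "0 < measure \<mu> (L K)" by blast
      have "hausdorff_measure s A \<noteq> 0"
      proof (rule hausdorff_measure_pos[OF M.finite_measure_axioms sets L _ K s])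
        show "L K \<subseteq> A" using supp by (auto simp: L_def S_def)
        fix x r assume x: "x \<in> L K" and r: "0 < (r :: real)" "r \<le> 1"
        define l where "l = (LEAST l. (1 / ?p) ^ Suc l < r)"
        have "\<exists>l. (1 / ?p) ^ Suc l < r"
        proof -
          obtain l where "(1 / ?p) ^ l < r" using real_arch_pow_inv[OF r(1), of "1 / ?p"] CARD_gt_1[where 'p = 'p] by auto
          moreover have "(1 / ?p) ^ Suc l \<le> (1 / ?p) ^ l" using p by (intro power_decreasing) auto
          ultimately show ?thesis by (intro exI[of _ l]) linarith
        qed
        then have l1: "(1 / ?p) ^ Suc l < r" unfolding l_def by (rule LeastI_ex)
        have l2: "r \<le> (1 / ?p) ^ l"
        proof (cases l)
          case (Suc l')
          then have "\<not> (1 / ?p) ^ Suc l' < r"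
            using not_less_Least[of l' "\<lambda>l. (1 / ?p) ^ Suc l < r"] by (simp only: l_def) simp
          then show ?thesis by (simp only: Suc not_less)
        qed (use r in simp)
        have "ennreal (\<phi> l x) \<le> \<Phi> x"
          unfolding \<Phi>_def using sum_le_suminf[of "\<lambda>l. ennreal (\<phi> l x)" "{l}"] by simp
        also have "\<dots> \<le> of_nat K" using x by (simp add: L_def)
        finally have "\<phi> l x \<le> real K" by (simp add: ennreal_of_nat_eq_real_of_nat)
        then have "measure \<mu> (cball x ((1 / ?p) ^ l)) \<le> real K * ?p powr (- real l * s)"
          by (simp add: \<phi>_def powr_minus_divide pos_le_divide_eq mult.commute)
        moreover have "measure \<mu> (cball x r) \<le> measure \<mu> (cball x ((1 / ?p) ^ l))"
          using l2 by (intro M.finite_measure_mono) auto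
        moreover have "?p powr (- real l * s) \<le> ?p powr s * r powr s"
        proof -
          have "(1 / ?p) ^ Suc l = ?p powr (- real (Suc l))"
            using p by (simp only: powr_minus_divide powr_realpow power_one_over)
          then have "?p powr (- real (Suc l)) \<le> r" using l1 by simp
          then have "(?p powr (- real (Suc l))) powr s \<le> r powr s" using s by (intro powr_mono2) auto
          then have "?p powr s * ?p powr (- real (Suc l) * s) \<le> ?p powr s * r powr s"
            by (intro mult_left_mono) (simp_all only: powr_powr powr_ge_zero)
          then show ?thesis by (simp add: algebra_simps flip: powr_add)
        qed
        then have "real K * ?p powr (- real l * s) \<le> real K * (?p powr s * r powr s)" by (rule mult_left_mono) simp
        ultimately show "measure \<mu> (cball x r) \<le> (real K * ?p powr s) * r powr s" by (simp add: mult.assoc)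
      qed
      then show False using H0 by simp
    qed
  qed
qed

section \<open>Salem property and restriction for the well approximable numbers\<close>

lemma well_approximable_subset: "well_approximable \<tau> \<subseteq> (cball 0 1 :: 'p::prime_card padic set)"
  by (auto simp: well_approximable_def cball_padic)

lemma compact_unit_ball: "compact (cball 0 1 :: 'p::prime_card padic set)"
  unfolding compact_eq_totally_bounded
proof (intro conjI allI impI)
  show "uniform_space_class.complete (cball 0 1 :: 'p padic set)" by (simp add: complete_eq_closed)
  fix e :: real assume e: "0 < e"
  obtain n where n: "(1 / real CARD('p)) ^ n < e"
    using real_arch_pow_inv[OF e, of "1 / real CARD('p)"] CARD_gt_1[where 'p = 'p] by auto
  show "\<exists>k. finite k \<and> cball 0 1 \<subseteq> (\<Union>x\<in>k. ball x e :: 'p padic set)"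
  proof (intro exI[of _ "of_nat ` {..<CARD('p) ^ n}"] conjI subsetI)
    fix x :: "'p padic" assume "x \<in> cball 0 1"
    then have x: "padic_abs x \<le> 1" by (simp add: cball_padic)
    have "dist (of_nat (residue n x)) x < e"
      using residue(2)[OF x, of n] n by (simp add: dist_padic_def padic_abs_minus_commute[of x])
    then show "x \<in> (\<Union>x\<in>of_nat ` {..<CARD('p) ^ n}. ball x e)"
      using residue(1)[OF x, of n] by auto
  qed simp
qed

section \<open>Lower bound for the Fourier dimension\<close>

lemma closed_closed_support: "closed (closed_support \<mu>)"
proof -
  have "- closed_support \<mu> = \<Union>{U. open U \<and> emeasure \<mu> U = 0}"
    by (auto simp: closed_support_def)
  then have "open (- closed_support \<mu>)" by (metis (no_types, lifting) mem_Collect_eq open_Union)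
  then show ?thesis by (simp add: closed_def)
qed

text \<open>After squaring, ln^4 is dominated by any positive power, so every exponent \<beta> - e
  is admissible and the supremum recovers \<beta>. For |\<xi>| < 1 the transform is at most 1, and
  so is the power of |\<xi>|.\<close>

lemma fourier_dim_ge:
  fixes \<mu> :: "'p::prime_card padic measure"
  assumes \<mu>: "borel_prob \<mu>" and supp: "closed_support \<mu> \<subseteq> A" and A: "A \<subseteq> cball 0 1"
    and \<beta>: "0 < \<beta>" "\<beta> \<le> 1" and C: "0 < C"
    and decay: "\<And>\<xi>. 1 \<le> padic_abs \<xi> \<Longrightarrow>
      cmod (fourier_measure \<mu> \<xi>) \<le> C * padic_abs \<xi> powr (- \<beta> / 2) * (ln (1 + padic_abs \<xi>))\<^sup>2"
  shows "ennreal \<beta> \<le> fourier_dim A"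
proof (rule ennreal_le_epsilon)
  fix e' :: real assume "0 < e'"
  \<comment> \<open>Keeping e below \<beta> makes the exponent \<beta> - e positive, which the small
    frequencies require.\<close>
  define e where "e = min e' (\<beta> / 2)"
  have e: "0 < e" "e \<le> e'" "e < \<beta>" using \<open>0 < e'\<close> \<beta> by (auto simp: e_def)
  have "((\<lambda>x. x powr (- e) * ln (1 + x) ^ 4) \<longlongrightarrow> 0) at_top" using e by real_asymp
  then have "\<forall>\<^sub>F x in at_top. x powr (- e) * ln (1 + x) ^ 4 < 1" by (rule order_tendstoD) simp
  then obtain x0 where x0: "\<And>x. x0 \<le> x \<Longrightarrow> x powr (- e) * ln (1 + x) ^ 4 < 1"
    unfolding eventually_at_top_linorder by blast
  define x1 where "x1 = max 1 x0"
  have bound: "x powr (- e) * ln (1 + x) ^ 4 \<le> 1 + ln (1 + x1) ^ 4" if "1 \<le> x" for x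
  proof (cases "x0 \<le> x")
    case True
    have "0 \<le> ln (1 + x1) ^ 4" by simp
    then show ?thesis using x0[OF True] by linarith
  next
    case False
    have "x powr (- e) \<le> x powr 0" using that e by (intro powr_mono) auto
    then have "x powr (- e) * ln (1 + x) ^ 4 \<le> 1 * ln (1 + x1) ^ 4"
      using False that by (intro mult_mono power_mono) (auto simp: x1_def)
    then show ?thesis by simp
  qed
  have "(cmod (fourier_measure \<mu> \<xi>))\<^sup>2 * padic_abs \<xi> powr (\<beta> - e) \<le> 1 + C\<^sup>2 * (1 + ln (1 + x1) ^ 4)" for \<xi>
  proof (cases "1 \<le> padic_abs \<xi>")
    case True
    let ?x = "padic_abs \<xi>"
    have "(cmod (fourier_measure \<mu> \<xi>))\<^sup>2 \<le> (C * ?x powr (- \<beta> / 2) * (ln (1 + ?x))\<^sup>2)\<^sup>2"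
      by (intro power_mono decay True) simp
    also have "\<dots> = C\<^sup>2 * ?x powr (- \<beta>) * ln (1 + ?x) ^ 4"
    proof -
      have "(?x powr (- \<beta> / 2))\<^sup>2 = ?x powr (- \<beta>)" by (simp add: power2_eq_square flip: powr_add)
      then show ?thesis by (simp only: power_mult_distrib flip: power_mult) simp
    qed
    finally have "(cmod (fourier_measure \<mu> \<xi>))\<^sup>2 * ?x powr (\<beta> - e)
        \<le> C\<^sup>2 * ?x powr (- \<beta>) * ln (1 + ?x) ^ 4 * ?x powr (\<beta> - e)" by (rule mult_right_mono) simp
    also have "\<dots> = C\<^sup>2 * (?x powr (- \<beta>) * ?x powr (\<beta> - e) * ln (1 + ?x) ^ 4)" by simp
    also have "\<dots> = C\<^sup>2 * (?x powr (- e) * ln (1 + ?x) ^ 4)" by (simp flip: powr_add)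
    also have "\<dots> \<le> C\<^sup>2 * (1 + ln (1 + x1) ^ 4)" by (intro mult_left_mono bound True) simp
    finally show ?thesis by simp
  next
    case False
    have "(cmod (fourier_measure \<mu> \<xi>))\<^sup>2 * padic_abs \<xi> powr (\<beta> - e) \<le> 1 * 1"
      using False e norm_fourier_measure_le_1[OF \<mu>, of \<xi>]
      by (intro mult_mono) (auto simp: power_le_one intro!: powr_le1)
    also have "1 * 1 \<le> 1 + C\<^sup>2 * (1 + ln (1 + x1) ^ 4)" by simp
    finally show ?thesis .
  qed
  then have bdd: "bdd_above ((\<lambda>\<xi>. (cmod (fourier_measure \<mu> \<xi>))\<^sup>2 * padic_abs \<xi> powr (\<beta> - e)) ` {\<xi>. \<xi> \<noteq> 0})"
    by (intro bdd_aboveI2)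
  have "compact (closed_support \<mu>)"
    using compact_Int_closed[OF compact_unit_ball closed_closed_support[of \<mu>]] supp A
    by (simp add: Int_absorb1 subset_trans)
  then have "ennreal (\<beta> - e) \<le> fourier_dim A"
    unfolding fourier_dim_def using \<mu> supp bdd e \<beta> by (intro SUP_upper) auto
  then have "ennreal (\<beta> - e) + ennreal e' \<le> fourier_dim A + ennreal e'" by (rule add_right_mono)
  moreover have "ennreal \<beta> \<le> ennreal (\<beta> - e) + ennreal e'"
    using e by (simp add: ennreal_leI flip: ennreal_plus)
  ultimately show "ennreal \<beta> \<le> fourier_dim A + ennreal e'" by (rule order_trans[rotated])
qed

section \<open>Restriction for measures with logarithmic losses\<close>

lemma ln_sq_le_powr:
  fixes e :: real
  assumes "0 < e"
  obtains K where "0 < K" "\<And>x. 1 \<le> x \<Longrightarrow> (ln (1 + x))\<^sup>2 \<le> K * x powr e"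
proof -
  have "((\<lambda>x. (ln (1 + x))\<^sup>2 / x powr e) \<longlongrightarrow> 0) at_top" using assms by real_asymp
  then have "\<forall>\<^sub>F x in at_top. (ln (1 + x))\<^sup>2 / x powr e < 1" by (rule order_tendstoD) simp
  then obtain x0 where x0: "\<And>x. x0 \<le> x \<Longrightarrow> (ln (1 + x))\<^sup>2 / x powr e < 1"
    unfolding eventually_at_top_linorder by blast
  define x1 where "x1 = max 1 x0"
  show ?thesis
  proof (rule that[of "1 + (ln (1 + x1))\<^sup>2"])
    show "0 < 1 + (ln (1 + x1))\<^sup>2" by (simp add: add_pos_nonneg)
    fix x :: real assume x: "1 \<le> x"
    have p1: "1 \<le> x powr e" using x assms by (simp add: ge_one_powr_ge_zero)
    show "(ln (1 + x))\<^sup>2 \<le> (1 + (ln (1 + x1))\<^sup>2) * x powr e"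
    proof (cases "x0 \<le> x")
      case True
      then have "(ln (1 + x))\<^sup>2 \<le> 1 * x powr e" using x0[OF True] x by (simp add: divide_less_eq)
      also have "\<dots> \<le> (1 + (ln (1 + x1))\<^sup>2) * x powr e" by (intro mult_right_mono) auto
      finally show ?thesis .
    next
      case False
      have "(ln (1 + x))\<^sup>2 \<le> (ln (1 + x1))\<^sup>2" using False x by (intro power_mono) (auto simp: x1_def)
      also have "\<dots> \<le> (1 + (ln (1 + x1))\<^sup>2) * 1" by simp
      also have "\<dots> \<le> (1 + (ln (1 + x1))\<^sup>2) * x powr e" using p1 by (intro mult_left_mono) (auto simp: add_nonneg_nonneg)
      finally show ?thesis .
    qed
  qed
qed

text \<open>For \<alpha> = 2/\<tau> and \<beta> = 1/\<tau> the condition of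
  \<open>restriction_setting\<close> reads q (2 - 3/\<tau>) < 2 (1 - 1/\<tau>), that is, q < 1 +
  1/(2\<tau> - 3). Being strict, it survives lowering both exponents by a small e, which removes the
  logarithms.\<close>

lemma restriction_from_bounds:
  fixes \<mu> :: "'p::prime_card padic measure"
  assumes \<tau>: "2 < \<tau>" and \<mu>: "borel_prob \<mu>" and supp: "closed_support \<mu> \<subseteq> cball 0 1" and C: "0 < C"
    and decay: "\<And>\<xi>. 1 \<le> padic_abs \<xi> \<Longrightarrow>
      cmod (fourier_measure \<mu> \<xi>) \<le> C * padic_abs \<xi> powr (- 1 / \<tau>) * (ln (1 + padic_abs \<xi>))\<^sup>2"
    and balls: "\<And>x r. 0 < r \<Longrightarrow> r \<le> 1 \<Longrightarrow> measure \<mu> (cball x r) \<le> C * r powr (2 / \<tau>) * (ln (1 + 1 / r))\<^sup>2"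
    and q: "1 \<le> q" "q < 1 + 1 / (2 * \<tau> - 3)"
  shows "\<exists>C'>0. \<forall>f \<in> Lq_space haar q \<inter> Lq_space haar 1.
    integrable \<mu> (\<lambda>x. (cmod (fourier_fun f x))\<^sup>2) \<and>
    sqrt (LINT x|\<mu>. (cmod (fourier_fun f x))\<^sup>2) \<le> C' * Lq_norm haar q f"
proof -
  interpret M: prob_space \<mu> using \<mu> by (simp add: borel_prob_def)
  have "measure \<mu> (closed_support \<mu>) \<le> measure \<mu> (cball 0 1)"
    using supp \<mu> by (intro M.finite_measure_mono) (auto simp: borel_prob_def)
  then have unit: "measure \<mu> (cball 0 1) = 1"
    using closed_support_measure(2)[OF \<mu>] M.prob_le_1[of "cball 0 1"] by simp
  define gap where "gap = 2 * (1 - 1 / \<tau>) - q * (2 - 3 / \<tau>)"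
  have "q * (2 * \<tau> - 3) < 2 * \<tau> - 2" using q \<tau> by (simp add: field_simps)
  then have "0 < (2 * \<tau> - 2 - q * (2 * \<tau> - 3)) / \<tau>" using \<tau> by simp
  also have "\<dots> = gap" using \<tau> by (simp add: gap_def field_simps)
  finally have gap: "0 < gap" .
  \<comment> \<open>Lowering both exponents by e changes only the left side of the condition, by q
    e, which must stay below \<open>gap\<close>; the other bound keeps 1/\<tau> - e
    positive.\<close>
  define e where "e = min (1 / (2 * \<tau>)) (gap / (2 * q))"
  have e: "0 < e" "e < 1 / \<tau>" using \<tau> gap q by (auto simp: e_def min_def field_simps)
  have qe: "q * e < gap"
  proof -
    have "q * e \<le> q * (gap / (2 * q))" using q by (intro mult_left_mono) (auto simp: e_def)
    then show ?thesis using q gap by simp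
  qed
  obtain K where K: "0 < K" "\<And>x. 1 \<le> x \<Longrightarrow> (ln (1 + x))\<^sup>2 \<le> K * x powr e"
    by (rule ln_sq_le_powr[OF e(1)]) (rule that)
  interpret restriction_setting \<mu> "2 / \<tau> - e" "1 / \<tau> - e" "C * K" q
  proof
    have "2 / \<tau> \<le> 1" using \<tau> by simp
    then show "2 / \<tau> - e \<le> 1" using e by linarith
    show "0 < 1 / \<tau> - e" "0 < C * K" using e C K by auto
    fix y :: "'p padic" and r :: real assume r: "0 < r" "r \<le> 1"
    have "measure \<mu> (cball y r) \<le> C * r powr (2 / \<tau>) * (ln (1 + 1 / r))\<^sup>2" by (rule balls[OF r])
    also have "\<dots> \<le> C * r powr (2 / \<tau>) * (K * (1 / r) powr e)"
      using r C by (intro mult_left_mono K(2)) auto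
    also have "\<dots> = C * K * (r powr (2 / \<tau>) * r powr (- e))"
      using r by (simp add: powr_divide powr_minus_divide)
    also have "\<dots> = C * K * r powr (2 / \<tau> - e)" by (simp flip: powr_add)
    finally show "measure \<mu> (cball y r) \<le> C * K * r powr (2 / \<tau> - e)" .
  next
    fix \<xi> :: "'p padic" assume \<xi>: "1 \<le> padic_abs \<xi>"
    have "cmod (fourier_measure \<mu> \<xi>) \<le> C * padic_abs \<xi> powr (- 1 / \<tau>) * (ln (1 + padic_abs \<xi>))\<^sup>2" by (rule decay[OF \<xi>])
    also have "\<dots> \<le> C * padic_abs \<xi> powr (- 1 / \<tau>) * (K * padic_abs \<xi> powr e)"
      using \<xi> C by (intro mult_left_mono K(2)) auto
    also have "\<dots> = C * K * (padic_abs \<xi> powr (- 1 / \<tau>) * padic_abs \<xi> powr e)" by simp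
    also have "\<dots> = C * K * padic_abs \<xi> powr (- (1 / \<tau> - e))" by (simp flip: powr_add)
    finally show "cmod (fourier_measure \<mu> \<xi>) \<le> C * K * padic_abs \<xi> powr (- (1 / \<tau> - e))" .
  next
    show "q * (2 - 2 * (2 / \<tau> - e) + (1 / \<tau> - e)) < 2 * (1 - (2 / \<tau> - e) + (1 / \<tau> - e))"
      using qe by (simp add: gap_def algebra_simps)
  qed (fact \<mu> unit q(1))+
  show ?thesis
    using restriction_estimate rconst_pos by (intro exI[of _ "sqrt rconst"] conjI ballI) auto
qed

text \<open>\<open>C\<close> precedes \<tau> and so depends on p only, whereas \<open>C'\<close> may
  depend on \<tau> and q. The ranges |\<xi>| \<ge> 1 and r \<le> 1 are the meaningful ones: the
  right-hand sides tend to 0 as \<xi> tends to 0 and as r tends to infinity, while a probability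
  measure on Z_p has transform 1 on Z_p and gives large balls mass 1. Integrability is asserted
  because the integral of a non-integrable function is 0 by convention.\<close>

theorem theorem1p4p3:
  shows "\<exists>C>0. \<forall>\<tau>>2.
    salem_set (well_approximable \<tau> :: 'p::prime_card padic set) \<and>
    hausdorff_dim (well_approximable \<tau> :: 'p padic set) = ennreal (2 / \<tau>) \<and>
    fourier_dim (well_approximable \<tau> :: 'p padic set) = ennreal (2 / \<tau>) \<and>
    (\<exists>\<mu> :: 'p padic measure.
      borel_prob \<mu> \<and> closed_support \<mu> \<subseteq> well_approximable \<tau> \<and>
      (\<forall>\<xi>. padic_abs \<xi> \<ge> 1 \<longrightarrow>
        cmod (fourier_measure \<mu> \<xi>)
          \<le> C * padic_abs \<xi> powr (- 1 / \<tau>) * (ln (1 + padic_abs \<xi>))\<^sup>2) \<and>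
      (\<forall>x r. 0 < r \<and> r \<le> 1 \<longrightarrow>
        measure \<mu> (cball x r) \<le> C * r powr (2 / \<tau>) * (ln (1 + 1 / r))\<^sup>2) \<and>
      (\<forall>q. 1 \<le> q \<and> q < 1 + 1 / (2 * \<tau> - 3) \<longrightarrow>
        (\<exists>C'>0. \<forall>f \<in> Lq_space haar q \<inter> Lq_space haar 1.
          integrable \<mu> (\<lambda>x. (cmod (fourier_fun f x))\<^sup>2) \<and>
          sqrt (LINT x|\<mu>. (cmod (fourier_fun f x))\<^sup>2) \<le> C' * Lq_norm haar q f)))"
proof (intro exI[of _ "approx_const CARD('p)"] conjI allI impI)
  have "0 < real CARD('p) / (ln 2)\<^sup>2" by simp
  then show C: "0 < approx_const CARD('p)"
    using approx_const_ge(1)[OF CARD_gt_1[where 'p = 'p]] by linarith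
  fix \<tau> :: real assume \<tau>: "2 < \<tau>"
  let ?W = "well_approximable \<tau> :: 'p padic set"
  obtain \<mu> :: "'p padic measure" where \<mu>: "borel_prob \<mu>" "closed_support \<mu> \<subseteq> ?W"
    and decay: "\<And>\<xi>. 1 \<le> padic_abs \<xi> \<Longrightarrow> cmod (fourier_measure \<mu> \<xi>)
      \<le> approx_const CARD('p) * padic_abs \<xi> powr (- 1 / \<tau>) * (ln (1 + padic_abs \<xi>))\<^sup>2"
    and balls: "\<And>x r. 0 < r \<Longrightarrow> r \<le> 1 \<Longrightarrow>
      measure \<mu> (cball x r) \<le> approx_const CARD('p) * r powr (2 / \<tau>) * (ln (1 + 1 / r))\<^sup>2"
    using salem_measure_exists[OF \<tau>, where 'p = 'p] by blast
  have "ennreal (2 / \<tau>) \<le> fourier_dim ?W"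
    using \<tau> decay by (intro fourier_dim_ge[OF \<mu> well_approximable_subset _ _ C]) auto
  moreover have "fourier_dim ?W \<le> hausdorff_dim ?W"
    by (rule fourier_dim_le_hausdorff_dim[OF well_approximable_subset])
  moreover have "hausdorff_dim ?W \<le> ennreal (2 / \<tau>)"
    using \<tau> by (intro hausdorff_dim_well_approximable_le) simp
  ultimately show dims: "hausdorff_dim ?W = ennreal (2 / \<tau>)" "fourier_dim ?W = ennreal (2 / \<tau>)"
    by (auto intro: antisym order_trans)
  then show "salem_set ?W" by (simp add: salem_set_def)
  have restr: "\<exists>C'>0. \<forall>f \<in> Lq_space haar q \<inter> Lq_space haar 1.
      integrable \<mu> (\<lambda>x. (cmod (fourier_fun f x))\<^sup>2) \<and>
      sqrt (LINT x|\<mu>. (cmod (fourier_fun f x))\<^sup>2) \<le> C' * Lq_norm haar q f"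
    if "1 \<le> q" "q < 1 + 1 / (2 * \<tau> - 3)" for q
    by (rule restriction_from_bounds[OF \<tau> \<mu>(1) subset_trans[OF \<mu>(2) well_approximable_subset] C decay balls that])
  show "\<exists>\<mu> :: 'p padic measure. borel_prob \<mu> \<and> closed_support \<mu> \<subseteq> ?W \<and>
      (\<forall>\<xi>. padic_abs \<xi> \<ge> 1 \<longrightarrow> cmod (fourier_measure \<mu> \<xi>)
          \<le> approx_const CARD('p) * padic_abs \<xi> powr (- 1 / \<tau>) * (ln (1 + padic_abs \<xi>))\<^sup>2) \<and>
      (\<forall>x r. 0 < r \<and> r \<le> 1 \<longrightarrow>
        measure \<mu> (cball x r) \<le> approx_const CARD('p) * r powr (2 / \<tau>) * (ln (1 + 1 / r))\<^sup>2) \<and>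
      (\<forall>q. 1 \<le> q \<and> q < 1 + 1 / (2 * \<tau> - 3) \<longrightarrow>
        (\<exists>C'>0. \<forall>f \<in> Lq_space haar q \<inter> Lq_space haar 1.
          integrable \<mu> (\<lambda>x. (cmod (fourier_fun f x))\<^sup>2) \<and>
          sqrt (LINT x|\<mu>. (cmod (fourier_fun f x))\<^sup>2) \<le> C' * Lq_norm haar q f))"
    using \<mu> decay balls restr by (intro exI[of _ \<mu>] conjI allI impI) auto
qed

end
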